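(* Let $0<q<1$, $N,n\ge1$ finite and $m\ge2N$. For all labels $k,j\in\{1,\dots,N\}$, on $\mathcal M$ one has $$\mathbb L_{kj}^{\rm seed}+\{\mathbb A_k^+,\boldsymbol\Omega_{j}\}=\mathscr T(\mathbb L_{kj}^{\rm seed})+\sum_{r=1}^N\mathscr T_{<r}\,\mathrm{Ad}_{\mathbb R_r}\,\mathrm{ad}^{\rm s}_{\boldsymbol\Theta_{k,r}}\,\mathscr T_{>r}(\mathbb A_j^-),$$ where $\mathbb L_{kj}^{\rm seed}=\{\mathbb A_k^+,\mathbb A_j^-\}$, $\boldsymbol\Omega_j=\mathbb R_q\mathbb A_j^-\mathbb R_q^{-1}-\mathbb A_j^-$ with $\mathbb R_q=\mathbb U_q^+(\mathbb U_q^-)^{-1}$, $\mathbb R_i=(I+\mathbb H_i^+)(I-\mathbb H_i^-)$, $\mathscr K_i(X)=\mathbb R_iX\mathbb R_i^{-1}-X$, $\boldsymbol\Theta_{k,i}=\mathbb R_i^{-1}\mathbb A_k^+\mathbb R_i-\mathbb A_k^+$, $\mathscr T_{<r}=\prod_{i<r}(I+\mathscr K_i)$, $\mathscr T_{>r}=\prod_{i>r}(I+\mathscr K_i)$ and $\mathscr T=\prod_{i=1}^N(I+\mathscr K_i)$. Together with $$\{\mathbb D_{k,q}^+,\mathbb D_{j,q}^-\}=\mathbb G^{\rm PBW}_{m,N}(\mathbb U_q^+)^{-1}\big(\mathbb L_{kj}^{\rm seed}+\{\mathbb A_k^+,\boldsymbol\Omega_j\}\big)\mathbb U_q^+(\mathbb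 G^{\rm PBW}_{m,N})^{-1}$$ this determines every mixed anticommutator $\{\mathbb D_{k,q}^+,\mathbb D_{j,q}^-\}$ on arbitrary polynomial inputs.
   Context: $\mathrm{Ad}_RX=RXR^{-1}$, $\mathrm{ad}^{\rm s}_YX=[Y,X]_{\rm s}$ (superbracket; anticommutator for two odd operators). **Coordinates.** $[r]_q=\frac{1-q^r}{1-q}$, $\gamma_q=\frac{1+q}2$, $c_r=\gamma_q[r]_{q^2}=\frac12[2r]_q$, $c_r!=\prod_{t=1}^rc_t$, $[r]_q!=\prod_{t=1}^r[t]_q$. For $1\le k\le N$, $1\le a\le m$ let $z_{ka},\bar z_{ka}$ be independent commuting variables; $f_a,f_a^\dagger$ is a Witt basis of the complex Clifford algebra $\mathrm{Cl}_{2m}$: $\{f_a,f_b\}=\{f_a^\dagger,f_b^\dagger\}=0$, $\{f_a,f_b^\dagger\}=\delta_{ab}$. $\mathscr P^{\rm sc}_{m,N}=\mathbb C[z_{ka},\bar z_{ka}]$, $\mathscr P^{\rm Cl}_{m,N}=\mathscr P^{\rm sc}_{m,N}\otimes\mathrm{Cl}_{2m}$ ($\mathbb Z_2$-graded by Clifford parity). $H_{ij}=\sum_az_{ia}\bar z_{ja}$, $\partial_{Z_k}=\sum_af_a^\dagger\partial_{z_{ka}}$, $\partial_{Z_k^\dagger}=\sum_af_a\partial_{\bar z_{ka}}$ (Clifford elements act by left multiplication), $\Delta_{ij}=\sum_a\partial_{z_{ia}}\partial_{\bar z_{ja}}$. $\ddagger$ is the order-preserving antilinear involution $z\leftrightarrow\bar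 z$, $f_a\leftrightarrow f_a^\dagger$, $\vartheta\leftrightarrow\bar\vartheta$, $a\leftrightarrow b$ (fermionic symbols below), and $X^\ddagger=\ddagger X\ddagger$ on operators. **Capelli contractions.** $\delta_a$ is the odd antiderivation of Clifford coefficients with $\delta_a(f_b)=\delta_{ab}$, $\delta_a(f_b^\dagger)=0$. $\mathfrak s_i=\sum_a\delta_a\partial_{z_{ia}}$, $\mathcal E^z_{ji}=\sum_az_{ja}\partial_{z_{ia}}$, $(\mathcal C_z)_{ij}=m\delta_{ij}+\mathcal E^z_{ji}$ (an $N\times N$ matrix of operators, invertible on columns of polynomials in each homogeneous degree for $m\ge2N$). $\mathfrak n_i^+=\sum_\ell(\mathcal C_z^{-1})_{i\ell}\mathfrak s_\ell$, $\mathfrak n_i^-=(\mathfrak n_i^+)^\ddagger$. **Gauge.** For $m\ge 2N$ every $P\in\mathscr P^{\rm sc}_{m,N}$ is uniquely a finite sum $P=\sum_{\alpha\in\mathbb N^{N\times N}}H^\alpha h_\alpha$ with $\Delta_{ij}h_\alpha=0$ for all $i,j$. $\mathbb G^{\rm nf}(H^\alpha h)=g_\alpha H^\alpha h$ for such $h$, with $g_\alpha=\prod_i\frac{\alpha_{ii}!}{c_{\alpha_{ii}}!}\prod_{i\ne j}\frac{\alpha_{ij}!}{[\alpha_{ij}]_q!}$. Let $\sigma_{\rm Ch}$ be the Chevalley symbol isomorphism from the Clifford algebra to the exterior algebra on $f_a,f_a^\dagger$; in the exterior model $\mathbb K=\frac12\sum_{i,j}H_{ij}\,\mathfrak n_j^-\mathfrak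 n_i^+$; $\mathbb W=\sigma_{\rm Ch}^{-1}\exp(\mathbb K)\sigma_{\rm Ch}$. $\mathbb G^{\rm PBW}_{m,N}=\mathbb W\,\mathbb G^{{\rm nf},\Lambda}\,\mathbb W^{-1}$, where $\mathbb G^{{\rm nf},\Lambda}$ is $\mathbb G^{\rm nf}$ acting coefficientwise in the exterior-symbol basis. It is extended by the identity on fermionic factors. **Fermionic data.** One pair: Grassmann generators $\vartheta,\bar\vartheta$ (odd), Weyl generators $a,b$ (even), $ab-ba=-2i$, $B=ba-i$. Put $s=\frac1nq^{2m-2n}[2n]_q$, $\sigma R(B)=R(B+2i)$; $\mathcal A_s^{\min}$ is the localization of $\mathbb C[B]$ at the multiplicative set generated by $\sigma^k(B-i),\sigma^k(s-2iB),\sigma^k(s+2iB)$, $k\in\mathbb Z$. $x_j=a^j$ ($j\ge0$), $x_j=b^{-j}$ ($j<0$); $\beta_j(B)=B+(2j-1)i$ for $j\ge1$ and $1$ for $j\le0$; $\alpha_j(B)=1$ for $j\ge0$ and $B+(2j+1)i$ for $j\le-1$. The charge-$c$ module ($c\in\mathbb Z$) is the free right $\mathcal A_s^{\min}$-module on $e_{0,c}=x_c$, $e_{\vartheta,c}=\vartheta x_{c+1}$, $e_{\bar\vartheta,c}=\bar\vartheta x_{c-1}$, $e_{2,c}=\vartheta\bar\vartheta x_c$. $\Phi_s(B)=\frac{4-s+2iB}{B-i}$, $\Psi_s(B)=\frac{-s-2iB}{B-i}$, $\sigma_c^+(B)=\beta_{c+1}(B)\Phi_s(B+2i(c+1))$,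 $\sigma_c^-(B)=\alpha_{c-1}(B)\Psi_s(B+2ic)$, $\pi_c^\pm=-\frac14\sigma_c^\pm$. Right-linear maps (zero on unlisted basis vectors): $\mathbb Q_c^+:e_{\vartheta,c}\mapsto e_{0,c}\pi_c^+,\ e_{2,c}\mapsto\frac1{2i}e_{\bar\vartheta,c}\beta_c$; $\mathbb h_c^+:e_{0,c}\mapsto e_{\vartheta,c}(\pi_c^+)^{-1},\ e_{\bar\vartheta,c}\mapsto2i\,e_{2,c}\beta_c^{-1}$. The minus maps are the $\ddagger$-conjugates ($c\leftrightarrow-c$): $\mathbb Q_c^-:e_{\bar\vartheta,c}\mapsto e_{0,c}\pi_c^-,\ e_{2,c}\mapsto\frac1{2i}e_{\vartheta,c}\alpha_c$; $\mathbb h_c^-:e_{0,c}\mapsto e_{\bar\vartheta,c}(\pi_c^-)^{-1},\ e_{\vartheta,c}\mapsto2i\,e_{2,c}\alpha_c^{-1}$. For $n$ pairs and $\mathbf c\in\mathbb Z^n$ take the graded tensor product of the one-pair modules; $\mathbb Q^\pm=\sum_j\widehat{\mathbb Q}_j^\pm$, $\mathbb h^\pm=\frac1n\sum_j\widehat{\mathbb h}_j^\pm$ (hats: graded embeddings in factor $j$). Let $\widehat{\mathsf P}_j^+$ be the projector on the span of $e_{\bar\vartheta,c_j},e_{2,c_j}$ in factor $j$ (killing $e_{0,c_j},e_{\vartheta,c_j}$), $\mathsf P_S^+=\prod_{j\in S}\widehat{\mathsf P}_j^+\prod_{j\notin S}(I-\widehat{\mathsf P}_j^+)$; $\kappa_c^+=-\frac14\sigma_c^+\alpha_c$,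 $K_c=\frac1{2i}\alpha_{c-1}\beta_c$, $\delta_m(q)=\frac{2m-[2m]_q}4$, and $$\mathbb M^+=\delta_m(q)I+\sum_{\varnothing\ne S}\mathsf P_S^+\Big(\sum_{j\in S}\kappa_{c_j}^+-|S|-B_q^{(|S|)}(E_{\bar z})\sum_{j\in S}K_{c_j}\Big),\qquad \mathbb N^+=-\mathbb h^+\mathbb M^+,$$ where $B_q^{(k)}(E_{\bar z})$ is the scalar $\frac{c_{r+k}}{r+k}$ on bosonic elements of antiholomorphic Euler degree $r$. $\mathbb M^-,\mathbb N^-$ are the $\ddagger$-conjugates (depending on the holomorphic Euler degree). $\mathscr F_k$ ($1\le k\le N$) is a copy, for label $k$, of the direct sum over $\mathbf c\in\mathbb Z^n$ of these modules; $\mathbb Q_k^\pm,\mathbb N_k^\pm$ are the corresponding operators, the Euler degree in $\mathbb N_k^+$ (resp. $\mathbb N_k^-$) being that in the variables $\bar z_k$ (resp. $z_k$), its coefficient acting on the bosonic factor. **Transport.** $\mathcal M=\mathscr P^{\rm Cl}_{m,N}\widehat\otimes\mathscr F_1\widehat\otimes\cdots\widehat\otimes\mathscr F_N$. With $(X\widehat\otimes Y)(F\otimes e)=(-1)^{|Y||F|}XF\otimes Ye$: $\mathbb A_k^+=\partial_{Z_k}\widehat\otimes I+I\widehat\otimes\mathbb Q_k^+$, $\mathbb A_k^-=(\mathbb A_k^+)^\ddagger$; $\mathbb H_i^\pm=\mathfrak n_i^\pm\widehat\otimes\mathbb N_i^\pm$, $\mathbb U_q^\pm=\exp(\sum_{i=1}^N\mathbb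 H_i^\pm)$; $\mathbb D_{k,q}^{\pm}=\mathbb G^{\rm PBW}_{m,N}(\mathbb U_q^\pm)^{-1}\mathbb A_k^\pm\,\mathbb U_q^\pm(\mathbb G^{\rm PBW}_{m,N})^{-1}$. *)

theory Defs
  imports
    Complex_Main
    "HOL-Library.Poly_Mapping"
    "HOL-Library.Product_Lexorder"
    "HOL-Library.Function_Algebras"
    "HOL-Computational_Algebra.Fraction_Field"
begin

text \<open>
  Every space below consists of finitely supported functions on a set of basis labels. Operators
  are plain functions, added pointwise (\<^theory>\<open>HOL-Library.Function_Algebras\<close>). Labels and
  coefficients range over ambient types that do not depend on \<open>m, N, n, q\<close>; the spaces of the
  paper are the carriers \<open>Psc m N\<close>, \<open>PCl m N\<close> and \<open>Mcar m N n q\<close>, and operator inverses are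
  taken on these carriers (\<^const>\<open>inv_into\<close>). Indices run from 1 as in the paper.
\<close>

section \<open>Finitely supported functions\<close>

definition smul :: "'r::comm_ring_1 \<Rightarrow> ('b \<Rightarrow>\<^sub>0 'r) \<Rightarrow> ('b \<Rightarrow>\<^sub>0 'r)" where
  "smul r v = Poly_Mapping.map ((*) r) v"

definition lext :: "('a \<Rightarrow> ('b \<Rightarrow>\<^sub>0 'r::comm_ring_1)) \<Rightarrow> ('a \<Rightarrow>\<^sub>0 'r) \<Rightarrow> ('b \<Rightarrow>\<^sub>0 'r)" where
  "lext \<phi> v = (\<Sum>b\<in>Poly_Mapping.keys v. smul (Poly_Mapping.lookup v b) (\<phi> b))"

text \<open>Exponential of a locally nilpotent operator; \<open>sc\<close> is multiplication by complex scalars.\<close>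

definition expo :: "(complex \<Rightarrow> 'v \<Rightarrow> 'v) \<Rightarrow> ('v \<Rightarrow> 'v) \<Rightarrow> 'v \<Rightarrow> 'v::comm_monoid_add" where
  "expo sc X v = (\<Sum>k | (X ^^ k) v \<noteq> 0. sc (1 / fact k) ((X ^^ k) v))"

definition acomm :: "('v \<Rightarrow> 'v) \<Rightarrow> ('v \<Rightarrow> 'v) \<Rightarrow> 'v \<Rightarrow> 'v::ab_group_add" where
  "acomm X Y v = X (Y v) + Y (X v)"


section \<open>\<open>q\<close>-numbers\<close>

definition qnum :: "real \<Rightarrow> nat \<Rightarrow> real" where
  "qnum q r = (1 - q ^ r) / (1 - q)"

definition qgam :: "real \<Rightarrow> real" where
  "qgam q = (1 + q) / 2"

definition cnum :: "real \<Rightarrow> nat \<Rightarrow> real" where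
  "cnum q r = qgam q * qnum (q\<^sup>2) r"

definition qfact :: "real \<Rightarrow> nat \<Rightarrow> real" where
  "qfact q r = (\<Prod>t=1..r. qnum q t)"

definition cfact :: "real \<Rightarrow> nat \<Rightarrow> real" where
  "cfact q r = (\<Prod>t=1..r. cnum q t)"


section \<open>Scalar polynomials\<close>

text \<open>\<open>(False, k, a)\<close> stands for \<open>z\<^bsub>ka\<^esub>\<close> and \<open>(True, k, a)\<close> for its conjugate variable.\<close>

type_synonym zvar = "bool \<times> nat \<times> nat"
type_synonym zmon = "zvar \<Rightarrow>\<^sub>0 nat"
type_synonym psc = "zmon \<Rightarrow>\<^sub>0 complex"

definition Psc :: "nat \<Rightarrow> nat \<Rightarrow> psc set" where
  "Psc m N = {p. \<forall>\<mu>\<in>Poly_Mapping.keys p. Poly_Mapping.keys \<mu> \<subseteq> UNIV \<times> {1..N} \<times> {1..m}}"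

definition pconst :: "complex \<Rightarrow> psc" where
  "pconst c = Poly_Mapping.single 0 c"

definition zv :: "zvar \<Rightarrow> psc" where
  "zv x = Poly_Mapping.single (Poly_Mapping.single x 1) 1"

definition pd :: "zvar \<Rightarrow> psc \<Rightarrow> psc" where
  "pd x p = (\<Sum>\<mu>\<in>Poly_Mapping.keys p.
     Poly_Mapping.single (\<mu> - Poly_Mapping.single x 1)
       (of_nat (Poly_Mapping.lookup \<mu> x) * Poly_Mapping.lookup p \<mu>))"

definition Hpol :: "nat \<Rightarrow> nat \<Rightarrow> nat \<Rightarrow> psc" where
  "Hpol m i j = (\<Sum>a=1..m. zv (False, i, a) * zv (True, j, a))"

definition Lap :: "nat \<Rightarrow> nat \<Rightarrow> nat \<Rightarrow> psc \<Rightarrow> psc" where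
  "Lap m i j p = (\<Sum>a=1..m. pd (False, i, a) (pd (True, j, a) p))"

definition Ez :: "nat \<Rightarrow> nat \<Rightarrow> nat \<Rightarrow> psc \<Rightarrow> psc" where
  "Ez m j i p = (\<Sum>a=1..m. zv (False, j, a) * pd (False, i, a) p)"

definition conj_mon :: "zmon \<Rightarrow> zmon" where
  "conj_mon \<mu> = (\<Sum>(d, k, a)\<in>Poly_Mapping.keys \<mu>.
     Poly_Mapping.single (\<not> d, k, a) (Poly_Mapping.lookup \<mu> (d, k, a)))"

definition conj_psc :: "psc \<Rightarrow> psc" where
  "conj_psc p = (\<Sum>\<mu>\<in>Poly_Mapping.keys p.
     Poly_Mapping.single (conj_mon \<mu>) (cnj (Poly_Mapping.lookup p \<mu>)))"

text \<open>Euler degrees of a monomial in the variables \<open>z\<^sub>k\<close> (\<open>d = False\<close>) or their conjugates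
  (\<open>d = True\<close>).\<close>

definition edeg :: "nat \<Rightarrow> bool \<Rightarrow> nat \<Rightarrow> zmon \<Rightarrow> nat" where
  "edeg m d k \<mu> = (\<Sum>a=1..m. Poly_Mapping.lookup \<mu> (d, k, a))"


section \<open>Clifford polynomials\<close>

text \<open>
  \<open>(False, a)\<close> stands for \<open>f\<^sub>a\<close> and \<open>(True, a)\<close> for \<open>f\<^sub>a\<close> dagger, ordered lexicographically.
  The label \<open>A = {g\<^sub>1 < \<dots> < g\<^sub>r}\<close> denotes the product \<open>g\<^sub>1 \<dots> g\<^sub>r\<close>: the Clifford product in
  the Clifford algebra, the wedge product in the exterior algebra. Both algebras thus live on the
  same type and are told apart by their left multiplications \<open>clmul\<close> and \<open>extmul\<close>.
\<close>

type_synonym gen = "bool \<times> nat"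
type_synonym pcl = "gen set \<Rightarrow>\<^sub>0 psc"

definition PCl :: "nat \<Rightarrow> nat \<Rightarrow> pcl set" where
  "PCl m N = {F. \<forall>A\<in>Poly_Mapping.keys F. A \<subseteq> UNIV \<times> {1..m} \<and> Poly_Mapping.lookup F A \<in> Psc m N}"

text \<open>A scalar operator acting coefficientwise.\<close>

definition cw :: "(psc \<Rightarrow> psc) \<Rightarrow> pcl \<Rightarrow> pcl" where
  "cw D F = Poly_Mapping.map D F"

definition cscale :: "complex \<Rightarrow> pcl \<Rightarrow> pcl" where
  "cscale c = smul (pconst c)"

text \<open>The anticommutator of two Witt generators.\<close>

definition brk :: "gen \<Rightarrow> gen \<Rightarrow> psc" where
  "brk g h = of_bool (snd g = snd h \<and> fst g \<noteq> fst h)"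

definition wedge :: "gen \<Rightarrow> gen set \<Rightarrow> pcl" where
  "wedge g A = (if g \<in> A then 0
     else Poly_Mapping.single (insert g A) ((-1) ^ card {h\<in>A. h < g}))"

text \<open>The odd antiderivation sending the generator \<open>h\<close> to 1 and the others to 0, on the ordered
  product labelled \<open>A\<close>.\<close>

definition contr :: "gen \<Rightarrow> gen set \<Rightarrow> pcl" where
  "contr h A = (if h \<in> A then Poly_Mapping.single (A - {h}) ((-1) ^ card {x\<in>A. x < h}) else 0)"

text \<open>Left multiplication by \<open>g\<close>: in the Clifford algebra, \<open>g\<close> is moved to the right past all
  smaller generators, using \<open>g h = {g,h} - h g\<close> and \<open>g\<^sup>2 = 0\<close>.\<close>

definition extmul :: "gen \<Rightarrow> pcl \<Rightarrow> pcl" where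
  "extmul g = lext (wedge g)"

definition clmul :: "gen \<Rightarrow> pcl \<Rightarrow> pcl" where
  "clmul g = lext (\<lambda>A. wedge g A + (\<Sum>h | h \<in> A \<and> h < g. smul (brk g h) (contr h A)))"

text \<open>Chevalley's action of a generator on the exterior algebra: exterior multiplication plus
  contraction with the symmetric bilinear form \<open>{g,h}/2\<close> of the Clifford algebra.\<close>

definition chevmul :: "gen \<Rightarrow> pcl \<Rightarrow> pcl" where
  "chevmul g = lext (\<lambda>A. wedge g A + (\<Sum>h\<in>A. smul (pconst (1/2) * brk g h) (contr h A)))"

definition word :: "(gen \<Rightarrow> pcl \<Rightarrow> pcl) \<Rightarrow> gen list \<Rightarrow> pcl" where
  "word mul gs = foldr mul gs (Poly_Mapping.single {} 1)"

text \<open>The order-preserving antilinear involution, for either of the two multiplications.\<close>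

definition dag_pcl :: "(gen \<Rightarrow> pcl \<Rightarrow> pcl) \<Rightarrow> pcl \<Rightarrow> pcl" where
  "dag_pcl mul F = (\<Sum>A\<in>Poly_Mapping.keys F. smul (conj_psc (Poly_Mapping.lookup F A))
     (word mul (map (\<lambda>(d, a). (\<not> d, a)) (sorted_list_of_set A))))"

definition dZ :: "nat \<Rightarrow> nat \<Rightarrow> pcl \<Rightarrow> pcl" where
  "dZ m k F = (\<Sum>a=1..m. clmul (True, a) (cw (pd (False, k, a)) F))"


section \<open>Capelli contractions\<close>

definition sop :: "nat \<Rightarrow> nat \<Rightarrow> pcl \<Rightarrow> pcl" where
  "sop m i F = (\<Sum>a=1..m. lext (contr (False, a)) (cw (pd (False, i, a)) F))"

text \<open>Columns are indexed by \<open>1..N\<close> and padded with 0.\<close>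

definition Cols :: "nat \<Rightarrow> nat \<Rightarrow> (nat \<Rightarrow> pcl) set" where
  "Cols m N = {u. (\<forall>i\<in>{1..N}. u i \<in> PCl m N) \<and> (\<forall>i. i \<notin> {1..N} \<longrightarrow> u i = 0)}"

definition Cz_entry :: "nat \<Rightarrow> nat \<Rightarrow> nat \<Rightarrow> pcl \<Rightarrow> pcl" where
  "Cz_entry m i j F = (if i = j then cscale (of_nat m) F else 0) + cw (Ez m j i) F"

definition Cz :: "nat \<Rightarrow> nat \<Rightarrow> (nat \<Rightarrow> pcl) \<Rightarrow> (nat \<Rightarrow> pcl)" where
  "Cz m N u i = (if i \<in> {1..N} then (\<Sum>j=1..N. Cz_entry m i j (u j)) else 0)"

definition Cz_inv_entry :: "nat \<Rightarrow> nat \<Rightarrow> nat \<Rightarrow> nat \<Rightarrow> pcl \<Rightarrow> pcl" where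
  "Cz_inv_entry m N i l F = inv_into (Cols m N) (Cz m N) (\<lambda>j. if j = l then F else 0) i"

definition nplus :: "nat \<Rightarrow> nat \<Rightarrow> nat \<Rightarrow> pcl \<Rightarrow> pcl" where
  "nplus m N i F = (\<Sum>l=1..N. Cz_inv_entry m N i l (sop m l F))"

definition nminus :: "(gen \<Rightarrow> pcl \<Rightarrow> pcl) \<Rightarrow> nat \<Rightarrow> nat \<Rightarrow> nat \<Rightarrow> pcl \<Rightarrow> pcl" where
  "nminus mul m N i = dag_pcl mul \<circ> nplus m N i \<circ> dag_pcl mul"


section \<open>The gauge\<close>

definition Hpow :: "nat \<Rightarrow> (nat \<times> nat \<Rightarrow>\<^sub>0 nat) \<Rightarrow> psc" where
  "Hpow m \<alpha> = (\<Prod>(i, j)\<in>Poly_Mapping.keys \<alpha>. Hpol m i j ^ Poly_Mapping.lookup \<alpha> (i, j))"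

text \<open>\<open>h\<close> is the finite family of harmonic components of \<open>P = \<Sum>\<^sub>\<alpha> H\<^sup>\<alpha> h\<^sub>\<alpha>\<close>.\<close>

definition hdecomp :: "nat \<Rightarrow> nat \<Rightarrow> psc \<Rightarrow> ((nat \<times> nat \<Rightarrow>\<^sub>0 nat) \<Rightarrow>\<^sub>0 psc) \<Rightarrow> bool" where
  "hdecomp m N P h \<longleftrightarrow>
     (\<forall>\<alpha>\<in>Poly_Mapping.keys h. Poly_Mapping.keys \<alpha> \<subseteq> {1..N} \<times> {1..N} \<and>
        Poly_Mapping.lookup h \<alpha> \<in> Psc m N \<and>
        (\<forall>i\<in>{1..N}. \<forall>j\<in>{1..N}. Lap m i j (Poly_Mapping.lookup h \<alpha>) = 0)) \<and>
     P = (\<Sum>\<alpha>\<in>Poly_Mapping.keys h. Hpow m \<alpha> * Poly_Mapping.lookup h \<alpha>)"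

definition gcoef :: "nat \<Rightarrow> real \<Rightarrow> (nat \<times> nat \<Rightarrow>\<^sub>0 nat) \<Rightarrow> real" where
  "gcoef N q \<alpha> =
     (\<Prod>i=1..N. fact (Poly_Mapping.lookup \<alpha> (i, i)) / cfact q (Poly_Mapping.lookup \<alpha> (i, i))) *
     (\<Prod>(i, j)\<in>{(i, j). i \<in> {1..N} \<and> j \<in> {1..N} \<and> i \<noteq> j}.
        fact (Poly_Mapping.lookup \<alpha> (i, j)) / qfact q (Poly_Mapping.lookup \<alpha> (i, j)))"

definition Gnf :: "nat \<Rightarrow> nat \<Rightarrow> real \<Rightarrow> psc \<Rightarrow> psc" where
  "Gnf m N q P = (let h = (THE h. hdecomp m N P h) in
     \<Sum>\<alpha>\<in>Poly_Mapping.keys h.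
       pconst (of_real (gcoef N q \<alpha>)) * Hpow m \<alpha> * Poly_Mapping.lookup h \<alpha>)"

text \<open>The Chevalley symbol map, from Clifford to exterior labels: \<open>x \<mapsto> x \<cdot> 1\<close> for Chevalley's
  action.\<close>

definition sigCh :: "pcl \<Rightarrow> pcl" where
  "sigCh = lext (\<lambda>A. word chevmul (sorted_list_of_set A))"

definition sigCh_inv :: "nat \<Rightarrow> nat \<Rightarrow> pcl \<Rightarrow> pcl" where
  "sigCh_inv m N = inv_into (PCl m N) sigCh"

definition Kop :: "nat \<Rightarrow> nat \<Rightarrow> pcl \<Rightarrow> pcl" where
  "Kop m N F = cscale (1/2) (\<Sum>i=1..N. \<Sum>j=1..N.
     smul (Hpol m i j) (nminus extmul m N j (nplus m N i F)))"

definition Wop :: "nat \<Rightarrow> nat \<Rightarrow> pcl \<Rightarrow> pcl" where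
  "Wop m N = sigCh_inv m N \<circ> expo cscale (Kop m N) \<circ> sigCh"

definition GnfL :: "nat \<Rightarrow> nat \<Rightarrow> real \<Rightarrow> pcl \<Rightarrow> pcl" where
  "GnfL m N q = sigCh_inv m N \<circ> cw (Gnf m N q) \<circ> sigCh"

definition Gpbw :: "nat \<Rightarrow> nat \<Rightarrow> real \<Rightarrow> pcl \<Rightarrow> pcl" where
  "Gpbw m N q = Wop m N \<circ> GnfL m N q \<circ> inv_into (PCl m N) (Wop m N)"


section \<open>Coefficients of the fermionic modules\<close>

text \<open>
  The tensor product over all pairs \<open>(k,l)\<close> (label \<open>k\<close>, factor \<open>l\<close>) of the one-pair modules is
  free over the tensor product of one copy of the localization of \<open>\<complex>[B]\<close> per pair. That tensor
  product is the localization of \<open>\<complex>[B\<^bsub>kl\<^esub>]\<close> at the linear forms inverted in the single factors;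
  \<open>Amin\<close> realizes it in the field of rational functions in the variables \<open>B\<^bsub>kl\<^esub>\<close>.
\<close>

type_synonym bpol = "(nat \<times> nat \<Rightarrow>\<^sub>0 nat) \<Rightarrow>\<^sub>0 complex"
type_synonym ratB = "bpol fract"

definition bconst :: "complex \<Rightarrow> bpol" where
  "bconst c = Poly_Mapping.single 0 c"

definition bvar :: "nat \<times> nat \<Rightarrow> bpol" where
  "bvar kl = Poly_Mapping.single (Poly_Mapping.single kl 1) 1"

definition rc :: "complex \<Rightarrow> ratB" where
  "rc c = Fract (bconst c) 1"

definition Bv :: "nat \<times> nat \<Rightarrow> ratB" where
  "Bv kl = Fract (bvar kl) 1"

definition sval :: "nat \<Rightarrow> nat \<Rightarrow> real \<Rightarrow> real" where
  "sval m n q = 1 / of_nat n * q powi (2 * int m - 2 * int n) * qnum q (2 * n)"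

inductive_set Dens :: "nat \<Rightarrow> nat \<Rightarrow> real \<Rightarrow> bpol set" for N n :: nat and s :: real where
  one: "1 \<in> Dens N n s"
| pole: "\<lbrakk>d \<in> Dens N n s; kl \<in> {1..N} \<times> {1..n}\<rbrakk> \<Longrightarrow>
     d * (bvar kl + bconst (2 * \<i> * of_int j) - bconst \<i>) \<in> Dens N n s"
| minus: "\<lbrakk>d \<in> Dens N n s; kl \<in> {1..N} \<times> {1..n}\<rbrakk> \<Longrightarrow>
     d * (bconst (of_real s) - bconst (2 * \<i>) * (bvar kl + bconst (2 * \<i> * of_int j))) \<in> Dens N n s"
| plus: "\<lbrakk>d \<in> Dens N n s; kl \<in> {1..N} \<times> {1..n}\<rbrakk> \<Longrightarrow>
     d * (bconst (of_real s) + bconst (2 * \<i>) * (bvar kl + bconst (2 * \<i> * of_int j))) \<in> Dens N n s"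

definition Amin :: "nat \<Rightarrow> nat \<Rightarrow> real \<Rightarrow> ratB set" where
  "Amin N n s = {Fract p d | p d. d \<in> Dens N n s \<and>
     (\<forall>\<mu>\<in>Poly_Mapping.keys p. Poly_Mapping.keys \<mu> \<subseteq> {1..N} \<times> {1..n})}"

text \<open>Conjugation of coefficients fixes every \<open>B\<close>: \<open>a \<leftrightarrow> b\<close> sends \<open>B = ba - i\<close> to
  \<open>ab + i = ba - i\<close>.\<close>

definition conj_bpol :: "bpol \<Rightarrow> bpol" where
  "conj_bpol p = Poly_Mapping.map cnj p"

definition conj_rat :: "ratB \<Rightarrow> ratB" where
  "conj_rat x = (THE y. \<exists>p d. d \<noteq> 0 \<and> x = Fract p d \<and> y = Fract (conj_bpol p) (conj_bpol d))"


section \<open>One fermionic pair\<close>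

text \<open>
  \<open>(E0, c)\<close>, \<open>(Et, c)\<close>, \<open>(Eb, c)\<close>, \<open>(E2, c)\<close> label the basis vectors \<open>x\<^sub>c\<close>,
  \<open>\<vartheta> x\<^bsub>c+1\<^esub>\<close>, \<open>\<vartheta>bar x\<^bsub>c-1\<^esub>\<close>, \<open>\<vartheta> \<vartheta>bar x\<^sub>c\<close> of the charge-\<open>c\<close> module. The functions
  of \<open>B\<close> below are evaluated at elements of the coefficient field.
\<close>

datatype fstate = E0 | Et | Eb | E2

type_synonym plab = "fstate \<times> int"

definition oddst :: "plab \<Rightarrow> bool" where
  "oddst t \<longleftrightarrow> fst t \<in> {Et, Eb}"

definition bet :: "int \<Rightarrow> ratB \<Rightarrow> ratB" where
  "bet j x = (if j \<ge> 1 then x + rc (of_int (2 * j - 1) * \<i>) else 1)"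

definition alp :: "int \<Rightarrow> ratB \<Rightarrow> ratB" where
  "alp j x = (if j \<ge> 0 then 1 else x + rc (of_int (2 * j + 1) * \<i>))"

definition Phi :: "real \<Rightarrow> ratB \<Rightarrow> ratB" where
  "Phi s x = (rc (4 - of_real s) + rc (2 * \<i>) * x) / (x - rc \<i>)"

definition sigp :: "real \<Rightarrow> int \<Rightarrow> ratB \<Rightarrow> ratB" where
  "sigp s c x = bet (c + 1) x * Phi s (x + rc (2 * \<i> * of_int (c + 1)))"

definition pip :: "real \<Rightarrow> int \<Rightarrow> ratB \<Rightarrow> ratB" where
  "pip s c x = rc (-1/4) * sigp s c x"

definition kapp :: "real \<Rightarrow> int \<Rightarrow> ratB \<Rightarrow> ratB" where
  "kapp s c x = rc (-1/4) * sigp s c x * alp c x"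

definition Kc :: "int \<Rightarrow> ratB \<Rightarrow> ratB" where
  "Kc c x = rc (1 / (2 * \<i>)) * alp (c - 1) x * bet c x"

fun Q1 :: "real \<Rightarrow> ratB \<Rightarrow> plab \<Rightarrow> (plab \<Rightarrow>\<^sub>0 ratB)" where
  "Q1 s x (E0, c) = 0"
| "Q1 s x (Et, c) = Poly_Mapping.single (E0, c) (pip s c x)"
| "Q1 s x (Eb, c) = 0"
| "Q1 s x (E2, c) = Poly_Mapping.single (Eb, c) (rc (1 / (2 * \<i>)) * bet c x)"

fun h1 :: "real \<Rightarrow> ratB \<Rightarrow> plab \<Rightarrow> (plab \<Rightarrow>\<^sub>0 ratB)" where
  "h1 s x (E0, c) = Poly_Mapping.single (Et, c) (inverse (pip s c x))"
| "h1 s x (Et, c) = 0"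
| "h1 s x (Eb, c) = Poly_Mapping.single (E2, c) (rc (2 * \<i>) * inverse (bet c x))"
| "h1 s x (E2, c) = 0"

text \<open>The involution on labels: \<open>x\<^sub>c \<mapsto> x\<^bsub>-c\<^esub>\<close>, and \<open>\<vartheta> \<vartheta>bar \<mapsto> \<vartheta>bar \<vartheta> = - \<vartheta> \<vartheta>bar\<close> because the
  order is preserved.\<close>

fun dag_lab :: "plab \<Rightarrow> plab" where
  "dag_lab (E0, c) = (E0, - c)"
| "dag_lab (Et, c) = (Eb, - c)"
| "dag_lab (Eb, c) = (Et, - c)"
| "dag_lab (E2, c) = (E2, - c)"


section \<open>The fermionic factors\<close>

text \<open>
  A label assigns a one-pair label to every pair \<open>(k,l)\<close>, with \<open>(E0, 0)\<close> outside
  \<open>{1..N} \<times> {1..n}\<close>. The factors are ordered lexicographically in \<open>(k,l)\<close>: first by label \<open>k\<close>,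
  within one label by \<open>l\<close>.
\<close>

type_synonym flab = "nat \<times> nat \<Rightarrow> plab"
type_synonym ferm = "flab \<Rightarrow>\<^sub>0 ratB"

definition fpar :: "flab \<Rightarrow> nat" where
  "fpar b = card {kl. oddst (b kl)}"

text \<open>Graded embedding of an odd one-pair map in the factor \<open>kl\<close>.\<close>

definition emb :: "(ratB \<Rightarrow> plab \<Rightarrow> (plab \<Rightarrow>\<^sub>0 ratB)) \<Rightarrow> nat \<times> nat \<Rightarrow> ferm \<Rightarrow> ferm" where
  "emb f kl = lext (\<lambda>b. smul ((-1) ^ card {kl'. kl' < kl \<and> oddst (b kl')})
     (lext (\<lambda>t. Poly_Mapping.single (b(kl := t)) 1) (f (Bv kl) (b kl))))"

definition dag_ferm :: "ferm \<Rightarrow> ferm" where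
  "dag_ferm v = (\<Sum>b\<in>Poly_Mapping.keys v. Poly_Mapping.single (dag_lab \<circ> b)
     ((-1) ^ card {kl. fst (b kl) = E2} * conj_rat (Poly_Mapping.lookup v b)))"

definition Qp :: "nat \<Rightarrow> nat \<Rightarrow> real \<Rightarrow> nat \<Rightarrow> ferm \<Rightarrow> ferm" where
  "Qp m n q k = (\<Sum>l=1..n. emb (Q1 (sval m n q)) (k, l))"

definition hp :: "nat \<Rightarrow> nat \<Rightarrow> real \<Rightarrow> nat \<Rightarrow> ferm \<Rightarrow> ferm" where
  "hp m n q k v = smul (rc (1 / of_nat n)) (\<Sum>l=1..n. emb (h1 (sval m n q)) (k, l) v)"

definition delm :: "nat \<Rightarrow> real \<Rightarrow> real" where
  "delm m q = (of_nat (2 * m) - qnum q (2 * m)) / 4"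

text \<open>The scalar by which \<open>B\<^sub>q\<^sup>(\<^sup>j\<^sup>)\<close> acts in Euler degree \<open>r\<close>.\<close>

definition Bq :: "real \<Rightarrow> nat \<Rightarrow> nat \<Rightarrow> real" where
  "Bq q j r = cnum q (r + j) / of_nat (r + j)"

text \<open>Eigenvalues of the projector for the factor \<open>kl\<close> and, for a set \<open>S\<close> of factors of label
  \<open>k\<close>, of the product projector.\<close>

definition Pj :: "nat \<times> nat \<Rightarrow> flab \<Rightarrow> ratB" where
  "Pj kl b = of_bool (fst (b kl) \<in> {Eb, E2})"

definition PS :: "nat \<Rightarrow> nat \<Rightarrow> nat set \<Rightarrow> flab \<Rightarrow> ratB" where
  "PS n k S b = (\<Prod>l\<in>S. Pj (k, l) b) * (\<Prod>l\<in>{1..n} - S. 1 - Pj (k, l) b)"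

definition Mp :: "nat \<Rightarrow> nat \<Rightarrow> real \<Rightarrow> nat \<Rightarrow> nat \<Rightarrow> ferm \<Rightarrow> ferm" where
  "Mp m n q k r = lext (\<lambda>b. Poly_Mapping.single b (rc (of_real (delm m q)) +
     (\<Sum>S | S \<subseteq> {1..n} \<and> S \<noteq> {}. PS n k S b *
        ((\<Sum>l\<in>S. kapp (sval m n q) (snd (b (k, l))) (Bv (k, l))) - of_nat (card S)
         - rc (of_real (Bq q (card S) r)) * (\<Sum>l\<in>S. Kc (snd (b (k, l))) (Bv (k, l)))))))"

definition Np :: "nat \<Rightarrow> nat \<Rightarrow> real \<Rightarrow> nat \<Rightarrow> nat \<Rightarrow> ferm \<Rightarrow> ferm" where
  "Np m n q k r v = - hp m n q k (Mp m n q k r v)"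

definition Nm :: "nat \<Rightarrow> nat \<Rightarrow> real \<Rightarrow> nat \<Rightarrow> nat \<Rightarrow> ferm \<Rightarrow> ferm" where
  "Nm m n q k r = dag_ferm \<circ> Np m n q k r \<circ> dag_ferm"


section \<open>The total module\<close>

type_synonym tot = "(zmon \<times> gen set \<times> flab) \<Rightarrow>\<^sub>0 ratB"

definition Mcar :: "nat \<Rightarrow> nat \<Rightarrow> nat \<Rightarrow> real \<Rightarrow> tot set" where
  "Mcar m N n q = {v. \<forall>(\<mu>, A, b)\<in>Poly_Mapping.keys v.
     Poly_Mapping.keys \<mu> \<subseteq> UNIV \<times> {1..N} \<times> {1..m} \<and> A \<subseteq> UNIV \<times> {1..m} \<and>
     (\<forall>kl. kl \<notin> {1..N} \<times> {1..n} \<longrightarrow> b kl = (E0, 0)) \<and>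
     Poly_Mapping.lookup v (\<mu>, A, b) \<in> Amin N n (sval m n q)}"

definition mscale :: "complex \<Rightarrow> tot \<Rightarrow> tot" where
  "mscale c = smul (rc c)"

definition tens :: "pcl \<Rightarrow> ferm \<Rightarrow> tot" where
  "tens F e = (\<Sum>A\<in>Poly_Mapping.keys F. \<Sum>\<mu>\<in>Poly_Mapping.keys (Poly_Mapping.lookup F A).
     \<Sum>b\<in>Poly_Mapping.keys e. Poly_Mapping.single (\<mu>, A, b)
       (rc (Poly_Mapping.lookup (Poly_Mapping.lookup F A) \<mu>) * Poly_Mapping.lookup e b))"

text \<open>\<open>gtens d X Y\<close> is the graded tensor product of \<open>X\<close> and \<open>Y\<close>, \<open>d\<close> being the parity of \<open>Y\<close>.
  The operator \<open>Y\<close> may depend on the monomial it is tensored with: this is how its Euler degree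
  coefficients act on the bosonic factor.\<close>

definition gtens :: "nat \<Rightarrow> (pcl \<Rightarrow> pcl) \<Rightarrow> (zmon \<Rightarrow> ferm \<Rightarrow> ferm) \<Rightarrow> tot \<Rightarrow> tot" where
  "gtens d X Y = lext (\<lambda>(\<mu>, A, b). smul ((-1) ^ (d * card A))
     (tens (X (Poly_Mapping.single A (Poly_Mapping.single \<mu> 1))) (Y \<mu> (Poly_Mapping.single b 1))))"

definition dag :: "tot \<Rightarrow> tot" where
  "dag v = (\<Sum>(\<mu>, A, b)\<in>Poly_Mapping.keys v. smul (conj_rat (Poly_Mapping.lookup v (\<mu>, A, b)))
     (tens (dag_pcl clmul (Poly_Mapping.single A (Poly_Mapping.single \<mu> 1)))
           (dag_ferm (Poly_Mapping.single b 1))))"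

definition grading :: "tot \<Rightarrow> tot" where
  "grading = lext (\<lambda>(\<mu>, A, b). Poly_Mapping.single (\<mu>, A, b) ((-1) ^ (card A + fpar b)))"

definition evenpart :: "(tot \<Rightarrow> tot) \<Rightarrow> tot \<Rightarrow> tot" where
  "evenpart X v = mscale (1/2) (X v + grading (X (grading v)))"

definition oddpart :: "(tot \<Rightarrow> tot) \<Rightarrow> tot \<Rightarrow> tot" where
  "oddpart X v = mscale (1/2) (X v - grading (X (grading v)))"

text \<open>\<open>ads Y X\<close> is the superbracket of \<open>Y\<close> and \<open>X\<close>, extended bilinearly from homogeneous
  operators.\<close>

definition ads :: "(tot \<Rightarrow> tot) \<Rightarrow> (tot \<Rightarrow> tot) \<Rightarrow> tot \<Rightarrow> tot" where
  "ads Y X v =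
      (evenpart Y (evenpart X v) - evenpart X (evenpart Y v))
    + (evenpart Y (oddpart X v) - oddpart X (evenpart Y v))
    + (oddpart Y (evenpart X v) - evenpart X (oddpart Y v))
    + (oddpart Y (oddpart X v) + oddpart X (oddpart Y v))"


section \<open>Transport\<close>

definition Ap :: "nat \<Rightarrow> nat \<Rightarrow> real \<Rightarrow> nat \<Rightarrow> tot \<Rightarrow> tot" where
  "Ap m n q k = gtens 0 (dZ m k) (\<lambda>_. id) + gtens 1 id (\<lambda>_. Qp m n q k)"

definition Am :: "nat \<Rightarrow> nat \<Rightarrow> real \<Rightarrow> nat \<Rightarrow> tot \<Rightarrow> tot" where
  "Am m n q k = dag \<circ> Ap m n q k \<circ> dag"

definition Hp :: "nat \<Rightarrow> nat \<Rightarrow> nat \<Rightarrow> real \<Rightarrow> nat \<Rightarrow> tot \<Rightarrow> tot" where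
  "Hp m N n q i = gtens 1 (nplus m N i) (\<lambda>\<mu>. Np m n q i (edeg m True i \<mu>))"

definition Hm :: "nat \<Rightarrow> nat \<Rightarrow> nat \<Rightarrow> real \<Rightarrow> nat \<Rightarrow> tot \<Rightarrow> tot" where
  "Hm m N n q i = gtens 1 (nminus clmul m N i) (\<lambda>\<mu>. Nm m n q i (edeg m False i \<mu>))"

definition Up :: "nat \<Rightarrow> nat \<Rightarrow> nat \<Rightarrow> real \<Rightarrow> tot \<Rightarrow> tot" where
  "Up m N n q = expo mscale (\<Sum>i=1..N. Hp m N n q i)"

definition Um :: "nat \<Rightarrow> nat \<Rightarrow> nat \<Rightarrow> real \<Rightarrow> tot \<Rightarrow> tot" where
  "Um m N n q = expo mscale (\<Sum>i=1..N. Hm m N n q i)"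

definition GM :: "nat \<Rightarrow> nat \<Rightarrow> real \<Rightarrow> tot \<Rightarrow> tot" where
  "GM m N q = gtens 0 (Gpbw m N q) (\<lambda>_. id)"

definition opinv :: "nat \<Rightarrow> nat \<Rightarrow> nat \<Rightarrow> real \<Rightarrow> (tot \<Rightarrow> tot) \<Rightarrow> tot \<Rightarrow> tot" where
  "opinv m N n q X = inv_into (Mcar m N n q) X"

definition Dp :: "nat \<Rightarrow> nat \<Rightarrow> nat \<Rightarrow> real \<Rightarrow> nat \<Rightarrow> tot \<Rightarrow> tot" where
  "Dp m N n q k = GM m N q \<circ> opinv m N n q (Up m N n q) \<circ> Ap m n q k \<circ>
     Up m N n q \<circ> opinv m N n q (GM m N q)"

definition Dm :: "nat \<Rightarrow> nat \<Rightarrow> nat \<Rightarrow> real \<Rightarrow> nat \<Rightarrow> tot \<Rightarrow> tot" where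
  "Dm m N n q k = GM m N q \<circ> opinv m N n q (Um m N n q) \<circ> Am m n q k \<circ>
     Um m N n q \<circ> opinv m N n q (GM m N q)"


section \<open>Seed, tail and ordered products\<close>

definition Ad :: "nat \<Rightarrow> nat \<Rightarrow> nat \<Rightarrow> real \<Rightarrow> (tot \<Rightarrow> tot) \<Rightarrow> (tot \<Rightarrow> tot) \<Rightarrow> tot \<Rightarrow> tot" where
  "Ad m N n q R X = R \<circ> X \<circ> opinv m N n q R"

definition Lseed :: "nat \<Rightarrow> nat \<Rightarrow> real \<Rightarrow> nat \<Rightarrow> nat \<Rightarrow> tot \<Rightarrow> tot" where
  "Lseed m n q k j = acomm (Ap m n q k) (Am m n q j)"

definition Rq :: "nat \<Rightarrow> nat \<Rightarrow> nat \<Rightarrow> real \<Rightarrow> tot \<Rightarrow> tot" where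
  "Rq m N n q = Up m N n q \<circ> opinv m N n q (Um m N n q)"

definition Omg :: "nat \<Rightarrow> nat \<Rightarrow> nat \<Rightarrow> real \<Rightarrow> nat \<Rightarrow> tot \<Rightarrow> tot" where
  "Omg m N n q j = Ad m N n q (Rq m N n q) (Am m n q j) - Am m n q j"

definition Ri :: "nat \<Rightarrow> nat \<Rightarrow> nat \<Rightarrow> real \<Rightarrow> nat \<Rightarrow> tot \<Rightarrow> tot" where
  "Ri m N n q i = (id + Hp m N n q i) \<circ> (id - Hm m N n q i)"

definition Kap :: "nat \<Rightarrow> nat \<Rightarrow> nat \<Rightarrow> real \<Rightarrow> nat \<Rightarrow> (tot \<Rightarrow> tot) \<Rightarrow> tot \<Rightarrow> tot" where
  "Kap m N n q i X = Ad m N n q (Ri m N n q i) X - X"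

definition Theta :: "nat \<Rightarrow> nat \<Rightarrow> nat \<Rightarrow> real \<Rightarrow> nat \<Rightarrow> nat \<Rightarrow> tot \<Rightarrow> tot" where
  "Theta m N n q k i =
     (opinv m N n q (Ri m N n q i) \<circ> Ap m n q k \<circ> Ri m N n q i) - Ap m n q k"

text \<open>The product of the \<open>I + \<K>\<^sub>i\<close> over \<open>a \<le> i < b\<close> in increasing order, \<open>i = a\<close> outermost.\<close>

definition Tprod :: "nat \<Rightarrow> nat \<Rightarrow> nat \<Rightarrow> real \<Rightarrow> nat \<Rightarrow> nat \<Rightarrow> (tot \<Rightarrow> tot) \<Rightarrow> tot \<Rightarrow> tot" where
  "Tprod m N n q a b = foldr (\<lambda>i T. (id + Kap m N n q i) \<circ> T) [a..<b] id"

abbreviation "T_all m N n q \<equiv> Tprod m N n q 1 (N + 1)"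
abbreviation "T_below m N n q r \<equiv> Tprod m N n q 1 r"
abbreviation "T_above m N n q r \<equiv> Tprod m N n q (r + 1) (N + 1)"

end

theory Submission
  imports Defs
begin

text \<open>
  Writing \<open>H\<^sub>i\<^sup>\<plusminus>\<close> for the transport generators, all of them are even and square to zero, and they
  commute with each other except for \<open>H\<^sub>i\<^sup>+\<close> with \<open>H\<^sub>i\<^sup>-\<close>: the contractions \<open>n\<^sub>i\<^sup>\<plusminus>\<close> anticommute,
  which follows from the commutation relations of the Capelli matrix and its invertibility, and the
  operators \<open>N\<^sub>i\<^sup>\<plusminus>\<close> of different labels anticommute. Hence \<open>exp (\<Sum>\<^sub>i H\<^sub>i\<^sup>\<plusminus>) = \<Prod>\<^sub>i (1 + H\<^sub>i\<^sup>\<plusminus>)\<close>,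
  so \<open>R\<^sub>q = R\<^sub>1 \<cdots> R\<^sub>N\<close>, and the formula is obtained by telescoping
  \<open>{A, R B R\<^sup>-\<^sup>1} = R {A, B} R\<^sup>-\<^sup>1 + R {R\<^sup>-\<^sup>1 A R - A, B} R\<^sup>-\<^sup>1\<close>.

  The second formula needs the invertibility of the gauge. The Capelli matrix is
  \<open>\<Sum>\<^sub>a \<partial>\<^sub>i\<^sub>a z\<^sub>j\<^sub>a\<close>, hence positive definite for the Fischer inner product. For the same inner product
  the harmonic polynomials are the orthogonal complement of the ideal of the \<open>H\<^sub>i\<^sub>j\<close>, which gives
  existence of the decomposition \<open>\<Sum>\<^sub>\<alpha> H\<^sup>\<alpha> h\<^sub>\<alpha>\<close>; uniqueness for \<open>m \<ge> 2N\<close> holds because the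
  \<open>H\<^sub>i\<^sub>j\<close> have leading monomials in pairwise disjoint variables. The Chevalley map and \<open>W\<close> are
  unipotent for the filtration by Clifford degree.
\<close>

text \<open>Operators are total functions on ambient types and inverses are taken with
  \<open>inv_into\<close> on carriers, so identities have to be paired with stability of the
  carrier. For the fermionic coefficients this means that all matrix entries, including the inverses
  of pi_c^+ and beta_c, stay in the localization \<open>Amin\<close>. The contractions n_i^+ have no
  closed formula: they are known only through the linear system C n = s, and their properties are
  obtained by showing that two columns solve the same system. The products of H_i^+ and H_j^- also
  involve the Euler degrees on which N_i^+ and N_j^- depend. For different labels these degrees are
  untouched by n_j^- and n_i^+, and the fermionic blocks are disjoint; for equal labels no such
  invariance is available, so H_i^+ and H_i^- are kept together inside R_i, in this order. Since the
  superbracket is defined through parity projections, the operators have to be shown homogeneous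
  before the bracket becomes an anticommutator.\<close>

abbreviation lookup :: "('a \<Rightarrow>\<^sub>0 'b::zero) \<Rightarrow> 'a \<Rightarrow> 'b" where
  "lookup \<equiv> Poly_Mapping.lookup"
abbreviation keys :: "('a \<Rightarrow>\<^sub>0 'b::zero) \<Rightarrow> 'a set" where
  "keys \<equiv> Poly_Mapping.keys"
abbreviation single :: "'a \<Rightarrow> 'b \<Rightarrow> 'a \<Rightarrow>\<^sub>0 'b::zero" where
  "single \<equiv> Poly_Mapping.single"

section \<open>Linear maps of finitely supported functions\<close>

lemma lookup_map_zero: "f 0 = 0 \<Longrightarrow> lookup (Poly_Mapping.map f p) k = f (lookup p k)"
  by (simp add: Poly_Mapping.map.rep_eq when_def)

lemma lookup_smul [simp]: "lookup (smul r v) k = r * lookup v k"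
  by (simp add: smul_def lookup_map_zero)

lemma smul_add: "smul r (v + w) = smul r v + smul r w"
  by (rule poly_mapping_eqI) (simp add: lookup_add algebra_simps)

lemma smul_add_left: "smul (r + s) v = smul r v + smul s v"
  by (rule poly_mapping_eqI) (simp add: lookup_add algebra_simps)

lemma smul_zero [simp]: "smul r 0 = 0"
  by (rule poly_mapping_eqI) simp

lemma smul_zero_left [simp]: "smul 0 v = 0"
  by (rule poly_mapping_eqI) simp

lemma smul_one [simp]: "smul 1 v = v"
  by (rule poly_mapping_eqI) simp

lemma smul_smul [simp]: "smul r (smul s v) = smul (r * s) v"
  by (rule poly_mapping_eqI) (simp add: algebra_simps)

lemma smul_minus: "smul r (- v) = - smul r v"
  by (rule poly_mapping_eqI) simp

lemma smul_minus_left: "smul (- r) v = - smul r v"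
  by (rule poly_mapping_eqI) simp

lemma smul_diff: "smul r (v - w) = smul r v - smul r w"
  by (rule poly_mapping_eqI) (simp add: lookup_minus algebra_simps)

lemma smul_sum: "smul r (sum f I) = (\<Sum>i\<in>I. smul r (f i))"
  by (rule poly_mapping_eqI) (simp add: lookup_sum sum_distrib_left)

lemma smul_single [simp]: "smul r (single b s) = single b (r * s)"
  by (rule poly_mapping_eqI) (simp add: lookup_single when_def)

lemma keys_smul_subset: "keys (smul r v) \<subseteq> keys v"
  by (auto simp: in_keys_iff)

lemma poly_mapping_expand: "v = (\<Sum>b\<in>keys v. single b (lookup v b))"
proof (rule poly_mapping_eqI)
  fix k
  show "lookup v k = lookup (\<Sum>b\<in>keys v. single b (lookup v b)) k"
    by (simp add: lookup_sum lookup_single when_def in_keys_iff sum.delta)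
qed

lemma lookup_lext: "lookup (lext \<phi> v) k = (\<Sum>b\<in>keys v. lookup v b * lookup (\<phi> b) k)"
  by (simp add: lext_def lookup_sum)

lemma lookup_lext_superset:
  assumes "finite I" "keys v \<subseteq> I"
  shows "lookup (lext \<phi> v) k = (\<Sum>b\<in>I. lookup v b * lookup (\<phi> b) k)"
  unfolding lookup_lext using assms by (intro sum.mono_neutral_left) (auto simp: in_keys_iff)

text \<open>Linearity over the full coefficient ring. Maps built from \<open>lext\<close> have it;
  the contractions \<open>nplus\<close> and the gauge are linear over complex scalars only and are
  treated with \<open>PLin\<close> below.\<close>

definition slin :: "(('a \<Rightarrow>\<^sub>0 'r::comm_ring_1) \<Rightarrow> ('b \<Rightarrow>\<^sub>0 'r)) \<Rightarrow> bool" where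
  "slin f \<longleftrightarrow> (\<forall>v w. f (v + w) = f v + f w) \<and> (\<forall>r v. f (smul r v) = smul r (f v))"

lemma slin_add: "slin f \<Longrightarrow> f (v + w) = f v + f w"
  and slin_smul: "slin f \<Longrightarrow> f (smul r v) = smul r (f v)"
  by (auto simp: slin_def)

lemma slin_zero: "slin f \<Longrightarrow> f 0 = 0"
  using slin_smul[of f 0 0] by simp

lemma slin_minus: "slin f \<Longrightarrow> f (- v) = - f v"
  using slin_smul[of f "-1" v] by (simp add: smul_minus_left)

lemma slin_diff: "slin f \<Longrightarrow> f (v - w) = f v - f w"
  using slin_add[of f v "- w"] by (simp add: slin_minus)

lemma slin_sum: "slin f \<Longrightarrow> f (sum g I) = (\<Sum>i\<in>I. f (g i))"
  by (induction I rule: infinite_finite_induct) (auto simp: slin_zero slin_add)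

lemma slin_lext: "slin (lext \<phi>)"
  unfolding slin_def
proof (intro conjI allI)
  fix v w :: "'a \<Rightarrow>\<^sub>0 'b" and r
  have "keys (v + w) \<subseteq> keys v \<union> keys w" by (rule Poly_Mapping.keys_add)
  then show "lext \<phi> (v + w) = lext \<phi> v + lext \<phi> w"
    by (intro poly_mapping_eqI)
      (simp add: lookup_lext_superset[of "keys v \<union> keys w"] lookup_add algebra_simps sum.distrib)
  show "lext \<phi> (smul r v) = smul r (lext \<phi> v)"
    by (intro poly_mapping_eqI)
      (simp add: lookup_lext_superset[of "keys v"] keys_smul_subset sum_distrib_left algebra_simps)
qed

lemmas lext_add = slin_add[OF slin_lext] and lext_smul = slin_smul[OF slin_lext]
  and lext_zero [simp] = slin_zero[OF slin_lext] and lext_minus = slin_minus[OF slin_lext]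
  and lext_diff = slin_diff[OF slin_lext] and lext_sum = slin_sum[OF slin_lext]

lemma lext_single [simp]: "lext \<phi> (single b r) = smul r (\<phi> b)"
  by (cases "r = 0") (auto simp: lext_def)

lemma slin_comp: "slin f \<Longrightarrow> slin g \<Longrightarrow> slin (\<lambda>v. f (g v))"
  by (simp add: slin_def)

lemma slin_plus: "slin f \<Longrightarrow> slin g \<Longrightarrow> slin (\<lambda>v. f v + g v)"
  by (simp add: slin_def smul_add algebra_simps)

lemma slin_smult: "slin f \<Longrightarrow> slin (\<lambda>v. smul r (f v))"
  by (simp add: slin_def smul_add algebra_simps)

lemma slin_uminus: "slin f \<Longrightarrow> slin (\<lambda>v. - f v)"
  by (simp add: slin_def smul_minus algebra_simps)

lemma slin_sum_fun: "(\<And>i. i \<in> I \<Longrightarrow> slin (f i)) \<Longrightarrow> slin (\<lambda>v. \<Sum>i\<in>I. f i v)"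
  by (simp add: slin_def smul_sum sum.distrib)

lemma slin_id: "slin (\<lambda>v. v)"
  by (simp add: slin_def)

lemma slin_expand:
  assumes "slin f"
  shows "f v = (\<Sum>b\<in>keys v. smul (lookup v b) (f (single b 1)))"
proof -
  have "f v = f (\<Sum>b\<in>keys v. smul (lookup v b) (single b 1))"
    using poly_mapping_expand[of v] by simp
  also have "\<dots> = (\<Sum>b\<in>keys v. smul (lookup v b) (f (single b 1)))"
    using assms by (simp add: slin_sum slin_smul del: smul_single)
  finally show ?thesis .
qed

lemma slin_eqI:
  assumes "slin f" "slin g" "\<And>b. b \<in> keys v \<Longrightarrow> f (single b 1) = g (single b 1)"
  shows "f v = g v"
  using assms by (subst slin_expand, simp, subst slin_expand[of g], simp) simp

lemma lookup_slin:
  assumes "slin f" "finite I" "keys v \<subseteq> I"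
  shows "lookup (f v) k = (\<Sum>b\<in>I. lookup v b * lookup (f (single b 1)) k)"
proof -
  have "lookup (f v) k = (\<Sum>b\<in>keys v. lookup v b * lookup (f (single b 1)) k)"
    by (subst slin_expand[OF assms(1)]) (simp add: lookup_sum)
  then show ?thesis
    using assms by (auto intro!: sum.mono_neutral_left simp: in_keys_iff)
qed

section \<open>Scalar polynomials and the Fischer form\<close>

text \<open>A product is a double sum of products of monomials, so an additive map is multiplicative
  once it is so on monomials. This serves both conjugations, of \<open>psc\<close> and of
  \<open>bpol\<close>.\<close>

lemma poly_mapping_mult_hom:
  fixes f :: "('a::monoid_add \<Rightarrow>\<^sub>0 'b::semiring_0) \<Rightarrow> 'c::semiring_0"
  assumes zero: "f 0 = 0" and add: "\<And>p q. f (p + q) = f p + f q"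
    and mult: "\<And>a r b s. f (single (a + b) (r * s)) = f (single a r) * f (single b s)"
  shows "f (p * q) = f p * f q"
proof -
  have sum: "f (sum g I) = (\<Sum>i\<in>I. f (g i))" for g :: "'d \<Rightarrow> _" and I
    by (induction I rule: infinite_finite_induct) (auto simp: zero add)
  have sum2: "f (sum g I) = (\<Sum>i\<in>I. f (g i))" for g :: "'a \<Rightarrow> _" and I
    by (induction I rule: infinite_finite_induct) (auto simp: zero add)
  have "p * q = (\<Sum>a\<in>keys p. \<Sum>b\<in>keys q. single (a + b) (lookup p a * lookup q b))"
    by (subst poly_mapping_expand[of p], subst poly_mapping_expand[of q])
      (simp add: sum_product mult_single)
  then have "f (p * q) = (\<Sum>a\<in>keys p. \<Sum>b\<in>keys q. f (single a (lookup p a)) * f (single b (lookup q b)))"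
    by (simp add: sum2 mult)
  also have "\<dots> = f (\<Sum>a\<in>keys p. single a (lookup p a)) * f (\<Sum>b\<in>keys q. single b (lookup q b))"
    by (simp add: sum2 sum_product)
  finally show ?thesis
    by (simp flip: poly_mapping_expand)
qed

lemma pconst_mult: "pconst c * p = smul c p"
  by (simp add: pconst_def smul_def mult_map_scale_conv_mult)

lemma slin_zv: "slin (\<lambda>p. zv x * p)"
  by (auto simp: slin_def algebra_simps pconst_mult[symmetric])

lemma zv_single: "zv x * single \<mu> c = single (\<mu> + single x 1) c"
  by (simp add: zv_def mult_single add.commute)

text \<open>Subtraction of exponents is truncated; dividing by x inverts multiplying by x only where
  x occurs.\<close>

lemma mon_diff_eq_iff:
  fixes \<mu> \<nu> :: "'a \<Rightarrow>\<^sub>0 nat"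
  assumes "lookup \<nu> x \<noteq> 0"
  shows "\<nu> - single x 1 = \<mu> \<longleftrightarrow> \<nu> = \<mu> + single x 1"
proof
  assume "\<nu> - single x 1 = \<mu>"
  then have "\<mu> + single x 1 = (\<nu> - single x 1) + single x 1" by simp
  also have "\<dots> = \<nu>"
    by (rule poly_mapping_eqI) (use assms in \<open>auto simp: lookup_add lookup_minus lookup_single when_def\<close>)
  finally show "\<nu> = \<mu> + single x 1" ..
qed simp

lemma lookup_zv_mult:
  "lookup (zv x * p) \<mu> = (if lookup \<mu> x = 0 then 0 else lookup p (\<mu> - single x 1))"
proof -
  have "zv x * p = lext (\<lambda>\<nu>. single (\<nu> + single x 1) 1) p"
    by (rule slin_eqI[OF slin_zv slin_lext]) (simp add: zv_single)
  then have "lookup (zv x * p) \<mu> = (\<Sum>\<nu>\<in>keys p. if \<nu> + single x 1 = \<mu> then lookup p \<nu> else 0)"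
    by (auto simp: lookup_lext lookup_single when_def intro!: sum.cong)
  also have "\<dots> = (if lookup \<mu> x = 0 then 0 else lookup p (\<mu> - single x 1))"
  proof (cases "lookup \<mu> x = 0")
    case True
    then have "\<nu> + single x 1 \<noteq> \<mu>" for \<nu>
      by (auto simp: lookup_add)
    with True show ?thesis by simp
  next
    case False
    then have "\<nu> + single x 1 = \<mu> \<longleftrightarrow> \<nu> = \<mu> - single x 1" for \<nu>
      using mon_diff_eq_iff[of \<mu> x \<nu>] by auto
    with False show ?thesis by (auto simp: sum.delta in_keys_iff)
  qed
  finally show ?thesis .
qed

text \<open>Reading off a coefficient raises the exponent, so the truncated difference in
  \<open>pd\<close> disappears: the monomials for which it truncates carry the factor 0.\<close>

lemma lookup_pd:
  "lookup (pd x p) \<mu> = of_nat (lookup \<mu> x + 1) * lookup p (\<mu> + single x 1)"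
proof -
  have *: "lookup (single (\<nu> - single x 1) (of_nat (lookup \<nu> x) * lookup p \<nu>)) \<mu>
      = (if \<nu> = \<mu> + single x 1 then of_nat (lookup \<mu> x + 1) * lookup p (\<mu> + single x 1) else 0)" for \<nu>
  proof (cases "lookup \<nu> x = 0")
    case True
    then show ?thesis by (auto simp: lookup_add)
  next
    case False
    then show ?thesis
      using mon_diff_eq_iff[OF False, of \<mu>] by (auto simp: lookup_single when_def lookup_add)
  qed
  show ?thesis
    unfolding pd_def lookup_sum * by (auto simp: sum.delta in_keys_iff)
qed

lemma slin_pd: "slin (pd x)"
  unfolding slin_def by (auto intro!: poly_mapping_eqI simp: lookup_pd lookup_add algebra_simps)

lemma pd_commute: "pd x (pd y p) = pd y (pd x p)"
  by (rule poly_mapping_eqI) (auto simp: lookup_pd lookup_add lookup_single when_def algebra_simps)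

lemma pd_zv: "pd x (zv y * p) = (if x = y then p else 0) + zv y * pd x p"
proof (rule poly_mapping_eqI)
  fix \<mu>
  show "lookup (pd x (zv y * p)) \<mu> = lookup ((if x = y then p else 0) + zv y * pd x p) \<mu>"
  proof (cases "x = y")
    case True
    have "lookup \<mu> y \<noteq> 0 \<Longrightarrow> \<mu> - single y 1 + single y 1 = \<mu>"
      using mon_diff_eq_iff[of \<mu> y "\<mu> - single y 1"] by simp
    with True show ?thesis
      by (auto simp: lookup_pd lookup_zv_mult lookup_add lookup_minus distrib_right of_nat_diff)
  next
    case False
    have "lookup \<mu> y \<noteq> 0 \<Longrightarrow> \<mu> + single x 1 - single y 1 = \<mu> - single y 1 + single x 1"
      using False by (intro poly_mapping_eqI) (auto simp: lookup_add lookup_minus lookup_single when_def)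
    with False show ?thesis
      by (auto simp: lookup_pd lookup_zv_mult lookup_add lookup_minus lookup_single when_def)
  qed
qed

section \<open>Polarization operators\<close>

lemma slin_Ez: "slin (Ez m j i)"
  unfolding Ez_def by (intro slin_sum_fun slin_comp[OF slin_zv slin_pd])

text \<open>The conjugate of \<open>Ez\<close>. It commutes with every \<open>Ez\<close>, hence with
  the Capelli matrix, and its diagonal members measure the degrees in the conjugate
  variables.\<close>

definition Ezb :: "nat \<Rightarrow> nat \<Rightarrow> nat \<Rightarrow> psc \<Rightarrow> psc" where
  "Ezb m j i p = (\<Sum>a=1..m. zv (True, j, a) * pd (True, i, a) p)"

lemma slin_Ezb: "slin (Ezb m j i)"
  unfolding Ezb_def by (intro slin_sum_fun slin_comp[OF slin_zv slin_pd])

lemma pd_Ez: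
  assumes "a \<in> {1..m}"
  shows "pd (False, k, a) (Ez m j i p) = (if k = j then pd (False, i, a) p else 0) + Ez m j i (pd (False, k, a) p)"
proof -
  have "pd (False, k, a) (Ez m j i p) = (\<Sum>b=1..m. (if k = j \<and> a = b then pd (False, i, b) p else 0)
      + zv (False, j, b) * pd (False, i, b) (pd (False, k, a) p))"
    unfolding Ez_def slin_sum[OF slin_pd] by (intro sum.cong) (auto simp: pd_zv pd_commute)
  also have "\<dots> = (if k = j then pd (False, i, a) p else 0) + Ez m j i (pd (False, k, a) p)"
    using assms by (auto simp: sum.distrib Ez_def sum.delta)
  finally show ?thesis .
qed

lemma pd_bar_Ez: "pd (True, k, a) (Ez m j i p) = Ez m j i (pd (True, k, a) p)"
  unfolding Ez_def slin_sum[OF slin_pd] by (intro sum.cong) (auto simp: pd_zv pd_commute)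

lemma zv_bar_Ez: "zv (True, k, a) * Ez m j i p = Ez m j i (zv (True, k, a) * p)"
  unfolding Ez_def sum_distrib_left by (intro sum.cong) (auto simp: pd_zv mult.left_commute)

lemma Ez_Ezb: "Ezb m k l (Ez m j i p) = Ez m j i (Ezb m k l p)"
  unfolding Ezb_def slin_sum[OF slin_Ez] by (simp add: pd_bar_Ez zv_bar_Ez)

lemma zv_Ez:
  assumes "a \<in> {1..m}"
  shows "Ez m j i (zv (False, k, a) * p) = (if k = i then zv (False, j, a) * p else 0) + zv (False, k, a) * Ez m j i p"
proof -
  have "Ez m j i (zv (False, k, a) * p) = (\<Sum>b=1..m. (if k = i \<and> a = b then zv (False, j, b) * p else 0)
      + zv (False, k, a) * (zv (False, j, b) * pd (False, i, b) p))"
    unfolding Ez_def by (intro sum.cong) (auto simp: pd_zv distrib_left mult.left_commute)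
  also have "\<dots> = (if k = i then zv (False, j, a) * p else 0) + zv (False, k, a) * Ez m j i p"
    using assms by (auto simp: sum.distrib Ez_def sum.delta sum_distrib_left)
  finally show ?thesis .
qed

text \<open>These are the relations of gl_N: moving one polarization past the variable and past the
  derivative of the other leaves one correction term each.\<close>

lemma Ez_commutator:
  "Ez m j l (Ez m i k p) - Ez m i k (Ez m j l p)
     = (if l = i then Ez m j k p else 0) - (if j = k then Ez m i l p else 0)"
proof -
  have "Ez m j l (Ez m i k p) = (\<Sum>a=1..m. Ez m j l (zv (False, i, a) * pd (False, k, a) p))"
    by (subst (2) Ez_def) (simp add: slin_sum[OF slin_Ez])
  also have "\<dots> = (\<Sum>a=1..m. (if l = i then zv (False, j, a) * pd (False, k, a) p else 0)
      + zv (False, i, a) * pd (False, k, a) (Ez m j l p)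
      - (if j = k then zv (False, i, a) * pd (False, l, a) p else 0))"
    by (intro sum.cong refl) (auto simp: zv_Ez pd_Ez algebra_simps)
  also have "\<dots> = (if l = i then Ez m j k p else 0) + Ez m i k (Ez m j l p)
      - (if j = k then Ez m i l p else 0)"
    by (simp add: sum.distrib sum_subtractf Ez_def)
  finally show ?thesis by simp
qed

text \<open>Each Capelli entry is a sum of products \<open>\<partial>\<^sub>i\<^sub>a z\<^sub>j\<^sub>a\<close>; this makes the Capelli matrix positive for
  the Fischer form.\<close>

lemma Capelli_entry_factor:
  "(\<Sum>a=1..m. pd (False, i, a) (zv (False, j, a) * p)) = (if i = j then smul (of_nat m) p else 0) + Ez m j i p"
proof -
  have "smul (of_nat m) p = of_nat m * p"
    by (rule poly_mapping_eqI)
      (simp add: pconst_mult[symmetric] pconst_def flip: single_of_nat)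
  then show ?thesis
    by (auto simp: pd_zv sum.distrib Ez_def)
qed

text \<open>The diagonal polarizations are Euler operators. Commutation rules with them turn into
  statements about degrees in \<open>nplus_edeg\<close> and \<open>nminusC_edeg\<close>.\<close>

lemma Euler_single:
  "Ez m k k (single \<mu> c) = single \<mu> (of_nat (edeg m False k \<mu>) * c)"
  "Ezb m k k (single \<mu> c) = single \<mu> (of_nat (edeg m True k \<mu>) * c)"
proof -
  have *: "zv x * pd x (single \<mu> c) = single \<mu> (of_nat (lookup \<mu> x) * c)" for x
  proof (rule poly_mapping_eqI)
    fix \<nu> :: zmon
    have "lookup \<nu> x \<noteq> 0 \<Longrightarrow> \<nu> - single x 1 + single x 1 = \<nu>"
      using mon_diff_eq_iff[of \<nu> x "\<nu> - single x 1"] by simp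
    then show "lookup (zv x * pd x (single \<mu> c)) \<nu> = lookup (single \<mu> (of_nat (lookup \<mu> x) * c)) \<nu>"
      by (auto simp: lookup_zv_mult lookup_pd lookup_single when_def lookup_minus)
  qed
  have **: "(\<Sum>a=1..m. single \<mu> (f a * c)) = single \<mu> ((\<Sum>a=1..m. f a) * c)" for f :: "nat \<Rightarrow> complex"
    by (rule poly_mapping_eqI) (simp add: lookup_sum lookup_single when_def sum_distrib_right)
  show "Ez m k k (single \<mu> c) = single \<mu> (of_nat (edeg m False k \<mu>) * c)"
    using **[of "\<lambda>a. of_nat (lookup \<mu> (False, k, a))"] by (simp add: Ez_def * edeg_def)
  show "Ezb m k k (single \<mu> c) = single \<mu> (of_nat (edeg m True k \<mu>) * c)"
    using **[of "\<lambda>a. of_nat (lookup \<mu> (True, k, a))"] by (simp add: Ezb_def * edeg_def)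
qed

lemma lookup_Euler:
  "lookup (Ez m k k p) \<mu> = of_nat (edeg m False k \<mu>) * lookup p \<mu>"
  "lookup (Ezb m k k p) \<mu> = of_nat (edeg m True k \<mu>) * lookup p \<mu>"
  by (simp_all add: lookup_slin[OF slin_Ez, of "insert \<mu> (keys p)"]
      lookup_slin[OF slin_Ezb, of "insert \<mu> (keys p)"] subset_insertI
      Euler_single lookup_single when_def sum.delta algebra_simps if_distrib cong: if_cong)


section \<open>Fischer inner product\<close>

definition mfact :: "zmon \<Rightarrow> complex" where
  "mfact \<mu> = (\<Prod>x\<in>keys \<mu>. fact (lookup \<mu> x))"

lemma mfact_add_single: "mfact (\<mu> + single x 1) = of_nat (lookup \<mu> x + 1) * mfact \<mu>"
proof -
  have *: "mfact \<nu> = (\<Prod>y\<in>I. fact (lookup \<nu> y))" if "finite I" "keys \<nu> \<subseteq> I" for \<nu> I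
    unfolding mfact_def using that by (intro prod.mono_neutral_left) (auto simp: in_keys_iff)
  let ?I = "insert x (keys \<mu>)"
  have "mfact (\<mu> + single x 1) = (\<Prod>y\<in>?I. fact (lookup (\<mu> + single x 1) y))"
    by (rule *) (use Poly_Mapping.keys_add[of \<mu> "single x 1"] in auto)
  also have "\<dots> = fact (lookup \<mu> x + 1) * (\<Prod>y\<in>?I - {x}. fact (lookup (\<mu> + single x 1) y))"
    by (subst prod.remove[of _ x]) (auto simp: lookup_add)
  also have "(\<Prod>y\<in>?I - {x}. fact (lookup (\<mu> + single x 1) y)) = (\<Prod>y\<in>?I - {x}. fact (lookup \<mu> y) :: complex)"
    by (intro prod.cong) (auto simp: lookup_add lookup_single when_def)
  also have "fact (lookup \<mu> x + 1) * \<dots> = of_nat (lookup \<mu> x + 1) * (\<Prod>y\<in>?I. fact (lookup \<mu> y) :: complex)"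
    by (subst prod.remove[of ?I x]) (auto simp: algebra_simps)
  also have "(\<Prod>y\<in>?I. fact (lookup \<mu> y)) = mfact \<mu>"
    by (rule *[symmetric]) auto
  finally show ?thesis .
qed

definition fischer :: "psc \<Rightarrow> psc \<Rightarrow> complex" where
  "fischer p q = (\<Sum>\<mu>\<in>keys p. mfact \<mu> * lookup p \<mu> * cnj (lookup q \<mu>))"

lemma fischer_superset:
  assumes "finite I" "keys p \<subseteq> I"
  shows "fischer p q = (\<Sum>\<mu>\<in>I. mfact \<mu> * lookup p \<mu> * cnj (lookup q \<mu>))"
  unfolding fischer_def using assms by (intro sum.mono_neutral_left) (auto simp: in_keys_iff)

lemma fischer_add: "fischer (p + p') q = fischer p q + fischer p' q"
proof -
  have "keys (p + p') \<subseteq> keys p \<union> keys p'" by (rule Poly_Mapping.keys_add)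
  then show ?thesis
    by (simp add: fischer_superset[of "keys p \<union> keys p'"] lookup_add sum.distrib algebra_simps)
qed

lemma fischer_zero [simp]: "fischer 0 q = 0"
  by (simp add: fischer_def)

lemma fischer_sum: "fischer (sum f I) q = (\<Sum>i\<in>I. fischer (f i) q)"
  by (induction I rule: infinite_finite_induct) (auto simp: fischer_add)

lemma fischer_smul: "fischer (smul c p) q = c * fischer p q"
  by (simp add: fischer_superset[of "keys p"] keys_smul_subset sum_distrib_left algebra_simps)

lemma fischer_single: "fischer (single \<mu> c) q = mfact \<mu> * c * cnj (lookup q \<mu>)"
  by (cases "c = 0") (auto simp: fischer_def)

lemma cnj_mfact [simp]: "cnj (mfact \<mu>) = mfact \<mu>"
  by (simp add: mfact_def)

lemma fischer_sym: "fischer p q = cnj (fischer q p)"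
  by (simp add: fischer_superset[of "keys p \<union> keys q"] algebra_simps)

lemma fischer_sum_right: "fischer q (sum f I) = (\<Sum>i\<in>I. fischer q (f i))"
  by (metis (mono_tags, lifting) fischer_sum fischer_sym cnj_sum sum.cong)

text \<open>The weight \<open>mfact\<close> is made for this: raising the exponent of x multiplies
  it by the same factor that differentiation produces.\<close>

lemma fischer_adjoint: "fischer (zv x * p) q = fischer p (pd x q)"
proof -
  have "zv x * p = (\<Sum>\<mu>\<in>keys p. zv x * single \<mu> (lookup p \<mu>))"
    using poly_mapping_expand[of p] by (simp flip: sum_distrib_left)
  then have "fischer (zv x * p) q = (\<Sum>\<mu>\<in>keys p. fischer (zv x * single \<mu> (lookup p \<mu>)) q)"
    by (simp add: fischer_sum)
  also have "\<dots> = (\<Sum>\<mu>\<in>keys p. mfact \<mu> * lookup p \<mu> * cnj (lookup (pd x q) \<mu>))"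
    by (intro sum.cong) (auto simp: zv_single fischer_single mfact_add_single lookup_pd simp del: of_nat_Suc of_nat_add One_nat_def)
  finally show ?thesis by (simp add: fischer_def)
qed

lemma fischer_adjoint': "fischer (pd x p) q = fischer p (zv x * q)"
  by (metis fischer_adjoint fischer_sym)

text \<open>The real value of \<open>fischer p p\<close>. Positivity arguments run over the reals
  and are transferred by \<open>fischer_self\<close>.\<close>

definition fischer_sqnorm :: "psc \<Rightarrow> real" where
  "fischer_sqnorm p = (\<Sum>\<mu>\<in>keys p. (\<Prod>x\<in>keys \<mu>. fact (lookup \<mu> x)) * (cmod (lookup p \<mu>))\<^sup>2)"

lemma fischer_self: "fischer p p = of_real (fischer_sqnorm p)"
  by (simp add: fischer_def fischer_sqnorm_def mfact_def mult.assoc flip: complex_norm_square)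

lemma fischer_sqnorm_nonneg: "0 \<le> fischer_sqnorm p"
  unfolding fischer_sqnorm_def by (auto intro!: sum_nonneg mult_nonneg_nonneg prod_nonneg)

lemma fischer_sqnorm_eq_0:
  assumes "fischer_sqnorm p = 0"
  shows "p = 0"
proof (rule poly_mapping_eqI)
  fix \<mu>
  have "(\<Sum>\<mu>\<in>keys p. (\<Prod>x\<in>keys \<mu>. fact (lookup \<mu> x) :: real) * (cmod (lookup p \<mu>))\<^sup>2) = 0"
    using assms unfolding fischer_sqnorm_def by simp
  then have "\<forall>\<mu>\<in>keys p. (\<Prod>x\<in>keys \<mu>. fact (lookup \<mu> x) :: real) * (cmod (lookup p \<mu>))\<^sup>2 = 0"
    by (subst (asm) sum_nonneg_eq_0_iff) (auto intro!: mult_nonneg_nonneg prod_nonneg)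
  then show "lookup p \<mu> = lookup 0 \<mu>"
    by (cases "\<mu> \<in> keys p") (auto simp: in_keys_iff)
qed

text \<open>Keeps exponents such as \<open>single x 1\<close> from being rewritten with
  \<open>Suc 0\<close>, so that the rules stated with 1 still match.\<close>

declare One_nat_def [simp del]

section \<open>Carriers, weights and orthogonal decomposition\<close>

text \<open>The sets \<open>Psc\<close>, \<open>PscD\<close>, \<open>FinL\<close>,
  \<open>Fil\<close>, \<open>Bpol\<close> and \<open>TG\<close> are all of this form, so their
  additive closure properties are instances of the ones proved here.\<close>

definition supp_in :: "'a set \<Rightarrow> ('a \<Rightarrow>\<^sub>0 'b::zero) set" where
  "supp_in Q = {p. keys p \<subseteq> Q}"

lemma supp_inI: "(\<And>\<mu>. lookup p \<mu> \<noteq> 0 \<Longrightarrow> \<mu> \<in> Q) \<Longrightarrow> p \<in> supp_in Q"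
  by (auto simp: supp_in_def in_keys_iff)

lemma supp_inD: "p \<in> supp_in Q \<Longrightarrow> lookup p \<mu> \<noteq> 0 \<Longrightarrow> \<mu> \<in> Q"
  by (auto simp: supp_in_def in_keys_iff)

lemma supp_in_zero [simp]: "0 \<in> supp_in Q"
  by (simp add: supp_in_def)

lemma supp_in_single: "b \<in> Q \<Longrightarrow> single b r \<in> supp_in Q"
  by (simp add: supp_in_def)

lemma supp_in_add: "p \<in> supp_in Q \<Longrightarrow> p' \<in> supp_in Q \<Longrightarrow> p + p' \<in> supp_in Q"
  using Poly_Mapping.keys_add[of p p'] by (auto simp: supp_in_def)

lemma supp_in_uminus: "p \<in> supp_in Q \<Longrightarrow> - (p :: _ \<Rightarrow>\<^sub>0 _::ab_group_add) \<in> supp_in Q"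
  by (auto simp: supp_in_def in_keys_iff)

lemma supp_in_diff:
  "p \<in> supp_in Q \<Longrightarrow> p' \<in> supp_in Q \<Longrightarrow> p - (p' :: _ \<Rightarrow>\<^sub>0 _::ab_group_add) \<in> supp_in Q"
  using supp_in_add[of p Q "- p'"] by (simp add: supp_in_uminus)

lemma supp_in_smul: "p \<in> supp_in Q \<Longrightarrow> smul r p \<in> supp_in Q"
  using keys_smul_subset[of r p] by (auto simp: supp_in_def)

lemma supp_in_sum: "(\<And>i. i \<in> I \<Longrightarrow> f i \<in> supp_in Q) \<Longrightarrow> sum f I \<in> supp_in Q"
  by (induction I rule: infinite_finite_induct) (auto intro: supp_in_add)

lemma supp_in_mono: "Q \<subseteq> Q' \<Longrightarrow> supp_in Q \<subseteq> supp_in Q'"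
  by (auto simp: supp_in_def)

section \<open>Weighted degrees of monomials\<close>

definition mwt :: "('a \<Rightarrow> nat) \<Rightarrow> ('a \<Rightarrow>\<^sub>0 nat) \<Rightarrow> nat" where
  "mwt w \<mu> = (\<Sum>x\<in>keys \<mu>. lookup \<mu> x * w x)"

lemma mwt_superset: "finite I \<Longrightarrow> keys \<mu> \<subseteq> I \<Longrightarrow> mwt w \<mu> = (\<Sum>x\<in>I. lookup \<mu> x * w x)"
  unfolding mwt_def by (intro sum.mono_neutral_left) (auto simp: in_keys_iff)

lemma mwt_add: "mwt w (\<mu> + \<nu>) = mwt w \<mu> + mwt w \<nu>"
  using Poly_Mapping.keys_add[of \<mu> \<nu>]
  by (simp add: mwt_superset[of "keys \<mu> \<union> keys \<nu>"] lookup_add distrib_right sum.distrib)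

lemma mwt_zero [simp]: "mwt w 0 = 0"
  by (simp add: mwt_def)

lemma mwt_single [simp]: "mwt w (single x k) = k * w x"
  by (cases "k = 0") (auto simp: mwt_def)

abbreviation mdeg :: "('a \<Rightarrow>\<^sub>0 nat) \<Rightarrow> nat" where
  "mdeg \<equiv> mwt (\<lambda>_. 1)"

lemma mdeg_eq_0: "mdeg \<mu> = 0 \<longleftrightarrow> \<mu> = 0"
  by (auto simp: mwt_def in_keys_iff intro!: poly_mapping_eqI)

lemma keys_mon_add: "keys (\<mu> + \<nu>) = keys \<mu> \<union> keys (\<nu> :: 'a \<Rightarrow>\<^sub>0 nat)"
  by (auto simp: in_keys_iff lookup_add)

lemma mon_split:
  assumes "x \<in> keys (\<mu> :: 'a \<Rightarrow>\<^sub>0 nat)"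
  obtains \<nu> where "\<mu> = \<nu> + single x 1"
  using mon_diff_eq_iff[of \<mu> x "\<mu> - single x 1"] assms by (auto simp: in_keys_iff)

text \<open>A nonzero monomial of degree at most d + 1 is a variable times one of degree at most d.
  The finiteness supplies the finite test sets for the orthogonal projections.\<close>

lemma finite_monomials:
  assumes "finite X"
  shows "finite {\<mu> :: 'a \<Rightarrow>\<^sub>0 nat. keys \<mu> \<subseteq> X \<and> mdeg \<mu> \<le> d}"
proof (induction d)
  case 0
  then show ?case
    by (rule finite_subset[of _ "{0}"]) (auto simp: mdeg_eq_0)
next
  case (Suc d)
  let ?M = "\<lambda>d. {\<mu> :: 'a \<Rightarrow>\<^sub>0 nat. keys \<mu> \<subseteq> X \<and> mdeg \<mu> \<le> d}"
  have "?M (Suc d) \<subseteq> {0} \<union> (\<Union>x\<in>X. (\<lambda>\<nu>. \<nu> + single x 1) ` ?M d)"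
  proof
    fix \<mu> assume \<mu>: "\<mu> \<in> ?M (Suc d)"
    show "\<mu> \<in> {0} \<union> (\<Union>x\<in>X. (\<lambda>\<nu>. \<nu> + single x 1) ` ?M d)"
    proof (cases "keys \<mu> = {}")
      case True
      then show ?thesis by simp
    next
      case False
      then obtain x where x: "x \<in> keys \<mu>" by blast
      then obtain \<nu> where "\<mu> = \<nu> + single x 1" by (rule mon_split)
      with \<mu> x show ?thesis by (auto simp: mwt_add keys_mon_add)
    qed
  qed
  then show ?case
    by (rule finite_subset) (use Suc assms in auto)
qed

lemma keys_zv_mult: "keys (zv x * p) \<subseteq> (\<lambda>\<nu>. \<nu> + single x 1) ` keys p"
proof
  fix \<mu> assume "\<mu> \<in> keys (zv x * p)"
  then have "lookup \<mu> x \<noteq> 0" "\<mu> - single x 1 \<in> keys p"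
    by (auto simp: in_keys_iff lookup_zv_mult split: if_splits)
  then show "\<mu> \<in> (\<lambda>\<nu>. \<nu> + single x 1) ` keys p"
    using mon_diff_eq_iff[of \<mu> x "\<mu> - single x 1"] by auto
qed

lemma keys_pd: "keys (pd x p) \<subseteq> {\<mu>. \<mu> + single x 1 \<in> keys p}"
  by (auto simp: in_keys_iff lookup_pd)

lemma Psc_supp_in: "Psc m N = supp_in {\<mu>. keys \<mu> \<subseteq> UNIV \<times> {1..N} \<times> {1..m}}"
  by (auto simp: Psc_def supp_in_def)

text \<open>Spanned by finitely many monomials; these sets play the part of finite-dimensional
  spaces in the projection arguments.\<close>

definition PscD :: "nat \<Rightarrow> nat \<Rightarrow> nat \<Rightarrow> psc set" where
  "PscD m N d = supp_in {\<mu>. keys \<mu> \<subseteq> UNIV \<times> {1..N} \<times> {1..m} \<and> mdeg \<mu> \<le> d}"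

lemma zv_PscD:
  assumes "p \<in> PscD m N d" "x \<in> UNIV \<times> {1..N} \<times> {1..m}"
  shows "zv x * p \<in> PscD m N (Suc d)"
  using assms keys_zv_mult[of x p] by (fastforce simp: PscD_def supp_in_def mwt_add keys_mon_add)

lemma pd_PscD:
  assumes "p \<in> PscD m N (Suc d)"
  shows "pd x p \<in> PscD m N d"
  using assms keys_pd[of x p] by (fastforce simp: PscD_def supp_in_def mwt_add keys_mon_add)

lemma PscD_mono: "d \<le> d' \<Longrightarrow> PscD m N d \<subseteq> PscD m N d'"
  unfolding PscD_def by (rule supp_in_mono) auto

lemma PscD_subset: "PscD m N d \<subseteq> Psc m N"
  unfolding PscD_def Psc_supp_in by (rule supp_in_mono) auto

lemma Psc_PscD:
  assumes "p \<in> Psc m N"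
  obtains d where "p \<in> PscD m N d"
proof
  show "p \<in> PscD m N (Max (insert 0 (mdeg ` keys p)))"
    using assms by (auto simp: PscD_def Psc_supp_in supp_in_def intro!: Max_ge)
qed

lemma pd_Psc: "p \<in> Psc m N \<Longrightarrow> pd x p \<in> Psc m N"
  by (metis PscD_subset Psc_PscD pd_PscD PscD_mono le_SucI order_refl subsetD)

lemma zv_Psc: "p \<in> Psc m N \<Longrightarrow> x \<in> UNIV \<times> {1..N} \<times> {1..m} \<Longrightarrow> zv x * p \<in> Psc m N"
  by (metis PscD_subset Psc_PscD zv_PscD subsetD)

lemma Ez_Psc: "p \<in> Psc m N \<Longrightarrow> j \<in> {1..N} \<Longrightarrow> Ez m j i p \<in> Psc m N"
  unfolding Ez_def Psc_supp_in
  by (intro supp_in_sum) (auto intro!: zv_Psc[unfolded Psc_supp_in] pd_Psc[unfolded Psc_supp_in])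

lemma Psc_add: "p \<in> Psc m N \<Longrightarrow> p' \<in> Psc m N \<Longrightarrow> p + p' \<in> Psc m N"
  and Psc_smul: "p \<in> Psc m N \<Longrightarrow> smul c p \<in> Psc m N"
  and Psc_zero [simp]: "0 \<in> Psc m N"
  and Psc_uminus: "p \<in> Psc m N \<Longrightarrow> - p \<in> Psc m N"
  and Psc_diff: "p \<in> Psc m N \<Longrightarrow> p' \<in> Psc m N \<Longrightarrow> p - p' \<in> Psc m N"
  by (simp_all add: Psc_supp_in supp_in_add supp_in_smul supp_in_uminus supp_in_diff)

lemma Psc_sum: "(\<And>i. i \<in> I \<Longrightarrow> f i \<in> Psc m N) \<Longrightarrow> sum f I \<in> Psc m N"
  by (simp add: Psc_supp_in supp_in_sum)

lemma Psc_mult: "p \<in> Psc m N \<Longrightarrow> p' \<in> Psc m N \<Longrightarrow> p * p' \<in> Psc m N"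
  using Poly_Mapping.keys_mult[of p p'] by (fastforce simp: Psc_def keys_mon_add)

lemma Psc_single: "keys \<mu> \<subseteq> UNIV \<times> {1..N} \<times> {1..m} \<Longrightarrow> single \<mu> c \<in> Psc m N"
  by (auto simp: Psc_def)

lemma Psc_one [simp]: "1 \<in> Psc m N"
  using Psc_single[of 0 N m 1] by simp

lemma zv_in_Psc: "x \<in> UNIV \<times> {1..N} \<times> {1..m} \<Longrightarrow> zv x \<in> Psc m N"
  unfolding zv_def by (rule Psc_single) auto

lemma Psc_pconst [simp]: "pconst c \<in> Psc m N"
  unfolding pconst_def by (rule Psc_single) auto

text \<open>Gram-Schmidt by induction on B. The last conjunct, that s lies in the double complement
  of B, is what carries the induction: once p - s' is orthogonal to B and to b - t, it is orthogonal
  to t and therefore to b. Definiteness is asked on S only, because the form on columns ignores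
  entries outside 1..N.\<close>

lemma orthogonal_decomposition:
  fixes ip :: "'v::ab_group_add \<Rightarrow> 'v \<Rightarrow> complex" and sc :: "complex \<Rightarrow> 'v \<Rightarrow> 'v"
  assumes ip_add: "\<And>u v w. ip (u + v) w = ip u w + ip v w"
    and ip_sc: "\<And>c u w. ip (sc c u) w = c * ip u w"
    and ip_sym: "\<And>u w. ip u w = cnj (ip w u)"
    and S: "0 \<in> S" "\<And>u v. u \<in> S \<Longrightarrow> v \<in> S \<Longrightarrow> u + v \<in> S" "\<And>u. u \<in> S \<Longrightarrow> - u \<in> S"
      "\<And>c u. u \<in> S \<Longrightarrow> sc c u \<in> S"
    and definite: "\<And>u. u \<in> S \<Longrightarrow> ip u u = 0 \<Longrightarrow> u = 0"
    and B: "finite B" "B \<subseteq> S"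
  shows "\<exists>s\<in>S. (\<forall>b\<in>B. ip (p - s) b = 0) \<and> (\<forall>x. (\<forall>b\<in>B. ip x b = 0) \<longrightarrow> ip x s = 0)"
  using B
proof (induction B arbitrary: p rule: finite_induct)
  case empty
  have "ip x 0 = 0" for x
    using ip_add[of 0 0 x] ip_sym[of x 0] by simp
  then show ?case using S by auto
next
  case (insert b B)
  have ip_zero: "ip x 0 = 0" for x
    using ip_add[of 0 0 x] ip_sym[of x 0] by simp
  have ip_diff: "ip (u - v) w = ip u w - ip v w" for u v w
    using ip_add[of "u - v" v w] by simp
  have ip_add2: "ip w (u + v) = ip w u + ip w v" for u v w
    by (metis ip_add ip_sym complex_cnj_add)
  have ip_diff2: "ip w (u - v) = ip w u - ip w v" for u v w
    using ip_add2[of w "u - v" v] by simp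
  have ip_sc2: "ip w (sc c u) = cnj c * ip w u" for c u w
    by (metis ip_sc ip_sym complex_cnj_mult complex_cnj_cnj)
  obtain s where s: "s \<in> S" "\<forall>b\<in>B. ip (p - s) b = 0" "\<And>x. (\<forall>b\<in>B. ip x b = 0) \<Longrightarrow> ip x s = 0"
    using insert.IH[of p] insert.prems by auto
  obtain t where t: "t \<in> S" "\<forall>b'\<in>B. ip (b - t) b' = 0" "\<And>x. (\<forall>b\<in>B. ip x b = 0) \<Longrightarrow> ip x t = 0"
    using insert.IH[of b] insert.prems by auto
  have bt: "b - t \<in> S"
    using S(2)[of b "- t"] S(3) t(1) insert.prems by auto
  \<comment> \<open>If b - t has norm 0 it vanishes by definiteness; the quotient is then 0 by
    convention, and no correction is due.\<close>
  define c where "c = ip (p - s) (b - t) / ip (b - t) (b - t)"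
  define s' where "s' = s + sc c (b - t)"
  have ps': "ip (p - s') x = ip (p - s) x - c * ip (b - t) x" for x
    by (simp add: s'_def ip_diff ip_add ip_sc)
  have perp: "\<forall>b'\<in>B. ip (p - s') b' = 0"
    using s(2) t(2) by (simp add: ps')
  have "ip (p - s') (b - t) = 0"
    using definite[OF bt] by (cases "ip (b - t) (b - t) = 0") (auto simp: ps' c_def ip_zero)
  then have "ip (p - s') b = 0"
    using t(3)[OF perp] by (simp add: ip_diff2)
  moreover have "s' \<in> S"
    unfolding s'_def using S(2,4) s(1) bt by auto
  moreover have "ip x s' = 0" if "\<forall>b'\<in>insert b B. ip x b' = 0" for x
    using that s(3)[of x] t(3)[of x] by (simp add: s'_def ip_add2 ip_sc2 ip_diff2)
  ultimately show ?case
    using perp by (intro bexI[of _ s']) auto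
qed


section \<open>The Capelli matrix on columns of scalar polynomials\<close>

text \<open>The diagonal constant is a parameter, so that C and C + 1 are covered together, with s =
  m and s = m + 1.\<close>

definition capelli :: "nat \<Rightarrow> nat \<Rightarrow> nat \<Rightarrow> (nat \<Rightarrow> psc) \<Rightarrow> nat \<Rightarrow> psc" where
  "capelli m N s u i = (if i \<in> {1..N}
     then \<Sum>j=1..N. (if i = j then smul (of_nat s) (u j) else 0) + Ez m j i (u j) else 0)"

definition colz :: "nat \<Rightarrow> nat \<Rightarrow> (nat \<Rightarrow> psc) \<Rightarrow> psc" where
  "colz N a u = (\<Sum>j=1..N. zv (False, j, a) * u j)"

lemma capelli_eq:
  assumes "i \<in> {1..N}"
  shows "capelli m N (m + s) u i = (\<Sum>a=1..m. pd (False, i, a) (colz N a u)) + smul (of_nat s) (u i)"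
proof -
  have "(\<Sum>a=1..m. pd (False, i, a) (colz N a u)) = (\<Sum>j=1..N. \<Sum>a=1..m. pd (False, i, a) (zv (False, j, a) * u j))"
    unfolding colz_def slin_sum[OF slin_pd] by (rule sum.swap)
  also have "\<dots> = (\<Sum>j=1..N. (if i = j then smul (of_nat m) (u j) else 0) + Ez m j i (u j))"
    by (intro sum.cong refl Capelli_entry_factor)
  finally have 1: "(\<Sum>a=1..m. pd (False, i, a) (colz N a u))
      = (\<Sum>j=1..N. (if i = j then smul (of_nat m) (u j) else 0) + Ez m j i (u j))" .
  have "capelli m N (m + s) u i = (\<Sum>j=1..N. ((if i = j then smul (of_nat m) (u j) else 0) + Ez m j i (u j))
      + (if i = j then smul (of_nat s) (u j) else 0))"
    using assms by (auto intro!: sum.cong simp: capelli_def smul_add_left)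
  then show ?thesis
    using assms unfolding 1 by (simp add: sum.distrib[of _ "\<lambda>j. if i = j then smul (of_nat s) (u j) else 0"])
qed

lemma fischer_zero_right: "fischer p 0 = 0"
  by (simp add: fischer_def)

definition cip :: "nat \<Rightarrow> (nat \<Rightarrow> psc) \<Rightarrow> (nat \<Rightarrow> psc) \<Rightarrow> complex" where
  "cip N u v = (\<Sum>i=1..N. fischer (u i) (v i))"

lemma cip_sym: "cip N u v = cnj (cip N v u)"
  unfolding cip_def cnj_sum by (intro sum.cong refl fischer_sym)

text \<open>Let Z send u to the family of all \<open>colz N a u\<close>. By Fischer adjointness C is
  the adjoint of Z applied after Z, and the shift adds s times the identity.\<close>

lemma cip_capelli:
  "cip N (capelli m N (m + s) u) v
     = (\<Sum>a=1..m. fischer (colz N a u) (colz N a v)) + of_nat s * cip N u v"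
proof -
  have "cip N (capelli m N (m + s) u) v
      = (\<Sum>i=1..N. (\<Sum>a=1..m. fischer (colz N a u) (zv (False, i, a) * v i)) + of_nat s * fischer (u i) (v i))"
    unfolding cip_def
    by (intro sum.cong refl) (simp add: capelli_eq fischer_add fischer_sum fischer_smul fischer_adjoint')
  also have "\<dots> = (\<Sum>a=1..m. \<Sum>i=1..N. fischer (colz N a u) (zv (False, i, a) * v i)) + of_nat s * cip N u v"
    unfolding sum.distrib cip_def sum_distrib_left by (subst sum.swap) simp
  finally show ?thesis
    by (simp add: colz_def[of N _ v] fischer_sum_right)
qed

lemma capelli_self_adjoint: "cip N (capelli m N m u) v = cip N u (capelli m N m v)"
proof -
  have "cip N u (capelli m N m v) = cnj (\<Sum>a=1..m. fischer (colz N a v) (colz N a u))"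
    using cip_capelli[of N m 0 v u] by (subst cip_sym) simp
  also have "\<dots> = (\<Sum>a=1..m. fischer (colz N a u) (colz N a v))"
    unfolding cnj_sum by (intro sum.cong refl fischer_sym[symmetric])
  also have "\<dots> = cip N (capelli m N m u) v"
    using cip_capelli[of N m 0 u v] by simp
  finally show ?thesis ..
qed

text \<open>If all \<open>\<Sum>\<^sub>j z\<^bsub>ja\<^esub> u\<^sub>j\<close> vanish, a monomial of \<open>u\<^sub>a\<close> of maximal degree in the diagonal
  variables cannot be cancelled in the \<open>a\<close>-th sum.\<close>

lemma colz_zero:
  assumes "\<And>a. a \<in> {1..N} \<Longrightarrow> colz N a u = 0" and "i \<in> {1..N}"
  shows "u i = 0"
proof (rule ccontr)
  define w :: "zvar \<Rightarrow> nat" where "w = (\<lambda>(d, j, a). of_bool (j = a))"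
  define X where "X = (\<Union>j\<in>{1..N}. mwt w ` keys (u j))"
  assume "u i \<noteq> 0"
  then have "X \<noteq> {}" using \<open>i \<in> {1..N}\<close> unfolding X_def by auto
  moreover have "finite X" unfolding X_def by auto
  ultimately have "Max X \<in> X" by simp
  then obtain a \<mu> where a: "a \<in> {1..N}" and \<mu>: "\<mu> \<in> keys (u a)" and max: "mwt w \<mu> = Max X"
    unfolding X_def by auto
  \<comment> \<open>The variable z_aa has weight 1 and z_ja with j different from a has weight 0, so
    a cancelling monomial of u_j would exceed the maximal weight by one.\<close>
  have zero: "lookup (zv (False, j, a) * u j) (\<mu> + single (False, a, a) 1) = 0"
    if "j \<in> {1..N}" "j \<noteq> a" for j
  proof (rule ccontr)
    assume "\<not> ?thesis"
    then have "\<mu> + single (False, a, a) 1 \<in> keys (zv (False, j, a) * u j)"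
      by (simp add: in_keys_iff)
    then obtain \<nu> where \<nu>: "\<nu> \<in> keys (u j)" "\<mu> + single (False, a, a) 1 = \<nu> + single (False, j, a) 1"
      using keys_zv_mult by blast
    have "mwt w \<mu> + 1 = mwt w \<nu>"
      using arg_cong[OF \<nu>(2), of "mwt w"] that by (simp add: mwt_add w_def)
    moreover have "mwt w \<nu> \<le> Max X"
      using \<nu>(1) that \<open>finite X\<close> by (intro Max_ge) (auto simp: X_def)
    ultimately show False using max by simp
  qed
  have "lookup (colz N a u) (\<mu> + single (False, a, a) 1)
      = (\<Sum>j=1..N. if j = a then lookup (u a) \<mu> else 0)"
    unfolding colz_def lookup_sum
    by (intro sum.cong) (use zero in \<open>auto simp: lookup_zv_mult lookup_add\<close>)
  also have "\<dots> = lookup (u a) \<mu>"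
    using a by simp
  finally show False
    using assms(1)[OF a] \<mu> by (simp add: in_keys_iff)
qed

text \<open>The quadratic form of C + s is a sum of squares plus a nonnegative term, so on the
  kernel each square vanishes. As N is at most m, the squares include those for all a in 1..N, and
  \<open>colz_zero\<close> applies.\<close>

lemma capelli_inj:
  assumes "N \<le> m" "\<And>i. i \<in> {1..N} \<Longrightarrow> capelli m N (m + s) u i = 0" "i \<in> {1..N}"
  shows "u i = 0"
proof -
  have "(\<Sum>a=1..m. fischer (colz N a u) (colz N a u)) + of_nat s * cip N u u = 0"
    using assms(2) by (subst cip_capelli[symmetric]) (simp add: cip_def)
  then have "complex_of_real ((\<Sum>a=1..m. fischer_sqnorm (colz N a u)) + real s * (\<Sum>i=1..N. fischer_sqnorm (u i))) = 0"
    by (simp add: fischer_self cip_def)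
  then have "(\<Sum>a=1..m. fischer_sqnorm (colz N a u)) + real s * (\<Sum>i=1..N. fischer_sqnorm (u i)) = 0"
    by (simp only: of_real_eq_0_iff)
  moreover have "0 \<le> (\<Sum>a=1..m. fischer_sqnorm (colz N a u))" "0 \<le> real s * (\<Sum>i=1..N. fischer_sqnorm (u i))"
    by (auto intro!: sum_nonneg mult_nonneg_nonneg simp: fischer_sqnorm_nonneg)
  ultimately have "(\<Sum>a=1..m. fischer_sqnorm (colz N a u)) = 0" by linarith
  then have "\<forall>a\<in>{1..m}. fischer_sqnorm (colz N a u) = 0"
    by (subst (asm) sum_nonneg_eq_0_iff) (auto simp: fischer_sqnorm_nonneg)
  then have "colz N a u = 0" if "a \<in> {1..N}" for a
    using that assms(1) by (intro fischer_sqnorm_eq_0) auto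
  then show ?thesis
    using assms(3) by (rule colz_zero)
qed

definition colsD :: "nat \<Rightarrow> nat \<Rightarrow> nat \<Rightarrow> (nat \<Rightarrow> psc) set" where
  "colsD m N d = {u. (\<forall>i\<in>{1..N}. u i \<in> PscD m N d) \<and> (\<forall>i. i \<notin> {1..N} \<longrightarrow> u i = 0)}"

lemma capelli_add: "capelli m N s (u + v) = capelli m N s u + capelli m N s v"
  by (auto simp: capelli_def fun_eq_iff smul_add slin_add[OF slin_Ez] sum.distrib algebra_simps
      intro!: sum.cong)

lemma capelli_smul: "capelli m N s (\<lambda>i. smul c (u i)) = (\<lambda>i. smul c (capelli m N s u i))"
  by (auto simp: capelli_def fun_eq_iff smul_add slin_smul[OF slin_Ez] smul_sum algebra_simps
      intro!: sum.cong)

lemma capelli_uminus: "capelli m N s (- u) = - capelli m N s u"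
  using capelli_smul[of m N s "-1" u] by (simp add: smul_minus_left fun_Compl_def)

lemma Ez_PscD:
  assumes "p \<in> PscD m N d" "j \<in> {1..N}"
  shows "Ez m j i p \<in> PscD m N d"
proof -
  have "zv (False, j, a) * pd (False, i, a) p \<in> PscD m N d" if "a \<in> {1..m}" for a
  proof
    have "keys (zv (False, j, a) * pd (False, i, a) p)
        \<subseteq> {\<mu> + single (False, j, a) 1 |\<mu>. \<mu> + single (False, i, a) 1 \<in> keys p}"
      using keys_zv_mult[of "(False, j, a)" "pd (False, i, a) p"] keys_pd[of "(False, i, a)" p] by blast
    then show "zv (False, j, a) * pd (False, i, a) p \<in> PscD m N d"
      using assms that by (fastforce simp: PscD_def supp_in_def mwt_add keys_mon_add)
  qed simp
  then show ?thesis
    unfolding Ez_def PscD_def by (intro supp_in_sum) simp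
qed

lemma capelli_colsD: "u \<in> colsD m N d \<Longrightarrow> capelli m N s u \<in> colsD m N d"
proof -
  assume u: "u \<in> colsD m N d"
  have "capelli m N s u i \<in> PscD m N d" if "i \<in> {1..N}" for i
  proof -
    have "(if i = j then smul (of_nat s) (u j) else 0) + Ez m j i (u j) \<in> PscD m N d" if "j \<in> {1..N}" for j
    proof -
      have "u j \<in> PscD m N d" using u that by (auto simp: colsD_def)
      then have "Ez m j i (u j) \<in> PscD m N d" "(if i = j then smul (of_nat s) (u j) else 0) \<in> PscD m N d"
        using Ez_PscD[OF _ that] by (auto simp: PscD_def supp_in_smul)
      then show ?thesis by (simp add: PscD_def supp_in_add)
    qed
    then show ?thesis
      using that by (auto simp: capelli_def PscD_def intro!: supp_in_sum)
  qed
  then show ?thesis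
    by (auto simp: colsD_def capelli_def)
qed

text \<open>A self-adjoint injective map of a finite-dimensional space is onto: the part of v
  orthogonal to the image of C is annihilated by C, hence zero. C preserves the degree bound, so
  bounded degree supplies the finite dimension.\<close>

lemma capelli_surjD:
  assumes "N \<le> m" "v \<in> colsD m N d"
  obtains u where "u \<in> colsD m N d" "capelli m N m u = v"
proof -
  define S where "S = capelli m N m ` colsD m N d"
  define e :: "nat \<times> zmon \<Rightarrow> nat \<Rightarrow> psc" where "e = (\<lambda>(j, \<mu>) i. if i = j then single \<mu> 1 else 0)"
  define Q where "Q = {\<mu> :: zmon. keys \<mu> \<subseteq> UNIV \<times> {1..N} \<times> {1..m} \<and> mdeg \<mu> \<le> d}"
  define B where "B = (capelli m N m \<circ> e) ` ({1..N} \<times> Q)"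
  define sc :: "complex \<Rightarrow> (nat \<Rightarrow> psc) \<Rightarrow> nat \<Rightarrow> psc" where "sc = (\<lambda>c u i. smul c (u i))"
  have e: "e (j, \<mu>) \<in> colsD m N d" if "j \<in> {1..N}" "\<mu> \<in> Q" for j \<mu>
    using that by (auto simp: e_def colsD_def PscD_def Q_def supp_in_single)
  have cols: "0 \<in> colsD m N d" "u + v \<in> colsD m N d" "- u \<in> colsD m N d" "sc c u \<in> colsD m N d"
    if "u \<in> colsD m N d" "v \<in> colsD m N d" for u v c
    using that by (auto simp: colsD_def sc_def PscD_def supp_in_add supp_in_uminus supp_in_smul)
  have "\<exists>s\<in>S. (\<forall>b\<in>B. cip N (v - s) b = 0) \<and> (\<forall>x. (\<forall>b\<in>B. cip N x b = 0) \<longrightarrow> cip N x s = 0)"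
  proof (rule orthogonal_decomposition[where sc = sc])
    show "cip N (u + v) w = cip N u w + cip N v w" for u v w
      by (simp add: cip_def fischer_add sum.distrib)
    show "cip N (sc c u) w = c * cip N u w" for c u w
      by (simp add: cip_def sc_def fischer_smul sum_distrib_left)
    show "cip N u w = cnj (cip N w u)" for u w by (rule cip_sym)
    have "capelli m N m 0 = 0"
      by (auto simp: capelli_def fun_eq_iff slin_zero[OF slin_Ez])
    with cols(1)[OF assms(2) assms(2)] show "0 \<in> S" unfolding S_def by force
    show "u + v \<in> S" if uv: "u \<in> S" "v \<in> S" for u v
    proof -
      obtain u' v' where "u' \<in> colsD m N d" "v' \<in> colsD m N d" "u = capelli m N m u'" "v = capelli m N m v'"
        using uv unfolding S_def by blast
      then show ?thesis
        unfolding S_def by (intro image_eqI[of _ _ "u' + v'"]) (auto simp: capelli_add cols)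
    qed
    show "- u \<in> S" if uS: "u \<in> S" for u
    proof -
      obtain u' where "u' \<in> colsD m N d" "u = capelli m N m u'"
        using uS unfolding S_def by blast
      then show ?thesis
        unfolding S_def using cols(3) by (intro image_eqI[of _ _ "- u'"]) (auto simp: capelli_uminus)
    qed
    show "sc c u \<in> S" if uS: "u \<in> S" for u c
    proof -
      obtain u' where "u' \<in> colsD m N d" "u = capelli m N m u'"
        using uS unfolding S_def by blast
      then show ?thesis
        unfolding S_def using cols(4) by (intro image_eqI[of _ _ "sc c u'"]) (auto simp: sc_def capelli_smul)
    qed
    have "finite (UNIV \<times> {1..N} \<times> {1..m} :: zvar set)" by simp
    from finite_monomials[OF this, of d] show "finite B"
      unfolding B_def Q_def by simp
    show "B \<subseteq> S" using e by (auto simp: B_def S_def)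
    show "u = 0" if "u \<in> S" "cip N u u = 0" for u
    proof -
      have "complex_of_real (\<Sum>i=1..N. fischer_sqnorm (u i)) = 0"
        using that(2) by (simp add: cip_def fischer_self)
      then have "(\<Sum>i=1..N. fischer_sqnorm (u i)) = 0" by (simp only: of_real_eq_0_iff)
      then have "\<forall>i\<in>{1..N}. fischer_sqnorm (u i) = 0"
        by (subst (asm) sum_nonneg_eq_0_iff) (auto simp: fischer_sqnorm_nonneg)
      moreover have "u i = 0" if "i \<notin> {1..N}" for i
        using \<open>u \<in> S\<close> that by (auto simp: S_def capelli_def)
      ultimately show "u = 0" by (auto simp: fun_eq_iff intro: fischer_sqnorm_eq_0)
    qed
  qed
  then obtain u where u: "u \<in> colsD m N d" and perp: "\<forall>b\<in>B. cip N (v - capelli m N m u) b = 0"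
    unfolding S_def by blast
  define x where "x = v - capelli m N m u"
  have x: "x \<in> colsD m N d"
    using cols(2)[OF assms(2) cols(3)[OF capelli_colsD[OF u, of m] u]] by (simp add: x_def)
  \<comment> \<open>Orthogonality of x to all C e says, by self-adjointness, that C x is orthogonal
    to every monomial column e; these detect all its coefficients.\<close>
  have "capelli m N m x i = 0" if i: "i \<in> {1..N}" for i
  proof (rule poly_mapping_eqI)
    fix \<mu>
    show "lookup (capelli m N m x i) \<mu> = lookup 0 \<mu>"
    proof (cases "\<mu> \<in> Q")
      case True
      then have "cip N x (capelli m N m (e (i, \<mu>))) = 0"
        using perp i by (auto simp: B_def x_def)
      then have "cip N (capelli m N m x) (e (i, \<mu>)) = 0"
        by (simp only: capelli_self_adjoint)
      moreover have "cip N (capelli m N m x) (e (i, \<mu>)) = fischer (capelli m N m x i) (single \<mu> 1)"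
        using i by (simp add: cip_def e_def if_distrib fischer_zero_right cong: if_cong)
      ultimately have "cnj (fischer (single \<mu> 1) (capelli m N m x i)) = 0"
        by (metis fischer_sym)
      then show ?thesis
        by (simp add: fischer_single mfact_def)
    next
      case False
      moreover have "capelli m N m x i \<in> PscD m N d"
        using capelli_colsD[OF x] i by (auto simp: colsD_def)
      ultimately show ?thesis
        by (auto simp: PscD_def Q_def dest: supp_inD)
    qed
  qed
  then have "x i = 0" for i
    using capelli_inj[OF assms(1), of 0 x i] x by (cases "i \<in> {1..N}") (auto simp: colsD_def)
  then have "capelli m N m u = v"
    by (simp add: x_def fun_eq_iff)
  with u show ?thesis by (rule that)
qed

lemma capelli_surj:
  assumes "N \<le> m" "\<And>i. i \<in> {1..N} \<Longrightarrow> v i \<in> Psc m N" "\<And>i. i \<notin> {1..N} \<Longrightarrow> v i = 0"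
  obtains u where "\<And>i. i \<in> {1..N} \<Longrightarrow> u i \<in> Psc m N" "\<And>i. i \<notin> {1..N} \<Longrightarrow> u i = 0" "capelli m N m u = v"
proof -
  have "\<exists>d. v i \<in> PscD m N d" if "i \<in> {1..N}" for i
    using assms(2)[OF that] by (meson Psc_PscD)
  then obtain d where d: "\<And>i. i \<in> {1..N} \<Longrightarrow> v i \<in> PscD m N (d i)"
    by metis
  have "v i \<in> PscD m N (Max (d ` {1..N}))" if "i \<in> {1..N}" for i
    using d[OF that] that PscD_mono[of "d i" "Max (d ` {1..N})"] by auto
  then have "v \<in> colsD m N (Max (d ` {1..N}))"
    using assms(3) by (auto simp: colsD_def)
  then obtain u where u: "u \<in> colsD m N (Max (d ` {1..N}))" "capelli m N m u = v"
    by (rule capelli_surjD[OF assms(1)])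
  show ?thesis
    by (rule that[of u]) (use u PscD_subset[of m N "Max (d ` {1..N})"] in \<open>auto simp: colsD_def\<close>)
qed

section \<open>Clifford polynomials\<close>

definition zswap :: "zvar \<Rightarrow> zvar" where
  "zswap x = (\<not> fst x, snd x)"

definition gswap :: "gen \<Rightarrow> gen" where
  "gswap g = (\<not> fst g, snd g)"

lemma zswap_zswap [simp]: "zswap (zswap x) = x"
  by (simp add: zswap_def)

lemma gswap_gswap [simp]: "gswap (gswap g) = g"
  by (simp add: gswap_def)

lemma gswap_inject [simp]: "gswap g = gswap h \<longleftrightarrow> g = h"
  by (metis gswap_gswap)

lemma lookup_conj_mon: "lookup (conj_mon \<mu>) x = lookup \<mu> (zswap x)"
proof -
  have "lookup (conj_mon \<mu>) x = (\<Sum>y\<in>keys \<mu>. if y = zswap x then lookup \<mu> (zswap x) else 0)"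
    unfolding conj_mon_def lookup_sum
    by (intro sum.cong) (auto simp: lookup_single when_def zswap_def split: prod.splits)
  then show ?thesis
    by (auto simp: in_keys_iff)
qed

lemma conj_mon_conj_mon [simp]: "conj_mon (conj_mon \<mu>) = \<mu>"
  by (rule poly_mapping_eqI) (simp add: lookup_conj_mon)

lemma conj_mon_add: "conj_mon (\<mu> + \<nu>) = conj_mon \<mu> + conj_mon \<nu>"
  by (rule poly_mapping_eqI) (simp add: lookup_conj_mon lookup_add)

lemma conj_mon_zero [simp]: "conj_mon 0 = 0"
  by (rule poly_mapping_eqI) (simp add: lookup_conj_mon)

lemma conj_mon_single: "conj_mon (single x k) = single (zswap x) k"
proof (rule poly_mapping_eqI)
  fix y
  have "x = zswap y \<longleftrightarrow> zswap x = y" by auto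
  then show "lookup (conj_mon (single x k)) y = lookup (single (zswap x) k) y"
    by (simp add: lookup_conj_mon lookup_single when_def)
qed

lemma lookup_conj_psc: "lookup (conj_psc p) \<mu> = cnj (lookup p (conj_mon \<mu>))"
proof -
  have *: "conj_mon \<nu> = \<mu> \<longleftrightarrow> \<nu> = conj_mon \<mu>" for \<nu>
    by (metis conj_mon_conj_mon)
  have "lookup (conj_psc p) \<mu> = (\<Sum>\<nu>\<in>keys p. if \<nu> = conj_mon \<mu> then cnj (lookup p (conj_mon \<mu>)) else 0)"
    unfolding conj_psc_def lookup_sum
    by (intro sum.cong) (auto simp: lookup_single when_def *)
  then show ?thesis
    by (auto simp: in_keys_iff)
qed

lemma conj_psc_conj_psc [simp]: "conj_psc (conj_psc p) = p"
  by (rule poly_mapping_eqI) (simp add: lookup_conj_psc)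

lemma conj_psc_add: "conj_psc (p + q) = conj_psc p + conj_psc q"
  by (rule poly_mapping_eqI) (simp add: lookup_conj_psc lookup_add)

lemma conj_psc_zero [simp]: "conj_psc 0 = 0"
  by (rule poly_mapping_eqI) (simp add: lookup_conj_psc)

lemma conj_psc_sum: "conj_psc (sum f I) = (\<Sum>i\<in>I. conj_psc (f i))"
  by (induction I rule: infinite_finite_induct) (auto simp: conj_psc_add)

lemma conj_psc_single: "conj_psc (single \<mu> c) = single (conj_mon \<mu>) (cnj c)"
proof (rule poly_mapping_eqI)
  fix \<nu>
  have "\<mu> = conj_mon \<nu> \<longleftrightarrow> conj_mon \<mu> = \<nu>" by (metis conj_mon_conj_mon)
  then show "lookup (conj_psc (single \<mu> c)) \<nu> = lookup (single (conj_mon \<mu>) (cnj c)) \<nu>"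
    by (auto simp: lookup_conj_psc lookup_single when_def)
qed

lemma conj_psc_mult: "conj_psc (p * q) = conj_psc p * conj_psc q"
  by (rule poly_mapping_mult_hom)
    (auto simp: conj_psc_add conj_psc_single conj_mon_add mult_single)

lemma conj_psc_pconst [simp]: "conj_psc (pconst c) = pconst (cnj c)"
  by (simp add: pconst_def conj_psc_single)

lemma conj_psc_one [simp]: "conj_psc 1 = 1"
  using conj_psc_single[of 0 1] by simp

lemma conj_psc_zv [simp]: "conj_psc (zv x) = zv (zswap x)"
  by (simp add: zv_def conj_psc_single conj_mon_single)

lemma conj_psc_pd: "conj_psc (pd x p) = pd (zswap x) (conj_psc p)"
  by (rule poly_mapping_eqI)
    (simp add: lookup_conj_psc lookup_pd lookup_conj_mon conj_mon_add conj_mon_single)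

lemma conj_psc_Ez: "conj_psc (Ez m j i p) = Ezb m j i (conj_psc p)"
  by (simp add: Ez_def Ezb_def conj_psc_sum conj_psc_mult conj_psc_pd zswap_def)

lemma conj_psc_Psc: "p \<in> Psc m N \<Longrightarrow> conj_psc p \<in> Psc m N"
proof -
  assume p: "p \<in> Psc m N"
  have "keys \<mu> \<subseteq> UNIV \<times> {1..N} \<times> {1..m}" if "\<mu> \<in> keys (conj_psc p)" for \<mu>
  proof
    fix x assume x: "x \<in> keys \<mu>"
    then have "zswap x \<in> keys (conj_mon \<mu>)" "conj_mon \<mu> \<in> keys p"
      using that by (auto simp: in_keys_iff lookup_conj_mon lookup_conj_psc)
    then have "zswap x \<in> UNIV \<times> {1..N} \<times> {1..m}"
      using p unfolding Psc_def by blast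
    then show "x \<in> UNIV \<times> {1..N} \<times> {1..m}"
      by (cases x) (auto simp: zswap_def)
  qed
  then show ?thesis by (auto simp: Psc_def)
qed

text \<open>For an infinite label \<open>card\<close> is 0 and the signs lose their meaning, so the
  Clifford relations are stated for combinations of finite labels.\<close>

abbreviation FinL :: "pcl set" where
  "FinL \<equiv> supp_in (Collect finite)"

section \<open>Exterior and Clifford left multiplication\<close>

abbreviation ctr :: "gen \<Rightarrow> pcl \<Rightarrow> pcl" where
  "ctr h \<equiv> lext (contr h)"

definition eps :: "gen \<Rightarrow> gen set \<Rightarrow> psc" where
  "eps g A = (-1) ^ card {x\<in>A. x < g}"

lemma eps_square [simp]: "eps g A * eps g A = 1" "eps g A * (eps g A * p) = p"
  by (simp_all add: eps_def flip: power_add mult.assoc)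

lemma eps_insert:
  assumes "finite A" "g \<notin> A"
  shows "eps k (insert g A) = (if g < k then - eps k A else eps k A)"
proof -
  have "{x \<in> insert g A. x < k} = (if g < k then insert g {x\<in>A. x < k} else {x\<in>A. x < k})"
    by auto
  then show ?thesis using assms by (simp add: eps_def)
qed

lemma eps_remove:
  assumes "finite A" "g \<in> A"
  shows "eps k (A - {g}) = (if g < k then - eps k A else eps k A)"
  using eps_insert[of "A - {g}" g k] assms by (auto simp: insert_absorb split: if_splits)

text \<open>Read coefficient by coefficient, the relations between contractions and wedges reduce to
  the behaviour of \<open>eps\<close> under adding or removing one generator.\<close>

lemma lookup_ctr: "lookup (ctr h F) B = (if h \<in> B then 0 else eps h B * lookup F (insert h B))"
proof -
  have *: "lookup F A * lookup (contr h A) B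
      = (if A = insert h B then if h \<in> B then 0 else eps h B * lookup F (insert h B) else 0)" for A
  proof (cases "h \<in> A \<and> A - {h} = B")
    case True
    then have "{x \<in> A. x < h} = {x \<in> B. x < h}" by auto
    then show ?thesis
      using True by (auto simp: contr_def lookup_single when_def eps_def insert_absorb mult.commute)
  next
    case False
    then show ?thesis by (auto simp: contr_def lookup_single when_def)
  qed
  show ?thesis
    unfolding lookup_lext * by (auto simp: in_keys_iff)
qed

lemma lookup_ext: "lookup (extmul g F) B = (if g \<in> B then eps g B * lookup F (B - {g}) else 0)"
proof -
  have *: "lookup F A * lookup (wedge g A) B
      = (if A = B - {g} then if g \<in> B then eps g B * lookup F (B - {g}) else 0 else 0)" for A
  proof (cases "g \<notin> A \<and> insert g A = B")
    case True
    then have "{x \<in> A. x < g} = {x \<in> B. x < g}" by auto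
    then show ?thesis
      using True by (auto simp: wedge_def lookup_single when_def eps_def mult.commute)
  next
    case False
    then show ?thesis by (auto simp: wedge_def lookup_single when_def)
  qed
  show ?thesis
    unfolding extmul_def lookup_lext * by (auto simp: in_keys_iff)
qed

lemma FinL_lookup: "F \<in> FinL \<Longrightarrow> infinite A \<Longrightarrow> lookup F A = 0"
  by (auto simp: supp_in_def in_keys_iff)

lemma ctr_FinL: "F \<in> FinL \<Longrightarrow> ctr h F \<in> FinL"
  by (rule supp_inI) (auto simp: lookup_ctr split: if_splits dest: supp_inD)

lemma ext_FinL: "F \<in> FinL \<Longrightarrow> extmul h F \<in> FinL"
  by (rule supp_inI) (auto simp: lookup_ext split: if_splits dest: supp_inD)

text \<open>For distinct generators exactly one of g < h and h < g holds, so reversing the order of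
  removal changes exactly one of the two position signs.\<close>

lemma ctr_ctr:
  assumes "F \<in> FinL"
  shows "ctr g (ctr h F) = - ctr h (ctr g F)"
proof (rule poly_mapping_eqI)
  fix B
  show "lookup (ctr g (ctr h F)) B = lookup (- ctr h (ctr g F)) B"
    using assms by (cases "finite B")
      (auto simp: lookup_ctr eps_insert insert_commute FinL_lookup mult.left_commute)
qed

lemma ext_ext:
  assumes "F \<in> FinL"
  shows "extmul g (extmul h F) = - extmul h (extmul g F)"
proof (rule poly_mapping_eqI)
  fix B
  have "B - {g} - {h} = B - {h} - {g}" by auto
  then show "lookup (extmul g (extmul h F)) B = lookup (- extmul h (extmul g F)) B"
    using assms by (cases "finite B") (auto simp: lookup_ext eps_remove FinL_lookup mult.left_commute)
qed

lemma ctr_ext: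
  assumes "F \<in> FinL"
  shows "ctr g (extmul h F) = (if g = h then F else 0) - extmul h (ctr g F)"
proof (rule poly_mapping_eqI)
  fix B
  have "g \<noteq> h \<Longrightarrow> insert g B - {h} = insert g (B - {h})" by auto
  then show "lookup (ctr g (extmul h F)) B = lookup ((if g = h then F else 0) - extmul h (ctr g F)) B"
    using assms by (cases "finite B")
      (auto simp: lookup_ext lookup_ctr lookup_minus eps_insert eps_remove FinL_lookup
        mult.left_commute insert_absorb)
qed

lemma slin_clmul: "slin (clmul g)"
  unfolding clmul_def by (rule slin_lext)

lemma slin_extmul: "slin (extmul g)"
  unfolding extmul_def by (rule slin_lext)

lemma slin_chevmul: "slin (chevmul g)"
  unfolding chevmul_def by (rule slin_lext)

lemma brk_eq: "brk g h = of_bool (h = gswap g)"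
  by (auto simp: brk_def gswap_def prod_eq_iff intro!: arg_cong[of _ _ of_bool])

text \<open>Every f_a precedes every f_a dagger in the order. A generator therefore meets its
  partner among the smaller ones only if it is a dagger, which is the condition
  \<open>fst g\<close>.\<close>

lemma clmul_eq:
  assumes "F \<in> FinL"
  shows "clmul g F = extmul g F + (if fst g then ctr (gswap g) F else 0)"
proof -
  have "clmul g F = extmul g F + lext (\<lambda>A. if fst g then contr (gswap g) A else 0) F"
  proof (rule slin_eqI[OF slin_clmul slin_plus[OF slin_extmul slin_lext]])
    fix A assume "A \<in> keys F"
    then have fin: "finite A" using assms by (auto simp: supp_in_def)
    have "(\<Sum>h | h \<in> A \<and> h < g. smul (brk g h) (contr h A))
        = (\<Sum>h | h \<in> A \<and> h < g. if h = gswap g then contr (gswap g) A else 0)"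
      by (intro sum.cong) (auto simp: brk_eq)
    also have "\<dots> = (if fst g then contr (gswap g) A else 0)"
      using fin by (cases g) (auto simp: gswap_def contr_def)
    finally show "clmul g (single A 1) = extmul g (single A 1) + lext (\<lambda>A. if fst g then contr (gswap g) A else 0) (single A 1)"
      by (simp add: clmul_def extmul_def)
  qed
  then show ?thesis
    by (auto simp: lext_def)
qed

lemma clmul_FinL: "F \<in> FinL \<Longrightarrow> clmul g F \<in> FinL"
  by (simp add: clmul_eq supp_in_add ext_FinL ctr_FinL)

text \<open>The contraction part of \<open>clmul g\<close> anticommutes with \<open>ctr h\<close>,
  so contraction is an antiderivation of the Clifford product just as of the exterior one.\<close>

lemma ctr_clmul:
  assumes "F \<in> FinL"
  shows "ctr h (clmul g F) = (if h = g then F else 0) - clmul g (ctr h F)"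
  using assms
  by (simp add: clmul_eq ctr_FinL ext_FinL lext_add ctr_ext ctr_ctr[of F h] )

text \<open>Wedges anticommute and contractions anticommute; only the mixed terms survive. For a
  pair of partners just one of the two generators has a contraction part, so the bracket arises
  once.\<close>

lemma clmul_clmul:
  assumes "F \<in> FinL"
  shows "clmul g (clmul h F) + clmul h (clmul g F) = smul (brk g h) F"
proof -
  have "gswap g = h \<longleftrightarrow> gswap h = g" "gswap g = h \<Longrightarrow> fst g = (\<not> fst h)"
    by (auto simp: gswap_def)
  then show ?thesis
    using assms ext_ext[OF assms, of g h] ctr_ctr[OF assms, of "gswap g" "gswap h"]
    by (auto simp: clmul_eq ctr_FinL ext_FinL supp_in_add lext_add slin_add[OF slin_extmul]
        ctr_ext brk_eq slin_zero[OF slin_extmul])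
qed

lemma pcl_double_zero: "(F :: pcl) + F = 0 \<Longrightarrow> F = 0"
proof (rule poly_mapping_eqI, rule poly_mapping_eqI)
  fix A \<mu> assume "F + F = 0"
  then have "lookup (lookup (F + F) A) \<mu> = 0" by simp
  then have "lookup (lookup F A) \<mu> + lookup (lookup F A) \<mu> = 0" by (simp only: lookup_add)
  then show "lookup (lookup F A) \<mu> = lookup (lookup 0 A) \<mu>" by simp
qed

lemma gswap_neq [simp]: "gswap g \<noteq> g" "g \<noteq> gswap g"
  by (auto simp: gswap_def prod_eq_iff)

lemma clmul_self: "F \<in> FinL \<Longrightarrow> clmul g (clmul g F) = 0"
  using clmul_clmul[of F g g] pcl_double_zero[of "clmul g (clmul g F)"] by (simp add: brk_eq)

lemma clmul_single:
  assumes "finite A" "\<And>h. h \<in> A \<Longrightarrow> g < h"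
  shows "clmul g (single A r) = single (insert g A) r"
proof -
  have e: "{h. h \<in> A \<and> h < g} = {}" "g \<notin> A"
    using assms(2) less_asym less_irrefl by blast+
  then show ?thesis by (simp add: clmul_def wedge_def e(1))
qed

lemma sorted_list_of_set_insert_min:
  fixes g :: "'a::linorder"
  assumes "finite A" "\<And>h. h \<in> A \<Longrightarrow> g < h"
  shows "sorted_list_of_set (insert g A) = g # sorted_list_of_set A"
proof -
  have "Min (insert g A) = g" using assms by (intro Min_eqI) (auto intro: less_imp_le)
  moreover have "insert g A - {g} = A" using assms(2) by auto
  ultimately show ?thesis
    using sorted_list_of_set_nonempty[of "insert g A"] assms(1) by simp
qed

text \<open>Labels stand for increasing words, so adding a new minimum to a label prepends a letter
  to its word.\<close>

lemma finite_min_induct [consumes 1, case_names empty insert]: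
  fixes A :: "'a::linorder set"
  assumes "finite A" "P {}"
    and "\<And>g A. finite A \<Longrightarrow> (\<And>h. h \<in> A \<Longrightarrow> g < h) \<Longrightarrow> P A \<Longrightarrow> P (insert g A)"
  shows "P A"
  using assms(1)
proof (induction "card A" arbitrary: A)
  case 0
  then show ?case using assms(2) by simp
next
  case (Suc n)
  then have "A \<noteq> {}" by auto
  then have A: "A = insert (Min A) (A - {Min A})" using Suc by (auto simp: insert_absorb)
  have "P (insert (Min A) (A - {Min A}))"
    using Suc \<open>A \<noteq> {}\<close> by (intro assms(3)) (auto simp: order_less_le)
  then show ?case using A by simp
qed

lemma word_Nil [simp]: "word mul [] = single {} 1"
  and word_Cons [simp]: "word mul (g # gs) = mul g (word mul gs)"
  by (simp_all add: word_def)

lemma word_clmul_sorted: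
  assumes "finite A"
  shows "word clmul (sorted_list_of_set A) = single A 1"
  using assms
  by (induction A rule: finite_min_induct) (simp_all add: sorted_list_of_set_insert_min clmul_single
      del: sorted_list_of_set.sorted_key_list_of_set_insert_remove)

lemma word_clmul_FinL: "word clmul gs \<in> FinL"
  by (induction gs) (auto intro: supp_in_single clmul_FinL)

section \<open>The involution on Clifford polynomials\<close>

definition dagw :: "(gen \<Rightarrow> pcl \<Rightarrow> pcl) \<Rightarrow> gen set \<Rightarrow> pcl" where
  "dagw mul A = word mul (map gswap (sorted_list_of_set A))"

lemma gswap_case: "(\<lambda>(d, a). (\<not> d, a)) = gswap"
  by (auto simp: gswap_def)

lemma dag_pcl_superset:
  assumes "finite I" "keys F \<subseteq> I"
  shows "dag_pcl mul F = (\<Sum>A\<in>I. smul (conj_psc (lookup F A)) (dagw mul A))"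
  unfolding dag_pcl_def gswap_case dagw_def[symmetric]
  using assms by (intro sum.mono_neutral_left) (auto simp: in_keys_iff)

lemma dag_pcl_add: "dag_pcl mul (F + G) = dag_pcl mul F + dag_pcl mul G"
  using Poly_Mapping.keys_add[of F G]
  by (simp add: dag_pcl_superset[of "keys F \<union> keys G"] lookup_add conj_psc_add smul_add_left sum.distrib)

lemma dag_pcl_zero [simp]: "dag_pcl mul 0 = 0"
  by (simp add: dag_pcl_def)

lemma dag_pcl_sum: "dag_pcl mul (sum f I) = (\<Sum>i\<in>I. dag_pcl mul (f i))"
  by (induction I rule: infinite_finite_induct) (auto simp: dag_pcl_add)

lemma dag_pcl_smul: "dag_pcl mul (smul c F) = smul (conj_psc c) (dag_pcl mul F)"
  by (simp add: dag_pcl_superset[of "keys F"] keys_smul_subset smul_sum conj_psc_mult)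

lemma dag_pcl_uminus: "dag_pcl mul (- F) = - dag_pcl mul F"
proof -
  have "dag_pcl mul F + dag_pcl mul (- F) = 0"
    by (simp flip: dag_pcl_add)
  then show ?thesis by (simp add: minus_unique)
qed

lemma dag_pcl_diff: "dag_pcl mul (F - G) = dag_pcl mul F - dag_pcl mul G"
  using dag_pcl_add[of mul F "- G"] by (simp add: dag_pcl_uminus)

lemma dag_pcl_single: "dag_pcl mul (single A c) = smul (conj_psc c) (dagw mul A)"
  by (cases "c = 0") (auto simp: dag_pcl_superset[of "{A}"])

abbreviation dagC :: "pcl \<Rightarrow> pcl" where
  "dagC \<equiv> dag_pcl clmul"

lemma dagC_FinL: "dagC F \<in> FinL"
  unfolding dag_pcl_def gswap_case by (intro supp_in_sum supp_in_smul word_clmul_FinL)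

text \<open>The parameter \<open>\<rho>\<close> is conjugation for one application of the involution
  and the identity for two.\<close>

lemma semilinear_eqI:
  fixes f g :: "('a \<Rightarrow>\<^sub>0 'r::comm_ring_1) \<Rightarrow> ('b \<Rightarrow>\<^sub>0 'r)"
  assumes "\<And>v w. f (v + w) = f v + f w" "\<And>v w. g (v + w) = g v + g w"
    and "f 0 = 0" "g 0 = 0"
    and "\<And>c v. f (smul c v) = smul (\<rho> c) (f v)" "\<And>c v. g (smul c v) = smul (\<rho> c) (g v)"
    and "\<And>b. b \<in> keys v \<Longrightarrow> f (single b 1) = g (single b 1)"
  shows "f v = g v"
proof -
  have fs: "f (sum h I) = (\<Sum>i\<in>I. f (h i))" and gs: "g (sum h I) = (\<Sum>i\<in>I. g (h i))" for h :: "'a \<Rightarrow> _" and I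
    using assms(1-4) by (induction I rule: infinite_finite_induct) auto
  have v: "v = (\<Sum>b\<in>keys v. smul (lookup v b) (single b 1))"
    using poly_mapping_expand[of v] by simp
  have "f v = (\<Sum>b\<in>keys v. smul (\<rho> (lookup v b)) (f (single b 1)))"
    using arg_cong[OF v, of f] by (simp only: fs assms(5))
  also have "\<dots> = (\<Sum>b\<in>keys v. smul (\<rho> (lookup v b)) (g (single b 1)))"
    using assms(7) by simp
  also have "\<dots> = g v"
    using arg_cong[OF v, of g] by (simp only: gs assms(6))
  finally show ?thesis .
qed

lemma dagC_clmul_less:
  assumes "X \<in> supp_in {A. finite A \<and> (\<forall>h\<in>A. g < h)}"
  shows "dagC (clmul g X) = clmul (gswap g) (dagC X)"
proof (rule semilinear_eqI[where \<rho> = conj_psc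
      and f = "\<lambda>X. dagC (clmul g X)"
      and g = "\<lambda>X. clmul (gswap g) (dagC X)" and v = X])
  fix A assume "A \<in> keys X"
  then have A: "finite A" "\<And>h. h \<in> A \<Longrightarrow> g < h"
    using assms by (auto simp: supp_in_def)
  then show "dagC (clmul g (single A 1)) = clmul (gswap g) (dagC (single A 1))"
    by (simp add: clmul_single dag_pcl_single dagw_def sorted_list_of_set_insert_min
        del: sorted_list_of_set.sorted_key_list_of_set_insert_remove)
qed (simp_all add: dag_pcl_add dag_pcl_smul slin_add[OF slin_clmul] slin_smul[OF slin_clmul] slin_zero[OF slin_clmul])

lemma keys_clmul_single:
  assumes "finite A"
  shows "keys (clmul g (single A 1)) \<subseteq> {B. B \<subseteq> insert g A}"
proof -
  have F: "single A 1 \<in> FinL" using assms by (simp add: supp_in_single)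
  have "lookup (clmul g (single A 1)) B = 0" if "\<not> B \<subseteq> insert g A" for B
  proof -
    have "lookup (single A 1 :: pcl) (B - {g}) = 0" "lookup (single A 1 :: pcl) (insert (gswap g) B) = 0"
      using that by (auto simp: lookup_single when_def)
    then show ?thesis
      by (simp add: clmul_eq[OF F] lookup_add lookup_ext lookup_ctr del: lext_single)
  qed
  then show ?thesis by (auto simp: in_keys_iff)
qed

text \<open>The involution is defined by swapping letters of increasing words, so prepending a
  letter is immediate only below the first one. A larger letter is exchanged with the first letter
  by \<open>clmul_clmul\<close>; swapping preserves the bracket, so the same exchange is valid on
  the other side.\<close>

lemma dagC_clmul_single:
  assumes "finite A"
  shows "dagC (clmul g (single A 1)) = clmul (gswap g) (dagC (single A 1))"
  using assms
proof (induction A arbitrary: g rule: finite_min_induct)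
  case empty
  then show ?case by (intro dagC_clmul_less) (simp add: supp_in_single)
next
  case (insert k A)
  let ?W = "single A 1 :: pcl"
  have W: "?W \<in> FinL" and kW: "single (insert k A) 1 = clmul k ?W"
    using insert by (auto simp: supp_in_single clmul_single)
  consider "g < k" | "g = k" | "k < g" by fastforce
  then show ?case
  proof cases
    case 1
    then show ?thesis
      using insert(1,2) less_trans by (intro dagC_clmul_less supp_in_single) blast
  next
    case 2
    have "dagC (clmul k ?W) = clmul (gswap k) (dagC ?W)"
      using insert by (intro dagC_clmul_less) (auto simp: supp_in_single)
    then show ?thesis
      unfolding kW 2 by (simp add: clmul_self W dagC_FinL)
  next
    case 3
    have "keys (clmul g ?W) \<subseteq> {B. B \<subseteq> insert g A}"
      by (rule keys_clmul_single) (rule insert)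
    then have "clmul g ?W \<in> supp_in {B. finite B \<and> (\<forall>h\<in>B. k < h)}"
      using insert(1,2) 3 by (auto simp: supp_in_def intro: finite_subset)
    then have 1: "dagC (clmul k (clmul g ?W)) = clmul (gswap k) (clmul (gswap g) (dagC ?W))"
      by (simp add: dagC_clmul_less insert.IH)
    have 2: "dagC (clmul k ?W) = clmul (gswap k) (dagC ?W)"
      using insert by (intro dagC_clmul_less) (auto simp: supp_in_single)
    have b: "conj_psc (brk g k) = brk (gswap g) (gswap k)"
      by (auto simp: brk_eq)
    have "clmul g (clmul k ?W) = smul (brk g k) ?W - clmul k (clmul g ?W)"
      using clmul_clmul[OF W, of g k] by (simp add: algebra_simps)
    then have "dagC (clmul g (clmul k ?W))
        = smul (brk (gswap g) (gswap k)) (dagC ?W) - clmul (gswap k) (clmul (gswap g) (dagC ?W))"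
      by (simp only: dag_pcl_diff dag_pcl_smul b 1)
    also have "\<dots> = clmul (gswap g) (clmul (gswap k) (dagC ?W))"
      using clmul_clmul[OF dagC_FinL, of "gswap g" "gswap k" ?W] by (simp add: algebra_simps)
    finally show ?thesis
      unfolding kW 2 .
  qed
qed

lemma dagC_clmul:
  assumes "F \<in> FinL"
  shows "dagC (clmul g F) = clmul (gswap g) (dagC F)"
  by (rule semilinear_eqI[where \<rho> = conj_psc
      and f = "\<lambda>X. dagC (clmul g X)"
      and g = "\<lambda>X. clmul (gswap g) (dagC X)" and v = F])
    (use assms in \<open>auto simp: dag_pcl_add dag_pcl_smul slin_add[OF slin_clmul] slin_smul[OF slin_clmul]
      slin_zero[OF slin_clmul] dagC_clmul_single supp_in_def\<close>)

lemma dagC_one [simp]: "dagC (single {} 1) = single {} 1"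
  by (simp add: dag_pcl_single dagw_def)

lemma dagC_word: "dagC (word clmul gs) = word clmul (map gswap gs)"
  by (induction gs) (auto simp: dagC_clmul word_clmul_FinL)

lemma dagC_dagC:
  assumes "F \<in> FinL"
  shows "dagC (dagC F) = F"
proof (rule semilinear_eqI[where \<rho> = "\<lambda>c. c"
      and f = "\<lambda>F. dagC (dagC F)"
      and g = "\<lambda>F. F" and v = F])
  fix A assume "A \<in> keys F"
  then have "finite A" using assms by (auto simp: supp_in_def)
  then have e: "single A 1 = word clmul (sorted_list_of_set A)"
    by (simp add: word_clmul_sorted)
  show "dagC (dagC (single A 1)) = single A 1"
    unfolding e by (simp add: dagC_word comp_def)
qed (simp_all add: dag_pcl_add dag_pcl_smul)

text \<open>On a word a contraction is computed by the antiderivation rule alone, and swapping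
  letters carries this rule to the one for the swapped generator.\<close>

lemma dagC_ctr_word: "dagC (ctr h (word clmul gs)) = ctr (gswap h) (word clmul (map gswap gs))"
proof (induction gs)
  case Nil
  have "ctr h (single {} 1) = 0" for h by (simp add: contr_def)
  then show ?case by simp
next
  case (Cons g gs)
  then show ?case
    by (simp add: ctr_clmul word_clmul_FinL dag_pcl_diff dagC_clmul ctr_FinL dagC_word)
qed

lemma dagC_ctr:
  assumes "F \<in> FinL"
  shows "dagC (ctr h F) = ctr (gswap h) (dagC F)"
proof (rule semilinear_eqI[where \<rho> = conj_psc
      and f = "\<lambda>X. dagC (ctr h X)"
      and g = "\<lambda>X. ctr (gswap h) (dagC X)" and v = F])
  fix A assume "A \<in> keys F"
  then have "finite A" using assms by (auto simp: supp_in_def)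
  then have e: "single A 1 = word clmul (sorted_list_of_set A)"
    by (simp add: word_clmul_sorted)
  show "dagC (ctr h (single A 1)) = ctr (gswap h) (dagC (single A 1))"
    unfolding e by (simp add: dagC_word dagC_ctr_word del: lext_single)
qed (simp_all add: dag_pcl_add dag_pcl_smul lext_add lext_smul)

section \<open>Coefficientwise operators and parity\<close>

lemma lookup_cw: "D 0 = 0 \<Longrightarrow> lookup (cw D F) A = D (lookup F A)"
  by (simp add: cw_def lookup_map_zero)

lemma slin_sign: "slin D \<Longrightarrow> D ((-1) ^ k * p) = (-1) ^ k * D p"
  by (cases "even k") (auto simp: slin_minus)

lemma slin_eps: "slin D \<Longrightarrow> D (eps g A * p) = eps g A * D p"
  by (simp add: eps_def slin_sign)

lemma cw_add: "slin D \<Longrightarrow> cw D (F + G) = cw D F + cw D G"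
  by (rule poly_mapping_eqI) (simp add: lookup_cw slin_zero lookup_add slin_add)

lemma cw_zero: "D 0 = 0 \<Longrightarrow> cw D 0 = 0"
  by (rule poly_mapping_eqI) (simp add: lookup_cw)

lemma cw_sum: "slin D \<Longrightarrow> cw D (sum f I) = (\<Sum>i\<in>I. cw D (f i))"
  by (induction I rule: infinite_finite_induct) (auto simp: cw_zero slin_zero cw_add)

lemma cw_single: "D 0 = 0 \<Longrightarrow> cw D (single A c) = single A (D c)"
  by (rule poly_mapping_eqI) (simp add: lookup_cw lookup_single when_def)

lemma cw_cscale: "slin D \<Longrightarrow> cw D (cscale c F) = cscale c (cw D F)"
  by (rule poly_mapping_eqI) (simp add: lookup_cw slin_zero cscale_def pconst_mult slin_smul)

lemma cw_cw: "D 0 = 0 \<Longrightarrow> D' 0 = 0 \<Longrightarrow> cw D (cw D' F) = cw (\<lambda>p. D (D' p)) F"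
  by (rule poly_mapping_eqI) (simp add: lookup_cw)

lemma cw_ctr: "slin D \<Longrightarrow> cw D (ctr h F) = ctr h (cw D F)"
  by (rule poly_mapping_eqI) (simp add: lookup_cw slin_zero lookup_ctr slin_eps)

lemma cw_ext: "slin D \<Longrightarrow> cw D (extmul h F) = extmul h (cw D F)"
  by (rule poly_mapping_eqI) (simp add: lookup_cw slin_zero lookup_ext slin_eps)

lemma cw_supp_in: "D 0 = 0 \<Longrightarrow> F \<in> supp_in Q \<Longrightarrow> cw D F \<in> supp_in Q"
  by (rule supp_inI) (metis lookup_cw supp_inD)

lemma cw_clmul: "slin D \<Longrightarrow> F \<in> FinL \<Longrightarrow> cw D (clmul g F) = clmul g (cw D F)"
  by (simp add: clmul_eq cw_supp_in slin_zero cw_add cw_ext cw_ctr cw_zero)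

lemma cw_word: "slin D \<Longrightarrow> cw D (smul c (word clmul gs)) = smul (D c) (word clmul gs)"
proof (induction gs)
  case Nil
  then show ?case by (simp add: cw_single slin_zero)
next
  case (Cons g gs)
  then have "cw D (clmul g (smul c (word clmul gs))) = clmul g (smul (D c) (word clmul gs))"
    by (simp add: cw_clmul word_clmul_FinL supp_in_smul)
  then show ?case by (simp add: slin_smul[OF slin_clmul])
qed

lemma dagC_cw:
  assumes "slin D" "slin D'" "\<And>p. conj_psc (D p) = D' (conj_psc p)"
  shows "dagC (cw D F) = cw D' (dagC F)"
proof -
  have "keys (cw D F) \<subseteq> keys F"
    using assms(1) by (auto simp: in_keys_iff lookup_cw slin_zero)
  then show ?thesis
    using assms by (simp add: dag_pcl_superset[of "keys F"] cw_sum dagw_def cw_word lookup_cw slin_zero)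
qed

text \<open>The parity automorphism. Oddness is expressed as anticommutation with it, a form that
  can be transported through the linear system defining \<open>nplus\<close>.\<close>

definition gpar :: "pcl \<Rightarrow> pcl" where
  "gpar = lext (\<lambda>A. single A ((-1) ^ card A))"

lemma lookup_gpar: "lookup (gpar F) A = (-1) ^ card A * lookup F A"
proof -
  have "lookup (gpar F) A = (\<Sum>B\<in>keys F. if B = A then (-1) ^ card A * lookup F A else 0)"
    unfolding gpar_def lookup_lext by (intro sum.cong) (auto simp: lookup_single when_def)
  then show ?thesis by (auto simp: in_keys_iff)
qed

lemma gpar_ctr: "F \<in> FinL \<Longrightarrow> gpar (ctr h F) = - ctr h (gpar F)"
proof (rule poly_mapping_eqI)
  fix B assume "F \<in> FinL"
  then show "lookup (gpar (ctr h F)) B = lookup (- ctr h (gpar F)) B"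
    by (cases "finite B") (auto simp: lookup_gpar lookup_ctr FinL_lookup mult.left_commute)
qed

lemma gpar_ext: "F \<in> FinL \<Longrightarrow> gpar (extmul h F) = - extmul h (gpar F)"
proof (rule poly_mapping_eqI)
  fix B assume F: "F \<in> FinL"
  show "lookup (gpar (extmul h F)) B = lookup (- extmul h (gpar F)) B"
  proof (cases "finite B \<and> h \<in> B")
    case True
    then have "card B = Suc (card (B - {h}))" by (metis card_Suc_Diff1)
    then have "(-1 :: psc) ^ card B = - ((-1) ^ card (B - {h}))" by simp
    with True show ?thesis by (simp add: lookup_gpar lookup_ext mult.left_commute)
  qed (use F in \<open>auto simp: lookup_gpar lookup_ext FinL_lookup\<close>)
qed

lemma slin_gpar: "slin gpar"
  unfolding gpar_def by (rule slin_lext)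

lemma gpar_FinL: "F \<in> FinL \<Longrightarrow> gpar F \<in> FinL"
  by (rule supp_inI) (auto simp: lookup_gpar dest: FinL_lookup)

lemma gpar_clmul: "F \<in> FinL \<Longrightarrow> gpar (clmul g F) = - clmul g (gpar F)"
  by (simp add: clmul_eq gpar_FinL slin_add[OF slin_gpar] slin_zero[OF slin_gpar] gpar_ext gpar_ctr)

lemma cw_gpar: "slin D \<Longrightarrow> cw D (gpar F) = gpar (cw D F)"
  by (rule poly_mapping_eqI) (simp add: lookup_cw slin_zero lookup_gpar slin_sign)

lemma gpar_word: "gpar (word clmul gs) = smul ((-1) ^ length gs) (word clmul gs)"
proof (induction gs)
  case Nil
  then show ?case by (simp add: gpar_def)
next
  case (Cons g gs)
  then show ?case
    by (simp add: gpar_clmul word_clmul_FinL slin_smul[OF slin_clmul] smul_minus_left)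
qed

lemma dagC_gpar: "dagC (gpar F) = gpar (dagC F)"
proof (rule semilinear_eqI[where \<rho> = conj_psc
      and f = "\<lambda>X. dagC (gpar X)"
      and g = "\<lambda>X. gpar (dagC X)" and v = F])
  fix A
  have "conj_psc (- 1) = - 1"
  proof -
    have "1 + conj_psc (- 1) = 0" using conj_psc_add[of 1 "- 1"] by simp
    then show ?thesis by (rule minus_unique[symmetric])
  qed
  then have "conj_psc ((-1) ^ k) = (-1) ^ k" for k
    by (cases "even k") auto
  moreover have "gpar (dagw clmul A) = smul ((-1) ^ card A) (dagw clmul A)"
    by (simp add: dagw_def gpar_word)
  ultimately show "dagC (gpar (single A 1)) = gpar (dagC (single A 1))"
    by (simp add: dag_pcl_single gpar_def[THEN fun_cong, of "single A 1"])
qed (simp_all add: dag_pcl_add dag_pcl_smul slin_add[OF slin_gpar] slin_smul[OF slin_gpar] slin_zero[OF slin_gpar])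

section \<open>Capelli contractions\<close>

lemma PCl_iff: "F \<in> PCl m N \<longleftrightarrow> F \<in> supp_in {A. A \<subseteq> UNIV \<times> {1..m}} \<and> (\<forall>A. lookup F A \<in> Psc m N)"
proof -
  have "lookup F A \<in> Psc m N" if "\<forall>A\<in>keys F. lookup F A \<in> Psc m N" for A
    using that by (cases "A \<in> keys F") (auto simp: in_keys_iff)
  then show ?thesis by (auto simp: PCl_def supp_in_def)
qed

lemma PCl_lookup: "F \<in> PCl m N \<Longrightarrow> lookup F A \<in> Psc m N"
  by (simp add: PCl_iff)

lemma PCl_FinL: "F \<in> PCl m N \<Longrightarrow> F \<in> FinL"
proof (rule supp_inI)
  fix A assume "F \<in> PCl m N" "lookup F A \<noteq> 0"
  then have "A \<subseteq> UNIV \<times> {1..m}" by (auto simp: PCl_iff dest: supp_inD)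
  then show "A \<in> Collect finite" by (simp add: finite_subset)
qed

lemma PCl_zero [simp]: "0 \<in> PCl m N"
  and PCl_add: "F \<in> PCl m N \<Longrightarrow> G \<in> PCl m N \<Longrightarrow> F + G \<in> PCl m N"
  and PCl_smul: "F \<in> PCl m N \<Longrightarrow> c \<in> Psc m N \<Longrightarrow> smul c F \<in> PCl m N"
  and PCl_uminus: "F \<in> PCl m N \<Longrightarrow> - F \<in> PCl m N"
  and PCl_diff: "F \<in> PCl m N \<Longrightarrow> G \<in> PCl m N \<Longrightarrow> F - G \<in> PCl m N"
proof -
  show zero: "0 \<in> PCl m N" by (simp add: PCl_iff)
  show "F + G \<in> PCl m N" if "F \<in> PCl m N" "G \<in> PCl m N"
    using that unfolding PCl_iff lookup_add by (blast intro: supp_in_add Psc_add)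
  show "smul c F \<in> PCl m N" if "F \<in> PCl m N" "c \<in> Psc m N"
    using that unfolding PCl_iff lookup_smul by (blast intro: supp_in_smul Psc_mult)
  show "- F \<in> PCl m N" if "F \<in> PCl m N"
    using that unfolding PCl_iff lookup_uminus by (blast intro: supp_in_uminus Psc_uminus)
  show "F - G \<in> PCl m N" if "F \<in> PCl m N" "G \<in> PCl m N"
    using that unfolding PCl_iff lookup_minus by (blast intro: supp_in_diff Psc_diff)
qed

lemma PCl_cscale: "F \<in> PCl m N \<Longrightarrow> cscale c F \<in> PCl m N"
  by (simp add: cscale_def PCl_smul)

lemma PCl_sum: "(\<And>i. i \<in> I \<Longrightarrow> f i \<in> PCl m N) \<Longrightarrow> sum f I \<in> PCl m N"
  by (induction I rule: infinite_finite_induct) (auto intro: PCl_add)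

lemma PCl_single: "A \<subseteq> UNIV \<times> {1..m} \<Longrightarrow> c \<in> Psc m N \<Longrightarrow> single A c \<in> PCl m N"
  by (simp add: PCl_iff supp_in_single lookup_single when_def)

lemma PCl_cw:
  assumes "F \<in> PCl m N" "D 0 = 0" "\<And>p. p \<in> Psc m N \<Longrightarrow> D p \<in> Psc m N"
  shows "cw D F \<in> PCl m N"
  using assms by (simp add: PCl_iff cw_supp_in lookup_cw)

lemma eps_Psc: "p \<in> Psc m N \<Longrightarrow> eps g A * p \<in> Psc m N"
  by (cases "even (card {x\<in>A. x < g})") (auto simp: eps_def Psc_uminus)

lemma PCl_ctr: "F \<in> PCl m N \<Longrightarrow> ctr h F \<in> PCl m N"
proof -
  assume F: "F \<in> PCl m N"
  have "ctr h F \<in> supp_in {A. A \<subseteq> UNIV \<times> {1..m}}"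
  proof (rule supp_inI)
    fix B assume "lookup (ctr h F) B \<noteq> 0"
    then have "lookup F (insert h B) \<noteq> 0" by (auto simp: lookup_ctr split: if_splits)
    then have "insert h B \<subseteq> UNIV \<times> {1..m}" using F by (auto simp: PCl_iff dest: supp_inD)
    then show "B \<in> {A. A \<subseteq> UNIV \<times> {1..m}}" by blast
  qed
  moreover have "lookup (ctr h F) A \<in> Psc m N" for A
    using F by (simp add: lookup_ctr eps_Psc PCl_lookup)
  ultimately show ?thesis by (simp add: PCl_iff)
qed

lemma PCl_ext: "F \<in> PCl m N \<Longrightarrow> h \<in> UNIV \<times> {1..m} \<Longrightarrow> extmul h F \<in> PCl m N"
proof -
  assume F: "F \<in> PCl m N" and h: "h \<in> UNIV \<times> {1..m}"
  have "B \<subseteq> UNIV \<times> {1..m}" if "lookup (extmul h F) B \<noteq> 0" for B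
  proof -
    have "lookup F (B - {h}) \<noteq> 0" using that by (auto simp: lookup_ext split: if_splits)
    then have "B - {h} \<subseteq> UNIV \<times> {1..m}" using F by (auto simp: PCl_iff dest: supp_inD)
    then show ?thesis using h by blast
  qed
  then have "extmul h F \<in> supp_in {A. A \<subseteq> UNIV \<times> {1..m}}"
    by (intro supp_inI) blast
  moreover have "lookup (extmul h F) A \<in> Psc m N" for A
    using F by (simp add: lookup_ext eps_Psc PCl_lookup)
  ultimately show ?thesis by (simp add: PCl_iff)
qed

lemma PCl_clmul: "F \<in> PCl m N \<Longrightarrow> h \<in> UNIV \<times> {1..m} \<Longrightarrow> clmul h F \<in> PCl m N"
  by (simp add: clmul_eq PCl_FinL PCl_add PCl_ext PCl_ctr)

lemma PCl_gpar: "F \<in> PCl m N \<Longrightarrow> gpar F \<in> PCl m N"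
proof -
  have "(-1) ^ k * p \<in> Psc m N" if "p \<in> Psc m N" for k p
    using that by (cases "even k") (auto simp: Psc_uminus)
  then show "F \<in> PCl m N \<Longrightarrow> gpar F \<in> PCl m N"
    by (auto simp: PCl_iff lookup_gpar supp_in_def in_keys_iff)
qed

lemma PCl_word:
  assumes "\<And>g G. g \<in> UNIV \<times> {1..m} \<Longrightarrow> G \<in> PCl m N \<Longrightarrow> mul g G \<in> PCl m N" "set gs \<subseteq> UNIV \<times> {1..m}"
  shows "word mul gs \<in> PCl m N"
  using assms(2) by (induction gs) (auto intro: PCl_single assms(1))

lemma PCl_dag:
  assumes "\<And>g G. g \<in> UNIV \<times> {1..m} \<Longrightarrow> G \<in> PCl m N \<Longrightarrow> mul g G \<in> PCl m N" "F \<in> PCl m N"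
  shows "dag_pcl mul F \<in> PCl m N"
  unfolding dag_pcl_def gswap_case
proof (intro PCl_sum PCl_smul)
  fix A assume "A \<in> keys F"
  then have A: "A \<subseteq> UNIV \<times> {1..m}" using assms(2) by (auto simp: PCl_iff supp_in_def)
  then have "finite A" by (rule finite_subset) simp
  with A show "word mul (map gswap (sorted_list_of_set A)) \<in> PCl m N"
    by (intro PCl_word assms(1)) (auto simp: gswap_def)
  show "conj_psc (lookup F A) \<in> Psc m N"
    using assms(2) by (simp add: conj_psc_Psc PCl_lookup)
qed

lemma PCl_dagC: "F \<in> PCl m N \<Longrightarrow> dagC F \<in> PCl m N"
  by (rule PCl_dag) (auto intro: PCl_clmul)

lemma cscale_one [simp]: "cscale 1 F = F"
  by (simp add: cscale_def pconst_def)

lemma cscale_minus_one [simp]: "cscale (-1) F = - F"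
  by (simp add: cscale_def pconst_def single_uminus smul_minus_left)

lemma cscale_add: "cscale c (F + G) = cscale c F + cscale c G"
  by (simp add: cscale_def smul_add)

lemma cscale_cscale: "cscale c (cscale d F) = cscale d (cscale c F)"
  by (simp add: cscale_def mult.commute)

lemma cscale_sum: "cscale c (sum f I) = (\<Sum>i\<in>I. cscale c (f i))"
  by (simp add: cscale_def smul_sum)

lemma cscale_zero [simp]: "cscale c 0 = 0"
  by (simp add: cscale_def)

lemma lookup_cscale: "lookup (cscale c F) A = smul c (lookup F A)"
  by (simp add: cscale_def pconst_mult)

lemma slin_cscale: "slin f \<Longrightarrow> f (cscale c F) = cscale c (f F)"
  by (simp add: cscale_def slin_smul)

lemma dag_cscale: "dag_pcl mul (cscale c F) = cscale (cnj c) (dag_pcl mul F)"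
  by (simp add: cscale_def dag_pcl_smul)

section \<open>The contractions s_k and their conjugates\<close>

definition sopb :: "nat \<Rightarrow> nat \<Rightarrow> pcl \<Rightarrow> pcl" where
  "sopb m i F = (\<Sum>a=1..m. ctr (True, a) (cw (pd (True, i, a)) F))"

lemma sop_add: "sop m i (F + G) = sop m i F + sop m i G"
  and sopb_add: "sopb m i (F + G) = sopb m i F + sopb m i G"
  by (simp_all add: sop_def sopb_def cw_add slin_pd lext_add sum.distrib)

lemma sop_zero [simp]: "sop m i 0 = 0"
  by (simp add: sop_def cw_zero slin_zero slin_pd)

lemma sop_sum: "sop m i (sum f I) = (\<Sum>i'\<in>I. sop m i (f i'))"
  by (induction I rule: infinite_finite_induct) (auto simp: sop_add)

lemma sop_cscale: "sop m i (cscale c F) = cscale c (sop m i F)"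
  and sopb_cscale: "sopb m i (cscale c F) = cscale c (sopb m i F)"
  by (simp_all add: sop_def sopb_def cw_cscale slin_pd slin_cscale slin_lext cscale_sum)

lemma sop_PCl: "F \<in> PCl m N \<Longrightarrow> sop m i F \<in> PCl m N"
  and sopb_PCl: "F \<in> PCl m N \<Longrightarrow> sopb m i F \<in> PCl m N"
  unfolding sop_def sopb_def
  by (auto intro!: PCl_sum PCl_ctr PCl_cw simp: slin_zero slin_pd pd_Psc)

text \<open>Derivatives commute while contractions anticommute. The free choices of variables and of
  the flags d and e cover both s with s and s with its conjugate.\<close>

lemma contraction_sums_anticommute:
  assumes F: "F \<in> FinL"
  shows "(\<Sum>a=1..m. ctr (d, a) (cw (pd (x a)) (\<Sum>b=1..m. ctr (e, b) (cw (pd (y b)) F))))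
      = - (\<Sum>b=1..m. ctr (e, b) (cw (pd (y b)) (\<Sum>a=1..m. ctr (d, a) (cw (pd (x a)) F))))"
proof -
  have "ctr (d, a) (cw (pd (x a)) (ctr (e, b) (cw (pd (y b)) F)))
      = - ctr (e, b) (cw (pd (y b)) (ctr (d, a) (cw (pd (x a)) F)))" for a b
    using F by (simp add: cw_ctr slin_pd slin_zero cw_cw pd_commute[of "x a"] cw_supp_in
        ctr_ctr[of _ "(d, a)" "(e, b)"])
  then have "(\<Sum>a=1..m. ctr (d, a) (cw (pd (x a)) (\<Sum>b=1..m. ctr (e, b) (cw (pd (y b)) F))))
      = (\<Sum>a=1..m. \<Sum>b=1..m. - ctr (e, b) (cw (pd (y b)) (ctr (d, a) (cw (pd (x a)) F))))"
    by (simp add: cw_sum slin_pd lext_sum)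
  also have "\<dots> = (\<Sum>b=1..m. \<Sum>a=1..m. - ctr (e, b) (cw (pd (y b)) (ctr (d, a) (cw (pd (x a)) F))))"
    by (rule sum.swap)
  finally show ?thesis
    by (simp add: cw_sum slin_pd lext_sum sum_negf)
qed

lemma sop_sop: "F \<in> FinL \<Longrightarrow> sop m k (sop m l F) = - sop m l (sop m k F)"
  and sop_sopb: "F \<in> FinL \<Longrightarrow> sop m k (sopb m l F) = - sopb m l (sop m k F)"
  unfolding sop_def sopb_def by (rule contraction_sums_anticommute, assumption)+

lemma sop_Ez: "sop m k (cw (Ez m j i) F) = cw (Ez m j i) (sop m k F) + (if k = j then sop m i F else 0)"
proof -
  have "cw (pd (False, k, a)) (cw (Ez m j i) F)
      = cw (Ez m j i) (cw (pd (False, k, a)) F) + (if k = j then cw (pd (False, i, a)) F else 0)"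
    if "a \<in> {1..m}" for a
    by (rule poly_mapping_eqI)
      (simp add: lookup_cw slin_zero slin_Ez slin_pd lookup_add pd_Ez[OF that] algebra_simps)
  then show ?thesis
    by (simp add: sop_def lext_add cw_sum slin_Ez cw_ctr sum.distrib)
qed

lemma sop_Ezb: "sop m k (cw (Ezb m j i) F) = cw (Ezb m j i) (sop m k F)"
proof -
  have "pd (False, k, a) (Ezb m j i p) = Ezb m j i (pd (False, k, a) p)" for a p
    unfolding Ezb_def slin_sum[OF slin_pd] by (intro sum.cong) (auto simp: pd_zv pd_commute)
  then have "cw (pd (False, k, a)) (cw (Ezb m j i) F) = cw (Ezb m j i) (cw (pd (False, k, a)) F)" for a
    by (simp add: cw_cw slin_zero slin_Ezb slin_pd)
  then show ?thesis
    by (simp add: sop_def cw_sum slin_Ezb cw_ctr)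
qed

lemma sopb_Ez: "sopb m k (cw (Ez m j i) F) = cw (Ez m j i) (sopb m k F)"
proof -
  have "cw (pd (True, k, a)) (cw (Ez m j i) F) = cw (Ez m j i) (cw (pd (True, k, a)) F)" for a
    by (simp add: cw_cw slin_zero slin_Ez slin_pd pd_bar_Ez)
  then show ?thesis
    by (simp add: sopb_def cw_sum slin_Ez cw_ctr)
qed

lemma gpar_sop: "F \<in> FinL \<Longrightarrow> sop m k (gpar F) = - gpar (sop m k F)"
  by (simp add: sop_def slin_sum[OF slin_gpar] gpar_ctr cw_supp_in slin_zero slin_pd cw_gpar sum_negf)

lemma dagC_sop: "F \<in> FinL \<Longrightarrow> dagC (sop m k F) = sopb m k (dagC F)"
  by (simp add: sop_def sopb_def dag_pcl_sum dagC_ctr cw_supp_in slin_zero slin_pd gswap_def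
      dagC_cw[OF slin_pd slin_pd conj_psc_pd] zswap_def)

lemma dagC_Ez: "dagC (cw (Ez m j i) F) = cw (Ezb m j i) (dagC F)"
  by (rule dagC_cw[OF slin_Ez slin_Ezb conj_psc_Ez])

lemma dagC_Ezb: "dagC (cw (Ezb m j i) F) = cw (Ez m j i) (dagC F)"
  by (rule dagC_cw[OF slin_Ezb slin_Ez]) (metis conj_psc_Ez conj_psc_conj_psc)

section \<open>The Capelli matrix over Clifford polynomials\<close>

lemma lookup_Cz:
  assumes "i \<in> {1..N}"
  shows "lookup (\<Sum>j=1..N. Cz_entry m i j (u j)) A = capelli m N m (\<lambda>j. lookup (u j) A) i"
  using assms by (auto simp: Cz_entry_def capelli_def lookup_sum lookup_add lookup_cscale lookup_cw
      slin_zero slin_Ez intro!: sum.cong)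

text \<open>The Capelli matrix acts on the coefficients of each label separately, which reduces the
  claim to scalar columns. The cases of interest are s = 0 and s = 1.\<close>

lemma Cz_shift_inj:
  assumes "N \<le> m" "\<And>i. i \<in> {1..N} \<Longrightarrow> (\<Sum>j=1..N. Cz_entry m i j (u j)) + cscale (of_nat s) (u i) = 0"
    "i \<in> {1..N}"
  shows "u i = 0"
proof (rule poly_mapping_eqI)
  fix A
  have "capelli m N (m + s) (\<lambda>j. lookup (u j) A) i = 0" if i: "i \<in> {1..N}" for i
  proof -
    have "lookup ((\<Sum>j=1..N. Cz_entry m i j (u j)) + cscale (of_nat s) (u i)) A = 0"
      using assms(2)[OF i] by simp
    then have "capelli m N m (\<lambda>j. lookup (u j) A) i + smul (of_nat s) (lookup (u i) A) = 0"
      by (simp add: lookup_add lookup_Cz[OF i] lookup_cscale)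
    then show ?thesis
      using capelli_eq[OF i, of m s] capelli_eq[OF i, of m 0] by simp
  qed
  then show "lookup (u i) A = lookup 0 A"
    using capelli_inj[OF assms(1), of s "\<lambda>j. lookup (u j) A" i] assms(3) by simp
qed

lemma Cz_inj:
  assumes "N \<le> m" "\<And>i. i \<in> {1..N} \<Longrightarrow> (\<Sum>j=1..N. Cz_entry m i j (u j)) = 0" "i \<in> {1..N}"
  shows "u i = 0"
  by (rule Cz_shift_inj[where s = 0 and N = N and m = m])
    (use assms in \<open>auto simp: cscale_def pconst_def\<close>)

lemma Cz_entry_add: "Cz_entry m i j (F + G) = Cz_entry m i j F + Cz_entry m i j G"
  by (simp add: Cz_entry_def cscale_add cw_add slin_Ez)

lemma Cz_entry_zero [simp]: "Cz_entry m i j 0 = 0"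
  by (simp add: Cz_entry_def cw_zero slin_zero slin_Ez)

lemma Cz_entry_sum: "Cz_entry m i j (sum f I) = (\<Sum>i'\<in>I. Cz_entry m i j (f i'))"
  by (induction I rule: infinite_finite_induct) (auto simp: Cz_entry_add)

lemma Cz_entry_uminus: "Cz_entry m i j (- F) = - Cz_entry m i j F"
  using Cz_entry_add[of m i j F "- F"] by (simp add: minus_unique)

lemma Cz_entry_diff: "Cz_entry m i j (F - G) = Cz_entry m i j F - Cz_entry m i j G"
  using Cz_entry_add[of m i j F "- G"] by (simp add: Cz_entry_uminus)

text \<open>The scalar systems are solved label by label; labels outside the finite support of v
  receive the solution 0, so the result is again finitely supported.\<close>

lemma Cz_surj:
  assumes "N \<le> m" "v \<in> Cols m N"
  shows "v \<in> Cz m N ` Cols m N"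
proof -
  have "\<forall>A. \<exists>u. (\<forall>i\<in>{1..N}. u i \<in> Psc m N) \<and> (\<forall>i. i \<notin> {1..N} \<longrightarrow> u i = 0)
      \<and> capelli m N m u = (\<lambda>i. lookup (v i) A)"
  proof
    fix A
    obtain u where "\<And>i. i \<in> {1..N} \<Longrightarrow> u i \<in> Psc m N" "\<And>i. i \<notin> {1..N} \<Longrightarrow> u i = 0"
        "capelli m N m u = (\<lambda>i. lookup (v i) A)"
      by (rule capelli_surj[OF assms(1), of "\<lambda>i. lookup (v i) A"])
        (use assms(2) in \<open>auto simp: Cols_def PCl_lookup\<close>)
    then show "\<exists>u. (\<forall>i\<in>{1..N}. u i \<in> Psc m N) \<and> (\<forall>i. i \<notin> {1..N} \<longrightarrow> u i = 0)
      \<and> capelli m N m u = (\<lambda>i. lookup (v i) A)" by blast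
  qed
  from choice[OF this] obtain U where U: "\<And>A i. i \<in> {1..N} \<Longrightarrow> U A i \<in> Psc m N" "\<And>A i. i \<notin> {1..N} \<Longrightarrow> U A i = 0"
      "\<And>A. capelli m N m (U A) = (\<lambda>i. lookup (v i) A)"
    by blast
  define Q where "Q = (\<Union>i\<in>{1..N}. keys (v i))"
  have Q: "finite Q" "A \<in> Q \<Longrightarrow> A \<subseteq> UNIV \<times> {1..m}" for A
    using assms(2) by (auto simp: Q_def Cols_def PCl_iff supp_in_def)
  define u where "u = (\<lambda>i. \<Sum>A\<in>Q. single A (U A i))"
  have "u i \<in> PCl m N" for i
    unfolding u_def by (intro PCl_sum PCl_single Q) (use U(1,2) in \<open>metis Psc_zero\<close>)+
  moreover have "u i = 0" if "i \<notin> {1..N}" for i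
    using U(2)[OF that] by (simp add: u_def)
  ultimately have u: "u \<in> Cols m N" by (auto simp: Cols_def)
  have lu: "lookup (u i) A = (if A \<in> Q then U A i else 0)" for i A
    using Q(1) by (simp add: u_def lookup_sum lookup_single when_def)
  have "Cz m N u i = v i" for i
  proof (cases "i \<in> {1..N}")
    case True
    show ?thesis
    proof (rule poly_mapping_eqI)
      fix A
      have "capelli m N m (\<lambda>j. lookup (u j) A) i = lookup (v i) A"
      proof (cases "A \<in> Q")
        case True
        then show ?thesis using U(3)[of A] by (simp add: lu fun_eq_iff)
      next
        case False
        then have "lookup (v i) A = 0" using \<open>i \<in> {1..N}\<close> by (auto simp: Q_def in_keys_iff)
        then show ?thesis using False
          by (auto simp: lu capelli_def slin_zero slin_Ez)
      qed
      then show "lookup (Cz m N u i) A = lookup (v i) A"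
        using True lookup_Cz[OF True, of m u A] by (simp add: Cz_def)
    qed
  next
    case False
    then show ?thesis using assms(2) by (auto simp: Cz_def Cols_def)
  qed
  then show ?thesis using u by (metis ext image_eqI)
qed

lemma Cz_inverse:
  assumes "N \<le> m" "v \<in> Cols m N"
  shows "inv_into (Cols m N) (Cz m N) v \<in> Cols m N" "Cz m N (inv_into (Cols m N) (Cz m N) v) = v"
  by (rule inv_into_into[OF Cz_surj[OF assms]], rule f_inv_into_f[OF Cz_surj[OF assms]])

lemma nplus_PCl:
  assumes "N \<le> m" "F \<in> PCl m N"
  shows "nplus m N i F \<in> PCl m N"
proof -
  have "(\<lambda>j. if j = l then sop m l F else 0) \<in> Cols m N" if "l \<in> {1..N}" for l
    using assms that by (auto simp: Cols_def sop_PCl)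
  from Cz_inverse(1)[OF assms(1) this]
  have "Cz_inv_entry m N i l (sop m l F) \<in> PCl m N" if "l \<in> {1..N}" for l
    using that unfolding Cz_inv_entry_def Cols_def by (cases "i \<in> {1..N}") auto
  then show ?thesis
    unfolding nplus_def by (rule PCl_sum)
qed

text \<open>The linear system that characterizes n^+. Together with \<open>nplus_unique\<close> and
  \<open>nplus_PCl\<close> it replaces the definition by \<open>inv_into\<close> from here
  on.\<close>

lemma nplus_eqn:
  assumes "N \<le> m" "F \<in> PCl m N" "i \<in> {1..N}"
  shows "(\<Sum>j=1..N. Cz_entry m i j (nplus m N j F)) = sop m i F"
proof -
  define u where "u l = inv_into (Cols m N) (Cz m N) (\<lambda>j. if j = l then sop m l F else 0)" for l
  have u: "Cz m N (u l) = (\<lambda>j. if j = l then sop m l F else 0)" if "l \<in> {1..N}" for l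
    unfolding u_def using assms that by (intro Cz_inverse) (auto simp: Cols_def sop_PCl)
  have "(\<Sum>j=1..N. Cz_entry m i j (nplus m N j F)) = (\<Sum>j=1..N. \<Sum>l=1..N. Cz_entry m i j (u l j))"
    by (simp add: nplus_def Cz_entry_sum Cz_inv_entry_def u_def)
  also have "\<dots> = (\<Sum>l=1..N. Cz m N (u l) i)"
    using assms(3) by (subst sum.swap) (simp add: Cz_def)
  also have "\<dots> = (\<Sum>l=1..N. if i = l then sop m l F else 0)"
    by (intro sum.cong) (auto simp: u)
  also have "\<dots> = sop m i F"
    using assms(3) by simp
  finally show ?thesis .
qed

section \<open>Commutation rules of n^+\<close>

lemma nplus_unique:
  assumes "N \<le> m" "F \<in> PCl m N" "\<And>i. i \<in> {1..N} \<Longrightarrow> (\<Sum>j=1..N. Cz_entry m i j (w j)) = sop m i F"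
    and "i \<in> {1..N}"
  shows "nplus m N i F = w i"
proof -
  have "nplus m N i F - w i = 0"
    by (rule Cz_inj[OF assms(1) _ assms(4)])
      (simp add: Cz_entry_diff sum_subtractf assms(3) nplus_eqn[OF assms(1,2)])
  then show ?thesis by simp
qed

text \<open>If X commutes with the Capelli entries and with the s_k up to the factor
  \<open>\<epsilon>\<close>, then \<open>\<epsilon>\<close> X n_i F solves the system for X F, and
  solutions are unique. The hypotheses are restricted to the carrier because one of the X is n_j^-,
  which is controlled only there.\<close>

lemma nplus_intertwine:
  assumes "N \<le> m" and F: "F \<in> PCl m N" and i: "i \<in> {1..N}"
    and PCl: "\<And>G. G \<in> PCl m N \<Longrightarrow> X G \<in> PCl m N"
    and add: "\<And>G G'. G \<in> PCl m N \<Longrightarrow> G' \<in> PCl m N \<Longrightarrow> X (G + G') = X G + X G'"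
    and scale: "\<And>G. G \<in> PCl m N \<Longrightarrow> X (cscale (of_nat m) G) = cscale (of_nat m) (X G)"
    and Ez: "\<And>G j k. G \<in> PCl m N \<Longrightarrow> j \<in> {1..N} \<Longrightarrow> k \<in> {1..N} \<Longrightarrow> X (cw (Ez m j k) G) = cw (Ez m j k) (X G)"
    and sop: "\<And>k. k \<in> {1..N} \<Longrightarrow> sop m k (X F) = cscale \<epsilon> (X (sop m k F))"
  shows "nplus m N i (X F) = cscale \<epsilon> (X (nplus m N i F))"
proof (rule nplus_unique[OF assms(1) PCl[OF F] _ i])
  fix k assume k: "k \<in> {1..N}"
  have X0: "X 0 = 0" using add[of 0 0] by simp
  have X_sum: "X (\<Sum>j\<in>I. g j) = (\<Sum>j\<in>I. X (g j))" if "\<And>j. j \<in> I \<Longrightarrow> g j \<in> PCl m N" for g and I :: "nat set"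
    using that by (induction I rule: infinite_finite_induct) (auto simp: X0 add PCl_sum)
  have nPCl: "nplus m N j F \<in> PCl m N" for j
    by (rule nplus_PCl[OF assms(1) F])
  have Ez_PCl: "cw (Ez m j k) (nplus m N j F) \<in> PCl m N" if "j \<in> {1..N}" for j
    using that by (intro PCl_cw nPCl) (auto simp: slin_zero slin_Ez Ez_Psc)
  have "Cz_entry m k j (cscale \<epsilon> (X (nplus m N j F))) = cscale \<epsilon> (X (Cz_entry m k j (nplus m N j F)))"
    if "j \<in> {1..N}" for j
    using that k nPCl[of j] Ez_PCl[of j]
    by (simp add: X0 Cz_entry_def cw_cscale slin_Ez add PCl_cscale scale Ez cscale_add cscale_cscale[of "of_nat m"])
  then have "(\<Sum>j=1..N. Cz_entry m k j (cscale \<epsilon> (X (nplus m N j F))))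
      = cscale \<epsilon> (\<Sum>j=1..N. X (Cz_entry m k j (nplus m N j F)))"
    by (simp add: cscale_sum)
  also have "(\<Sum>j=1..N. X (Cz_entry m k j (nplus m N j F))) = X (\<Sum>j=1..N. Cz_entry m k j (nplus m N j F))"
    by (rule X_sum[symmetric]) (auto simp: Cz_entry_def intro!: PCl_add PCl_cscale nPCl Ez_PCl)
  finally show "(\<Sum>j=1..N. Cz_entry m k j (cscale \<epsilon> (X (nplus m N j F)))) = sop m k (X F)"
    using k by (simp add: nplus_eqn[OF assms(1) F] sop)
qed

lemma nplus_add:
  assumes "N \<le> m" "F \<in> PCl m N" "G \<in> PCl m N" "i \<in> {1..N}"
  shows "nplus m N i (F + G) = nplus m N i F + nplus m N i G"
  by (rule nplus_unique)
    (use assms in \<open>auto simp: PCl_add Cz_entry_add sum.distrib nplus_eqn sop_add\<close>)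

lemma nplus_cscale:
  assumes "N \<le> m" "F \<in> PCl m N" "i \<in> {1..N}"
  shows "nplus m N i (cscale c F) = cscale c (nplus m N i F)"
  using nplus_intertwine[OF assms, of "cscale c" 1]
  by (simp add: PCl_cscale cscale_add cw_cscale slin_Ez sop_cscale cscale_cscale[of c])

lemma Ezb_Psc: "p \<in> Psc m N \<Longrightarrow> j \<in> {1..N} \<Longrightarrow> Ezb m j i p \<in> Psc m N"
  by (metis conj_psc_Ez conj_psc_Psc conj_psc_conj_psc Ez_Psc)

lemma nplus_Ezb:
  assumes "N \<le> m" "F \<in> PCl m N" "i \<in> {1..N}" "j \<in> {1..N}"
  shows "nplus m N i (cw (Ezb m j k) F) = cw (Ezb m j k) (nplus m N i F)"
  using nplus_intertwine[OF assms(1-3), of "cw (Ezb m j k)" 1] assms(4)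
  by (simp add: PCl_cw slin_zero slin_Ezb slin_Ez Ezb_Psc cw_add cw_cscale cw_cw Ez_Ezb sop_Ezb)

lemma nplus_sopb:
  assumes "N \<le> m" "F \<in> PCl m N" "i \<in> {1..N}"
  shows "nplus m N i (sopb m j F) = - sopb m j (nplus m N i F)"
  using nplus_intertwine[OF assms, of "sopb m j" "-1"] assms(2)
  by (simp add: sopb_PCl sopb_add sopb_cscale sopb_Ez sop_sopb PCl_FinL)

lemma nplus_gpar:
  assumes "N \<le> m" "F \<in> PCl m N" "i \<in> {1..N}"
  shows "nplus m N i (gpar F) = - gpar (nplus m N i F)"
  using nplus_intertwine[OF assms, of gpar "-1"] assms(2)
  by (simp add: PCl_gpar slin_add slin_gpar slin_cscale cw_gpar slin_Ez gpar_sop PCl_FinL)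

lemma cw_Ez_commutator:
  "cw (Ez m j l) (cw (Ez m i k) F) = cw (Ez m i k) (cw (Ez m j l) F)
     + (if l = i then cw (Ez m j k) F else 0) - (if j = k then cw (Ez m i l) F else 0)"
proof (rule poly_mapping_eqI)
  fix A
  show "lookup (cw (Ez m j l) (cw (Ez m i k) F)) A = lookup (cw (Ez m i k) (cw (Ez m j l) F)
     + (if l = i then cw (Ez m j k) F else 0) - (if j = k then cw (Ez m i l) F else 0)) A"
    using Ez_commutator[of m j l i k "lookup F A", unfolded diff_eq_eq]
    by (cases "j = k"; cases "l = i")
      (simp_all add: lookup_cw slin_zero slin_Ez lookup_add lookup_minus add_diff_eq)
qed

text \<open>Outside the scope of \<open>nplus_intertwine\<close>, since \<open>Ez m k k\<close> does
  not commute with the Capelli entries. The correction term absorbs the commutator: n_i lowers the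
  degree in z_i by one and keeps the other z-degrees.\<close>

lemma nplus_Euler:
  assumes "N \<le> m" "F \<in> PCl m N" "i \<in> {1..N}" "k \<in> {1..N}"
  shows "nplus m N i (cw (Ez m k k) F) = cw (Ez m k k) (nplus m N i F) + (if i = k then nplus m N i F else 0)"
proof (rule nplus_unique[OF assms(1) _ _ assms(3)])
  show "cw (Ez m k k) F \<in> PCl m N"
    using assms by (intro PCl_cw) (auto simp: slin_zero slin_Ez Ez_Psc)
  fix l assume l: "l \<in> {1..N}"
  let ?n = "\<lambda>j. nplus m N j F"
  let ?E = "\<lambda>j i. cw (Ez m j i)"
  have "Cz_entry m l j (?E k k (?n j) + (if j = k then ?n j else 0))
      = ?E k k (Cz_entry m l j (?n j)) + (if l = k then Cz_entry m k j (?n j) else 0)" for j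
    by (auto simp: Cz_entry_def cw_add slin_Ez cw_cscale cscale_add cw_Ez_commutator[of m j l k k]
        cw_zero slin_zero)
  then have "(\<Sum>j=1..N. Cz_entry m l j (?E k k (?n j) + (if j = k then ?n j else 0)))
      = ?E k k (\<Sum>j=1..N. Cz_entry m l j (?n j)) + (if l = k then \<Sum>j=1..N. Cz_entry m k j (?n j) else 0)"
    by (simp add: sum.distrib cw_sum slin_Ez)
  also have "\<dots> = sop m l (?E k k F)"
    using l assms by (auto simp: nplus_eqn sop_Ez)
  finally show "(\<Sum>j=1..N. Cz_entry m l j (?E k k (?n j) + (if j = k then ?n j else 0))) = sop m l (?E k k F)" .
qed

text \<open>Applying the Capelli matrix twice to the symmetrized products \<open>w\<^sub>i\<^sub>j = n\<^sub>i n\<^sub>j + n\<^sub>j n\<^sub>i\<close> turns the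
  anticommutation of the \<open>s\<^sub>k\<close> into \<open>(C + 1) w = 0\<close>, and \<open>C + 1\<close> is injective.\<close>

lemma nplus_nplus:
  assumes "N \<le> m" "F \<in> PCl m N" "i \<in> {1..N}" "j \<in> {1..N}"
  shows "nplus m N i (nplus m N j F) = - nplus m N j (nplus m N i F)"
proof -
  let ?C = "Cz_entry m"
  let ?E = "\<lambda>j i. cw (Ez m j i)"
  define u where "u i j = nplus m N i (nplus m N j F)" for i j
  define v where "v k j = sop m k (nplus m N j F)" for k j
  define w where "w i j = u i j + u j i" for i j
  define y where "y k j = (\<Sum>i=1..N. ?C k i (w i j))" for k j
  have v: "v k j = (\<Sum>i=1..N. ?C k i (u i j))" if "k \<in> {1..N}" for k j
    unfolding v_def u_def using nplus_eqn[OF assms(1) nplus_PCl[OF assms(1,2)] that] by simp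
  have sop_C: "sop m k (?C l j G) = ?C l j (sop m k G) + (if k = j then sop m l G else 0)" for k l j G
    by (auto simp: Cz_entry_def sop_add sop_cscale sop_Ez)
  have C_C: "?C l i (?C k j G) = ?C k j (?C l i G) - (if k = i then ?E j l G else 0) + (if j = l then ?E i k G else 0)"
    for l i k j G
    by (simp add: Cz_entry_def cw_add slin_Ez cw_cscale cscale_add cscale_cscale cw_zero slin_zero
        cw_Ez_commutator[of m i l j k])
  have ss: "sop m k (sop m l F) = (\<Sum>j=1..N. ?C l j (v k j)) + v l k" if "k \<in> {1..N}" "l \<in> {1..N}" for k l
  proof -
    have "sop m k (sop m l F) = (\<Sum>j=1..N. sop m k (?C l j (nplus m N j F)))"
      using nplus_eqn[OF assms(1,2) that(2)] by (simp flip: sop_sum)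
    also have "\<dots> = (\<Sum>j=1..N. ?C l j (v k j) + (if k = j then v l j else 0))"
      by (intro sum.cong) (auto simp: sop_C v_def)
    also have "\<dots> = (\<Sum>j=1..N. ?C l j (v k j)) + v l k"
      using that by (simp add: sum.distrib)
    finally show ?thesis .
  qed
  \<comment> \<open>First use of injectivity, for the column indexed by j with k fixed: C maps it to
    s_k s_l F + s_l s_k F, which is 0.\<close>
  have "y k j + w j k = 0" if k: "k \<in> {1..N}" and "j \<in> {1..N}" for k j
  proof (rule Cz_inj[OF assms(1) _ that(2)])
    fix l assume l: "l \<in> {1..N}"
    have "(\<Sum>j=1..N. ?C l j (y k j)) = (\<Sum>j=1..N. \<Sum>i=1..N. ?C l j (?C k i (u i j)))
        + (\<Sum>j=1..N. \<Sum>i=1..N. ?C l j (?C k i (u j i)))"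
      by (simp add: y_def w_def Cz_entry_add Cz_entry_sum sum.distrib)
    also have "(\<Sum>j=1..N. \<Sum>i=1..N. ?C l j (?C k i (u i j))) = (\<Sum>j=1..N. ?C l j (v k j))"
      by (simp add: v[OF k] Cz_entry_sum)
    also have "(\<Sum>j=1..N. \<Sum>i=1..N. ?C l j (?C k i (u j i)))
        = (\<Sum>j=1..N. \<Sum>i=1..N. ?C k i (?C l j (u j i)) - (if k = j then ?E i l (u j i) else 0)
            + (if i = l then ?E j k (u j i) else 0))"
      by (intro sum.cong refl C_C)
    also have "\<dots> = (\<Sum>j=1..N. \<Sum>i=1..N. ?C k i (?C l j (u j i)))
        - (\<Sum>j=1..N. \<Sum>i=1..N. if k = j then ?E i l (u j i) else 0)
        + (\<Sum>j=1..N. \<Sum>i=1..N. if i = l then ?E j k (u j i) else 0)"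
      by (simp add: sum.distrib sum_subtractf)
    also have "(\<Sum>j=1..N. \<Sum>i=1..N. ?C k i (?C l j (u j i))) = (\<Sum>i=1..N. ?C k i (v l i))"
      by (subst sum.swap) (simp add: v[OF l] Cz_entry_sum)
    also have "(\<Sum>j=1..N. \<Sum>i=1..N. if k = j then ?E i l (u j i) else 0) = (\<Sum>i=1..N. ?E i l (u k i))"
      using k by (subst sum.swap) simp
    also have "(\<Sum>j=1..N. \<Sum>i=1..N. if i = l then ?E j k (u j i) else 0) = (\<Sum>j=1..N. ?E j k (u j l))"
      using l by simp
    finally have 1: "(\<Sum>j=1..N. ?C l j (y k j)) = (\<Sum>j=1..N. ?C l j (v k j))
        + ((\<Sum>i=1..N. ?C k i (v l i)) - (\<Sum>i=1..N. ?E i l (u k i)) + (\<Sum>j=1..N. ?E j k (u j l)))" .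
    have C_sum: "(\<Sum>j=1..N. ?C l j (f j)) = cscale (of_nat m) (f l) + (\<Sum>j=1..N. ?E j l (f j))"
      if "l \<in> {1..N}" for l f
      using that by (simp add: Cz_entry_def sum.distrib)
    have "(\<Sum>j=1..N. ?C l j (w j k)) = v l k + (\<Sum>j=1..N. ?C l j (u k j))"
      by (simp add: w_def Cz_entry_add sum.distrib v[OF l])
    also have "(\<Sum>j=1..N. ?C l j (u k j)) = cscale (of_nat m) (u k l) + (\<Sum>j=1..N. ?E j l (u k j))"
      by (rule C_sum[OF l])
    finally have 2: "(\<Sum>j=1..N. ?C l j (w j k)) = v l k + (cscale (of_nat m) (u k l) + (\<Sum>j=1..N. ?E j l (u k j)))" .
    have 3: "v k l = cscale (of_nat m) (u k l) + (\<Sum>j=1..N. ?E j k (u j l))"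
      using v[OF k, of l] C_sum[OF k, of "\<lambda>j. u j l"] by simp
    have "(\<Sum>j=1..N. ?C l j (y k j + w j k)) = sop m k (sop m l F) + sop m l (sop m k F)"
      unfolding Cz_entry_add sum.distrib 1 2 ss[OF k l] ss[OF l k] 3 by simp
    also have "\<dots> = 0"
      using sop_sop[OF PCl_FinL[OF assms(2)], of m k l] by simp
    finally show "(\<Sum>j=1..N. ?C l j (y k j + w j k)) = 0" .
  qed
  \<comment> \<open>Second use: because w is symmetric, the previous relation says that C + 1
    annihilates the column i \<mapsto> w_ij.\<close>
  then have "w i j = 0"
  proof (intro Cz_shift_inj[OF assms(1), of "\<lambda>i. w i j" 1])
    fix k assume "k \<in> {1..N}"
    then show "(\<Sum>i=1..N. ?C k i (w i j)) + cscale (of_nat 1) (w k j) = 0"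
      using \<open>\<And>k j. k \<in> {1..N} \<Longrightarrow> j \<in> {1..N} \<Longrightarrow> y k j + w j k = 0\<close>[of k j] assms(4)
      by (simp add: y_def w_def add.commute)
  qed (use assms in auto)
  then show ?thesis
    by (simp add: w_def u_def eq_neg_iff_add_eq_0)
qed

section \<open>The conjugate contractions n^-\<close>

abbreviation nminusC :: "nat \<Rightarrow> nat \<Rightarrow> nat \<Rightarrow> pcl \<Rightarrow> pcl" where
  "nminusC \<equiv> nminus clmul"

lemma nminusC_PCl: "N \<le> m \<Longrightarrow> F \<in> PCl m N \<Longrightarrow> nminusC m N i F \<in> PCl m N"
  by (simp add: nminus_def PCl_dagC nplus_PCl)

lemma nminusC_add:
  assumes "N \<le> m" "F \<in> PCl m N" "G \<in> PCl m N" "i \<in> {1..N}"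
  shows "nminusC m N i (F + G) = nminusC m N i F + nminusC m N i G"
  using assms by (simp add: nminus_def PCl_dagC dag_pcl_add nplus_add)

lemma nminusC_cscale:
  assumes "N \<le> m" "F \<in> PCl m N" "i \<in> {1..N}"
  shows "nminusC m N i (cscale c F) = cscale c (nminusC m N i F)"
  using assms by (simp add: nminus_def PCl_dagC dag_cscale nplus_cscale)

lemma nminusC_nminusC:
  assumes "N \<le> m" "F \<in> PCl m N" "i \<in> {1..N}" "j \<in> {1..N}"
  shows "nminusC m N i (nminusC m N j F) = - nminusC m N j (nminusC m N i F)"
proof -
  have "dagC (dagC (nplus m N l (dagC F))) = nplus m N l (dagC F)" for l
    by (rule dagC_dagC[OF PCl_FinL[OF nplus_PCl[OF assms(1) PCl_dagC[OF assms(2)]]]])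
  then show ?thesis
    using assms nplus_nplus[of N m "dagC F" i j]
    by (simp add: nminus_def PCl_dagC dag_pcl_uminus)
qed

lemma nminusC_Ez:
  assumes "N \<le> m" "F \<in> PCl m N" "i \<in> {1..N}" "j \<in> {1..N}"
  shows "nminusC m N i (cw (Ez m j k) F) = cw (Ez m j k) (nminusC m N i F)"
  using assms by (simp add: nminus_def PCl_dagC dagC_Ez dagC_Ezb nplus_Ezb)

text \<open>The involution exchanges s_j with its conjugate and squares to the identity on the
  carrier, so this is the conjugate form of \<open>nplus_sopb\<close>.\<close>

lemma sop_nminusC:
  assumes "N \<le> m" "F \<in> PCl m N" "i \<in> {1..N}"
  shows "sop m j (nminusC m N i F) = - nminusC m N i (sop m j F)"
proof -
  have n: "nplus m N i (dagC F) \<in> PCl m N"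
    using assms by (simp add: nplus_PCl PCl_dagC)
  have "nminusC m N i (sop m j F) = - dagC (sopb m j (nplus m N i (dagC F)))"
    using assms by (simp add: nminus_def dagC_sop PCl_FinL nplus_sopb PCl_dagC dag_pcl_uminus)
  also have "sopb m j (nplus m N i (dagC F)) = dagC (sop m j (dagC (nplus m N i (dagC F))))"
    using n by (simp add: dagC_sop dagC_FinL dagC_dagC PCl_FinL)
  also have "dagC (dagC (sop m j (dagC (nplus m N i (dagC F))))) = sop m j (dagC (nplus m N i (dagC F)))"
    by (rule dagC_dagC[OF PCl_FinL[OF sop_PCl[OF PCl_dagC[OF n]]]])
  finally show ?thesis
    by (simp add: nminus_def)
qed

text \<open>n_j^- commutes with all \<open>Ez\<close>, since n_j^+ commutes with their conjugates,
  and it anticommutes with s_i; \<open>nplus_intertwine\<close> then applies with the factor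
  -1.\<close>

lemma nplus_nminusC:
  assumes "N \<le> m" "F \<in> PCl m N" "i \<in> {1..N}" "j \<in> {1..N}"
  shows "nplus m N i (nminusC m N j F) = - nminusC m N j (nplus m N i F)"
  using nplus_intertwine[OF assms(1-3), of "nminusC m N j" "-1"] assms
  by (simp add: nminusC_PCl nminusC_add nminusC_cscale nminusC_Ez sop_nminusC)

lemma nminusC_gpar:
  assumes "N \<le> m" "F \<in> PCl m N" "i \<in> {1..N}"
  shows "nminusC m N i (gpar F) = - gpar (nminusC m N i F)"
  using assms by (simp add: nminus_def PCl_dagC dagC_gpar nplus_gpar dag_pcl_uminus)

lemma nminusC_Euler:
  assumes "N \<le> m" "F \<in> PCl m N" "i \<in> {1..N}" "k \<in> {1..N}" "i \<noteq> k"
  shows "nminusC m N i (cw (Ezb m k k) F) = cw (Ezb m k k) (nminusC m N i F)"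
  using assms by (simp add: nminus_def PCl_dagC dagC_Ez dagC_Ezb nplus_Euler)

section \<open>Euler degrees\<close>

lemma edeg_of_Euler:
  assumes "cw (Ez m k k) F = cscale (of_nat e) F" "\<mu> \<in> keys (lookup F A)"
  shows "edeg m False k \<mu> = e"
  using arg_cong[OF assms(1), of "\<lambda>G. lookup (lookup G A) \<mu>"] assms(2)
  by (simp add: lookup_cw slin_zero slin_Ez lookup_Euler lookup_cscale in_keys_iff)

lemma edeg_of_Euler_bar:
  assumes "cw (Ezb m k k) F = cscale (of_nat e) F" "\<mu> \<in> keys (lookup F A)"
  shows "edeg m True k \<mu> = e"
  using arg_cong[OF assms(1), of "\<lambda>G. lookup (lookup G A) \<mu>"] assms(2)
  by (simp add: lookup_cw slin_zero slin_Ezb lookup_Euler lookup_cscale in_keys_iff)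

lemma Euler_monomial:
  "cw (Ez m k k) (single A (single \<mu> c)) = cscale (of_nat (edeg m False k \<mu>)) (single A (single \<mu> c))"
  "cw (Ezb m k k) (single A (single \<mu> c)) = cscale (of_nat (edeg m True k \<mu>)) (single A (single \<mu> c))"
  by (simp_all add: cw_single slin_zero slin_Ez slin_Ezb Euler_single cscale_def pconst_mult)

text \<open>Allows the degree-dependent coefficients of the fermionic operators to be evaluated
  before n_i^+ acts: those of N_k^+ for every k, those of N_k^- for k different from i.\<close>

lemma nplus_edeg:
  assumes "N \<le> m" "single A (single \<mu> 1) \<in> PCl m N" "i \<in> {1..N}" "k \<in> {1..N}"
    and "\<nu> \<in> keys (lookup (nplus m N i (single A (single \<mu> 1))) B)"
  shows "edeg m True k \<nu> = edeg m True k \<mu>" "k \<noteq> i \<Longrightarrow> edeg m False k \<nu> = edeg m False k \<mu>"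
proof -
  let ?F = "single A (single \<mu> 1) :: pcl"
  show "edeg m True k \<nu> = edeg m True k \<mu>"
    by (rule edeg_of_Euler_bar[OF _ assms(5)])
      (use assms nplus_Ezb[of N m ?F i k k] in \<open>simp add: Euler_monomial nplus_cscale\<close>)
  show "edeg m False k \<nu> = edeg m False k \<mu>" if "k \<noteq> i"
    by (rule edeg_of_Euler[OF _ assms(5)])
      (use assms that nplus_Euler[of N m ?F i k] in \<open>simp add: Euler_monomial nplus_cscale\<close>)
qed

lemma nminusC_edeg:
  assumes "N \<le> m" "single A (single \<mu> 1) \<in> PCl m N" "i \<in> {1..N}" "k \<in> {1..N}"
    and "\<nu> \<in> keys (lookup (nminusC m N i (single A (single \<mu> 1))) B)"
  shows "edeg m False k \<nu> = edeg m False k \<mu>" "k \<noteq> i \<Longrightarrow> edeg m True k \<nu> = edeg m True k \<mu>"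
proof -
  let ?F = "single A (single \<mu> 1) :: pcl"
  show "edeg m False k \<nu> = edeg m False k \<mu>"
    by (rule edeg_of_Euler[OF _ assms(5)])
      (use assms nminusC_Ez[of N m ?F i k k] in \<open>simp add: Euler_monomial nminusC_cscale\<close>)
  show "edeg m True k \<nu> = edeg m True k \<mu>" if "k \<noteq> i"
    by (rule edeg_of_Euler_bar[OF _ assms(5)])
      (use assms that nminusC_Euler[of N m ?F i k] in \<open>simp add: Euler_monomial nminusC_cscale\<close>)
qed

section \<open>Separation of variables\<close>

text \<open>A family of components is a polynomial over \<open>psc\<close> in formal variables
  indexed by (i, j), and this is its value at the H_ij. Since the components are arbitrary, harmonic
  and standard families share one map.\<close>

definition hev :: "nat \<Rightarrow> ((nat \<times> nat \<Rightarrow>\<^sub>0 nat) \<Rightarrow>\<^sub>0 psc) \<Rightarrow> psc" where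
  "hev m h = (\<Sum>\<alpha>\<in>keys h. Hpow m \<alpha> * lookup h \<alpha>)"

lemma hev_superset: "finite I \<Longrightarrow> keys h \<subseteq> I \<Longrightarrow> hev m h = (\<Sum>\<alpha>\<in>I. Hpow m \<alpha> * lookup h \<alpha>)"
  unfolding hev_def by (intro sum.mono_neutral_left) (auto simp: in_keys_iff)

lemma hev_add: "hev m (h + h') = hev m h + hev m h'"
  using Poly_Mapping.keys_add[of h h']
  by (simp add: hev_superset[of "keys h \<union> keys h'"] lookup_add distrib_left sum.distrib)

lemma hev_zero [simp]: "hev m 0 = 0"
  by (simp add: hev_def)

lemma hev_sum: "hev m (sum f I) = (\<Sum>i\<in>I. hev m (f i))"
  by (induction I rule: infinite_finite_induct) (auto simp: hev_add)

lemma hev_uminus: "hev m (- h) = - hev m h"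
  using hev_add[of m h "- h"] by (simp add: minus_unique)

lemma hev_diff: "hev m (h - h') = hev m h - hev m h'"
  using hev_add[of m h "- h'"] by (simp add: hev_uminus)

lemma hev_smul: "hev m (smul c h) = c * hev m h"
  using keys_smul_subset[of c h]
  by (simp add: hev_superset[of "keys h"] sum_distrib_left mult.left_commute)

lemma hev_single: "hev m (single \<alpha> p) = Hpow m \<alpha> * p"
  by (cases "p = 0") (auto simp: hev_def)

lemma Hpow_superset:
  "finite I \<Longrightarrow> keys \<alpha> \<subseteq> I \<Longrightarrow> Hpow m \<alpha> = (\<Prod>(i, j)\<in>I. Hpol m i j ^ lookup \<alpha> (i, j))"
  unfolding Hpow_def by (intro prod.mono_neutral_left) (auto simp: in_keys_iff)

lemma Hpow_add: "Hpow m (\<alpha> + \<beta>) = Hpow m \<alpha> * Hpow m \<beta>"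
  by (simp add: Hpow_superset[of "keys \<alpha> \<union> keys \<beta>"] keys_mon_add lookup_add power_add case_prod_beta
      flip: prod.distrib)

lemma Hpow_zero [simp]: "Hpow m 0 = 1"
  by (simp add: Hpow_def)

lemma Hpow_single: "Hpow m (single (i, j) 1) = Hpol m i j"
  by (simp add: Hpow_def)

lemma hev_shift: "hev m (single \<alpha> 1 * h) = Hpow m \<alpha> * hev m h"
proof -
  have "single \<alpha> 1 * h = single \<alpha> 1 * (\<Sum>\<beta>\<in>keys h. single \<beta> (lookup h \<beta>))"
    using poly_mapping_expand[of h] by simp
  also have "\<dots> = (\<Sum>\<beta>\<in>keys h. single (\<alpha> + \<beta>) (lookup h \<beta>))"
    by (simp add: sum_distrib_left mult_single)
  finally have e: "single \<alpha> 1 * h = (\<Sum>\<beta>\<in>keys h. single (\<alpha> + \<beta>) (lookup h \<beta>))" .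
  have "hev m (single \<alpha> 1 * h) = (\<Sum>\<beta>\<in>keys h. Hpow m \<alpha> * (Hpow m \<beta> * lookup h \<beta>))"
    unfolding e by (simp add: hev_sum hev_single Hpow_add mult.assoc)
  then show ?thesis
    by (simp add: hev_def[of m h] sum_distrib_left)
qed

lemma keys_shift: "keys (single a (1 :: 'b::comm_ring_1) * p) \<subseteq> (+) a ` keys (p :: 'a::cancel_comm_monoid_add \<Rightarrow>\<^sub>0 'b)"
  using Poly_Mapping.keys_mult[of "single a (1::'b)" p] by (auto split: if_splits)

lemma lookup_shift:
  "lookup (single a (1 :: 'b::comm_ring_1) * p) (a + k) = lookup (p :: 'a::cancel_comm_monoid_add \<Rightarrow>\<^sub>0 'b) k"
proof -
  have "single a 1 * p = single a 1 * (\<Sum>b\<in>keys p. single b (lookup p b))"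
    using poly_mapping_expand[of p] by simp
  also have "\<dots> = (\<Sum>b\<in>keys p. single (a + b) (lookup p b))"
    by (simp add: sum_distrib_left mult_single)
  finally have "lookup (single a 1 * p) (a + k) = (\<Sum>b\<in>keys p. if b = k then lookup p k else 0)"
    by (auto simp: lookup_sum lookup_single when_def intro!: sum.cong)
  then show ?thesis by (auto simp: in_keys_iff)
qed

section \<open>Leading monomials\<close>

definition leads :: "(zvar \<Rightarrow> nat) \<Rightarrow> zmon \<Rightarrow> psc \<Rightarrow> bool" where
  "leads w \<mu> p \<longleftrightarrow> (\<exists>p'. p = single \<mu> 1 + p' \<and> (\<forall>\<nu>\<in>keys p'. mwt w \<nu> < mwt w \<mu>))"

text \<open>Weights add under multiplication, so a product with at least one non-leading factor is
  strictly lighter than the product of the leading monomials.\<close>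

lemma leads_mult:
  assumes "leads w \<mu> p" "leads w \<nu> q"
  shows "leads w (\<mu> + \<nu>) (p * q)"
proof -
  obtain p' q' where p': "p = single \<mu> 1 + p'" "\<And>\<kappa>. \<kappa> \<in> keys p' \<Longrightarrow> mwt w \<kappa> < mwt w \<mu>"
    and q': "q = single \<nu> 1 + q'" "\<And>\<kappa>. \<kappa> \<in> keys q' \<Longrightarrow> mwt w \<kappa> < mwt w \<nu>"
    using assms by (auto simp: leads_def)
  have "p * q = single (\<mu> + \<nu>) 1 + (single \<mu> 1 * q' + p' * q)"
    by (simp add: p'(1) q'(1) algebra_simps mult_single)
  moreover have "mwt w \<kappa> < mwt w (\<mu> + \<nu>)" if "\<kappa> \<in> keys (single \<mu> 1 * q' + p' * q)" for \<kappa>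
  proof -
    have "\<kappa> \<in> keys (single \<mu> 1 * q') \<or> \<kappa> \<in> keys (p' * q)"
      using that Poly_Mapping.keys_add[of "single \<mu> 1 * q'" "p' * q"] by blast
    then show ?thesis
    proof
      assume "\<kappa> \<in> keys (single \<mu> 1 * q')"
      then show ?thesis using keys_shift[of \<mu> q'] q'(2) by (auto simp: mwt_add)
    next
      assume "\<kappa> \<in> keys (p' * q)"
      then obtain a b where ab: "\<kappa> = a + b" "a \<in> keys p'" "b \<in> keys q"
        using Poly_Mapping.keys_mult by blast
      then have "b = \<nu> \<or> b \<in> keys q'"
        using Poly_Mapping.keys_add[of "single \<nu> 1" q'] by (auto simp: q'(1))
      then have "mwt w b \<le> mwt w \<nu>" using q'(2)[of b] by auto
      then show ?thesis using p'(2)[OF ab(2)] by (simp add: ab mwt_add)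
    qed
  qed
  ultimately show ?thesis by (auto simp: leads_def)
qed

lemma leads_one: "leads w 0 1"
  unfolding leads_def by (rule exI[of _ 0]) simp

lemma leads_power: "leads w \<mu> p \<Longrightarrow> leads w (\<Sum>t<k. \<mu>) (p ^ k)"
proof (induction k)
  case 0
  then show ?case by (simp add: leads_one)
next
  case (Suc k)
  show ?case
    unfolding sum.lessThan_Suc power_Suc2 using Suc by (intro leads_mult)
qed

lemma leads_prod:
  assumes "finite I" "\<And>i. i \<in> I \<Longrightarrow> leads w (\<mu> i) (p i)"
  shows "leads w (\<Sum>i\<in>I. \<mu> i) (\<Prod>i\<in>I. p i)"
  using assms by (induction I rule: finite_induct) (auto simp: leads_one leads_mult)

text \<open>The summand \<open>a = i + j\<close> of \<open>H\<^sub>i\<^sub>j\<close> is its leading one for a weight concave in \<open>a\<close>. For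
  different \<open>(i, j)\<close> these leading monomials involve different variables; this is where
  \<open>m \<ge> 2N\<close> enters.\<close>

definition lm :: "nat \<Rightarrow> nat \<Rightarrow> zmon" where
  "lm i j = single (False, i, i + j) 1 + single (True, j, i + j) 1"

text \<open>For a at most m the subtraction is exact. The two variables in the summand a of H_ij
  have total weight 2(m^2 + 1) + 4a(i + j) - 2a^2, with its only maximum at a = i + j. The term m^2
  + 1 makes all weights positive, so dividing by a variable lowers the weight.\<close>

definition gwt :: "nat \<Rightarrow> zvar \<Rightarrow> nat" where
  "gwt m = (\<lambda>(d, i, a). m * m + 1 + 4 * a * i - a * a)"

lemma gwt_less:
  assumes "a \<le> m" "i + j \<le> m" "a \<noteq> i + j"
  shows "gwt m (False, i, a) + gwt m (True, j, a) < gwt m (False, i, i + j) + gwt m (True, j, i + j)"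
proof -
  have *: "int (gwt m (d, k, b)) = int m * int m + 1 + 4 * int b * int k - int b * int b" if "b \<le> m" for d k b
  proof -
    have "b * b \<le> m * m" using that by (rule mult_le_mono) (rule that)
    then show ?thesis by (simp add: gwt_def of_nat_diff)
  qed
  have "0 < (int a - int (i + j))\<^sup>2"
    using assms(3) by (simp add: zero_less_power2)
  then have "int (gwt m (False, i, a) + gwt m (True, j, a)) < int (gwt m (False, i, i + j) + gwt m (True, j, i + j))"
    using assms(1,2) by (simp add: * power2_eq_square algebra_simps)
  then show ?thesis by simp
qed

definition Lm :: "(nat \<times> nat \<Rightarrow>\<^sub>0 nat) \<Rightarrow> zmon" where
  "Lm \<gamma> = (\<Sum>x\<in>keys \<gamma>. \<Sum>t<lookup \<gamma> x. lm (fst x) (snd x))"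

definition Idx :: "nat \<Rightarrow> (nat \<times> nat \<Rightarrow>\<^sub>0 nat) set" where
  "Idx N = {\<alpha>. keys \<alpha> \<subseteq> {1..N} \<times> {1..N}}"

text \<open>The standard monomials: those divisible by no leading monomial
  \<open>lm i j\<close>.\<close>

definition Std :: "nat \<Rightarrow> zmon set" where
  "Std N = {\<nu>. \<forall>i\<in>{1..N}. \<forall>j\<in>{1..N}. lookup \<nu> (False, i, i + j) = 0 \<or> lookup \<nu> (True, j, i + j) = 0}"

lemma Idx_add: "\<alpha> \<in> Idx N \<Longrightarrow> \<beta> \<in> Idx N \<Longrightarrow> \<alpha> + \<beta> \<in> Idx N"
  and Idx_zero [simp]: "0 \<in> Idx N"
  by (auto simp: Idx_def keys_mon_add)

lemma Idx_single: "i \<in> {1..N} \<Longrightarrow> j \<in> {1..N} \<Longrightarrow> single (i, j) k \<in> Idx N"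
  by (auto simp: Idx_def)

lemma lookup_Lm:
  "lookup (Lm \<gamma>) (False, i, i + j) = lookup \<gamma> (i, j)" "lookup (Lm \<gamma>) (True, j, i + j) = lookup \<gamma> (i, j)"
proof -
  have *: "lookup (Lm \<gamma>) y = (\<Sum>x\<in>keys \<gamma>. lookup \<gamma> x * lookup (lm (fst x) (snd x)) y)" for y
    by (simp add: Lm_def lookup_sum)
  have "lookup (lm (fst x) (snd x)) (False, i, i + j) = of_bool (x = (i, j))" for x
    by (cases x) (auto simp: lm_def lookup_add lookup_single when_def)
  then have "lookup (Lm \<gamma>) (False, i, i + j) = (\<Sum>x\<in>keys \<gamma>. if x = (i, j) then lookup \<gamma> (i, j) else 0)"
    unfolding * by (intro sum.cong) (auto simp del: split_paired_All)
  then show "lookup (Lm \<gamma>) (False, i, i + j) = lookup \<gamma> (i, j)"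
    by (auto simp: in_keys_iff)
  have "lookup (lm (fst x) (snd x)) (True, j, i + j) = of_bool (x = (i, j))" for x
    by (cases x) (auto simp: lm_def lookup_add lookup_single when_def)
  then have "lookup (Lm \<gamma>) (True, j, i + j) = (\<Sum>x\<in>keys \<gamma>. if x = (i, j) then lookup \<gamma> (i, j) else 0)"
    unfolding * by (intro sum.cong) (auto simp del: split_paired_All)
  then show "lookup (Lm \<gamma>) (True, j, i + j) = lookup \<gamma> (i, j)"
    by (auto simp: in_keys_iff)
qed

text \<open>The two variables of \<open>lm i j\<close> occur in no other leading monomial, and a
  standard cofactor lacks one of them. Hence the exponent of \<open>\<gamma>\<close> at (i, j) is
  the smaller of the two exponents in the product.\<close>

lemma Lm_Std_unique:
  assumes "\<gamma> \<in> Idx N" "\<gamma>' \<in> Idx N" "\<nu> \<in> Std N" "\<nu>' \<in> Std N" "Lm \<gamma> + \<nu> = Lm \<gamma>' + \<nu>'"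
  shows "\<gamma> = \<gamma>' \<and> \<nu> = \<nu>'"
proof -
  have "\<gamma> = \<gamma>'"
  proof (rule poly_mapping_eqI)
    fix x
    show "lookup \<gamma> x = lookup \<gamma>' x"
    proof (cases "x \<in> {1..N} \<times> {1..N}")
      case True
      then obtain i j where x: "x = (i, j)" "i \<in> {1..N}" "j \<in> {1..N}" by auto
      have "lookup \<gamma> (i, j) + lookup \<nu> (False, i, i + j) = lookup \<gamma>' (i, j) + lookup \<nu>' (False, i, i + j)"
        "lookup \<gamma> (i, j) + lookup \<nu> (True, j, i + j) = lookup \<gamma>' (i, j) + lookup \<nu>' (True, j, i + j)"
        using arg_cong[OF assms(5), of "\<lambda>p. lookup p (False, i, i + j)"]
          arg_cong[OF assms(5), of "\<lambda>p. lookup p (True, j, i + j)"]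
        by (simp_all add: lookup_add lookup_Lm)
      moreover have "lookup \<nu> (False, i, i + j) = 0 \<or> lookup \<nu> (True, j, i + j) = 0"
        "lookup \<nu>' (False, i, i + j) = 0 \<or> lookup \<nu>' (True, j, i + j) = 0"
        using assms(3,4) x by (auto simp: Std_def)
      ultimately show ?thesis unfolding x(1) by linarith
    next
      case False
      then have "x \<notin> keys \<gamma>" "x \<notin> keys \<gamma>'" using assms(1,2) by (auto simp: Idx_def)
      then show ?thesis by (simp add: in_keys_iff)
    qed
  qed
  with assms(5) show ?thesis by simp
qed

lemma Hpol_split:
  assumes "i + j \<in> {1..m}"
  shows "Hpol m i j = single (lm i j) 1
    + (\<Sum>a\<in>{1..m} - {i + j}. single (single (False, i, a) 1 + single (True, j, a) 1) 1)"
  using assms by (simp add: Hpol_def zv_def mult_single lm_def sum.remove[of "{1..m}" "i + j"])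

lemma leads_Hpol:
  assumes "i + j \<in> {1..m}"
  shows "leads (gwt m) (lm i j) (Hpol m i j)"
  unfolding leads_def
proof (intro exI conjI ballI)
  show "Hpol m i j = single (lm i j) 1
      + (\<Sum>a\<in>{1..m} - {i + j}. single (single (False, i, a) 1 + single (True, j, a) 1) 1)"
    by (rule Hpol_split[OF assms])
  fix \<nu> :: zmon assume "\<nu> \<in> keys (\<Sum>a\<in>{1..m} - {i + j}. single (single (False, i, a) 1 + single (True, j, a) 1) (1::complex))"
  then obtain a where "a \<in> {1..m} - {i + j}" "\<nu> = single (False, i, a) 1 + single (True, j, a) 1"
    using keys_sum[of "\<lambda>a. single (single (False, i, a) 1 + single (True, j, a) 1) (1::complex)" "{1..m} - {i + j}"]
    by (auto simp del: Diff_iff)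
  then show "mwt (gwt m) \<nu> < mwt (gwt m) (lm i j)"
    using assms gwt_less[of a m i j] by (simp add: mwt_add lm_def)
qed

lemma leads_Hpow:
  assumes "2 * N \<le> m" "\<gamma> \<in> Idx N"
  shows "leads (gwt m) (Lm \<gamma>) (Hpow m \<gamma>)"
proof -
  have "leads (gwt m) (\<Sum>t<lookup \<gamma> x. lm (fst x) (snd x)) (Hpol m (fst x) (snd x) ^ lookup \<gamma> (fst x, snd x))"
    if "x \<in> keys \<gamma>" for x
  proof -
    have "x \<in> {1..N} \<times> {1..N}" using assms(2) that by (auto simp: Idx_def)
    then have "fst x + snd x \<in> {1..m}" using assms(1) by auto
    from leads_power[OF leads_Hpol[OF this]] show ?thesis by simp
  qed
  then show ?thesis
    unfolding Lm_def Hpow_def case_prod_beta by (intro leads_prod) auto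
qed

section \<open>Standard monomials times powers of the H_ij\<close>

definition hstd :: "nat \<Rightarrow> nat \<Rightarrow> ((nat \<times> nat \<Rightarrow>\<^sub>0 nat) \<Rightarrow>\<^sub>0 psc) \<Rightarrow> bool" where
  "hstd m N r \<longleftrightarrow> r \<in> supp_in (Idx N) \<and> (\<forall>\<gamma>. lookup r \<gamma> \<in> Psc m N \<inter> supp_in (Std N))"

text \<open>Take a pair \<open>(\<gamma>, \<nu>)\<close> with \<open>Lm \<gamma> + \<nu>\<close> of
  maximal weight. Non-leading parts are too light to produce this monomial, and by
  \<open>Lm_Std_unique\<close> no other leading part produces it, so its coefficient survives in the
  sum.\<close>

lemma hstd_independent:
  assumes "2 * N \<le> m" "hstd m N r" "hev m r = 0"
  shows "r = 0"
proof (rule ccontr)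
  assume "r \<noteq> 0"
  define X where "X = Sigma (keys r) (\<lambda>\<gamma>. keys (lookup r \<gamma>))"
  define W where "W = (\<lambda>(\<gamma>, \<nu>). mwt (gwt m) (Lm \<gamma> + \<nu>)) ` X"
  obtain \<gamma> where "\<gamma> \<in> keys r" using \<open>r \<noteq> 0\<close> by (metis keys_eq_empty ex_in_conv)
  then have "lookup r \<gamma> \<noteq> 0" by (simp add: in_keys_iff)
  then obtain \<nu> where "\<nu> \<in> keys (lookup r \<gamma>)" by (metis keys_eq_empty ex_in_conv)
  then have "X \<noteq> {}" using \<open>\<gamma> \<in> keys r\<close> unfolding X_def by blast
  moreover have "finite X" unfolding X_def by auto
  ultimately have "Max W \<in> W" by (auto simp: W_def)
  then obtain \<gamma>0 \<nu>0 where X0: "(\<gamma>0, \<nu>0) \<in> X" and max: "mwt (gwt m) (Lm \<gamma>0 + \<nu>0) = Max W"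
    by (auto simp: W_def)
  have le: "mwt (gwt m) (Lm \<gamma> + \<nu>) \<le> mwt (gwt m) (Lm \<gamma>0 + \<nu>0)" if "\<gamma> \<in> keys r" "\<nu> \<in> keys (lookup r \<gamma>)" for \<gamma> \<nu>
    unfolding max using that \<open>finite X\<close> by (intro Max_ge) (auto simp: W_def X_def intro!: image_eqI[of _ _ "(\<gamma>, \<nu>)"])
  have r_Std: "\<nu> \<in> Std N" if "\<nu> \<in> keys (lookup r \<gamma>)" for \<gamma> \<nu>
    using assms(2) that unfolding hstd_def supp_in_def by blast
  have r_Idx: "\<gamma> \<in> Idx N" if "\<gamma> \<in> keys r" for \<gamma>
    using assms(2) that by (auto simp: hstd_def supp_in_def)
  have coeff: "lookup (Hpow m \<gamma> * lookup r \<gamma>) (Lm \<gamma>0 + \<nu>0) = (if \<gamma> = \<gamma>0 then lookup (lookup r \<gamma>0) \<nu>0 else 0)"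
    if \<gamma>: "\<gamma> \<in> keys r" for \<gamma>
  proof -
    obtain p where p: "Hpow m \<gamma> = single (Lm \<gamma>) 1 + p" "\<And>\<kappa>. \<kappa> \<in> keys p \<Longrightarrow> mwt (gwt m) \<kappa> < mwt (gwt m) (Lm \<gamma>)"
      using leads_Hpow[OF assms(1) r_Idx[OF \<gamma>]] by (auto simp: leads_def)
    have "Lm \<gamma>0 + \<nu>0 \<notin> keys (p * lookup r \<gamma>)"
    proof
      assume "Lm \<gamma>0 + \<nu>0 \<in> keys (p * lookup r \<gamma>)"
      then obtain a b where ab: "Lm \<gamma>0 + \<nu>0 = a + b" "a \<in> keys p" "b \<in> keys (lookup r \<gamma>)"
        using Poly_Mapping.keys_mult by blast
      then show False
        using p(2)[OF ab(2)] le[OF \<gamma> ab(3)] by (simp add: mwt_add)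
    qed
    moreover have "lookup (single (Lm \<gamma>) 1 * lookup r \<gamma>) (Lm \<gamma>0 + \<nu>0) = (if \<gamma> = \<gamma>0 then lookup (lookup r \<gamma>0) \<nu>0 else 0)"
    proof (cases "\<gamma> = \<gamma>0")
      case True
      then show ?thesis by (simp add: lookup_shift)
    next
      case False
      have "Lm \<gamma>0 + \<nu>0 \<notin> keys (single (Lm \<gamma>) 1 * lookup r \<gamma>)"
      proof
        assume "Lm \<gamma>0 + \<nu>0 \<in> keys (single (Lm \<gamma>) 1 * lookup r \<gamma>)"
        then obtain \<nu> where "\<nu> \<in> keys (lookup r \<gamma>)" "Lm \<gamma>0 + \<nu>0 = Lm \<gamma> + \<nu>"
          using keys_shift by blast
        then show False
          using Lm_Std_unique[of \<gamma>0 N \<gamma> \<nu>0 \<nu>] X0 \<gamma> False r_Idx r_Std by (auto simp: X_def)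
      qed
      with False show ?thesis by (simp add: in_keys_iff)
    qed
    ultimately show ?thesis
      by (simp add: p(1) distrib_right lookup_add in_keys_iff)
  qed
  have "lookup (hev m r) (Lm \<gamma>0 + \<nu>0) = (\<Sum>\<gamma>\<in>keys r. if \<gamma> = \<gamma>0 then lookup (lookup r \<gamma>0) \<nu>0 else 0)"
    unfolding hev_def lookup_sum by (intro sum.cong refl coeff)
  also have "\<dots> \<noteq> 0"
    using X0 by (auto simp: X_def in_keys_iff)
  finally show False using assms(3) by simp
qed

lemma hstd_add: "hstd m N r \<Longrightarrow> hstd m N r' \<Longrightarrow> hstd m N (r + r')"
  by (auto simp: hstd_def lookup_add supp_in_add Psc_add)

lemma hstd_zero [simp]: "hstd m N 0"
  by (simp add: hstd_def)

lemma hstd_uminus: "hstd m N r \<Longrightarrow> hstd m N (- r)"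
  by (auto simp: hstd_def supp_in_uminus Psc_uminus)

lemma hstd_sum: "(\<And>i. i \<in> I \<Longrightarrow> hstd m N (f i)) \<Longrightarrow> hstd m N (sum f I)"
  by (induction I rule: infinite_finite_induct) (auto simp: hstd_add)

lemma shift_pred:
  fixes r :: "(nat \<times> nat \<Rightarrow>\<^sub>0 nat) \<Rightarrow>\<^sub>0 psc"
  assumes "r \<in> supp_in (Idx N)" "\<And>\<gamma>. P (lookup r \<gamma>)" "P 0" "\<alpha> \<in> Idx N"
  shows "single \<alpha> 1 * r \<in> supp_in (Idx N)" "P (lookup (single \<alpha> 1 * r) \<gamma>)"
proof -
  show "single \<alpha> 1 * r \<in> supp_in (Idx N)"
    using keys_shift[of \<alpha> r] assms(1,4) by (auto simp: supp_in_def Idx_add subset_iff)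
  show "P (lookup (single \<alpha> 1 * r) \<gamma>)"
  proof (cases "\<gamma> \<in> keys (single \<alpha> 1 * r)")
    case True
    then obtain \<beta> where "\<gamma> = \<alpha> + \<beta>" using keys_shift by blast
    then show ?thesis using assms(2) by (simp add: lookup_shift)
  next
    case False
    then show ?thesis using assms(3) by (simp add: in_keys_iff)
  qed
qed

lemma hstd_shift: "hstd m N r \<Longrightarrow> \<alpha> \<in> Idx N \<Longrightarrow> hstd m N (single \<alpha> 1 * r)"
  unfolding hstd_def
  by (auto intro: shift_pred(1) shift_pred(2)[where P = "\<lambda>p. p \<in> Psc m N"]
      shift_pred(2)[where P = "\<lambda>p. p \<in> supp_in (Std N)"])

text \<open>Division by the H_ij: a nonstandard monomial contains some \<open>lm i j\<close>, which
  is H_ij minus lighter summands. Both the cofactor and the remaining terms have smaller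
  weight.\<close>

lemma hstd_span_monomial:
  assumes "2 * N \<le> m" "keys \<mu> \<subseteq> UNIV \<times> {1..N} \<times> {1..m}"
  shows "\<exists>r. hstd m N r \<and> hev m r = single \<mu> 1"
  using assms(2)
proof (induction "mwt (gwt m) \<mu>" arbitrary: \<mu> rule: less_induct)
  case less
  show ?case
  proof (cases "\<mu> \<in> Std N")
    case True
    then have "hstd m N (single 0 (single \<mu> 1))"
      using less.prems by (auto simp: hstd_def supp_in_single Psc_single lookup_single when_def)
    moreover have "hev m (single 0 (single \<mu> 1)) = single \<mu> 1"
      by (simp add: hev_single)
    ultimately show ?thesis by blast
  next
    case False
    then obtain i j where ij: "i \<in> {1..N}" "j \<in> {1..N}" "(False, i, i + j) \<in> keys \<mu>" "(True, j, i + j) \<in> keys \<mu>"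
      by (auto simp: Std_def in_keys_iff)
    then have ijm: "i + j \<in> {1..m}" using assms(1) by auto
    obtain \<mu>1 where \<mu>1: "\<mu> = \<mu>1 + single (False, i, i + j) 1" by (rule mon_split[OF ij(3)])
    then have "(True, j, i + j) \<in> keys \<mu>1" using ij(4) by (auto simp: keys_mon_add)
    then obtain \<nu> where "\<mu>1 = \<nu> + single (True, j, i + j) 1" by (rule mon_split)
    then have \<mu>: "\<mu> = lm i j + \<nu>" using \<mu>1 by (simp add: lm_def algebra_simps)
    let ?\<mu> = "\<lambda>a. single (False, i, a) 1 + single (True, j, a) 1 + \<nu>"
    have \<nu>_in: "keys \<nu> \<subseteq> UNIV \<times> {1..N} \<times> {1..m}"
      using less.prems by (auto simp: \<mu> keys_mon_add)
    have gpos: "0 < gwt m (False, i, i + j)"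
    proof -
      have "(i + j) * (i + j) \<le> m * m" using ijm by (intro mult_le_mono) auto
      then show ?thesis by (simp add: gwt_def)
    qed
    then have "mwt (gwt m) \<nu> < mwt (gwt m) \<mu>" by (simp add: \<mu> mwt_add lm_def)
    from less.hyps[OF this \<nu>_in] obtain r where r: "hstd m N r" "hev m r = single \<nu> 1" by blast
    have "\<exists>r. hstd m N r \<and> hev m r = single (?\<mu> a) 1" if "a \<in> {1..m} - {i + j}" for a
    proof (rule less.hyps)
      show "mwt (gwt m) (?\<mu> a) < mwt (gwt m) \<mu>"
        using gwt_less[of a m i j] that ijm by (simp add: \<mu> mwt_add lm_def)
      show "keys (?\<mu> a) \<subseteq> UNIV \<times> {1..N} \<times> {1..m}"
        using \<nu>_in that ij by (auto simp: keys_mon_add)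
    qed
    then obtain R where R: "\<And>a. a \<in> {1..m} - {i + j} \<Longrightarrow> hstd m N (R a)"
      "\<And>a. a \<in> {1..m} - {i + j} \<Longrightarrow> hev m (R a) = single (?\<mu> a) 1"
      by metis
    define r' where "r' = single (single (i, j) 1) 1 * r + - (\<Sum>a\<in>{1..m} - {i + j}. R a)"
    have "hstd m N r'"
      unfolding r'_def using r(1) R(1) ij by (intro hstd_add hstd_uminus hstd_sum hstd_shift Idx_single) auto
    moreover have "hev m r' = Hpol m i j * single \<nu> 1 - (\<Sum>a\<in>{1..m} - {i + j}. single (?\<mu> a) 1)"
      by (simp add: r'_def hev_diff hev_sum R(2) hev_shift Hpow_single r(2))
    moreover have "Hpol m i j * single \<nu> 1 = single \<mu> 1 + (\<Sum>a\<in>{1..m} - {i + j}. single (?\<mu> a) 1)"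
      by (simp add: Hpol_split[OF ijm] distrib_right sum_distrib_right mult_single \<mu>)
    ultimately show ?thesis by auto
  qed
qed

lemma hstd_span:
  assumes "2 * N \<le> m" "p \<in> Psc m N"
  shows "\<exists>r. hstd m N r \<and> hev m r = p"
proof -
  have "\<exists>r. hstd m N r \<and> hev m r = single \<mu> 1" if "\<mu> \<in> keys p" for \<mu>
    using assms that by (intro hstd_span_monomial) (auto simp: Psc_def)
  then obtain R where R: "\<And>\<mu>. \<mu> \<in> keys p \<Longrightarrow> hstd m N (R \<mu>)" "\<And>\<mu>. \<mu> \<in> keys p \<Longrightarrow> hev m (R \<mu>) = single \<mu> 1"
    by metis
  define r where "r = (\<Sum>\<mu>\<in>keys p. smul (pconst (lookup p \<mu>)) (R \<mu>))"
  have "hstd m N (smul (pconst c) r)" if "hstd m N r" for c r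
    using that by (auto simp: hstd_def supp_in_smul pconst_mult Psc_smul)
  then have "hstd m N r"
    unfolding r_def by (intro hstd_sum) (simp add: R(1))
  moreover have "hev m r = (\<Sum>\<mu>\<in>keys p. single \<mu> (lookup p \<mu>))"
    by (simp add: r_def hev_sum hev_smul R(2) pconst_mult)
  ultimately show ?thesis
    using poly_mapping_expand[of p] by auto
qed

section \<open>Harmonic components\<close>

lemma mult_smul: "p * smul c q = smul c (p * q)" for q :: psc
  by (simp add: pconst_mult[symmetric] mult.left_commute)

lemma slin_Lap: "slin (Lap m i j)"
  unfolding Lap_def by (intro slin_sum_fun slin_comp[OF slin_pd slin_pd])

lemma fischer_Hpol: "fischer (Hpol m i j * p) q = fischer p (Lap m i j q)"
proof -
  have "Hpol m i j * p = (\<Sum>a=1..m. zv (True, j, a) * (zv (False, i, a) * p))"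
    unfolding Hpol_def sum_distrib_right by (intro sum.cong) (auto simp: mult_ac)
  then show ?thesis
    by (simp add: fischer_sum fischer_adjoint Lap_def fischer_sum_right)
qed

definition hharm :: "nat \<Rightarrow> nat \<Rightarrow> ((nat \<times> nat \<Rightarrow>\<^sub>0 nat) \<Rightarrow>\<^sub>0 psc) \<Rightarrow> bool" where
  "hharm m N h \<longleftrightarrow> h \<in> supp_in (Idx N) \<and> (\<forall>\<alpha>. lookup h \<alpha> \<in> Psc m N \<and>
     (\<forall>i\<in>{1..N}. \<forall>j\<in>{1..N}. Lap m i j (lookup h \<alpha>) = 0))"

lemma hdecomp_iff: "hdecomp m N P h \<longleftrightarrow> hharm m N h \<and> P = hev m h"
proof -
  have "(\<forall>\<alpha>\<in>keys h. Q (lookup h \<alpha>)) \<longleftrightarrow> (\<forall>\<alpha>. Q (lookup h \<alpha>))" if "Q 0" for Q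
    using that by (metis in_keys_iff)
  from this[of "\<lambda>p. p \<in> Psc m N \<and> (\<forall>i\<in>{1..N}. \<forall>j\<in>{1..N}. Lap m i j p = 0)"]
  show ?thesis
    unfolding hdecomp_def hharm_def hev_def supp_in_def Idx_def
    by (auto simp: slin_zero slin_Lap)
qed

text \<open>Expand the \<open>h\<^sub>\<alpha>\<close> in the basis \<open>H\<^sup>\<beta> \<nu>\<close> with standard \<open>\<nu>\<close>. For \<open>\<gamma>\<close> of minimal degree the
  component \<open>H\<^sup>\<gamma>\<close> of a vanishing sum can only come from the constant term of \<open>h\<^sub>\<gamma>\<close>; so \<open>h\<^sub>\<gamma>\<close> is in
  the ideal of the \<open>H\<^sub>i\<^sub>j\<close>, hence Fischer-orthogonal to itself.\<close>

lemma hharm_unique: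
  assumes "2 * N \<le> m" "hharm m N h" "hev m h = 0"
  shows "h = 0"
proof (rule ccontr)
  assume "h \<noteq> 0"
  have "\<exists>r. hstd m N r \<and> hev m r = lookup h \<alpha>" for \<alpha>
    using assms(1,2) by (intro hstd_span) (auto simp: hharm_def)
  then obtain R where R: "\<And>\<alpha>. hstd m N (R \<alpha>)" "\<And>\<alpha>. hev m (R \<alpha>) = lookup h \<alpha>"
    by metis
  \<comment> \<open>Substituting the standard expansions of the components merges the whole sum into
    one standard family, to which \<open>hstd_independent\<close> applies.\<close>
  define G where "G = (\<Sum>\<alpha>\<in>keys h. single \<alpha> 1 * R \<alpha>)"
  have "hstd m N G"
    unfolding G_def using assms(2) R(1)
    by (intro hstd_sum hstd_shift) (auto simp: hharm_def supp_in_def)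
  moreover have "hev m G = 0"
    using assms(3) by (simp add: G_def hev_sum hev_shift R(2) hev_def[of m h])
  ultimately have "G = 0" by (rule hstd_independent[OF assms(1)])
  have "keys h \<noteq> {}" using \<open>h \<noteq> 0\<close> by simp
  then obtain \<gamma> where \<gamma>: "\<gamma> \<in> keys h" and min: "\<And>\<alpha>. \<alpha> \<in> keys h \<Longrightarrow> mdeg \<gamma> \<le> mdeg \<alpha>"
    using ex_has_least_nat[of "\<lambda>\<alpha>. \<alpha> \<in> keys h" _ mdeg] by blast
  have "lookup (single \<alpha> 1 * R \<alpha>) \<gamma> = (if \<alpha> = \<gamma> then lookup (R \<gamma>) 0 else 0)" if "\<alpha> \<in> keys h" for \<alpha>
  proof (cases "\<alpha> = \<gamma>")
    case True
    then show ?thesis using lookup_shift[of \<gamma> "R \<gamma>" 0] by simp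
  next
    case False
    have "\<gamma> \<notin> keys (single \<alpha> 1 * R \<alpha>)"
    proof
      assume "\<gamma> \<in> keys (single \<alpha> 1 * R \<alpha>)"
      then obtain \<beta> where "\<gamma> = \<alpha> + \<beta>" using keys_shift by blast
      with min[OF that] have "mdeg \<beta> = 0" by (simp add: mwt_add)
      with False \<open>\<gamma> = \<alpha> + \<beta>\<close> show False by (simp add: mdeg_eq_0)
    qed
    with False show ?thesis by (simp add: in_keys_iff)
  qed
  then have "lookup G \<gamma> = (\<Sum>\<alpha>\<in>keys h. if \<alpha> = \<gamma> then lookup (R \<gamma>) 0 else 0)"
    unfolding G_def lookup_sum by (intro sum.cong refl)
  with \<open>G = 0\<close> \<gamma> have R0: "lookup (R \<gamma>) 0 = 0" by simp
  have "fischer (Hpow m \<beta> * p) (lookup h \<gamma>) = 0" if "\<beta> \<in> keys (R \<gamma>)" for \<beta> p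
  proof -
    have "\<beta> \<noteq> 0" using that R0 by (auto simp: in_keys_iff)
    then obtain i j where ij: "(i, j) \<in> keys \<beta>" by (metis keys_eq_empty ex_in_conv surj_pair)
    then obtain \<beta>' where \<beta>': "\<beta> = \<beta>' + single (i, j) 1" by (rule mon_split)
    have "\<beta> \<in> Idx N" using that R(1)[of \<gamma>] by (auto simp: hstd_def supp_in_def)
    with ij have "i \<in> {1..N}" "j \<in> {1..N}" by (auto simp: Idx_def)
    moreover have "Hpow m \<beta> * p = Hpol m i j * (Hpow m \<beta>' * p)"
      by (simp add: \<beta>' Hpow_add Hpow_single mult_ac)
    ultimately show ?thesis
      using assms(2) by (simp only: fischer_Hpol hharm_def fischer_zero_right)
  qed
  then have "fischer (lookup h \<gamma>) (lookup h \<gamma>) = 0"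
    by (subst (1) R(2)[symmetric]) (simp add: hev_def fischer_sum)
  then have "lookup h \<gamma> = 0"
    by (intro fischer_sqnorm_eq_0) (simp add: fischer_self)
  with \<gamma> show False by (simp add: in_keys_iff)
qed

lemma hharm_add: "hharm m N h \<Longrightarrow> hharm m N h' \<Longrightarrow> hharm m N (h + h')"
  by (auto simp: hharm_def lookup_add supp_in_add Psc_add slin_add slin_Lap)

lemma hharm_uminus: "hharm m N h \<Longrightarrow> hharm m N (- h)"
  by (auto simp: hharm_def supp_in_uminus Psc_uminus slin_minus slin_Lap)

lemma hharm_zero [simp]: "hharm m N 0"
  by (simp add: hharm_def slin_zero slin_Lap)

lemma hharm_sum: "(\<And>i. i \<in> I \<Longrightarrow> hharm m N (f i)) \<Longrightarrow> hharm m N (sum f I)"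
  by (induction I rule: infinite_finite_induct) (auto simp: hharm_add)

text \<open>The shift only relocates the components to other exponents; the product with H_ij
  appears after evaluation, so harmonicity of the components is kept.\<close>

lemma hharm_shift: "hharm m N r \<Longrightarrow> \<alpha> \<in> Idx N \<Longrightarrow> hharm m N (single \<alpha> 1 * r)"
  unfolding hharm_def
  by (intro conjI allI shift_pred(1) shift_pred(2)[where P = "\<lambda>p. p \<in> Psc m N \<and>
     (\<forall>i\<in>{1..N}. \<forall>j\<in>{1..N}. Lap m i j p = 0)", THEN conjunct1]
     shift_pred(2)[where P = "\<lambda>p. p \<in> Psc m N \<and>
     (\<forall>i\<in>{1..N}. \<forall>j\<in>{1..N}. Lap m i j p = 0)", THEN conjunct2])
    (auto simp: slin_zero slin_Lap)

lemma hdecomp_unique: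
  assumes "2 * N \<le> m" "hharm m N h" "hharm m N h'" "hev m h = hev m h'"
  shows "h = h'"
  using hharm_unique[OF assms(1) hharm_add[OF assms(2) hharm_uminus[OF assms(3)]]] assms(4)
  by (simp add: hev_add hev_uminus hev_diff)

lemma Hpol_PscD:
  assumes "p \<in> PscD m N d" "i \<in> {1..N}" "j \<in> {1..N}"
  shows "Hpol m i j * p \<in> PscD m N (Suc (Suc d))"
proof -
  have "zv (False, i, a) * (zv (True, j, a) * p) \<in> PscD m N (Suc (Suc d))" if "a \<in> {1..m}" for a
    using assms that by (intro zv_PscD) auto
  then show ?thesis
    unfolding Hpol_def sum_distrib_right PscD_def by (auto intro!: supp_in_sum simp: mult.assoc)
qed

lemma Lap_PscD: "p \<in> PscD m N (Suc (Suc d)) \<Longrightarrow> Lap m i j p \<in> PscD m N d"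
  unfolding Lap_def PscD_def by (intro supp_in_sum) (auto simp: pd_PscD[unfolded PscD_def])

lemma pd_PscD_0: "p \<in> PscD m N 0 \<Longrightarrow> pd x p = 0"
proof (rule poly_mapping_eqI)
  fix \<mu> assume "p \<in> PscD m N 0"
  moreover have "mdeg (\<mu> + single x 1) \<noteq> 0" by (simp add: mwt_add)
  ultimately have "lookup p (\<mu> + single x 1) = 0"
    unfolding PscD_def by (auto dest: supp_inD)
  then show "lookup (pd x p) \<mu> = lookup 0 \<mu>" by (simp add: lookup_pd)
qed

text \<open>Subtracting from P its projection to the span of the products H_ij p leaves a residual
  orthogonal to that span. Multiplication by H_ij is adjoint to the Laplacian, so every Laplacian of
  the residual is orthogonal to all monomials of degree at most d, while its own degree is at most
  d.\<close>

lemma harmonic_projection: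
  assumes "P \<in> PscD m N (Suc (Suc d))"
  shows "\<exists>p. (\<forall>i\<in>{1..N}. \<forall>j\<in>{1..N}. p i j \<in> PscD m N d \<and>
    Lap m i j (P - (\<Sum>i=1..N. \<Sum>j=1..N. Hpol m i j * p i j)) = 0)"
proof -
  let ?S = "\<lambda>p. \<Sum>i=1..N. \<Sum>j=1..N. Hpol m i j * p i j"
  define A where "A = {p :: nat \<Rightarrow> nat \<Rightarrow> psc. \<forall>i\<in>{1..N}. \<forall>j\<in>{1..N}. p i j \<in> PscD m N d}"
  define S where "S = ?S ` A"
  define Q where "Q = {\<mu> :: zmon. keys \<mu> \<subseteq> UNIV \<times> {1..N} \<times> {1..m} \<and> mdeg \<mu> \<le> d}"
  define B where "B = (\<lambda>((i, j), \<mu>). Hpol m i j * single \<mu> 1) ` (({1..N} \<times> {1..N}) \<times> Q)"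
  have "\<exists>s\<in>S. (\<forall>b\<in>B. fischer (P - s) b = 0) \<and> (\<forall>x. (\<forall>b\<in>B. fischer x b = 0) \<longrightarrow> fischer x s = 0)"
  proof (rule orthogonal_decomposition[where sc = smul])
    show "0 \<in> S"
      unfolding S_def by (rule image_eqI[of _ _ "\<lambda>_ _. 0"]) (auto simp: A_def PscD_def)
    show "u + v \<in> S" if uv: "u \<in> S" "v \<in> S" for u v
    proof -
      obtain p p' where "p \<in> A" "p' \<in> A" "u = ?S p" "v = ?S p'"
        using uv unfolding S_def by blast
      then show ?thesis
        unfolding S_def by (intro image_eqI[of _ _ "\<lambda>i j. p i j + p' i j"])
          (auto simp: A_def PscD_def supp_in_add distrib_left sum.distrib)
    qed
    show "- u \<in> S" if u: "u \<in> S" for u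
    proof -
      obtain p where "p \<in> A" "u = ?S p"
        using u unfolding S_def by blast
      then show ?thesis
        unfolding S_def by (intro image_eqI[of _ _ "\<lambda>i j. - p i j"])
          (auto simp: A_def PscD_def supp_in_uminus sum_negf)
    qed
    show "smul c u \<in> S" if u: "u \<in> S" for u c
    proof -
      obtain p where "p \<in> A" "u = ?S p"
        using u unfolding S_def by blast
      then show ?thesis
        unfolding S_def by (intro image_eqI[of _ _ "\<lambda>i j. smul c (p i j)"])
          (auto simp: A_def PscD_def supp_in_smul smul_sum mult_smul)
    qed
    show "u = 0" if "fischer u u = 0" for u
      using that by (intro fischer_sqnorm_eq_0) (simp add: fischer_self)
    have "finite (UNIV \<times> {1..N} \<times> {1..m} :: zvar set)" by simp
    from finite_monomials[OF this, of d] show "finite B"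
      unfolding B_def Q_def by simp
    show "B \<subseteq> S"
    proof
      fix b assume "b \<in> B"
      then obtain i j \<mu> where b: "i \<in> {1..N}" "j \<in> {1..N}" "\<mu> \<in> Q" "b = Hpol m i j * single \<mu> 1"
        unfolding B_def by auto
      have "b = ?S (\<lambda>i' j'. if i' = i \<and> j' = j then single \<mu> 1 else 0)"
      proof -
        have "(\<Sum>j'=1..N. Hpol m i' j' * (if i' = i \<and> j' = j then single \<mu> 1 else 0)) = (if i' = i then b else 0)" for i'
          using b(2) by (cases "i' = i") (simp_all add: b(4) if_distrib[of "\<lambda>x. _ * x"] cong: if_cong)
        then show ?thesis using b(1) by simp
      qed
      moreover have "(\<lambda>i' j'. if i' = i \<and> j' = j then single \<mu> 1 else 0) \<in> A"
        using b(3) by (auto simp: A_def PscD_def Q_def supp_in_single)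
      ultimately show "b \<in> S" unfolding S_def by (rule image_eqI)
    qed
  qed (auto simp: fischer_add fischer_smul intro: fischer_sym)
  then obtain p where p: "p \<in> A" and perp: "\<forall>b\<in>B. fischer (P - ?S p) b = 0"
    unfolding S_def by blast
  have "Lap m i j (P - ?S p) = 0" if ij: "i \<in> {1..N}" "j \<in> {1..N}" for i j
  proof (rule poly_mapping_eqI)
    fix \<mu>
    have "?S p \<in> PscD m N (Suc (Suc d))"
      unfolding PscD_def
      by (intro supp_in_sum Hpol_PscD[unfolded PscD_def]) (use p in \<open>auto simp: A_def PscD_def\<close>)
    then have "P - ?S p \<in> PscD m N (Suc (Suc d))"
      using assms by (simp add: PscD_def supp_in_diff)
    then have L: "Lap m i j (P - ?S p) \<in> PscD m N d" by (rule Lap_PscD)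
    show "lookup (Lap m i j (P - ?S p)) \<mu> = lookup 0 \<mu>"
    proof (cases "\<mu> \<in> Q")
      case True
      then have "fischer (P - ?S p) (Hpol m i j * single \<mu> 1) = 0"
        using perp ij by (auto simp: B_def)
      then have "fischer (Hpol m i j * single \<mu> 1) (P - ?S p) = 0"
        using fischer_sym[of "Hpol m i j * single \<mu> 1" "P - ?S p"] by (simp only: complex_cnj_zero)
      then show ?thesis
        by (simp add: fischer_Hpol fischer_single mfact_def)
    next
      case False
      then show ?thesis
        using L by (auto simp: PscD_def Q_def dest: supp_inD)
    qed
  qed
  with p show ?thesis by (intro exI[of _ p]) (auto simp: A_def)
qed

text \<open>The polynomials p_ij from the harmonic projection have degree two less and are
  decomposed recursively. In degrees 0 and 1 all second derivatives vanish, so P itself is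
  harmonic.\<close>

lemma hdecomp_exists_degree:
  assumes "P \<in> PscD m N d"
  shows "\<exists>h. hharm m N h \<and> P = hev m h"
  using assms
proof (induction d arbitrary: P rule: less_induct)
  case (less d)
  have harm: "hharm m N (single 0 Q) \<and> hev m (single 0 Q) = Q"
    if "Q \<in> Psc m N" "\<forall>i\<in>{1..N}. \<forall>j\<in>{1..N}. Lap m i j Q = 0" for Q
    using that by (auto simp: hharm_def supp_in_single hev_single lookup_single when_def slin_zero slin_Lap)
  consider "d = 0 \<or> d = 1" | d' where "d = Suc (Suc d')"
    by (metis One_nat_def not0_implies_Suc)
  then show ?case
  proof cases
    case 1
    have "P \<in> PscD m N (Suc 0)" using less.prems PscD_mono[of d "Suc 0" m N] 1 by (auto simp: One_nat_def)
    then have "pd x (pd y P) = 0" for x y by (intro pd_PscD_0 pd_PscD)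
    then have "Lap m i j P = 0" for i j by (simp add: Lap_def)
    then show ?thesis using harm[of P] less.prems PscD_subset[of m N d] by (metis subsetD)
  next
    case 2
    have "P \<in> PscD m N (Suc (Suc d'))" using less.prems 2 by simp
    from harmonic_projection[OF this] obtain p where p': "\<forall>i\<in>{1..N}. \<forall>j\<in>{1..N}. p i j \<in> PscD m N d' \<and>
      Lap m i j (P - (\<Sum>i=1..N. \<Sum>j=1..N. Hpol m i j * p i j)) = 0" ..
    then have p: "\<And>i j. i \<in> {1..N} \<Longrightarrow> j \<in> {1..N} \<Longrightarrow> p i j \<in> PscD m N d'"
      "\<And>i j. i \<in> {1..N} \<Longrightarrow> j \<in> {1..N} \<Longrightarrow> Lap m i j (P - (\<Sum>i=1..N. \<Sum>j=1..N. Hpol m i j * p i j)) = 0"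
      by blast+
    have "\<exists>h. hharm m N h \<and> p i j = hev m h" if "i \<in> {1..N}" "j \<in> {1..N}" for i j
      using p(1)[OF that] 2 by (intro less.IH[of d']) auto
    then obtain h where h: "\<And>i j. i \<in> {1..N} \<Longrightarrow> j \<in> {1..N} \<Longrightarrow> hharm m N (h i j)"
      "\<And>i j. i \<in> {1..N} \<Longrightarrow> j \<in> {1..N} \<Longrightarrow> hev m (h i j) = p i j"
      by metis
    let ?s = "\<Sum>i=1..N. \<Sum>j=1..N. Hpol m i j * p i j"
    have "?s \<in> Psc m N"
      using p(1) PscD_subset[of m N d'] Hpol_PscD[of _ m N d'] PscD_subset[of m N "Suc (Suc d')"]
      by (intro Psc_sum) blast
    then have x: "P - ?s \<in> Psc m N" using less.prems PscD_subset[of m N d] by (intro Psc_diff) auto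
    define h' where "h' = single 0 (P - ?s) + (\<Sum>i=1..N. \<Sum>j=1..N. single (single (i, j) 1) 1 * h i j)"
    have "hharm m N h'"
      unfolding h'_def using harm[OF x] p(2) h(1)
      by (intro hharm_add hharm_sum hharm_shift Idx_single) auto
    moreover have "hev m h' = P"
      using harm[OF x] p(2) by (simp add: h'_def hev_add hev_sum hev_shift Hpow_single h(2))
    ultimately show ?thesis by blast
  qed
qed

lemma hdecomp_exists: "P \<in> Psc m N \<Longrightarrow> \<exists>h. hharm m N h \<and> P = hev m h"
  by (meson Psc_PscD hdecomp_exists_degree)

section \<open>The gauge is invertible\<close>

text \<open>Complex linearity and stability on the carrier, which is all that
  \<open>inv_into\<close> constructions provide.\<close>

definition PLin :: "nat \<Rightarrow> nat \<Rightarrow> (pcl \<Rightarrow> pcl) \<Rightarrow> bool" where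
  "PLin m N X \<longleftrightarrow> (\<forall>F\<in>PCl m N. X F \<in> PCl m N) \<and>
     (\<forall>F\<in>PCl m N. \<forall>G\<in>PCl m N. X (F + G) = X F + X G) \<and>
     (\<forall>c. \<forall>F\<in>PCl m N. X (cscale c F) = cscale c (X F))"

definition PIso :: "nat \<Rightarrow> nat \<Rightarrow> (pcl \<Rightarrow> pcl) \<Rightarrow> bool" where
  "PIso m N X \<longleftrightarrow> PLin m N X \<and> bij_betw X (PCl m N) (PCl m N)"

lemma PLin_PCl: "PLin m N X \<Longrightarrow> F \<in> PCl m N \<Longrightarrow> X F \<in> PCl m N"
  and PLin_add: "PLin m N X \<Longrightarrow> F \<in> PCl m N \<Longrightarrow> G \<in> PCl m N \<Longrightarrow> X (F + G) = X F + X G"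
  and PLin_cscale: "PLin m N X \<Longrightarrow> F \<in> PCl m N \<Longrightarrow> X (cscale c F) = cscale c (X F)"
  by (simp_all add: PLin_def)

lemma PLin_zero: "PLin m N X \<Longrightarrow> X 0 = 0"
  using PLin_add[of m N X 0 0] by simp

lemma PLin_comp: "PLin m N X \<Longrightarrow> PLin m N Y \<Longrightarrow> PLin m N (X \<circ> Y)"
  by (simp add: PLin_def)

lemma PLin_sum:
  assumes "PLin m N X" "\<And>i. i \<in> I \<Longrightarrow> f i \<in> PCl m N"
  shows "X (sum f I) = (\<Sum>i\<in>I. X (f i))"
  using assms(2)
  by (induction I rule: infinite_finite_induct) (auto simp: PLin_zero[OF assms(1)] PLin_add[OF assms(1)] PCl_sum)

lemma PIso_comp: "PIso m N X \<Longrightarrow> PIso m N Y \<Longrightarrow> PIso m N (X \<circ> Y)"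
  by (auto simp: PIso_def PLin_comp intro: bij_betw_trans)

lemma PIso_inv:
  assumes "PIso m N X"
  shows "PIso m N (inv_into (PCl m N) X)"
    and "F \<in> PCl m N \<Longrightarrow> X (inv_into (PCl m N) X F) = F"
    and "F \<in> PCl m N \<Longrightarrow> inv_into (PCl m N) X (X F) = F"
proof -
  let ?Y = "inv_into (PCl m N) X"
  have X: "PLin m N X" and bij: "bij_betw X (PCl m N) (PCl m N)" using assms by (auto simp: PIso_def)
  have XY: "X (?Y F) = F" if "F \<in> PCl m N" for F
    using bij_betw_inv_into_right[OF bij that] .
  have YX: "?Y (X F) = F" if "F \<in> PCl m N" for F
    using bij_betw_inv_into_left[OF bij that] .
  have Y: "?Y F \<in> PCl m N" if "F \<in> PCl m N" for F
    using bij_betw_apply[OF bij_betw_inv_into[OF bij] that] .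
  have "?Y (F + G) = ?Y F + ?Y G" if "F \<in> PCl m N" "G \<in> PCl m N" for F G
    using YX[of "?Y F + ?Y G"] that by (simp add: PLin_add[OF X] Y XY PCl_add)
  moreover have "?Y (cscale c F) = cscale c (?Y F)" if "F \<in> PCl m N" for c F
    using YX[of "cscale c (?Y F)"] that by (simp add: PLin_cscale[OF X] Y XY PCl_cscale)
  ultimately show "PIso m N ?Y"
    using Y bij_betw_inv_into[OF bij] by (simp add: PIso_def PLin_def)
  show "F \<in> PCl m N \<Longrightarrow> X (?Y F) = F" by (rule XY)
  show "F \<in> PCl m N \<Longrightarrow> ?Y (X F) = F" by (rule YX)
qed

section \<open>Filtration by Clifford degree\<close>

definition Fil :: "nat \<Rightarrow> pcl set" where
  "Fil d = supp_in {A. finite A \<and> card A < d}"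

lemma Fil_0: "F \<in> Fil 0 \<longleftrightarrow> F = 0"
  by (auto simp: Fil_def supp_in_def)

lemma Fil_Suc: "F \<in> Fil d \<Longrightarrow> F \<in> Fil (Suc d)"
  by (fastforce simp: Fil_def supp_in_def)

lemma Fil_mono: "d \<le> d' \<Longrightarrow> F \<in> Fil d \<Longrightarrow> F \<in> Fil d'"
  by (induction d' rule: dec_induct) (auto intro: Fil_Suc)

lemma Fil_zero [simp]: "0 \<in> Fil d"
  and Fil_add: "F \<in> Fil d \<Longrightarrow> G \<in> Fil d \<Longrightarrow> F + G \<in> Fil d"
  and Fil_smul: "F \<in> Fil d \<Longrightarrow> smul c F \<in> Fil d"
  and Fil_sum: "(\<And>i. i \<in> I \<Longrightarrow> f i \<in> Fil d) \<Longrightarrow> sum f I \<in> Fil d"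
  by (simp_all add: Fil_def supp_in_add supp_in_smul supp_in_sum)

lemma Fil_cscale: "F \<in> Fil d \<Longrightarrow> cscale c F \<in> Fil d"
  by (simp add: cscale_def Fil_smul)

lemma Fil_diff: "F \<in> Fil d \<Longrightarrow> G \<in> Fil d \<Longrightarrow> F - G \<in> Fil d"
  by (simp add: Fil_def supp_in_diff)

lemma Fil_FinL: "F \<in> Fil d \<Longrightarrow> F \<in> FinL"
  using supp_in_mono[of "{A. finite A \<and> card A < d}" "Collect finite"] by (auto simp: Fil_def)

lemma PCl_Fil: "F \<in> PCl m N \<Longrightarrow> F \<in> Fil (Suc (2 * m))"
  unfolding Fil_def
proof (rule supp_inI)
  fix A assume "F \<in> PCl m N" "lookup F A \<noteq> 0"
  then have A: "A \<subseteq> UNIV \<times> {1..m}" by (auto simp: PCl_iff dest: supp_inD)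
  then have "card A \<le> card (UNIV \<times> {1..m} :: gen set)" by (intro card_mono) auto
  then have "card A \<le> 2 * m" by (simp add: card_cartesian_product)
  moreover have "finite A" using A by (rule finite_subset) simp
  ultimately show "A \<in> {A. finite A \<and> card A < Suc (2 * m)}" by simp
qed

text \<open>An element of the kernel lies in every lower step of the filtration, hence is 0. A
  preimage of F is F + G, where G is a preimage of the lower term F - X F. The filtration is
  exhausted at 2m + 1.\<close>

lemma unipotent_PIso:
  assumes X: "PLin m N X" and low: "\<And>d F. F \<in> PCl m N \<Longrightarrow> F \<in> Fil (Suc d) \<Longrightarrow> X F - F \<in> Fil d"
  shows "PIso m N X"
proof -
  have minus: "X (- F) = - X F" if "F \<in> PCl m N" for F
    using PLin_cscale[OF X that, of "-1"] by simp
  have ker: "F = 0" if "F \<in> PCl m N" "F \<in> Fil d" "X F = 0" for F d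
    using that(2)
  proof (induction d)
    case (Suc d)
    have "0 - (X F - F) \<in> Fil d" by (rule Fil_diff[OF Fil_zero low[OF that(1) Suc.prems]])
    moreover have "0 - (X F - F) = F" using that(3) by simp
    ultimately show ?case using Suc.IH by metis
  qed (simp add: Fil_0)
  have inj: "F = G" if FG: "F \<in> PCl m N" "G \<in> PCl m N" "X F = X G" for F G
  proof -
    have "X (F + - G) = 0"
      using FG by (subst PLin_add[OF X]) (simp_all add: minus PCl_uminus)
    then have "F + - G = 0"
      by (intro ker[of "F + - G" "Suc (2 * m)"]) (use FG PCl_Fil[OF PCl_diff[OF FG(1,2)]] in \<open>simp_all add: PCl_diff\<close>)
    then show ?thesis by simp
  qed
  have surj: "\<exists>G\<in>PCl m N. X G = F" if "F \<in> PCl m N" "F \<in> Fil d" for F d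
    using that
  proof (induction d arbitrary: F)
    case 0
    then show ?case using PLin_zero[OF X] by (auto simp: Fil_0)
  next
    case (Suc d)
    have "0 - (X F - F) \<in> Fil d" by (rule Fil_diff[OF Fil_zero low[OF Suc.prems]])
    then obtain G where "G \<in> PCl m N" "X G = F - X F"
      using Suc.IH[of "F - X F"] Suc.prems(1) by (auto simp: PCl_diff PLin_PCl[OF X])
    then show ?case
      using Suc.prems(1) by (intro bexI[of _ "F + G"]) (auto simp: PLin_add[OF X] PCl_add)
  qed
  have "bij_betw X (PCl m N) (PCl m N)"
    using PLin_PCl[OF X] surj[OF _ PCl_Fil] by (auto simp: bij_betw_def intro!: inj_onI inj) blast
  with X show ?thesis by (simp add: PIso_def)
qed

lemma ext_Fil: "F \<in> Fil d \<Longrightarrow> extmul g F \<in> Fil (Suc d)"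
  unfolding Fil_def
proof (rule supp_inI)
  fix B assume F: "F \<in> supp_in {A. finite A \<and> card A < d}" and "lookup (extmul g F) B \<noteq> 0"
  then have g: "g \<in> B" and "lookup F (B - {g}) \<noteq> 0" by (auto simp: lookup_ext split: if_splits)
  with F have "finite (B - {g})" "card (B - {g}) < d" by (auto dest: supp_inD)
  then show "B \<in> {A. finite A \<and> card A < Suc d}" using g by (auto simp: card_Diff_singleton)
qed

lemma ctr_Fil: "F \<in> Fil (Suc d) \<Longrightarrow> ctr h F \<in> Fil d"
  unfolding Fil_def
proof (rule supp_inI)
  fix B assume F: "F \<in> supp_in {A. finite A \<and> card A < Suc d}" and "lookup (ctr h F) B \<noteq> 0"
  then have "h \<notin> B" and "lookup F (insert h B) \<noteq> 0" by (auto simp: lookup_ctr split: if_splits)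
  with F have "finite (insert h B)" "card (insert h B) < Suc d" by (auto dest: supp_inD)
  then show "B \<in> {A. finite A \<and> card A < d}" using \<open>h \<notin> B\<close> by auto
qed

lemma ctr_Fil_same: "F \<in> Fil d \<Longrightarrow> ctr h F \<in> Fil d"
  by (rule ctr_Fil) (rule Fil_Suc)

lemma chevmul_eq:
  assumes "F \<in> FinL"
  shows "chevmul g F = extmul g F + cscale (1/2) (ctr (gswap g) F)"
proof -
  have "chevmul g F = extmul g F + cscale (1/2) (ctr (gswap g) F)"
    unfolding cscale_def
  proof (rule slin_eqI[OF slin_chevmul slin_plus[OF slin_extmul slin_smult[OF slin_lext]]])
    fix A assume "A \<in> keys F"
    then have fin: "finite A" using assms by (auto simp: supp_in_def)
    have "(\<Sum>h\<in>A. smul (pconst (1/2) * brk g h) (contr h A))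
        = (\<Sum>h\<in>A. if h = gswap g then smul (pconst (1/2)) (contr (gswap g) A) else 0)"
      by (intro sum.cong) (auto simp: brk_eq)
    also have "\<dots> = smul (pconst (1/2)) (contr (gswap g) A)"
      using fin by (auto simp: contr_def)
    finally show "chevmul g (single A 1) = extmul g (single A 1) + smul (pconst (1/2)) (ctr (gswap g) (single A 1))"
      by (simp add: chevmul_def extmul_def)
  qed
  then show ?thesis .
qed

lemma chevmul_Fil: "F \<in> Fil d \<Longrightarrow> chevmul g F \<in> Fil (Suc d)"
  by (simp add: chevmul_eq Fil_FinL Fil_add ext_Fil Fil_cscale Fil_Suc ctr_Fil_same)

lemma extmul_single:
  assumes "finite A" "\<And>h. h \<in> A \<Longrightarrow> g < h"
  shows "extmul g (single A r) = single (insert g A) r"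
proof -
  have e: "{h. h \<in> A \<and> h < g} = {}" "g \<notin> A"
    using assms(2) less_asym less_irrefl by blast+
  then show ?thesis by (simp add: extmul_def wedge_def e(1))
qed

text \<open>Each letter acts by a wedge plus a contraction. Wedging in increasing order rebuilds the
  label, and every term that uses a contraction has lower degree.\<close>

lemma chev_word_leading:
  assumes "finite A"
  shows "word chevmul (sorted_list_of_set A) - single A 1 \<in> Fil (card A)"
  using assms
proof (induction A rule: finite_min_induct)
  case empty
  then show ?case by simp
next
  case (insert g A)
  define L where "L = word chevmul (sorted_list_of_set A) - single A 1"
  have L: "L \<in> Fil (card A)" using insert.IH by (simp add: L_def)
  have w: "word chevmul (sorted_list_of_set A) = single A 1 + L" by (simp add: L_def)
  have eA: "single A 1 \<in> Fil (Suc (card A))" using insert(1) by (simp add: Fil_def supp_in_single)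
  have "g \<notin> A" using insert(2) by blast
  then have card: "card (insert g A) = Suc (card A)" using insert(1) by simp
  have "chevmul g (single A 1) = single (insert g A) 1 + cscale (1/2) (ctr (gswap g) (single A 1))"
    using insert(1,2) by (simp add: chevmul_eq supp_in_single extmul_single del: lext_single)
  then have "word chevmul (sorted_list_of_set (insert g A)) - single (insert g A) 1
      = cscale (1/2) (ctr (gswap g) (single A 1)) + chevmul g L"
    using insert(1,2) by (simp add: sorted_list_of_set_insert_min w slin_add[OF slin_chevmul]
        del: sorted_list_of_set.sorted_key_list_of_set_insert_remove lext_single)
  also have "\<dots> \<in> Fil (Suc (card A))"
    using ctr_Fil[OF eA, of "gswap g"] L
    by (intro Fil_add Fil_cscale chevmul_Fil) (auto intro: Fil_Suc)
  finally show ?case by (simp add: card)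
qed

lemma sigCh_PIso: "PIso m N sigCh"
proof (rule unipotent_PIso)
  have slin: "slin sigCh" unfolding sigCh_def by (rule slin_lext)
  have "sigCh F \<in> PCl m N" if F: "F \<in> PCl m N" for F
    unfolding sigCh_def lext_def
  proof (intro PCl_sum PCl_smul PCl_word)
    fix A assume "A \<in> keys F"
    then have A: "A \<subseteq> UNIV \<times> {1..m}" using F by (auto simp: PCl_iff supp_in_def)
    then have "finite A" by (rule finite_subset) simp
    with A show "set (sorted_list_of_set A) \<subseteq> UNIV \<times> {1..m}" by simp
    show "chevmul g G \<in> PCl m N" if "g \<in> UNIV \<times> {1..m}" "G \<in> PCl m N" for g G
      using that by (simp add: chevmul_eq PCl_FinL PCl_add PCl_ext PCl_cscale PCl_ctr)
    show "lookup F A \<in> Psc m N" by (rule PCl_lookup[OF F])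
  qed
  then show "PLin m N sigCh"
    by (auto simp: PLin_def slin_add[OF slin] slin_cscale[OF slin])
  fix d F assume "F \<in> Fil (Suc d)"
  then have F: "\<And>A. A \<in> keys F \<Longrightarrow> finite A \<and> card A \<le> d"
    by (auto simp: Fil_def supp_in_def)
  have "sigCh F - F = (\<Sum>A\<in>keys F. smul (lookup F A) (word chevmul (sorted_list_of_set A) - single A 1))"
    using poly_mapping_expand[of F] by (simp add: sigCh_def lext_def smul_diff sum_subtractf)
  also have "\<dots> \<in> Fil d"
    using F chev_word_leading by (intro Fil_sum Fil_smul) (blast intro: Fil_mono)
  finally show "sigCh F - F \<in> Fil d" .
qed

text \<open>Once a power vanishes at v all later ones do, so the index set in \<open>expo\<close> is
  finite and may be enlarged to any initial segment reaching the first zero.\<close>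

lemma expo_eq:
  assumes "X 0 = 0" "(X ^^ D) v = 0" "\<And>c. sc c 0 = 0"
  shows "expo sc X v = (\<Sum>k<D. sc (1 / fact k) ((X ^^ k) v))"
proof -
  have *: "(X ^^ k) v = 0" if "D \<le> k" for k
    using that by (induction k rule: dec_induct) (auto simp: assms)
  have "{k. (X ^^ k) v \<noteq> 0} \<subseteq> {..<D}"
    using * by (auto simp: not_less[symmetric])
  then show ?thesis
    unfolding expo_def by (intro sum.mono_neutral_left) (auto simp: assms)
qed

lemma expo_nilpotent_PIso:
  assumes X: "PLin m N X" and low: "\<And>d F. F \<in> PCl m N \<Longrightarrow> F \<in> Fil (Suc d) \<Longrightarrow> X F \<in> Fil d"
  shows "PIso m N (expo cscale X)"
proof (rule unipotent_PIso)
  have low': "X F \<in> Fil d" if "F \<in> PCl m N" "F \<in> Fil d" for F d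
    using low[OF that(1), of d] that(2) Fil_Suc by blast
  have pow: "(X ^^ k) F \<in> PCl m N" if "F \<in> PCl m N" for k F
    using that by (induction k) (auto simp: PLin_PCl[OF X])
  have nil: "(X ^^ d) F = 0" if "F \<in> PCl m N" "F \<in> Fil d" for d F
    using that
  proof (induction d arbitrary: F)
    case (Suc d)
    then show ?case
      using Suc.IH[of "X F"] low[of F d] by (simp add: PLin_PCl[OF X] funpow_swap1)
  qed (simp add: Fil_0)
  have eq: "expo cscale X F = (\<Sum>k<Suc (2 * m). cscale (1 / fact k) ((X ^^ k) F))" if "F \<in> PCl m N" for F
    using nil[OF that PCl_Fil[OF that]] by (intro expo_eq) (auto simp: PLin_zero[OF X])
  have add: "(X ^^ k) (F + G) = (X ^^ k) F + (X ^^ k) G" if "F \<in> PCl m N" "G \<in> PCl m N" for k F G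
    using that by (induction k) (auto simp: PLin_add[OF X] pow)
  have scale: "(X ^^ k) (cscale c F) = cscale c ((X ^^ k) F)" if "F \<in> PCl m N" for k c F
    using that by (induction k) (auto simp: PLin_cscale[OF X] pow)
  show "PLin m N (expo cscale X)"
    unfolding PLin_def
  proof (intro conjI ballI allI)
    fix F assume F: "F \<in> PCl m N"
    show "expo cscale X F \<in> PCl m N"
      unfolding eq[OF F] by (intro PCl_sum PCl_cscale pow F)
    show "expo cscale X (cscale c F) = cscale c (expo cscale X F)" for c
      using F by (simp add: eq PCl_cscale scale cscale_sum cscale_cscale[of c] del: sum.lessThan_Suc)
    fix G assume G: "G \<in> PCl m N"
    show "expo cscale X (F + G) = expo cscale X F + expo cscale X G"
      using F G by (simp add: eq PCl_add add cscale_add sum.distrib del: sum.lessThan_Suc)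
  qed
  fix d F assume F: "F \<in> PCl m N" "F \<in> Fil (Suc d)"
  have Fild: "(X ^^ Suc k) F \<in> Fil d" for k
  proof (induction k)
    case 0
    then show ?case using low[OF F] by simp
  next
    case (Suc k)
    then show ?case using low'[OF pow[OF F(1), of "Suc k"]] by simp
  qed
  have "expo cscale X F = F + (\<Sum>k<2 * m. cscale (1 / fact (Suc k)) ((X ^^ Suc k) F))"
    unfolding eq[OF F(1)] sum.lessThan_Suc_shift by simp
  then have "expo cscale X F - F = (\<Sum>k<2 * m. cscale (1 / fact (Suc k)) ((X ^^ Suc k) F))"
    by simp
  also have "\<dots> \<in> Fil d"
    by (intro Fil_sum Fil_cscale Fild)
  finally show "expo cscale X F - F \<in> Fil d" .
qed

text \<open>Each s_k lowers the Clifford degree. At a label where all s_k F vanish, the coefficients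
  of the n_j F solve the homogeneous Capelli system and hence vanish too.\<close>

lemma nplus_Fil:
  assumes "N \<le> m" "F \<in> PCl m N" "F \<in> Fil (Suc d)" "i \<in> {1..N}"
  shows "nplus m N i F \<in> Fil d"
  unfolding Fil_def
proof (rule supp_inI, rule ccontr)
  fix A assume A: "A \<notin> {A. finite A \<and> card A < d}" and nz: "lookup (nplus m N i F) A \<noteq> 0"
  have "sop m k F \<in> Fil d" for k
    unfolding sop_def
  proof (intro Fil_sum ctr_Fil)
    show "cw (pd (False, k, a)) F \<in> Fil (Suc d)" for a
      using assms(3) unfolding Fil_def by (intro cw_supp_in) (simp_all add: slin_zero slin_pd)
  qed
  then have s0: "lookup (sop m k F) A = 0" for k
    using A unfolding Fil_def by (auto dest: supp_inD)
  have "capelli m N (m + 0) (\<lambda>j. lookup (nplus m N j F) A) k = 0" if "k \<in> {1..N}" for k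
    using lookup_Cz[OF that, of m "\<lambda>j. nplus m N j F" A] nplus_eqn[OF assms(1,2) that] s0 by simp
  from capelli_inj[OF assms(1) this assms(4)] nz show False by simp
qed

text \<open>A swapped word need not be increasing, but an exterior word of length r still involves
  only labels with at most r elements.\<close>

lemma dag_ext_Fil: "F \<in> Fil d \<Longrightarrow> dag_pcl extmul F \<in> Fil d"
proof -
  assume F: "F \<in> Fil d"
  have word: "word extmul gs \<in> Fil (Suc (length gs))" for gs
  proof (induction gs)
    case Nil
    then show ?case by (simp add: Fil_def supp_in_single)
  next
    case (Cons g gs)
    then show ?case using ext_Fil[OF Cons, of g] by (simp add: One_nat_def)
  qed
  show ?thesis
    unfolding dag_pcl_def gswap_case
  proof (intro Fil_sum Fil_smul)
    fix A assume "A \<in> keys F"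
    then have "finite A" "card A < d" using F by (auto simp: Fil_def supp_in_def)
    then show "word extmul (map gswap (sorted_list_of_set A)) \<in> Fil d"
      using word[of "map gswap (sorted_list_of_set A)"] by (intro Fil_mono[of "Suc (card A)" d]) auto
  qed
qed

lemma Hpol_Psc: "i \<in> {1..N} \<Longrightarrow> j \<in> {1..N} \<Longrightarrow> Hpol m i j \<in> Psc m N"
  unfolding Hpol_def by (intro Psc_sum Psc_mult zv_in_Psc) auto

lemma Kop_PIso:
  assumes "N \<le> m"
  shows "PIso m N (expo cscale (Kop m N))"
proof (rule expo_nilpotent_PIso)
  have dag: "dag_pcl extmul F \<in> PCl m N" if "F \<in> PCl m N" for F
    by (rule PCl_dag) (use that in \<open>auto intro: PCl_ext\<close>)
  have term_PCl: "smul (Hpol m i j) (nminus extmul m N j (nplus m N i F)) \<in> PCl m N"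
    if "F \<in> PCl m N" "i \<in> {1..N}" "j \<in> {1..N}" for F i j
    using that assms by (intro PCl_smul Hpol_Psc) (simp_all add: nminus_def dag nplus_PCl)
  show "PLin m N (Kop m N)"
    unfolding PLin_def
  proof (intro conjI ballI allI)
    fix F assume F: "F \<in> PCl m N"
    show "Kop m N F \<in> PCl m N"
      unfolding Kop_def by (intro PCl_cscale PCl_sum term_PCl F)
    show "Kop m N (cscale c F) = cscale c (Kop m N F)" for c
    proof -
      have "smul (Hpol m i j) (nminus extmul m N j (nplus m N i (cscale c F)))
          = cscale c (smul (Hpol m i j) (nminus extmul m N j (nplus m N i F)))"
        if "i \<in> {1..N}" "j \<in> {1..N}" for i j
        using that assms F
        by (simp add: nplus_cscale nplus_PCl nminus_def dag dag_cscale) (simp add: cscale_def mult.commute)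
      then show ?thesis
        unfolding Kop_def by (simp add: cscale_sum cscale_cscale[of c])
    qed
    fix G assume G: "G \<in> PCl m N"
    show "Kop m N (F + G) = Kop m N F + Kop m N G"
      using assms F G by (simp add: Kop_def nplus_add nplus_PCl nminus_def dag dag_pcl_add smul_add
          sum.distrib cscale_add)
  qed
  fix d F assume F: "F \<in> PCl m N" "F \<in> Fil (Suc d)"
  have "nminus extmul m N j (nplus m N i F) \<in> Fil d" if "i \<in> {1..N}" "j \<in> {1..N}" for i j
  proof -
    have 1: "dag_pcl extmul (nplus m N i F) \<in> PCl m N"
      by (rule dag[OF nplus_PCl[OF assms F(1)]])
    have "dag_pcl extmul (nplus m N i F) \<in> Fil (Suc d)"
      by (rule dag_ext_Fil[OF Fil_Suc[OF nplus_Fil[OF assms F that(1)]]])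
    from dag_ext_Fil[OF nplus_Fil[OF assms 1 this that(2)]] show ?thesis
      by (simp add: nminus_def)
  qed
  then show "Kop m N F \<in> Fil d"
    unfolding Kop_def by (intro Fil_cscale Fil_sum Fil_smul)
qed

section \<open>The diagonal gauge\<close>

definition hscale :: "(('i \<Rightarrow> complex)) \<Rightarrow> ('i \<Rightarrow>\<^sub>0 psc) \<Rightarrow> 'i \<Rightarrow>\<^sub>0 psc" where
  "hscale c = lext (\<lambda>\<alpha>. single \<alpha> (pconst (c \<alpha>)))"

lemma lookup_hscale: "lookup (hscale c h) \<alpha> = smul (c \<alpha>) (lookup h \<alpha>)"
proof -
  have "lookup (hscale c h) \<alpha> = (\<Sum>\<beta>\<in>keys h. if \<beta> = \<alpha> then lookup h \<alpha> * pconst (c \<alpha>) else 0)"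
    unfolding hscale_def lookup_lext by (intro sum.cong) (auto simp: lookup_single when_def)
  then show ?thesis by (auto simp: in_keys_iff pconst_mult[symmetric] mult.commute)
qed

lemma hharm_hscale: "hharm m N h \<Longrightarrow> hharm m N (hscale c h)"
proof -
  have "keys (hscale c h) \<subseteq> keys h"
    by (auto simp: in_keys_iff lookup_hscale)
  then show "hharm m N h \<Longrightarrow> hharm m N (hscale c h)"
    by (auto simp: hharm_def lookup_hscale Psc_smul slin_smul slin_Lap supp_in_def)
qed

lemma gcoef_nonzero:
  assumes "0 < q" "q < 1"
  shows "gcoef N q \<alpha> \<noteq> 0"
proof -
  have qnum: "qnum r t \<noteq> 0" if "0 < r" "r < 1" "t \<in> {1..k}" for r :: real and t k
    using that power_strict_decreasing[of 0 t r] by (simp add: qnum_def)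
  have "0 < q\<^sup>2" "q\<^sup>2 < 1" using assms by (simp_all add: power_less_one_iff)
  then have "cfact q k \<noteq> 0" "qfact q k \<noteq> 0" for k
    using assms qnum[of q] qnum[of "q\<^sup>2"] by (auto simp: cfact_def qfact_def cnum_def qgam_def)
  moreover have "finite {(i, j). i \<in> {1..N} \<and> j \<in> {1..N} \<and> i \<noteq> j}"
    by (rule finite_subset[of _ "{1..N} \<times> {1..N}"]) auto
  ultimately show ?thesis
    by (auto simp: gcoef_def case_prod_beta)
qed

text \<open>Uniqueness of the harmonic decomposition gives the definite description in
  \<open>Gnf\<close> its value; the gauge is then diagonal on the components.\<close>

lemma Gnf_hev:
  assumes "2 * N \<le> m" "hharm m N h"
  shows "Gnf m N q (hev m h) = hev m (hscale (\<lambda>\<alpha>. of_real (gcoef N q \<alpha>)) h)"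
proof -
  have "(THE h'. hdecomp m N (hev m h) h') = h"
    unfolding hdecomp_iff using assms by (intro the_equality) (auto intro: hdecomp_unique)
  then have "Gnf m N q (hev m h) = (\<Sum>\<alpha>\<in>keys h. pconst (of_real (gcoef N q \<alpha>)) * Hpow m \<alpha> * lookup h \<alpha>)"
    by (simp add: Gnf_def)
  also have "\<dots> = (\<Sum>\<alpha>\<in>keys h. Hpow m \<alpha> * lookup (hscale (\<lambda>\<alpha>. of_real (gcoef N q \<alpha>)) h) \<alpha>)"
    by (intro sum.cong refl) (simp add: lookup_hscale pconst_mult[symmetric] mult_ac)
  also have "\<dots> = hev m (hscale (\<lambda>\<alpha>. of_real (gcoef N q \<alpha>)) h)"
    by (rule hev_superset[symmetric]) (auto simp: in_keys_iff lookup_hscale)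
  finally show ?thesis .
qed

lemma hev_Psc:
  assumes "hharm m N h"
  shows "hev m h \<in> Psc m N"
proof -
  have Hpow: "Hpow m \<alpha> \<in> Psc m N" if "\<alpha> \<in> Idx N" for \<alpha>
  proof -
    have pw: "Hpol m i j ^ k \<in> Psc m N" if "i \<in> {1..N}" "j \<in> {1..N}" for i j k
      using that by (induction k) (simp_all add: Psc_mult Hpol_Psc)
    have "(\<Prod>x\<in>I. Hpol m (fst x) (snd x) ^ lookup \<alpha> (fst x, snd x)) \<in> Psc m N"
      if "finite I" "I \<subseteq> {1..N} \<times> {1..N}" for I
      using that by (induction I rule: finite_induct) (auto intro!: Psc_mult pw)
    then show ?thesis
      using that by (simp add: Hpow_def Idx_def case_prod_beta)
  qed
  show ?thesis
    unfolding hev_def using assms by (intro Psc_sum Psc_mult Hpow) (auto simp: hharm_def supp_in_def)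
qed

text \<open>Existence and uniqueness of the decomposition carry linearity and bijectivity over from
  the diagonal map \<open>hscale\<close>, whose factors are nonzero for 0 < q < 1; the inverse
  divides by them.\<close>

lemma cw_Gnf_PIso:
  assumes "0 < q" "q < 1" "2 * N \<le> m"
  shows "PIso m N (cw (Gnf m N q))"
proof -
  let ?G = "Gnf m N q"
  define g where "g = (\<lambda>\<alpha>. complex_of_real (gcoef N q \<alpha>))"
  have g: "g \<alpha> \<noteq> 0" for \<alpha> using gcoef_nonzero[OF assms(1,2)] by (simp add: g_def)
  have G: "?G (hev m h) = hev m (hscale g h)" if "hharm m N h" for h
    unfolding g_def by (rule Gnf_hev[OF assms(3) that])
  have hs: "hscale g (h + h') = hscale g h + hscale g h'" "hscale g (smul (pconst c) h) = smul (pconst c) (hscale g h)" for h h' c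
    by (simp_all add: hscale_def lext_add lext_smul)
  have Psc: "?G P \<in> Psc m N" if "P \<in> Psc m N" for P
    using hdecomp_exists[OF that] by (auto simp: G hev_Psc hharm_hscale)
  have add: "?G (P + Q) = ?G P + ?G Q" if "P \<in> Psc m N" "Q \<in> Psc m N" for P Q
    using hdecomp_exists[OF that(1)] hdecomp_exists[OF that(2)]
    by (auto simp: G hharm_add hev_add[symmetric] hs)
  have scale: "?G (smul c P) = smul c (?G P)" if P: "P \<in> Psc m N" for c P
  proof -
    obtain h where h: "hharm m N h" "P = hev m h" using hdecomp_exists[OF P] by blast
    then have "hharm m N (smul (pconst c) h)"
      by (auto simp: hharm_def supp_in_smul pconst_mult Psc_smul slin_smul slin_Lap)
    then show ?thesis
      using G[of "smul (pconst c) h"] h by (simp add: hev_smul pconst_mult hs G)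
  qed
  have G0: "?G 0 = 0" using G[of 0] by (simp add: hscale_def)
  have inj: "P = Q" if PQ: "P \<in> Psc m N" "Q \<in> Psc m N" "?G P = ?G Q" for P Q
  proof -
    obtain h h' where h: "hharm m N h" "P = hev m h" "hharm m N h'" "Q = hev m h'"
      using hdecomp_exists PQ by meson
    then have "hscale g h = hscale g h'"
      using PQ(3) by (intro hdecomp_unique[OF assms(3)]) (auto simp: G hharm_hscale)
    then have "smul (inverse (g \<alpha>)) (lookup (hscale g h) \<alpha>) = smul (inverse (g \<alpha>)) (lookup (hscale g h') \<alpha>)" for \<alpha>
      by simp
    then have "h = h'"
      using g by (intro poly_mapping_eqI) (simp add: lookup_hscale)
    with h show ?thesis by simp
  qed
  have surj: "\<exists>Q\<in>Psc m N. ?G Q = P" if P: "P \<in> Psc m N" for P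
  proof -
    obtain h where h: "hharm m N h" "P = hev m h" using hdecomp_exists[OF P] by blast
    let ?h = "hscale (\<lambda>\<alpha>. inverse (g \<alpha>)) h"
    have "hscale g ?h = h"
      using g by (intro poly_mapping_eqI) (simp add: lookup_hscale)
    then show ?thesis
      using h by (intro bexI[of _ "hev m ?h"]) (auto simp: G hharm_hscale hev_Psc)
  qed
  have PLin: "PLin m N (cw ?G)"
    unfolding PLin_def
  proof (intro conjI ballI allI)
    fix F assume F: "F \<in> PCl m N"
    show "cw ?G F \<in> PCl m N" using F by (rule PCl_cw) (auto simp: G0 Psc)
    show "cw ?G (cscale c F) = cscale c (cw ?G F)" for c
      using F by (intro poly_mapping_eqI) (simp add: lookup_cw G0 lookup_cscale scale PCl_lookup)
    fix H assume "H \<in> PCl m N"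
    with F show "cw ?G (F + H) = cw ?G F + cw ?G H"
      by (intro poly_mapping_eqI) (simp add: lookup_cw G0 lookup_add add PCl_lookup)
  qed
  have "inj_on (cw ?G) (PCl m N)"
  proof (rule inj_onI, rule poly_mapping_eqI)
    fix F H A assume FH: "F \<in> PCl m N" "H \<in> PCl m N" "cw ?G F = cw ?G H"
    show "lookup F A = lookup H A"
    proof (rule inj)
      show "?G (lookup F A) = ?G (lookup H A)"
        using arg_cong[OF FH(3), of "\<lambda>F. lookup F A"] by (simp add: lookup_cw G0)
    qed (use FH in \<open>auto simp: PCl_lookup\<close>)
  qed
  moreover have "F \<in> cw ?G ` PCl m N" if F: "F \<in> PCl m N" for F
  proof -
    have "\<forall>A. \<exists>Q. Q \<in> Psc m N \<and> ?G Q = lookup F A" using surj[OF PCl_lookup[OF F]] by blast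
    from choice[OF this] obtain Q where Q: "\<And>A. Q A \<in> Psc m N" "\<And>A. ?G (Q A) = lookup F A" by blast
    define H where "H = (\<Sum>A\<in>keys F. single A (Q A))"
    have "lookup H A = (if A \<in> keys F then Q A else 0)" for A
      by (simp add: H_def lookup_sum lookup_single when_def)
    then have "cw ?G H = F"
      by (intro poly_mapping_eqI) (auto simp: lookup_cw G0 Q in_keys_iff)
    moreover have "H \<in> PCl m N"
      unfolding H_def using F by (intro PCl_sum PCl_single Q) (auto simp: PCl_iff supp_in_def)
    ultimately show ?thesis by blast
  qed
  ultimately have "bij_betw (cw ?G) (PCl m N) (PCl m N)"
    using PLin_PCl[OF PLin] by (auto simp: bij_betw_def)
  with PLin show ?thesis by (simp add: PIso_def)
qed

lemma Gpbw_PIso: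
  assumes "0 < q" "q < 1" "2 * N \<le> m"
  shows "PIso m N (Gpbw m N q)"
  unfolding Gpbw_def Wop_def GnfL_def sigCh_inv_def
  using assms by (intro PIso_comp PIso_inv(1) sigCh_PIso Kop_PIso cw_Gnf_PIso) auto

section \<open>Coefficients of the fermionic modules\<close>

lemma lookup_conj_bpol: "lookup (conj_bpol p) k = cnj (lookup p k)"
  by (simp add: conj_bpol_def lookup_map_zero)

lemma conj_bpol_conj_bpol [simp]: "conj_bpol (conj_bpol p) = p"
  by (rule poly_mapping_eqI) (simp add: lookup_conj_bpol)

lemma conj_bpol_zero [simp]: "conj_bpol 0 = 0"
  by (rule poly_mapping_eqI) (simp add: lookup_conj_bpol)

lemma conj_bpol_eq_0 [simp]: "conj_bpol p = 0 \<longleftrightarrow> p = 0"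
  by (metis conj_bpol_conj_bpol conj_bpol_zero)

lemma conj_bpol_add: "conj_bpol (p + q) = conj_bpol p + conj_bpol q"
  by (rule poly_mapping_eqI) (simp add: lookup_conj_bpol lookup_add)

lemma conj_bpol_single: "conj_bpol (single \<mu> c) = single \<mu> (cnj c)"
  by (rule poly_mapping_eqI) (simp add: lookup_conj_bpol lookup_single when_def)

lemma conj_bpol_mult: "conj_bpol (p * q) = conj_bpol p * conj_bpol q"
  by (rule poly_mapping_mult_hom) (simp_all add: conj_bpol_add conj_bpol_single mult_single)

lemma conj_bpol_bconst [simp]: "conj_bpol (bconst c) = bconst (cnj c)"
  by (simp add: bconst_def conj_bpol_single)

lemma conj_bpol_bvar [simp]: "conj_bpol (bvar kl) = bvar kl"
  by (simp add: bvar_def conj_bpol_single)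

lemma conj_bpol_one [simp]: "conj_bpol 1 = 1"
  using conj_bpol_single[of 0 1] by simp

text \<open>Conjugation of polynomials is multiplicative and injective, so it preserves equality of
  fractions and the description has a unique value.\<close>

lemma conj_rat_Fract: "d \<noteq> 0 \<Longrightarrow> conj_rat (Fract p d) = Fract (conj_bpol p) (conj_bpol d)"
  unfolding conj_rat_def
proof (rule the_equality)
  fix y assume "d \<noteq> 0" "\<exists>p' d'. d' \<noteq> 0 \<and> Fract p d = Fract p' d' \<and> y = Fract (conj_bpol p') (conj_bpol d')"
  then obtain p' d' where *: "d' \<noteq> 0" "p * d' = p' * d" "y = Fract (conj_bpol p') (conj_bpol d')"
    by (auto simp: eq_fract)
  then have "conj_bpol p * conj_bpol d' = conj_bpol p' * conj_bpol d"
    by (simp flip: conj_bpol_mult)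
  with * \<open>d \<noteq> 0\<close> show "y = Fract (conj_bpol p) (conj_bpol d)"
    by (simp add: eq_fract)
qed auto

lemma conj_rat_add: "conj_rat (x + y) = conj_rat x + conj_rat y"
  by (cases x, cases y) (simp add: conj_rat_Fract conj_bpol_add conj_bpol_mult)

lemma conj_rat_mult: "conj_rat (x * y) = conj_rat x * conj_rat y"
  by (cases x, cases y) (simp add: conj_rat_Fract conj_bpol_mult)

lemma conj_rat_conj_rat [simp]: "conj_rat (conj_rat x) = x"
  by (cases x) (simp add: conj_rat_Fract)

lemma conj_rat_zero [simp]: "conj_rat 0 = 0"
  by (simp add: Zero_fract_def conj_rat_Fract)

lemma conj_rat_one [simp]: "conj_rat 1 = 1"
  by (simp add: One_fract_def conj_rat_Fract)

lemma conj_rat_eq_0 [simp]: "conj_rat x = 0 \<longleftrightarrow> x = 0"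
  by (metis conj_rat_conj_rat conj_rat_zero)

lemma conj_rat_uminus: "conj_rat (- x) = - conj_rat x"
  using conj_rat_add[of x "- x"] minus_unique[of "conj_rat x" "conj_rat (- x)"] by simp

lemma conj_rat_sign [simp]: "conj_rat ((-1) ^ k) = (-1) ^ k"
  by (cases "even k") (auto simp: conj_rat_uminus)

lemma bconst_add: "bconst (a + b) = bconst a + bconst b"
  and bconst_mult: "bconst (a * b) = bconst a * bconst b"
  and bconst_uminus: "bconst (- a) = - bconst a"
  and bconst_one [simp]: "bconst 1 = 1"
  and bconst_zero [simp]: "bconst 0 = 0"
  by (simp_all add: bconst_def single_add mult_single single_uminus)

lemma rc_add: "rc (a + b) = rc a + rc b"
  and rc_mult: "rc (a * b) = rc a * rc b"
  and rc_uminus: "rc (- a) = - rc a"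
  and rc_one [simp]: "rc 1 = 1"
  and rc_zero [simp]: "rc 0 = 0"
  by (simp_all add: rc_def bconst_add bconst_mult bconst_uminus One_fract_def Zero_fract_def)

lemma rc_diff: "rc (a - b) = rc a - rc b"
  using rc_add[of a "- b"] by (simp add: rc_uminus)

section \<open>The localization\<close>

definition Bpol :: "nat \<Rightarrow> nat \<Rightarrow> bpol set" where
  "Bpol N n = supp_in {\<mu>. keys \<mu> \<subseteq> {1..N} \<times> {1..n}}"

lemma Bpol_mult: "p \<in> Bpol N n \<Longrightarrow> q \<in> Bpol N n \<Longrightarrow> p * q \<in> Bpol N n"
  using Poly_Mapping.keys_mult[of p q] by (fastforce simp: Bpol_def supp_in_def keys_mon_add)

lemma Bpol_add: "p \<in> Bpol N n \<Longrightarrow> q \<in> Bpol N n \<Longrightarrow> p + q \<in> Bpol N n"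
  and Bpol_uminus: "p \<in> Bpol N n \<Longrightarrow> - p \<in> Bpol N n"
  and Bpol_diff: "p \<in> Bpol N n \<Longrightarrow> q \<in> Bpol N n \<Longrightarrow> p - q \<in> Bpol N n"
  and Bpol_bconst [simp]: "bconst c \<in> Bpol N n"
  by (simp_all add: Bpol_def supp_in_add supp_in_uminus supp_in_diff bconst_def supp_in_single)

lemma Bpol_one [simp]: "1 \<in> Bpol N n"
  using Bpol_bconst[of 1] by simp

lemma Bpol_bvar: "kl \<in> {1..N} \<times> {1..n} \<Longrightarrow> bvar kl \<in> Bpol N n"
  by (simp add: Bpol_def bvar_def supp_in_single)

lemma Bpol_conj: "p \<in> Bpol N n \<Longrightarrow> conj_bpol p \<in> Bpol N n"
  by (auto simp: Bpol_def supp_in_def in_keys_iff lookup_conj_bpol)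

lemma Amin_iff: "x \<in> Amin N n s \<longleftrightarrow> (\<exists>p d. x = Fract p d \<and> d \<in> Dens N n s \<and> p \<in> Bpol N n)"
  by (auto simp: Amin_def Bpol_def supp_in_def)

lemma lookup_linear_bvar:
  "lookup (bconst a * bvar kl + bconst b) (single kl 1) = a"
  by (simp add: bconst_def bvar_def mult_single lookup_add lookup_single when_def)
    (metis single_one single_zero inj_single lookup_single_eq zero_neq_one lookup_zero)

text \<open>All three families of inverted forms are brought to the shape a B_kl + b, where
  nonvanishing and the effect of conjugation are visible.\<close>

lemma Dens_pole_eq: "bvar kl + bconst (2 * \<i> * of_int j) - bconst \<i> = bconst 1 * bvar kl + bconst (2 * \<i> * of_int j - \<i>)"
  using bconst_add[of "2 * \<i> * of_int j" "- \<i>"] by (simp add: bconst_uminus)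

lemma Dens_minus_eq: "bconst (of_real s) - bconst (2 * \<i>) * (bvar kl + bconst (2 * \<i> * of_int j))
    = bconst (- 2 * \<i>) * bvar kl + bconst (of_real s + 4 * of_int j)"
proof -
  have "bconst (of_real s + 4 * of_int j) = bconst (of_real s) - bconst (2 * \<i>) * bconst (2 * \<i> * of_int j)"
    using bconst_add[of "of_real s" "- (2 * \<i> * (2 * \<i> * of_int j))"]
    by (simp add: bconst_uminus flip: bconst_mult)
  then show ?thesis
    by (simp add: bconst_uminus algebra_simps)
qed

lemma Dens_plus_eq: "bconst (of_real s) + bconst (2 * \<i>) * (bvar kl + bconst (2 * \<i> * of_int j))
    = bconst (2 * \<i>) * bvar kl + bconst (of_real s - 4 * of_int j)"
proof -
  have "bconst (of_real s - 4 * of_int j) = bconst (of_real s) + bconst (2 * \<i>) * bconst (2 * \<i> * of_int j)"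
    using bconst_add[of "of_real s" "2 * \<i> * (2 * \<i> * of_int j)"]
    by (simp flip: bconst_mult)
  then show ?thesis
    by (simp add: algebra_simps)
qed

lemma linear_bvar_nonzero: "a \<noteq> 0 \<Longrightarrow> bconst a * bvar kl + bconst b \<noteq> 0"
  using lookup_linear_bvar[of a kl b] by auto

lemma Dens_nonzero: "d \<in> Dens N n s \<Longrightarrow> d \<noteq> 0"
proof (induction rule: Dens.induct)
  case (pole d kl j)
  have "bvar kl + bconst (2 * \<i> * of_int j) - bconst \<i> \<noteq> 0"
    unfolding Dens_pole_eq by (rule linear_bvar_nonzero) simp
  with pole show ?case by (metis mult_eq_0_iff)
next
  case (minus d kl j)
  have "bconst (of_real s) - bconst (2 * \<i>) * (bvar kl + bconst (2 * \<i> * of_int j)) \<noteq> 0"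
    unfolding Dens_minus_eq by (rule linear_bvar_nonzero) simp
  with minus show ?case by (metis mult_eq_0_iff)
next
  case (plus d kl j)
  have "bconst (of_real s) + bconst (2 * \<i>) * (bvar kl + bconst (2 * \<i> * of_int j)) \<noteq> 0"
    unfolding Dens_plus_eq by (rule linear_bvar_nonzero) simp
  with plus show ?case by (metis mult_eq_0_iff)
qed simp

lemma Dens_mult: "d' \<in> Dens N n s \<Longrightarrow> d \<in> Dens N n s \<Longrightarrow> d * d' \<in> Dens N n s"
proof (induction rule: Dens.induct)
  case one
  then show ?case by simp
qed (simp_all only: mult.assoc[symmetric] Dens.intros)

lemma Dens_Bpol: "d \<in> Dens N n s \<Longrightarrow> d \<in> Bpol N n"
  by (induction rule: Dens.induct) (auto intro!: Bpol_mult Bpol_add Bpol_diff Bpol_bvar)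

lemma Amin_of_Bpol: "p \<in> Bpol N n \<Longrightarrow> Fract p 1 \<in> Amin N n s"
  unfolding Amin_iff using Dens.one by blast

lemma Amin_add: "x \<in> Amin N n s \<Longrightarrow> y \<in> Amin N n s \<Longrightarrow> x + y \<in> Amin N n s"
proof -
  assume "x \<in> Amin N n s" "y \<in> Amin N n s"
  then obtain p d p' d' where *: "x = Fract p d" "d \<in> Dens N n s" "p \<in> Bpol N n"
    "y = Fract p' d'" "d' \<in> Dens N n s" "p' \<in> Bpol N n"
    unfolding Amin_iff by blast
  then have "x + y = Fract (p * d' + p' * d) (d * d')"
    by (simp add: Dens_nonzero)
  with * show ?thesis
    unfolding Amin_iff by (blast intro: Dens_mult Bpol_add Bpol_mult Dens_Bpol)
qed

lemma Amin_mult: "x \<in> Amin N n s \<Longrightarrow> y \<in> Amin N n s \<Longrightarrow> x * y \<in> Amin N n s"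
proof -
  assume "x \<in> Amin N n s" "y \<in> Amin N n s"
  then obtain p d p' d' where *: "x = Fract p d" "d \<in> Dens N n s" "p \<in> Bpol N n"
    "y = Fract p' d'" "d' \<in> Dens N n s" "p' \<in> Bpol N n"
    unfolding Amin_iff by blast
  then have "x * y = Fract (p * p') (d * d')" by simp
  with * show ?thesis
    unfolding Amin_iff by (blast intro: Dens_mult Bpol_mult)
qed

lemma Amin_rc [simp]: "rc c \<in> Amin N n s"
  unfolding rc_def by (rule Amin_of_Bpol) simp

lemma Amin_zero [simp]: "0 \<in> Amin N n s" and Amin_one [simp]: "1 \<in> Amin N n s"
  using Amin_rc[of 0] Amin_rc[of 1] by simp_all

lemma Amin_uminus: "x \<in> Amin N n s \<Longrightarrow> - x \<in> Amin N n s"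
  using Amin_mult[OF Amin_rc[of "-1"], of x] by (simp add: rc_uminus)

lemma Amin_diff: "x \<in> Amin N n s \<Longrightarrow> y \<in> Amin N n s \<Longrightarrow> x - y \<in> Amin N n s"
  using Amin_add[of x N n s "- y"] by (simp add: Amin_uminus)

lemma Amin_sum: "(\<And>i. i \<in> I \<Longrightarrow> f i \<in> Amin N n s) \<Longrightarrow> sum f I \<in> Amin N n s"
  by (induction I rule: infinite_finite_induct) (auto intro: Amin_add)

lemma Amin_prod: "(\<And>i. i \<in> I \<Longrightarrow> f i \<in> Amin N n s) \<Longrightarrow> prod f I \<in> Amin N n s"
  by (induction I rule: infinite_finite_induct) (auto intro: Amin_mult)

lemma Amin_of_nat: "of_nat k \<in> Amin N n s"
  by (induction k) (auto intro: Amin_add)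

lemma Amin_sign: "(-1) ^ k \<in> Amin N n s"
  by (induction k) (auto intro: Amin_uminus)

lemma Amin_Bv: "kl \<in> {1..N} \<times> {1..n} \<Longrightarrow> Bv kl \<in> Amin N n s"
  unfolding Bv_def by (intro Amin_of_Bpol Bpol_bvar)

text \<open>Conjugation fixes B and sends the imaginary unit to its negative: the pole form with
  index j goes to the one with index 1 - j, and the other two families are exchanged with j replaced
  by -j.\<close>

lemma Dens_conj: "d \<in> Dens N n s \<Longrightarrow> conj_bpol d \<in> Dens N n s"
proof (induction rule: Dens.induct)
  case one
  then show ?case using Dens.one by simp
next
  case (pole d kl j)
  have "conj_bpol (bvar kl + bconst (2 * \<i> * of_int j) - bconst \<i>)
      = bvar kl + bconst (2 * \<i> * of_int (1 - j)) - bconst \<i>"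
    by (simp only: Dens_pole_eq conj_bpol_add conj_bpol_mult conj_bpol_bconst conj_bpol_bvar)
      (simp add: algebra_simps)
  then show ?case
    using Dens.pole[OF pole.IH pole.hyps(2), of "1 - j"] by (simp add: conj_bpol_mult)
next
  case (minus d kl j)
  have "conj_bpol (bconst (of_real s) - bconst (2 * \<i>) * (bvar kl + bconst (2 * \<i> * of_int j)))
      = bconst (of_real s) + bconst (2 * \<i>) * (bvar kl + bconst (2 * \<i> * of_int (- j)))"
    unfolding Dens_minus_eq Dens_plus_eq by (simp add: conj_bpol_add conj_bpol_mult)
  then show ?case
    using Dens.plus[OF minus.IH minus.hyps(2), of "- j"] by (simp add: conj_bpol_mult)
next
  case (plus d kl j)
  have "conj_bpol (bconst (of_real s) + bconst (2 * \<i>) * (bvar kl + bconst (2 * \<i> * of_int j)))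
      = bconst (of_real s) - bconst (2 * \<i>) * (bvar kl + bconst (2 * \<i> * of_int (- j)))"
    unfolding Dens_minus_eq Dens_plus_eq by (simp add: conj_bpol_add conj_bpol_mult)
  then show ?case
    using Dens.minus[OF plus.IH plus.hyps(2), of "- j"] by (simp add: conj_bpol_mult)
qed

lemma Amin_conj: "x \<in> Amin N n s \<Longrightarrow> conj_rat x \<in> Amin N n s"
  unfolding Amin_iff by (metis conj_rat_Fract Dens_nonzero Dens_conj Bpol_conj)

lemma Amin_units:
  assumes "kl \<in> {1..N} \<times> {1..n}"
  shows "Bv kl + rc (2 * \<i> * of_int j) - rc \<i> \<in> Amin N n s"
    "inverse (Bv kl + rc (2 * \<i> * of_int j) - rc \<i>) \<in> Amin N n s"
    "rc (of_real s) - rc (2 * \<i>) * (Bv kl + rc (2 * \<i> * of_int j)) \<in> Amin N n s"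
    "inverse (rc (of_real s) - rc (2 * \<i>) * (Bv kl + rc (2 * \<i> * of_int j))) \<in> Amin N n s"
proof -
  have pole: "1 * (bvar kl + bconst (2 * \<i> * of_int j) - bconst \<i>) \<in> Dens N n s"
    and minus: "1 * (bconst (of_real s) - bconst (2 * \<i>) * (bvar kl + bconst (2 * \<i> * of_int j))) \<in> Dens N n s"
    by (rule Dens.pole[OF Dens.one assms], rule Dens.minus[OF Dens.one assms])
  have e: "Bv kl + rc (2 * \<i> * of_int j) - rc \<i> = Fract (bvar kl + bconst (2 * \<i> * of_int j) - bconst \<i>) 1"
    "rc (of_real s) - rc (2 * \<i>) * (Bv kl + rc (2 * \<i> * of_int j))
      = Fract (bconst (of_real s) - bconst (2 * \<i>) * (bvar kl + bconst (2 * \<i> * of_int j))) 1"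
    by (simp_all add: Bv_def rc_def)
  have "Fract 1 d \<in> Amin N n s" if "d \<in> Dens N n s" for d
    unfolding Amin_iff using that Bpol_one by blast
  then show "Bv kl + rc (2 * \<i> * of_int j) - rc \<i> \<in> Amin N n s"
    "inverse (Bv kl + rc (2 * \<i> * of_int j) - rc \<i>) \<in> Amin N n s"
    "rc (of_real s) - rc (2 * \<i>) * (Bv kl + rc (2 * \<i> * of_int j)) \<in> Amin N n s"
    "inverse (rc (of_real s) - rc (2 * \<i>) * (Bv kl + rc (2 * \<i> * of_int j))) \<in> Amin N n s"
    unfolding e using pole minus Dens_Bpol[OF pole] Dens_Bpol[OF minus] by (simp_all add: Amin_of_Bpol)
qed

lemma bet_Amin:
  assumes "kl \<in> {1..N} \<times> {1..n}"
  shows "bet c (Bv kl) \<in> Amin N n s" "inverse (bet c (Bv kl)) \<in> Amin N n s"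
proof -
  have "of_int (2 * c - 1) * \<i> = 2 * \<i> * of_int c + - \<i>"
    by (simp add: algebra_simps)
  then have e: "Bv kl + rc (of_int (2 * c - 1) * \<i>) = Bv kl + rc (2 * \<i> * of_int c) - rc \<i>"
    by (simp only: rc_add rc_uminus) simp
  show "bet c (Bv kl) \<in> Amin N n s" "inverse (bet c (Bv kl)) \<in> Amin N n s"
    unfolding bet_def e using Amin_units(1,2)[OF assms, of c] by simp_all
qed

lemma alp_Amin: "kl \<in> {1..N} \<times> {1..n} \<Longrightarrow> alp c (Bv kl) \<in> Amin N n s"
  by (auto simp: alp_def intro: Amin_add Amin_Bv)

text \<open>With x = B_kl, the shifted numerator 4 - s + 2i(B + 2i(c + 1)) equals -(s - 2i(B +
  2ic)), up to sign one of the inverted forms. So sigma_c^+ is a product of units, and pi_c^+ is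
  invertible in the localization.\<close>

lemma sigp_eq:
  "sigp s c x = - (bet (c + 1) x * ((rc (of_real s) - rc (2 * \<i>) * (x + rc (2 * \<i> * of_int c)))
     * inverse (x + rc (2 * \<i> * of_int (c + 1)) - rc \<i>)))"
proof -
  have "rc (4 - of_real s) + rc (2 * \<i>) * (x + rc (2 * \<i> * of_int (c + 1)))
      = rc (4 - of_real s + 2 * \<i> * (2 * \<i> * of_int (c + 1))) + rc (2 * \<i>) * x"
    by (simp only: rc_add rc_mult distrib_left) (simp only: add_ac)
  also have "4 - of_real s + 2 * \<i> * (2 * \<i> * of_int (c + 1)) = - (of_real s - 2 * \<i> * (2 * \<i> * of_int c))"
    by (simp add: algebra_simps)
  also have "rc \<dots> + rc (2 * \<i>) * x = - (rc (of_real s) - rc (2 * \<i>) * (x + rc (2 * \<i> * of_int c)))"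
    by (simp only: rc_uminus rc_diff rc_mult distrib_left) (simp only: minus_diff_eq diff_conv_add_uminus minus_add_distrib minus_minus add_ac)
  finally have e: "rc (4 - of_real s) + rc (2 * \<i>) * (x + rc (2 * \<i> * of_int (c + 1)))
      = - (rc (of_real s) - rc (2 * \<i>) * (x + rc (2 * \<i> * of_int c)))" .
  show ?thesis
    unfolding sigp_def Phi_def divide_inverse e by (simp only: mult_minus_left mult_minus_right)
qed

lemma sigp_Amin:
  assumes "kl \<in> {1..N} \<times> {1..n}"
  shows "sigp s c (Bv kl) \<in> Amin N n s"
  unfolding sigp_eq by (intro Amin_uminus Amin_mult bet_Amin Amin_units assms)

lemma pip_Amin:
  assumes "kl \<in> {1..N} \<times> {1..n}"
  shows "pip s c (Bv kl) \<in> Amin N n s" "inverse (pip s c (Bv kl)) \<in> Amin N n s"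
proof -
  show "pip s c (Bv kl) \<in> Amin N n s"
    unfolding pip_def by (intro Amin_mult Amin_rc sigp_Amin assms)
  have inv_rc: "inverse (rc (-1/4)) = rc (-4)"
    by (rule inverse_unique) (simp flip: rc_mult)
  show "inverse (pip s c (Bv kl)) \<in> Amin N n s"
    unfolding pip_def sigp_eq inverse_mult_distrib inverse_minus_eq inverse_inverse_eq inv_rc
    by (intro Amin_mult Amin_rc Amin_uminus bet_Amin Amin_units assms)
qed

lemma kapp_Amin: "kl \<in> {1..N} \<times> {1..n} \<Longrightarrow> kapp s c (Bv kl) \<in> Amin N n s"
  unfolding kapp_def by (intro Amin_mult Amin_rc sigp_Amin alp_Amin)

lemma Kc_Amin: "kl \<in> {1..N} \<times> {1..n} \<Longrightarrow> Kc c (Bv kl) \<in> Amin N n s"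
  unfolding Kc_def by (intro Amin_mult Amin_rc bet_Amin alp_Amin)

section \<open>Odd operators of one block of fermionic factors\<close>

lemma sum_fun_apply: "(sum f I) x = (\<Sum>i\<in>I. f i x)"
  for f :: "'i \<Rightarrow> 'a \<Rightarrow> 'b::comm_monoid_add"
  by (induction I rule: infinite_finite_induct) auto

definition fgood :: "nat \<Rightarrow> nat \<Rightarrow> flab \<Rightarrow> bool" where
  "fgood N n b \<longleftrightarrow> (\<forall>kl. kl \<notin> {1..N} \<times> {1..n} \<longrightarrow> b kl = (E0, 0))"

definition bgood :: "nat \<Rightarrow> (nat \<Rightarrow> plab) \<Rightarrow> bool" where
  "bgood n x \<longleftrightarrow> (\<forall>l. l \<notin> {1..n} \<longrightarrow> x l = (E0, 0))"

definition bcount :: "nat \<Rightarrow> (plab \<Rightarrow> bool) \<Rightarrow> (nat \<Rightarrow> plab) \<Rightarrow> nat" where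
  "bcount n Q x = card {l\<in>{1..n}. Q (x l)}"

definition sgnb :: "nat \<Rightarrow> flab \<Rightarrow> ratB" where
  "sgnb k b = (-1) ^ card {kl. fst kl < k \<and> oddst (b kl)}"

text \<open>The matrix of such an operator on block \<open>k\<close> is \<open>\<tau>\<close>; the sign comes from moving it past the
  blocks to the left.\<close>

definition blockmat :: "nat \<Rightarrow> nat \<Rightarrow> ratB set \<Rightarrow> nat \<Rightarrow> ((nat \<Rightarrow> plab) \<Rightarrow> (nat \<Rightarrow> plab) \<Rightarrow> ratB) \<Rightarrow> (ferm \<Rightarrow> ferm) \<Rightarrow> bool" where
  "blockmat N n R k \<tau> T \<longleftrightarrow> slin T \<and>
     (\<forall>b b'. fgood N n b \<longrightarrow> lookup (T (single b 1)) b' =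
        (if \<forall>kl. fst kl \<noteq> k \<longrightarrow> b' kl = b kl then sgnb k b * \<tau> (\<lambda>l. b (k, l)) (\<lambda>l. b' (k, l)) else 0)) \<and>
     (\<forall>x y. bgood n x \<longrightarrow> \<tau> x y \<noteq> 0 \<longrightarrow>
        bgood n y \<and> odd (bcount n oddst x + bcount n oddst y) \<and> \<tau> x y \<in> R)"

definition blockop :: "nat \<Rightarrow> nat \<Rightarrow> ratB set \<Rightarrow> nat \<Rightarrow> (ferm \<Rightarrow> ferm) \<Rightarrow> bool" where
  "blockop N n R k T \<longleftrightarrow> (\<exists>\<tau>. blockmat N n R k \<tau> T)"

lemma fgood_block: "fgood N n b \<Longrightarrow> bgood n (\<lambda>l. b (k, l))"
  by (simp add: fgood_def bgood_def)

lemma fgood_combine: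
  assumes "fgood N n b" "bgood n (\<lambda>l. b' (k, l))" "k \<in> {1..N}" "\<forall>kl. fst kl \<noteq> k \<longrightarrow> b' kl = b kl"
  shows "fgood N n b'"
  unfolding fgood_def
proof (intro allI impI)
  fix kl assume kl: "kl \<notin> {1..N} \<times> {1..n}"
  show "b' kl = (E0, 0)"
  proof (cases "fst kl = k")
    case True
    then have "snd kl \<notin> {1..n}" using kl assms(3) by (cases kl) auto
    then show ?thesis using assms(2) True unfolding bgood_def by (metis prod.collapse)
  next
    case False
    then show ?thesis using assms(1,4) kl unfolding fgood_def by metis
  qed
qed

lemma finite_fgood:
  assumes "fgood N n b" "\<not> Q (E0, 0)"
  shows "finite {kl. P kl \<and> Q (b kl)}"
proof (rule finite_subset)
  show "{kl. P kl \<and> Q (b kl)} \<subseteq> {1..N} \<times> {1..n}"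
    using assms unfolding fgood_def by (metis (mono_tags, lifting) mem_Collect_eq subsetI)
qed simp

section \<open>Koszul signs\<close>

lemma count_split:
  assumes "fgood N n b" "\<not> Q (E0, 0)"
  shows "card {kl. P (fst kl) \<and> Q (b kl)} = card {kl. (P (fst kl) \<and> fst kl \<noteq> k) \<and> Q (b kl)}
    + (if P k then bcount n Q (\<lambda>l. b (k, l)) else 0)"
proof -
  let ?U = "{kl. (P (fst kl) \<and> fst kl \<noteq> k) \<and> Q (b kl)}" and ?V = "{kl. (P (fst kl) \<and> fst kl = k) \<and> Q (b kl)}"
  have "{kl. P (fst kl) \<and> Q (b kl)} = ?U \<union> ?V" by blast
  moreover have "finite ?U" "finite ?V" by (rule finite_fgood[where Q = Q, OF assms])+
  ultimately have "card {kl. P (fst kl) \<and> Q (b kl)} = card ?U + card ?V"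
    by (simp add: card_Un_disjoint disjoint_iff)
  moreover have "card ?V = (if P k then bcount n Q (\<lambda>l. b (k, l)) else 0)"
  proof (cases "P k")
    case True
    have "Q (b (k, l)) \<Longrightarrow> l \<in> {1..n}" for l
      using fgood_block[OF assms(1), of k] assms(2) unfolding bgood_def by metis
    then have "?V = Pair k ` {l\<in>{1..n}. Q (b (k, l))}"
      using True by force
    then show ?thesis
      using True by (simp add: bcount_def card_image inj_on_def)
  next
    case False
    then have "?V = {}" by blast
    then show ?thesis using False by (simp only: card.empty if_False)
  qed
  ultimately show ?thesis by simp
qed

text \<open>The contributions outside block k are equal. The comparison is written with sums on both
  sides to avoid truncated subtraction.\<close>

lemma count_split_agree:
  assumes "fgood N n b" "fgood N n b'" "\<not> Q (E0, 0)" "\<forall>kl. fst kl \<noteq> k \<longrightarrow> b' kl = b kl"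
  shows "card {kl. P (fst kl) \<and> Q (b' kl)} + (if P k then bcount n Q (\<lambda>l. b (k, l)) else 0)
    = card {kl. P (fst kl) \<and> Q (b kl)} + (if P k then bcount n Q (\<lambda>l. b' (k, l)) else 0)"
proof -
  have "{kl. (P (fst kl) \<and> fst kl \<noteq> k) \<and> Q (b' kl)} = {kl. (P (fst kl) \<and> fst kl \<noteq> k) \<and> Q (b kl)}"
    using assms(4) by auto
  then show ?thesis
    unfolding count_split[where Q = Q, OF assms(1,3), of P k] count_split[where Q = Q, OF assms(2,3), of P k] by simp
qed

lemma not_oddst_default [simp]: "\<not> oddst (E0, 0)"
  by (simp add: oddst_def)

lemma parity_exchange: "a' + x = a + (x' :: nat) \<Longrightarrow> odd (x + x') \<Longrightarrow> even a' \<longleftrightarrow> odd a"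
  by presburger

text \<open>An odd change inside block k alters the number of odd factors preceding a block k' by an
  odd amount if k < k', and not at all otherwise.\<close>

lemma sgnb_block:
  assumes "fgood N n b" "fgood N n b'" "\<forall>kl. fst kl \<noteq> k \<longrightarrow> b' kl = b kl"
    "odd (bcount n oddst (\<lambda>l. b (k, l)) + bcount n oddst (\<lambda>l. b' (k, l)))"
  shows "sgnb k' b' = (if k < k' then - sgnb k' b else sgnb k' b)"
proof -
  let ?A = "\<lambda>b. card {kl. fst kl < k' \<and> oddst (b kl)}"
  have *: "?A b' + (if k < k' then bcount n oddst (\<lambda>l. b (k, l)) else 0)
      = ?A b + (if k < k' then bcount n oddst (\<lambda>l. b' (k, l)) else 0)"
    by (rule count_split_agree[where Q = oddst, OF assms(1,2) not_oddst_default assms(3)])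
  show ?thesis
  proof (cases "k < k'")
    case True
    then have "even (?A b') \<longleftrightarrow> odd (?A b)"
      using parity_exchange[OF _ assms(4)] * by simp
    with True show ?thesis by (simp add: sgnb_def minus_one_power_iff)
  next
    case False
    with * show ?thesis by (simp add: sgnb_def)
  qed
qed

lemma blockmat_elt:
  assumes "blockmat N n R k \<tau> T" "fgood N n b" "k \<in> {1..N}" "lookup (T (single b 1)) b' \<noteq> 0"
  shows "fgood N n b'" "\<forall>kl. fst kl \<noteq> k \<longrightarrow> b' kl = b kl" "\<tau> (\<lambda>l. b (k, l)) (\<lambda>l. b' (k, l)) \<in> R"
    "odd (bcount n oddst (\<lambda>l. b (k, l)) + bcount n oddst (\<lambda>l. b' (k, l)))"
    "lookup (T (single b 1)) b' = sgnb k b * \<tau> (\<lambda>l. b (k, l)) (\<lambda>l. b' (k, l))"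
proof -
  have e: "lookup (T (single b 1)) b' = (if \<forall>kl. fst kl \<noteq> k \<longrightarrow> b' kl = b kl
      then sgnb k b * \<tau> (\<lambda>l. b (k, l)) (\<lambda>l. b' (k, l)) else 0)"
    using assms(1,2) unfolding blockmat_def by blast
  show off: "\<forall>kl. fst kl \<noteq> k \<longrightarrow> b' kl = b kl"
    using assms(4) e by (metis (no_types, lifting))
  show e': "lookup (T (single b 1)) b' = sgnb k b * \<tau> (\<lambda>l. b (k, l)) (\<lambda>l. b' (k, l))"
    unfolding e using off by simp
  have "\<tau> (\<lambda>l. b (k, l)) (\<lambda>l. b' (k, l)) \<noteq> 0" using e' assms(4) by auto
  then have "bgood n (\<lambda>l. b' (k, l)) \<and> odd (bcount n oddst (\<lambda>l. b (k, l)) + bcount n oddst (\<lambda>l. b' (k, l)))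
      \<and> \<tau> (\<lambda>l. b (k, l)) (\<lambda>l. b' (k, l)) \<in> R"
    using assms(1) fgood_block[OF assms(2), of k] unfolding blockmat_def by blast
  then show "\<tau> (\<lambda>l. b (k, l)) (\<lambda>l. b' (k, l)) \<in> R"
    "odd (bcount n oddst (\<lambda>l. b (k, l)) + bcount n oddst (\<lambda>l. b' (k, l)))" "fgood N n b'"
    using fgood_combine[OF assms(2) _ assms(3) off] by auto
qed

lemma blockop_slin: "blockop N n R k T \<Longrightarrow> slin T"
  by (auto simp: blockop_def blockmat_def)

lemma blockop_elt:
  assumes "blockop N n (Amin N n s) k T" "fgood N n b" "k \<in> {1..N}" "lookup (T (single b 1)) b' \<noteq> 0"
  shows "fgood N n b'" "odd (fpar b + fpar b')" "lookup (T (single b 1)) b' \<in> Amin N n s"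
proof -
  obtain \<tau> where T: "blockmat N n (Amin N n s) k \<tau> T" using assms(1) by (auto simp: blockop_def)
  note e = blockmat_elt[OF T assms(2-4)]
  show "fgood N n b'" by (rule e(1))
  show "odd (fpar b + fpar b')"
    using count_split_agree[where Q = oddst, OF assms(2) e(1) not_oddst_default e(2), of "\<lambda>_. True"]
      parity_exchange[OF _ e(4), of "fpar b'" "fpar b"]
    by (simp add: fpar_def)
  show "lookup (T (single b 1)) b' \<in> Amin N n s"
    unfolding e(5) sgnb_def by (intro Amin_mult Amin_sign e(3))
qed

text \<open>Different blocks alter different coordinates, so just one intermediate label
  contributes. The operator applied second sees a changed sign precisely when the first has acted on
  a block to its left.\<close>

lemma blockmat_comp:
  assumes T: "blockmat N n R k \<tau> T" and T': "blockmat N n R k' \<tau>' T'"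
    and k: "k \<in> {1..N}" "k' \<in> {1..N}" "k \<noteq> k'" and b: "fgood N n b"
  shows "lookup (T' (T (single b 1))) b' =
    (if \<forall>kl. fst kl \<noteq> k \<and> fst kl \<noteq> k' \<longrightarrow> b' kl = b kl
     then (if k < k' then - 1 else 1) * (sgnb k b * sgnb k' b * \<tau> (\<lambda>l. b (k, l)) (\<lambda>l. b' (k, l)) * \<tau>' (\<lambda>l. b (k', l)) (\<lambda>l. b' (k', l)))
     else 0)"
proof -
  \<comment> \<open>The only possible intermediate label: final on block k, initial everywhere
    else.\<close>
  define c where "c = (\<lambda>kl. if fst kl = k then b' kl else b kl)"
  define C where "C \<longleftrightarrow> (\<forall>kl. fst kl \<noteq> k \<and> fst kl \<noteq> k' \<longrightarrow> b' kl = b kl)"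
  have slT': "slin T'" using T' by (simp add: blockmat_def)
  have T'_elt: "lookup (T' (single a 1)) b' = (if \<forall>kl. fst kl \<noteq> k' \<longrightarrow> b' kl = a kl
      then sgnb k' a * \<tau>' (\<lambda>l. a (k', l)) (\<lambda>l. b' (k', l)) else 0)" if "fgood N n a" for a
    using T' that unfolding blockmat_def by blast
  have "lookup (T' (T (single b 1))) b'
      = (\<Sum>a\<in>insert c (keys (T (single b 1))). lookup (T (single b 1)) a * lookup (T' (single a 1)) b')"
    by (rule lookup_slin[OF slT']) auto
  also have "\<dots> = (\<Sum>a\<in>insert c (keys (T (single b 1))).
      if a = c then lookup (T (single b 1)) c * lookup (T' (single c 1)) b' else 0)"
  proof (intro sum.cong refl)
    fix a
    show "lookup (T (single b 1)) a * lookup (T' (single a 1)) b'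
        = (if a = c then lookup (T (single b 1)) c * lookup (T' (single c 1)) b' else 0)"
    proof (cases "lookup (T (single b 1)) a = 0 \<or> lookup (T' (single a 1)) b' = 0")
      case False
      then have a: "fgood N n a" "\<forall>kl. fst kl \<noteq> k \<longrightarrow> a kl = b kl"
        using blockmat_elt[OF T b k(1)] by blast+
      have "\<forall>kl. fst kl \<noteq> k' \<longrightarrow> b' kl = a kl"
        using blockmat_elt(2)[OF T' a(1) k(2)] False by blast
      with a(2) k(3) have "a = c" by (auto simp: c_def fun_eq_iff)
      then show ?thesis by simp
    qed auto
  qed
  also have "\<dots> = lookup (T (single b 1)) c * lookup (T' (single c 1)) b'"
    by simp
  finally have 1: "lookup (T' (T (single b 1))) b' = lookup (T (single b 1)) c * lookup (T' (single c 1)) b'" .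
  have off: "\<forall>kl. fst kl \<noteq> k \<longrightarrow> c kl = b kl" by (simp add: c_def)
  have ck: "(\<lambda>l. c (k, l)) = (\<lambda>l. b' (k, l))" "(\<lambda>l. c (k', l)) = (\<lambda>l. b (k', l))"
    using k(3) by (auto simp: c_def)
  have 2: "lookup (T (single b 1)) c = sgnb k b * \<tau> (\<lambda>l. b (k, l)) (\<lambda>l. b' (k, l))"
    using T b off unfolding blockmat_def ck(1)[symmetric] by simp
  show ?thesis
  proof (cases "lookup (T (single b 1)) c = 0")
    case True
    then show ?thesis unfolding 1 using 2 by (simp add: sgnb_def)
  next
    case False
    note e = blockmat_elt[OF T b k(1) False]
    have "sgnb k' c = (if k < k' then - sgnb k' b else sgnb k' b)"
      by (rule sgnb_block[OF b e(1,2,4)])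
    moreover have "(\<forall>kl. fst kl \<noteq> k' \<longrightarrow> b' kl = c kl) \<longleftrightarrow> C"
      unfolding C_def c_def by (metis (full_types))
    ultimately show ?thesis
      unfolding 1 2 T'_elt[OF e(1)] ck C_def[symmetric] by (simp add: mult_ac)
  qed
qed

text \<open>Both orders yield the same product of commuting coefficients, and exactly one of k < k'
  and k' < k holds, so exactly one order acquires the minus sign.\<close>

lemma blockop_anticommute:
  assumes T: "blockop N n (Amin N n s) k T" and T': "blockop N n (Amin N n s) k' T'"
    and k: "k \<in> {1..N}" "k' \<in> {1..N}" "k \<noteq> k'" and e: "e \<in> supp_in {b. fgood N n b}"
  shows "T' (T e) = - T (T' e)"
proof (rule slin_eqI[where f = "\<lambda>e. T' (T e)" and g = "\<lambda>e. - T (T' e)" and v = e])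
  show "slin (\<lambda>e. T' (T e))"
    by (rule slin_comp[OF blockop_slin[OF T'] blockop_slin[OF T]])
  show "slin (\<lambda>e. - T (T' e))"
    by (rule slin_uminus[OF slin_comp[OF blockop_slin[OF T] blockop_slin[OF T']]])
  fix b assume "b \<in> keys e"
  then have b: "fgood N n b" using e by (auto simp: supp_in_def)
  obtain \<tau> \<tau>' where \<tau>: "blockmat N n (Amin N n s) k \<tau> T" "blockmat N n (Amin N n s) k' \<tau>' T'"
    using T T' by (auto simp: blockop_def)
  show "T' (T (single b 1)) = - T (T' (single b 1))"
  proof (rule poly_mapping_eqI)
    fix b'
    show "lookup (T' (T (single b 1))) b' = lookup (- T (T' (single b 1))) b'"
      using k(3) unfolding lookup_uminus blockmat_comp[OF \<tau> k b] blockmat_comp[OF \<tau>(2,1) k(2,1) k(3)[symmetric] b]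
      by (auto simp: mult_ac conj_commute)
  qed
qed

lemma blockop_sum:
  assumes "\<And>i. i \<in> I \<Longrightarrow> blockop N n (Amin N n s) k (T i)"
  shows "blockop N n (Amin N n s) k (\<lambda>v. \<Sum>i\<in>I. T i v)"
proof -
  obtain \<tau> where \<tau>: "\<And>i. i \<in> I \<Longrightarrow> blockmat N n (Amin N n s) k (\<tau> i) (T i)"
    using assms unfolding blockop_def by metis
  have "blockmat N n (Amin N n s) k (\<lambda>x y. \<Sum>i\<in>I. \<tau> i x y) (\<lambda>v. \<Sum>i\<in>I. T i v)"
    unfolding blockmat_def
  proof (intro conjI allI impI)
    show "slin (\<lambda>v. \<Sum>i\<in>I. T i v)"
      by (intro slin_sum_fun) (use assms blockop_slin in blast)
    show "lookup (\<Sum>i\<in>I. T i (single b 1)) b' = (if \<forall>kl. fst kl \<noteq> k \<longrightarrow> b' kl = b kl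
        then sgnb k b * (\<Sum>i\<in>I. \<tau> i (\<lambda>l. b (k, l)) (\<lambda>l. b' (k, l))) else 0)" if "fgood N n b" for b b'
      using \<tau> that unfolding blockmat_def lookup_sum by (auto simp: sum_distrib_left intro!: sum.cong sum.neutral)
    fix x y assume x: "bgood n x" and "(\<Sum>i\<in>I. \<tau> i x y) \<noteq> 0"
    then obtain i where i: "i \<in> I" "\<tau> i x y \<noteq> 0" by (metis sum.neutral)
    then show "bgood n y" "odd (bcount n oddst x + bcount n oddst y)"
      using \<tau>[OF i(1)] x unfolding blockmat_def by blast+
    show "(\<Sum>i\<in>I. \<tau> i x y) \<in> Amin N n s"
    proof (rule Amin_sum)
      fix i assume "i \<in> I"
      then show "\<tau> i x y \<in> Amin N n s"
        using \<tau>[of i] x unfolding blockmat_def by (cases "\<tau> i x y = 0") auto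
    qed
  qed
  then show ?thesis by (auto simp: blockop_def)
qed

lemma blockop_smul:
  assumes "blockop N n (Amin N n s) k T" "r \<in> Amin N n s"
  shows "blockop N n (Amin N n s) k (\<lambda>v. smul r (T v))"
proof -
  obtain \<tau> where \<tau>: "blockmat N n (Amin N n s) k \<tau> T"
    using assms unfolding blockop_def by metis
  have "blockmat N n (Amin N n s) k (\<lambda>x y. r * \<tau> x y) (\<lambda>v. smul r (T v))"
    using \<tau> assms(2) unfolding blockmat_def by (auto simp: slin_smult mult_ac intro: Amin_mult)
  then show ?thesis by (auto simp: blockop_def)
qed

text \<open>A diagonal factor that depends on block k only multiplies the rows of the block matrix
  and leaves the signs alone; this covers \<open>Mp\<close> followed by \<open>hp\<close>.\<close>

lemma blockop_diag:
  assumes "blockop N n (Amin N n s) k T"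
    and g: "\<And>b. g b = \<gamma> (\<lambda>l. b (k, l))" "\<And>x. bgood n x \<Longrightarrow> \<gamma> x \<in> Amin N n s"
  shows "blockop N n (Amin N n s) k (\<lambda>v. T (lext (\<lambda>b. single b (g b)) v))"
proof -
  obtain \<tau> where \<tau>: "blockmat N n (Amin N n s) k \<tau> T"
    using assms unfolding blockop_def by metis
  then have sl: "slin T" by (simp add: blockmat_def)
  have gd: "g = (\<lambda>b. \<gamma> (\<lambda>l. b (k, l)))" using g(1) by auto
  have T1: "lookup (T (lext (\<lambda>b. single b (g b)) (single b 1))) b' = \<gamma> (\<lambda>l. b (k, l)) * lookup (T (single b 1)) b'" for b b'
    using slin_smul[OF sl, of "g b" "single b 1"] by (simp add: gd)
  have "blockmat N n (Amin N n s) k (\<lambda>x y. \<gamma> x * \<tau> x y) (\<lambda>v. T (lext (\<lambda>b. single b (g b)) v))"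
    using \<tau> g(2) unfolding blockmat_def T1
    by (auto simp: slin_comp[OF sl slin_lext] mult_ac intro: Amin_mult)
  then show ?thesis by (auto simp: blockop_def)
qed

text \<open>The lexicographic predecessors of (k, l) are the blocks before k together with the
  earlier factors of block k. The sign splits accordingly: the first part is \<open>sgnb\<close>,
  the second belongs to the block matrix.\<close>

lemma blockop_emb:
  assumes l: "l \<in> {1..n}" and k: "k \<in> {1..N}"
    and f: "\<And>t t'. lookup (f (Bv (k, l)) t) t' \<noteq> 0 \<Longrightarrow> oddst t' \<noteq> oddst t \<and> lookup (f (Bv (k, l)) t) t' \<in> Amin N n s"
  shows "blockop N n (Amin N n s) k (emb f (k, l))"
proof -
  define \<tau> where "\<tau> x y = (if \<forall>l'. l' \<noteq> l \<longrightarrow> y l' = x l'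
    then (-1) ^ card {l'. l' < l \<and> oddst (x l')} * lookup (f (Bv (k, l)) (x l)) (y l) else 0)" for x y
  have "blockmat N n (Amin N n s) k \<tau> (emb f (k, l))"
    unfolding blockmat_def
  proof (intro conjI allI impI)
    show "slin (emb f (k, l))" unfolding emb_def by (rule slin_lext)
    fix b b' assume b: "fgood N n b"
    let ?v = "f (Bv (k, l)) (b (k, l))"
    have upd: "b((k, l) := t) = b' \<longleftrightarrow> t = b' (k, l) \<and> (\<forall>kl. kl \<noteq> (k, l) \<longrightarrow> b' kl = b kl)" for t
      by (auto simp: fun_eq_iff)
    have "lookup (lext (\<lambda>t. single (b((k, l) := t)) 1) ?v) b'
        = (\<Sum>t\<in>keys ?v. if t = b' (k, l) then if \<forall>kl. kl \<noteq> (k, l) \<longrightarrow> b' kl = b kl then lookup ?v (b' (k, l)) else 0 else 0)"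
      unfolding lookup_lext by (intro sum.cong refl) (auto simp: lookup_single when_def upd)
    then have 1: "lookup (lext (\<lambda>t. single (b((k, l) := t)) 1) ?v) b'
        = (if \<forall>kl. kl \<noteq> (k, l) \<longrightarrow> b' kl = b kl then lookup ?v (b' (k, l)) else 0)"
      by (simp add: in_keys_iff del: split_paired_All split_paired_Ex)
    define C D where "C \<longleftrightarrow> (\<forall>kl. fst kl \<noteq> k \<longrightarrow> b' kl = b kl)"
      and "D \<longleftrightarrow> (\<forall>l'. l' \<noteq> l \<longrightarrow> b' (k, l') = b (k, l'))"
    have cond: "(\<forall>kl. kl \<noteq> (k, l) \<longrightarrow> b' kl = b kl) \<longleftrightarrow> C \<and> D"
      unfolding C_def D_def by auto
    have "{kl'. kl' < (k, l) \<and> oddst (b kl')} = {kl. fst kl < k \<and> oddst (b kl)} \<union> Pair k ` {l'. l' < l \<and> oddst (b (k, l'))}"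
      by force
    moreover have "finite {kl. fst kl < k \<and> oddst (b kl)}" by (rule finite_fgood[where Q = oddst, OF b]) simp
    moreover have "finite {l'. l' < l \<and> oddst (b (k, l'))}" by simp
    moreover have "{kl. fst kl < k \<and> oddst (b kl)} \<inter> Pair k ` {l'. l' < l \<and> oddst (b (k, l'))} = {}" by auto
    ultimately have sgn: "card {kl'. kl' < (k, l) \<and> oddst (b kl')}
        = card {kl. fst kl < k \<and> oddst (b kl)} + card {l'. l' < l \<and> oddst (b (k, l'))}"
      by (simp add: card_Un_disjoint card_image inj_on_def)
    show "lookup (emb f (k, l) (single b 1)) b' = (if \<forall>kl. fst kl \<noteq> k \<longrightarrow> b' kl = b kl
        then sgnb k b * \<tau> (\<lambda>l. b (k, l)) (\<lambda>l. b' (k, l)) else 0)"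
      unfolding emb_def lext_single smul_one lookup_smul 1 cond sgn power_add sgnb_def \<tau>_def
        C_def[symmetric] D_def[symmetric]
      by (simp add: mult.assoc)
  next
    fix x y assume x: "bgood n x" and nz: "\<tau> x y \<noteq> 0"
    then have y: "\<forall>l'. l' \<noteq> l \<longrightarrow> y l' = x l'" and nz': "lookup (f (Bv (k, l)) (x l)) (y l) \<noteq> 0"
      by (auto simp: \<tau>_def split: if_splits)
    show "bgood n y" using x y l unfolding bgood_def by metis
    have "bcount n oddst z = card {l'\<in>{1..n} - {l}. oddst (z l')} + of_bool (oddst (z l))" for z
    proof -
      have "{l'\<in>{1..n}. oddst (z l')} = {l'\<in>{1..n} - {l}. oddst (z l')} \<union> (if oddst (z l) then {l} else {})"
        using l by auto
      then show ?thesis unfolding bcount_def by (simp add: card_Un_disjoint)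
    qed
    moreover have "{l'\<in>{1..n} - {l}. oddst (y l')} = {l'\<in>{1..n} - {l}. oddst (x l')}"
      using y by auto
    ultimately show "odd (bcount n oddst x + bcount n oddst y)"
      using f[OF nz'] by simp
    show "\<tau> x y \<in> Amin N n s"
      using f[OF nz'] y by (simp add: \<tau>_def Amin_mult Amin_sign)
  qed
  then show ?thesis by (auto simp: blockop_def)
qed

section \<open>The involution on the fermionic factors\<close>

definition fsgn :: "flab \<Rightarrow> ratB" where
  "fsgn b = (-1) ^ card {kl. fst (b kl) = E2}"

lemma dag_lab_dag_lab [simp]: "dag_lab (dag_lab t) = t"
  and oddst_dag_lab [simp]: "oddst (dag_lab t) = oddst t"
  and E2_dag_lab [simp]: "fst (dag_lab t) = E2 \<longleftrightarrow> fst t = E2"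
  by (induction t rule: dag_lab.induct; simp add: oddst_def)+

lemma dag_lab_inject [simp]: "dag_lab t = dag_lab t' \<longleftrightarrow> t = t'"
  by (metis dag_lab_dag_lab)

lemma dag_lab_comp [simp]: "dag_lab \<circ> (dag_lab \<circ> b) = b"
  by (simp add: fun_eq_iff)

lemma lookup_dag_ferm: "lookup (dag_ferm v) b = fsgn b * conj_rat (lookup v (dag_lab \<circ> b))"
proof -
  have eq: "dag_lab \<circ> b' = b \<longleftrightarrow> b' = dag_lab \<circ> b" for b'
    by (metis dag_lab_comp)
  have "lookup (dag_ferm v) b = (\<Sum>b'\<in>keys v. if b' = dag_lab \<circ> b then fsgn b * conj_rat (lookup v (dag_lab \<circ> b)) else 0)"
    unfolding dag_ferm_def lookup_sum
    by (intro sum.cong refl) (auto simp: lookup_single when_def eq fsgn_def)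
  then show ?thesis by (auto simp: in_keys_iff)
qed

lemma dag_ferm_add: "dag_ferm (v + w) = dag_ferm v + dag_ferm w"
  by (rule poly_mapping_eqI) (simp add: lookup_dag_ferm lookup_add conj_rat_add distrib_left)

lemma dag_ferm_smul: "dag_ferm (smul r v) = smul (conj_rat r) (dag_ferm v)"
  by (rule poly_mapping_eqI) (simp add: lookup_dag_ferm conj_rat_mult mult_ac)

lemma dag_ferm_single: "dag_ferm (single b 1) = smul (fsgn b) (single (dag_lab \<circ> b) 1)"
proof (rule poly_mapping_eqI)
  fix b'
  have "b = dag_lab \<circ> b' \<longleftrightarrow> dag_lab \<circ> b = b'" by (metis dag_lab_comp)
  then show "lookup (dag_ferm (single b 1)) b' = lookup (smul (fsgn b) (single (dag_lab \<circ> b) 1)) b'"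
    by (auto simp: lookup_dag_ferm lookup_single when_def fsgn_def)
qed

lemma fgood_dag: "fgood N n (dag_lab \<circ> b) \<longleftrightarrow> fgood N n b"
proof -
  have "dag_lab t = (E0, 0) \<longleftrightarrow> t = (E0, 0)" for t
    by (metis dag_lab.simps(1) dag_lab_dag_lab minus_zero)
  then show ?thesis by (simp add: fgood_def)
qed

text \<open>The sign \<open>fsgn\<close> counts \<open>E2\<close> over all blocks, but source and
  target agree outside block k. In the product of their two signs the other blocks cancel, and what
  remains depends on block k alone.\<close>

lemma blockop_dag:
  assumes "blockop N n (Amin N n s) k T"
    and k: "k \<in> {1..N}"
  shows "blockop N n (Amin N n s) k (\<lambda>v. dag_ferm (T (dag_ferm v)))"
proof -
  obtain \<tau> where \<tau>: "blockmat N n (Amin N n s) k \<tau> T"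
    using assms unfolding blockop_def by metis
  then have sl: "slin T" by (simp add: blockmat_def)
  define E2s where "E2s x = ((-1) ^ bcount n (\<lambda>t. fst t = E2) x :: ratB)" for x
  define \<tau>' where "\<tau>' x y = E2s x * E2s y * conj_rat (\<tau> (\<lambda>l. dag_lab (x l)) (\<lambda>l. dag_lab (y l)))" for x y
  have bgood_dag: "bgood n (\<lambda>l. dag_lab (x l)) \<longleftrightarrow> bgood n x" for x
  proof -
    have "dag_lab t = (E0, 0) \<longleftrightarrow> t = (E0, 0)" for t
      by (metis dag_lab.simps(1) dag_lab_dag_lab minus_zero)
    then show ?thesis by (simp add: bgood_def)
  qed
  have "blockmat N n (Amin N n s) k \<tau>' (\<lambda>v. dag_ferm (T (dag_ferm v)))"
    unfolding blockmat_def
  proof (intro conjI allI impI)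
    show "slin (\<lambda>v. dag_ferm (T (dag_ferm v)))"
      by (simp add: slin_def dag_ferm_add dag_ferm_smul slin_add[OF sl] slin_smul[OF sl])
    fix b b' assume b: "fgood N n b"
    have "lookup (dag_ferm (T (dag_ferm (single b 1)))) b'
        = fsgn b' * conj_rat (lookup (T (smul (fsgn b) (single (dag_lab \<circ> b) 1))) (dag_lab \<circ> b'))"
      unfolding lookup_dag_ferm dag_ferm_single ..
    also have "\<dots> = fsgn b' * fsgn b * conj_rat (lookup (T (single (dag_lab \<circ> b) 1)) (dag_lab \<circ> b'))"
      unfolding slin_smul[OF sl] lookup_smul conj_rat_mult by (simp add: fsgn_def mult.assoc)
    also have "\<dots> = (if \<forall>kl. fst kl \<noteq> k \<longrightarrow> b' kl = b kl
        then sgnb k b * \<tau>' (\<lambda>l. b (k, l)) (\<lambda>l. b' (k, l)) else 0)"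
    proof (cases "lookup (T (single (dag_lab \<circ> b) 1)) (dag_lab \<circ> b') = 0")
      case True
      moreover have "sgnb k (dag_lab \<circ> b) \<noteq> 0" by (simp add: sgnb_def)
      moreover have "lookup (T (single (dag_lab \<circ> b) 1)) (dag_lab \<circ> b') = (if \<forall>kl. fst kl \<noteq> k \<longrightarrow> (dag_lab \<circ> b') kl = (dag_lab \<circ> b) kl
        then sgnb k (dag_lab \<circ> b) * \<tau> (\<lambda>l. (dag_lab \<circ> b) (k, l)) (\<lambda>l. (dag_lab \<circ> b') (k, l)) else 0)"
        using \<tau> b unfolding blockmat_def fgood_dag[symmetric, of N n b] by blast
      ultimately show ?thesis
        by (auto simp: \<tau>'_def split: if_splits)
    next
      case False
      note e = blockmat_elt[OF \<tau> iffD2[OF fgood_dag b] k False]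
      have b': "fgood N n b'" by (rule iffD1[OF fgood_dag e(1)])
      have off: "\<forall>kl. fst kl \<noteq> k \<longrightarrow> b' kl = b kl" using e(2) by simp
      have sg: "sgnb k (dag_lab \<circ> b) = sgnb k b" by (simp add: sgnb_def)
      have cnt: "card {kl. fst (b' kl) = E2} + bcount n (\<lambda>t. fst t = E2) (\<lambda>l. b (k, l))
          = card {kl. fst (b kl) = E2} + bcount n (\<lambda>t. fst t = E2) (\<lambda>l. b' (k, l))"
        using count_split_agree[where Q = "\<lambda>t. fst t = E2", OF b b' _ off, of "\<lambda>_. True"] by simp
      have "even (card {kl. fst (b' kl) = E2} + card {kl. fst (b kl) = E2})
        \<longleftrightarrow> even (bcount n (\<lambda>t. fst t = E2) (\<lambda>l. b (k, l)) + bcount n (\<lambda>t. fst t = E2) (\<lambda>l. b' (k, l)))"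
        using cnt by presburger
      then have "fsgn b' * fsgn b = E2s (\<lambda>l. b (k, l)) * E2s (\<lambda>l. b' (k, l))"
        unfolding fsgn_def E2s_def power_add[symmetric] by (simp add: minus_one_power_iff)
      then show ?thesis
        using off unfolding e(5) conj_rat_mult sg by (simp add: \<tau>'_def sgnb_def o_def mult_ac)
    qed
    finally show "lookup (dag_ferm (T (dag_ferm (single b 1)))) b' = (if \<forall>kl. fst kl \<noteq> k \<longrightarrow> b' kl = b kl
        then sgnb k b * \<tau>' (\<lambda>l. b (k, l)) (\<lambda>l. b' (k, l)) else 0)" .
  next
    fix x y assume x: "bgood n x" and "\<tau>' x y \<noteq> 0"
    then have "\<tau> (\<lambda>l. dag_lab (x l)) (\<lambda>l. dag_lab (y l)) \<noteq> 0" by (auto simp: \<tau>'_def)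
    then have *: "bgood n (\<lambda>l. dag_lab (y l))"
      "odd (bcount n oddst (\<lambda>l. dag_lab (x l)) + bcount n oddst (\<lambda>l. dag_lab (y l)))"
      "\<tau> (\<lambda>l. dag_lab (x l)) (\<lambda>l. dag_lab (y l)) \<in> Amin N n s"
      using \<tau> x unfolding blockmat_def bgood_dag[symmetric, of x] by blast+
    show "bgood n y" using *(1) by (simp add: bgood_dag)
    show "odd (bcount n oddst x + bcount n oddst y)" using *(2) by (simp add: bcount_def)
    show "\<tau>' x y \<in> Amin N n s"
      unfolding \<tau>'_def E2s_def by (intro Amin_mult Amin_sign Amin_conj *)
  qed
  then show ?thesis by (auto simp: blockop_def)
qed

section \<open>The operators Q and N as block operators\<close>

lemma Qp_blockop:
  assumes "k \<in> {1..N}"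
  shows "blockop N n (Amin N n (sval m n q)) k (Qp m n q k)"
proof -
  have "blockop N n (Amin N n (sval m n q)) k (emb (Q1 (sval m n q)) (k, l))" if "l \<in> {1..n}" for l
  proof (rule blockop_emb[OF that assms])
    have kl: "(k, l) \<in> {1..N} \<times> {1..n}" using assms that by simp
    fix t t' assume nz: "lookup (Q1 (sval m n q) (Bv (k, l)) t) t' \<noteq> 0"
    obtain st c where t: "t = (st, c)" by (cases t)
    show "oddst t' \<noteq> oddst t \<and> lookup (Q1 (sval m n q) (Bv (k, l)) t) t' \<in> Amin N n (sval m n q)"
      using nz unfolding t by (cases st)
        (auto simp: lookup_single when_def oddst_def intro!: pip_Amin(1)[OF kl] Amin_mult bet_Amin(1)[OF kl] split: if_splits)
  qed
  then have "blockop N n (Amin N n (sval m n q)) k (\<lambda>v. \<Sum>l=1..n. emb (Q1 (sval m n q)) (k, l) v)"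
    by (intro blockop_sum) auto
  moreover have "Qp m n q k = (\<lambda>v. \<Sum>l=1..n. emb (Q1 (sval m n q)) (k, l) v)"
    by (simp add: Qp_def fun_eq_iff sum_fun_apply)
  ultimately show ?thesis by simp
qed

lemma Np_blockop:
  assumes "k \<in> {1..N}"
  shows "blockop N n (Amin N n (sval m n q)) k (Np m n q k r)"
proof -
  let ?s = "sval m n q"
  have "blockop N n (Amin N n ?s) k (emb (h1 ?s) (k, l))" if "l \<in> {1..n}" for l
  proof (rule blockop_emb[OF that assms])
    have kl: "(k, l) \<in> {1..N} \<times> {1..n}" using assms that by simp
    fix t t' assume nz: "lookup (h1 ?s (Bv (k, l)) t) t' \<noteq> 0"
    obtain st c where t: "t = (st, c)" by (cases t)
    show "oddst t' \<noteq> oddst t \<and> lookup (h1 ?s (Bv (k, l)) t) t' \<in> Amin N n ?s"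
      using nz unfolding t by (cases st)
        (auto simp: lookup_single when_def oddst_def intro!: pip_Amin(2)[OF kl] Amin_mult bet_Amin(2)[OF kl] split: if_splits)
  qed
  then have h: "blockop N n (Amin N n ?s) k (\<lambda>v. smul (rc (1 / of_nat n)) (\<Sum>l=1..n. emb (h1 ?s) (k, l) v))"
    by (intro blockop_smul blockop_sum) auto
  \<comment> \<open>The eigenvalues of \<open>PS\<close> and \<open>Mp\<close> rewritten as
    functions of the labels of the single block k, the form required by
    \<open>blockop_diag\<close>.\<close>
  define P where "P x S = ((\<Prod>l\<in>S. of_bool (fst (x l :: plab) \<in> {Eb, E2})) * (\<Prod>l\<in>{1..n} - S. 1 - of_bool (fst (x l) \<in> {Eb, E2})) :: ratB)" for x S
  define \<gamma> where "\<gamma> x = rc (of_real (delm m q)) + (\<Sum>S | S \<subseteq> {1..n} \<and> S \<noteq> {}. P x S *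
        ((\<Sum>l\<in>S. kapp ?s (snd (x l)) (Bv (k, l))) - of_nat (card S)
         - rc (of_real (Bq q (card S) r)) * (\<Sum>l\<in>S. Kc (snd (x l)) (Bv (k, l)))))" for x :: "nat \<Rightarrow> plab"
  have \<gamma>: "\<gamma> x \<in> Amin N n ?s" for x
    unfolding \<gamma>_def P_def
  proof (intro Amin_add Amin_sum Amin_mult Amin_diff Amin_rc Amin_of_nat Amin_prod)
    fix S l assume "S \<in> {S. S \<subseteq> {1..n} \<and> S \<noteq> {}}" "l \<in> S"
    then have kl: "(k, l) \<in> {1..N} \<times> {1..n}" using assms by auto
    show "kapp ?s (snd (x l)) (Bv (k, l)) \<in> Amin N n ?s" by (rule kapp_Amin[OF kl])
    show "Kc (snd (x l)) (Bv (k, l)) \<in> Amin N n ?s" by (rule Kc_Amin[OF kl])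
  qed auto
  from blockop_diag[OF h, of "\<lambda>b. \<gamma> (\<lambda>l. b (k, l))" \<gamma>, OF refl \<gamma>]
  have "blockop N n (Amin N n ?s) k (\<lambda>v. hp m n q k (Mp m n q k r v))"
    by (simp add: hp_def[abs_def] Mp_def \<gamma>_def P_def PS_def Pj_def)
  from blockop_smul[OF this Amin_rc[of "-1"]] show ?thesis
    by (simp add: Np_def[abs_def] rc_uminus smul_minus_left)
qed

lemma Nm_blockop:
  assumes "k \<in> {1..N}"
  shows "blockop N n (Amin N n (sval m n q)) k (Nm m n q k r)"
  using blockop_dag[OF Np_blockop[OF assms] assms] by (simp add: Nm_def o_def)

section \<open>Operators on the total module\<close>

lemma lookup_tens: "lookup (tens F e) (\<mu>, A, b) = rc (lookup (lookup F A) \<mu>) * lookup e b"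
proof -
  define t where "t = rc (lookup (lookup F A) \<mu>) * lookup e b"
  have 1: "(\<Sum>b'\<in>keys e. lookup (single (\<mu>', A', b') (rc (lookup (lookup F A') \<mu>') * lookup e b')) (\<mu>, A, b))
      = (if \<mu>' = \<mu> then if A' = A then t else 0 else 0)" for \<mu>' A'
    by (cases "\<mu>' = \<mu>"; cases "A' = A") (auto simp: lookup_single when_def t_def in_keys_iff)
  have 2: "(\<Sum>\<mu>'\<in>keys (lookup F A'). if \<mu>' = \<mu> then if A' = A then t else 0 else 0) = (if A' = A then t else 0)" for A'
    by (auto simp: t_def in_keys_iff)
  show ?thesis
    unfolding tens_def lookup_sum 1 2 t_def[symmetric] by (auto simp: t_def in_keys_iff)
qed

lemma tens_add_left: "tens (F + G) e = tens F e + tens G e"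
  by (rule poly_mapping_eqI) (auto simp: lookup_tens lookup_add rc_add distrib_right)

lemma tens_zero [simp]: "tens 0 e = 0" "tens F 0 = 0"
  by (rule poly_mapping_eqI; auto simp: lookup_tens)+

lemma tens_sum_left: "tens (sum f I) e = (\<Sum>i\<in>I. tens (f i) e)"
  by (induction I rule: infinite_finite_induct) (auto simp: tens_add_left)

lemma tens_cscale: "tens (cscale c F) e = smul (rc c) (tens F e)"
  by (rule poly_mapping_eqI) (auto simp: lookup_tens lookup_cscale rc_mult mult.assoc)

lemma tens_uminus: "tens (- F) e = - tens F e" "tens F (- e) = - tens F e"
  by (rule poly_mapping_eqI; auto simp: lookup_tens rc_uminus)+

lemma slin_tens: "slin (tens F)"
  unfolding slin_def
  by (auto intro!: poly_mapping_eqI simp: lookup_tens lookup_add distrib_left mult.left_commute)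

lemma tens_single: "tens (single A (single \<mu> 1)) (single b r) = single (\<mu>, A, b) r"
proof (rule poly_mapping_eqI)
  fix x
  show "lookup (tens (single A (single \<mu> 1)) (single b r)) x = lookup (single (\<mu>, A, b) r) x"
    by (cases x; cases "A = fst (snd x)") (auto simp: lookup_tens lookup_single when_def)
qed

lemma pcl_expand:
  "F = (\<Sum>A\<in>keys F. \<Sum>\<mu>\<in>keys (lookup F A). cscale (lookup (lookup F A) \<mu>) (single A (single \<mu> 1)))"
proof -
  have "(\<Sum>\<mu>\<in>keys p. cscale (lookup p \<mu>) (single A (single \<mu> 1))) = single A p" for p :: psc and A
  proof (rule poly_mapping_eqI)
    fix B
    show "lookup (\<Sum>\<mu>\<in>keys p. cscale (lookup p \<mu>) (single A (single \<mu> 1))) B = lookup (single A p) B"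
      using poly_mapping_expand[of p]
      by (cases "A = B") (simp_all add: lookup_sum lookup_cscale lookup_single when_def)
  qed
  then show ?thesis
    using poly_mapping_expand[of F] by simp
qed

section \<open>The carrier of the total module\<close>

type_synonym tlab = "zmon \<times> gen set \<times> flab"

definition tgood :: "nat \<Rightarrow> nat \<Rightarrow> nat \<Rightarrow> tlab \<Rightarrow> bool" where
  "tgood m N n = (\<lambda>(\<mu>, A, b). keys \<mu> \<subseteq> UNIV \<times> {1..N} \<times> {1..m} \<and> A \<subseteq> UNIV \<times> {1..m} \<and> fgood N n b)"

text \<open>Restricts the labels but leaves the coefficients free in the field. Identities of
  \<open>slin\<close> operators are checked here on basis labels; \<open>Mcar\<close> adds that the
  coefficients lie in \<open>Amin\<close>.\<close>

abbreviation TG :: "nat \<Rightarrow> nat \<Rightarrow> nat \<Rightarrow> tot set" where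
  "TG m N n \<equiv> supp_in {x. tgood m N n x}"

lemma Mcar_iff: "v \<in> Mcar m N n q \<longleftrightarrow> v \<in> TG m N n \<and> (\<forall>x. lookup v x \<in> Amin N n (sval m n q))"
proof -
  have "(\<forall>x\<in>keys v. lookup v x \<in> Amin N n (sval m n q)) \<longleftrightarrow> (\<forall>x. lookup v x \<in> Amin N n (sval m n q))"
    by (metis Amin_zero in_keys_iff)
  moreover have "v \<in> Mcar m N n q \<longleftrightarrow> v \<in> TG m N n \<and> (\<forall>x\<in>keys v. lookup v x \<in> Amin N n (sval m n q))"
    unfolding Mcar_def supp_in_def tgood_def fgood_def by fastforce
  ultimately show ?thesis by blast
qed

lemma Mcar_TG: "v \<in> Mcar m N n q \<Longrightarrow> v \<in> TG m N n"
  by (simp add: Mcar_iff)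

lemma Mcar_zero [simp]: "0 \<in> Mcar m N n q"
  by (simp add: Mcar_iff)

lemma Mcar_add: "v \<in> Mcar m N n q \<Longrightarrow> w \<in> Mcar m N n q \<Longrightarrow> v + w \<in> Mcar m N n q"
  unfolding Mcar_iff lookup_add by (blast intro: supp_in_add Amin_add)

lemma Mcar_smul: "v \<in> Mcar m N n q \<Longrightarrow> r \<in> Amin N n (sval m n q) \<Longrightarrow> smul r v \<in> Mcar m N n q"
  unfolding Mcar_iff lookup_smul by (blast intro: supp_in_smul Amin_mult)

lemma Mcar_uminus: "v \<in> Mcar m N n q \<Longrightarrow> - v \<in> Mcar m N n q"
  unfolding Mcar_iff lookup_uminus by (blast intro: supp_in_uminus Amin_uminus)

lemma Mcar_sum: "(\<And>i. i \<in> I \<Longrightarrow> f i \<in> Mcar m N n q) \<Longrightarrow> sum f I \<in> Mcar m N n q"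
  by (induction I rule: infinite_finite_induct) (auto intro: Mcar_add)

lemma Mcar_mscale: "v \<in> Mcar m N n q \<Longrightarrow> mscale c v \<in> Mcar m N n q"
  unfolding mscale_def by (rule Mcar_smul) simp_all

lemma Mcar_tens:
  assumes "F \<in> PCl m N" "e \<in> supp_in {b. fgood N n b}" "\<And>b. lookup e b \<in> Amin N n (sval m n q)"
  shows "tens F e \<in> Mcar m N n q"
proof -
  have "tgood m N n x" if "lookup (tens F e) x \<noteq> 0" for x
  proof -
    obtain \<mu> A b where x: "x = (\<mu>, A, b)" by (cases x)
    have nz: "lookup (lookup F A) \<mu> \<noteq> 0" "lookup e b \<noteq> 0"
      using that by (auto simp: x lookup_tens)
    then have "lookup F A \<noteq> 0" by auto
    then have "A \<subseteq> UNIV \<times> {1..m}" using assms(1) by (auto simp: PCl_iff dest: supp_inD)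
    moreover have "keys \<mu> \<subseteq> UNIV \<times> {1..N} \<times> {1..m}"
      using PCl_lookup[OF assms(1), of A] nz(1) unfolding Psc_supp_in by (auto dest: supp_inD)
    moreover have "fgood N n b" using assms(2) nz(2) by (auto dest: supp_inD)
    ultimately show ?thesis by (simp add: tgood_def x)
  qed
  moreover have "lookup (tens F e) x \<in> Amin N n (sval m n q)" for x
    using assms(3) by (cases x) (simp add: lookup_tens Amin_mult)
  ultimately show ?thesis by (auto simp: Mcar_iff intro: supp_inI)
qed

lemma slin_gtens: "slin (gtens d X Y)"
  unfolding gtens_def by (rule slin_lext)

lemma gtens_single:
  "gtens d X Y (single (\<mu>, A, b) 1)
     = smul ((-1) ^ (d * card A)) (tens (X (single A (single \<mu> 1))) (Y \<mu> (single b 1)))"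
  by (simp add: gtens_def)

lemma tgood_PCl: "tgood m N n (\<mu>, A, b) \<Longrightarrow> single A (single \<mu> 1) \<in> PCl m N"
  by (auto simp: tgood_def intro!: PCl_single Psc_single)

lemma semilinear_Mcar:
  assumes "\<And>v. f v = (\<Sum>x\<in>keys v. smul (\<rho> (lookup v x)) (g x))"
    and "\<And>x. tgood m N n x \<Longrightarrow> g x \<in> Mcar m N n q"
    and "\<And>r. r \<in> Amin N n (sval m n q) \<Longrightarrow> \<rho> r \<in> Amin N n (sval m n q)" "v \<in> Mcar m N n q"
  shows "f v \<in> Mcar m N n q"
  unfolding assms(1)
proof (intro Mcar_sum Mcar_smul)
  fix x assume "x \<in> keys v"
  then have "tgood m N n x" using assms(4) by (auto simp: Mcar_iff supp_in_def)
  then show "g x \<in> Mcar m N n q" by (rule assms(2))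
  show "\<rho> (lookup v x) \<in> Amin N n (sval m n q)" using assms(3)[of "lookup v x"] assms(4) unfolding Mcar_iff by blast
qed

lemma slin_Mcar:
  assumes "slin f" "\<And>x. tgood m N n x \<Longrightarrow> f (single x 1) \<in> Mcar m N n q" "v \<in> Mcar m N n q"
  shows "f v \<in> Mcar m N n q"
  by (rule semilinear_Mcar[where \<rho> = "\<lambda>r. r" and g = "\<lambda>x. f (single x 1)",
        OF slin_expand[OF assms(1)] assms(2) _ assms(3)])

lemma gtens_Mcar:
  assumes "\<And>F. F \<in> PCl m N \<Longrightarrow> X F \<in> PCl m N"
    and "\<And>\<mu> b b'. fgood N n b \<Longrightarrow> lookup (Y \<mu> (single b 1)) b' \<noteq> 0
      \<Longrightarrow> fgood N n b' \<and> lookup (Y \<mu> (single b 1)) b' \<in> Amin N n (sval m n q)"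
    and "v \<in> Mcar m N n q"
  shows "gtens d X Y v \<in> Mcar m N n q"
proof (rule slin_Mcar[OF slin_gtens _ assms(3)])
  fix x assume x: "tgood m N n x"
  obtain \<mu> A b where xe: "x = (\<mu>, A, b)" by (cases x)
  then have b: "fgood N n b" using x by (simp add: tgood_def)
  have "lookup (Y \<mu> (single b 1)) b' \<in> Amin N n (sval m n q)" for b'
    using assms(2)[OF b, of \<mu> b'] by (cases "lookup (Y \<mu> (single b 1)) b' = 0") auto
  moreover have "Y \<mu> (single b 1) \<in> supp_in {b. fgood N n b}"
    using assms(2)[OF b] by (intro supp_inI) auto
  ultimately show "gtens d X Y (single x 1) \<in> Mcar m N n q"
    using x unfolding xe gtens_single
    by (intro Mcar_smul Mcar_tens Amin_sign) (auto intro: assms(1) tgood_PCl)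
qed

text \<open>\<open>gtens\<close> is fixed on basis vectors, where both the sign and the second
  operator depend on the label. On a general tensor it factorizes once the second operator is
  constant on the monomials of F and the labels of F have one parity.\<close>

lemma gtens_tens:
  assumes F: "F \<in> PCl m N" and X: "PLin m N X" and Y0: "slin Y0"
    and Y: "\<And>A \<mu>. \<mu> \<in> keys (lookup F A) \<Longrightarrow> Y \<mu> = Y0"
    and par: "\<And>A. A \<in> keys F \<Longrightarrow> (-1 :: ratB) ^ (d * card A) = \<sigma>"
  shows "gtens d X Y (tens F e) = smul \<sigma> (tens (X F) (Y0 e))"
proof -
  let ?c = "\<lambda>A \<mu>. lookup (lookup F A) \<mu>"
  have e_PCl: "single A (single \<mu> 1) \<in> PCl m N" if "A \<in> keys F" "\<mu> \<in> keys (lookup F A)" for A \<mu>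
    using F that by (auto simp: PCl_def Psc_def intro!: PCl_single Psc_single)
  have "X F = X (\<Sum>A\<in>keys F. \<Sum>\<mu>\<in>keys (lookup F A). cscale (?c A \<mu>) (single A (single \<mu> 1)))"
    using pcl_expand[of F] by simp
  also have "\<dots> = (\<Sum>A\<in>keys F. X (\<Sum>\<mu>\<in>keys (lookup F A). cscale (?c A \<mu>) (single A (single \<mu> 1))))"
    by (intro PLin_sum[OF X] PCl_sum PCl_cscale e_PCl)
  also have "\<dots> = (\<Sum>A\<in>keys F. \<Sum>\<mu>\<in>keys (lookup F A). cscale (?c A \<mu>) (X (single A (single \<mu> 1))))"
  proof (intro sum.cong refl)
    fix A assume A: "A \<in> keys F"
    have "X (\<Sum>\<mu>\<in>keys (lookup F A). cscale (?c A \<mu>) (single A (single \<mu> 1)))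
        = (\<Sum>\<mu>\<in>keys (lookup F A). X (cscale (?c A \<mu>) (single A (single \<mu> 1))))"
      using A by (intro PLin_sum[OF X] PCl_cscale e_PCl)
    also have "\<dots> = (\<Sum>\<mu>\<in>keys (lookup F A). cscale (?c A \<mu>) (X (single A (single \<mu> 1))))"
      using A by (intro sum.cong refl PLin_cscale[OF X] e_PCl)
    finally show "X (\<Sum>\<mu>\<in>keys (lookup F A). cscale (?c A \<mu>) (single A (single \<mu> 1)))
        = (\<Sum>\<mu>\<in>keys (lookup F A). cscale (?c A \<mu>) (X (single A (single \<mu> 1))))" .
  qed
  finally have XF: "X F = (\<Sum>A\<in>keys F. \<Sum>\<mu>\<in>keys (lookup F A). cscale (?c A \<mu>) (X (single A (single \<mu> 1))))" .
  have "tens F e = (\<Sum>A\<in>keys F. \<Sum>\<mu>\<in>keys (lookup F A). \<Sum>b\<in>keys e.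
      smul (rc (?c A \<mu>) * lookup e b) (single (\<mu>, A, b) 1))"
    by (simp add: tens_def)
  then have "gtens d X Y (tens F e) = (\<Sum>A\<in>keys F. \<Sum>\<mu>\<in>keys (lookup F A). \<Sum>b\<in>keys e.
      smul (rc (?c A \<mu>) * lookup e b) (gtens d X Y (single (\<mu>, A, b) 1)))"
    by (simp only: slin_sum[OF slin_gtens] slin_smul[OF slin_gtens])
  also have "\<dots> = (\<Sum>A\<in>keys F. \<Sum>\<mu>\<in>keys (lookup F A). \<Sum>b\<in>keys e.
      smul \<sigma> (smul (rc (?c A \<mu>)) (smul (lookup e b) (tens (X (single A (single \<mu> 1))) (Y0 (single b 1))))))"
    by (intro sum.cong refl) (simp add: gtens_single par Y mult_ac)
  also have "\<dots> = smul \<sigma> (\<Sum>A\<in>keys F. \<Sum>\<mu>\<in>keys (lookup F A). smul (rc (?c A \<mu>)) (tens (X (single A (single \<mu> 1))) (Y0 e)))"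
    by (subst slin_expand[OF Y0, of e]) (simp only: slin_sum[OF slin_tens] slin_smul[OF slin_tens] smul_sum)
  also have "\<dots> = smul \<sigma> (tens (X F) (Y0 e))"
    by (simp only: XF tens_sum_left tens_cscale)
  finally show ?thesis .
qed

lemma neg_one_power_psc: "(-1) ^ k * p = (-1) ^ l * p \<Longrightarrow> (p :: psc) \<noteq> 0 \<Longrightarrow> even k \<longleftrightarrow> even l"
proof -
  assume eq: "(-1) ^ k * p = (-1) ^ l * p" and "p \<noteq> 0"
  have "p \<noteq> - p"
  proof
    assume "p = - p"
    then have "lookup p \<mu> = - lookup p \<mu>" for \<mu> by (metis lookup_uminus)
    then have "p = 0" by (intro poly_mapping_eqI) (simp add: eq_neg_iff_add_eq_0)
    with \<open>p \<noteq> 0\<close> show False ..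
  qed
  then show ?thesis
    using eq by (auto simp: minus_one_power_iff split: if_splits)
qed

lemma gpar_keys:
  assumes "gpar F = smul ((-1) ^ p) F" "A \<in> keys F"
  shows "even (card A) \<longleftrightarrow> even p"
  using arg_cong[OF assms(1), of "\<lambda>G. lookup G A"] assms(2)
  by (intro neg_one_power_psc[of "card A" "lookup F A"]) (auto simp: lookup_gpar in_keys_iff)

lemma gpar_single: "gpar (single A p) = smul ((-1) ^ card A) (single A p)"
  by (simp add: gpar_def mult.commute)

text \<open>A basis label is an eigenvector of \<open>gpar\<close>, and so is its image under an
  operator anticommuting with \<open>gpar\<close>, with opposite eigenvalue. All labels of the image
  therefore have the opposite parity.\<close>

lemma odd_map_keys:
  assumes X: "PLin m N X" and e: "single A (single \<mu> 1) \<in> PCl m N"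
    and odd: "gpar (X (single A (single \<mu> 1))) = - X (gpar (single A (single \<mu> 1)))"
    and B: "B \<in> keys (X (single A (single \<mu> 1)))"
  shows "even (card B) \<longleftrightarrow> odd (card A)"
proof -
  let ?e = "single A (single \<mu> 1) :: pcl"
  have "(-1) ^ card A = pconst ((-1) ^ card A)"
    by (cases "even (card A)") (auto simp: pconst_def single_uminus)
  then have "gpar ?e = cscale ((-1) ^ card A) ?e"
    unfolding gpar_single cscale_def by simp
  then have "gpar (X ?e) = - cscale ((-1) ^ card A) (X ?e)"
    using odd by (simp add: PLin_cscale[OF X e])
  also have "\<dots> = smul ((-1) ^ Suc (card A)) (X ?e)"
    using \<open>(-1) ^ card A = pconst ((-1) ^ card A)\<close> by (simp add: cscale_def smul_minus_left)
  finally show ?thesis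
    using gpar_keys[OF _ B, of "Suc (card A)"] by simp
qed

lemma nplus_PLin: "N \<le> m \<Longrightarrow> i \<in> {1..N} \<Longrightarrow> PLin m N (nplus m N i)"
  by (simp add: PLin_def nplus_PCl nplus_add nplus_cscale)

lemma nminusC_PLin: "N \<le> m \<Longrightarrow> i \<in> {1..N} \<Longrightarrow> PLin m N (nminusC m N i)"
  by (simp add: PLin_def nminusC_PCl nminusC_add nminusC_cscale)

text \<open>The first operator contributes the sign of A, the second that of a label of opposite
  parity, which gives -1 in total. Constancy of Y' on the monomials of the image permits evaluating
  it at the original \<open>\<mu>\<close>.\<close>

lemma gtens_gtens_odd:
  assumes x: "tgood m N n (\<mu>, A, b)"
    and X: "PLin m N X" "gpar (X (single A (single \<mu> 1))) = - X (gpar (single A (single \<mu> 1)))"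
    and X': "PLin m N X'" and Y': "slin (Y' \<mu>)"
    and deg: "\<And>B \<nu>. \<nu> \<in> keys (lookup (X (single A (single \<mu> 1))) B) \<Longrightarrow> Y' \<nu> = Y' \<mu>"
  shows "gtens 1 X' Y' (gtens 1 X Y (single (\<mu>, A, b) 1))
    = - tens (X' (X (single A (single \<mu> 1)))) (Y' \<mu> (Y \<mu> (single b 1)))"
proof -
  let ?e = "single A (single \<mu> 1) :: pcl"
  have e: "?e \<in> PCl m N" using x by (rule tgood_PCl)
  have "gtens 1 X' Y' (tens (X ?e) (Y \<mu> (single b 1)))
      = smul ((-1) ^ Suc (card A)) (tens (X' (X ?e)) (Y' \<mu> (Y \<mu> (single b 1))))"
  proof (rule gtens_tens[OF PLin_PCl[OF X(1) e] X' Y' deg])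
    fix B assume "B \<in> keys (X ?e)"
    then have "even (card B) \<longleftrightarrow> odd (card A)" by (rule odd_map_keys[OF X(1) e X(2)])
    then show "(-1 :: ratB) ^ (1 * card B) = (-1) ^ Suc (card A)"
      by (simp add: minus_one_power_iff)
  qed
  then show ?thesis
    unfolding gtens_single
    by (simp add: slin_smul[OF slin_gtens] smul_minus_left smul_minus flip: power_add)
qed

section \<open>The transport generators\<close>

lemma Hp_slin: "slin (Hp m N n q i)"
  and Hm_slin: "slin (Hm m N n q i)"
  by (simp_all add: Hp_def Hm_def slin_gtens)

lemma Hp_Mcar:
  assumes "N \<le> m" "i \<in> {1..N}" "v \<in> Mcar m N n q"
  shows "Hp m N n q i v \<in> Mcar m N n q"
  unfolding Hp_def
  using assms blockop_elt(1,3)[OF Np_blockop[OF assms(2)] _ assms(2)]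
  by (intro gtens_Mcar) (auto intro: nplus_PCl)

lemma Hm_Mcar:
  assumes "N \<le> m" "i \<in> {1..N}" "v \<in> Mcar m N n q"
  shows "Hm m N n q i v \<in> Mcar m N n q"
  unfolding Hm_def
  using assms blockop_elt(1,3)[OF Nm_blockop[OF assms(2)] _ assms(2)]
  by (intro gtens_Mcar) (auto intro: nminusC_PCl)

lemma slin_TG_eqI:
  assumes "slin f" "slin g" "v \<in> TG m N n"
    "\<And>\<mu> A b. tgood m N n (\<mu>, A, b) \<Longrightarrow> f (single (\<mu>, A, b) 1) = g (single (\<mu>, A, b) 1)"
  shows "f v = g v"
  by (rule slin_eqI[OF assms(1,2)]) (use assms(3,4) in \<open>auto simp: supp_in_def\<close>)

text \<open>For different labels the bosonic and the fermionic factors both anticommute and the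
  signs cancel. For equal labels n_i^+ anticommutes with itself, so its square is 0.\<close>

lemma Hp_Hp:
  assumes "N \<le> m" "i \<in> {1..N}" "j \<in> {1..N}" "v \<in> TG m N n"
  shows "Hp m N n q i (Hp m N n q j v) = Hp m N n q j (Hp m N n q i v)"
    and "Hp m N n q i (Hp m N n q i v) = 0"
proof -
  have eq: "Hp m N n q i (Hp m N n q j (single (\<mu>, A, b) 1))
      = - tens (nplus m N i (nplus m N j (single A (single \<mu> 1))))
          (Np m n q i (edeg m True i \<mu>) (Np m n q j (edeg m True j \<mu>) (single b 1)))"
    if "tgood m N n (\<mu>, A, b)" "i \<in> {1..N}" "j \<in> {1..N}" for \<mu> A b i j
    unfolding Hp_def using assms(1) that tgood_PCl[OF that(1)] nplus_edeg(1)[OF assms(1) tgood_PCl[OF that(1)] that(3,2)]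
    by (intro gtens_gtens_odd[OF that(1)])
      (auto simp: nplus_PLin nplus_gpar intro: blockop_slin[OF Np_blockop])
  have sq: "Hp m N n q i (Hp m N n q i (single (\<mu>, A, b) 1)) = 0" if x: "tgood m N n (\<mu>, A, b)" "i \<in> {1..N}" for \<mu> A b i
  proof -
    have "nplus m N i (nplus m N i (single A (single \<mu> 1))) + nplus m N i (nplus m N i (single A (single \<mu> 1))) = 0"
      using nplus_nplus[OF assms(1) tgood_PCl[OF x(1)] x(2) x(2)] by (simp only: eq_neg_iff_add_eq_0)
    then have "nplus m N i (nplus m N i (single A (single \<mu> 1))) = 0" by (rule pcl_double_zero)
    then show ?thesis by (simp add: eq[OF x x(2)])
  qed
  have sl: "slin (\<lambda>v. Hp m N n q i (Hp m N n q j v))" for i j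
    by (rule slin_comp[OF Hp_slin Hp_slin])
  have "slin (\<lambda>v. 0 :: tot)" by (simp add: slin_def)
  then show "Hp m N n q i (Hp m N n q i v) = 0"
    by (rule slin_TG_eqI[OF sl _ assms(4)]) (rule sq[OF _ assms(2)])
  show "Hp m N n q i (Hp m N n q j v) = Hp m N n q j (Hp m N n q i v)"
  proof (cases "i = j")
    case False
    show ?thesis
    proof (rule slin_TG_eqI[OF sl sl assms(4)])
      fix \<mu> A b assume x: "tgood m N n (\<mu>, A, b)"
      have sb: "single b 1 \<in> supp_in {b. fgood N n b}" using x by (simp add: tgood_def supp_in_single)
      have "Np m n q i (edeg m True i \<mu>) (Np m n q j (edeg m True j \<mu>) (single b 1))
          = - Np m n q j (edeg m True j \<mu>) (Np m n q i (edeg m True i \<mu>) (single b 1))"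
        by (rule blockop_anticommute[OF Np_blockop[OF assms(3)] Np_blockop[OF assms(2)] assms(3,2) _ sb])
          (use False in simp)
      then show "Hp m N n q i (Hp m N n q j (single (\<mu>, A, b) 1)) = Hp m N n q j (Hp m N n q i (single (\<mu>, A, b) 1))"
        by (simp add: eq[OF x assms(2,3)] eq[OF x assms(3,2)] nplus_nplus[OF assms(1) tgood_PCl[OF x] assms(2,3)] tens_uminus)
    qed
  qed simp
qed

lemma Hm_Hm:
  assumes "N \<le> m" "i \<in> {1..N}" "j \<in> {1..N}" "v \<in> TG m N n"
  shows "Hm m N n q i (Hm m N n q j v) = Hm m N n q j (Hm m N n q i v)"
    and "Hm m N n q i (Hm m N n q i v) = 0"
proof -
  have eq: "Hm m N n q i (Hm m N n q j (single (\<mu>, A, b) 1))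
      = - tens (nminusC m N i (nminusC m N j (single A (single \<mu> 1))))
          (Nm m n q i (edeg m False i \<mu>) (Nm m n q j (edeg m False j \<mu>) (single b 1)))"
    if "tgood m N n (\<mu>, A, b)" "i \<in> {1..N}" "j \<in> {1..N}" for \<mu> A b i j
    unfolding Hm_def using assms(1) that tgood_PCl[OF that(1)] nminusC_edeg(1)[OF assms(1) tgood_PCl[OF that(1)] that(3,2)]
    by (intro gtens_gtens_odd[OF that(1)])
      (auto simp: nminusC_PLin nminusC_gpar intro: blockop_slin[OF Nm_blockop])
  have sq: "Hm m N n q i (Hm m N n q i (single (\<mu>, A, b) 1)) = 0" if x: "tgood m N n (\<mu>, A, b)" "i \<in> {1..N}" for \<mu> A b i
  proof -
    have "nminusC m N i (nminusC m N i (single A (single \<mu> 1))) + nminusC m N i (nminusC m N i (single A (single \<mu> 1))) = 0"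
      using nminusC_nminusC[OF assms(1) tgood_PCl[OF x(1)] x(2) x(2)] by (simp only: eq_neg_iff_add_eq_0)
    then have "nminusC m N i (nminusC m N i (single A (single \<mu> 1))) = 0" by (rule pcl_double_zero)
    then show ?thesis by (simp add: eq[OF x x(2)])
  qed
  have sl: "slin (\<lambda>v. Hm m N n q i (Hm m N n q j v))" for i j
    by (rule slin_comp[OF Hm_slin Hm_slin])
  have "slin (\<lambda>v. 0 :: tot)" by (simp add: slin_def)
  then show "Hm m N n q i (Hm m N n q i v) = 0"
    by (rule slin_TG_eqI[OF sl _ assms(4)]) (rule sq[OF _ assms(2)])
  show "Hm m N n q i (Hm m N n q j v) = Hm m N n q j (Hm m N n q i v)"
  proof (cases "i = j")
    case False
    show ?thesis
    proof (rule slin_TG_eqI[OF sl sl assms(4)])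
      fix \<mu> A b assume x: "tgood m N n (\<mu>, A, b)"
      have sb: "single b 1 \<in> supp_in {b. fgood N n b}" using x by (simp add: tgood_def supp_in_single)
      have "Nm m n q i (edeg m False i \<mu>) (Nm m n q j (edeg m False j \<mu>) (single b 1))
          = - Nm m n q j (edeg m False j \<mu>) (Nm m n q i (edeg m False i \<mu>) (single b 1))"
        by (rule blockop_anticommute[OF Nm_blockop[OF assms(3)] Nm_blockop[OF assms(2)] assms(3,2) _ sb])
          (use False in simp)
      then show "Hm m N n q i (Hm m N n q j (single (\<mu>, A, b) 1)) = Hm m N n q j (Hm m N n q i (single (\<mu>, A, b) 1))"
        by (simp add: eq[OF x assms(2,3)] eq[OF x assms(3,2)] nminusC_nminusC[OF assms(1) tgood_PCl[OF x] assms(2,3)] tens_uminus)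
    qed
  qed simp
qed

text \<open>Distinct labels enter twice: they make the fermionic blocks disjoint, and they keep the
  degree in the conjugate variables of label i fixed under n_j^- and the degree in z_j fixed under
  n_i^+.\<close>

lemma Hp_Hm:
  assumes "N \<le> m" "i \<in> {1..N}" "j \<in> {1..N}" "i \<noteq> j" "v \<in> TG m N n"
  shows "Hp m N n q i (Hm m N n q j v) = Hm m N n q j (Hp m N n q i v)"
proof (rule slin_TG_eqI[OF slin_comp[OF Hp_slin Hm_slin] slin_comp[OF Hm_slin Hp_slin] assms(5)])
  fix \<mu> A b assume x: "tgood m N n (\<mu>, A, b)"
  note e = tgood_PCl[OF x]
  have 1: "Hp m N n q i (Hm m N n q j (single (\<mu>, A, b) 1))
      = - tens (nplus m N i (nminusC m N j (single A (single \<mu> 1))))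
          (Np m n q i (edeg m True i \<mu>) (Nm m n q j (edeg m False j \<mu>) (single b 1)))"
    unfolding Hp_def Hm_def using assms e nminusC_edeg(2)[OF assms(1) e assms(3,2)]
    by (intro gtens_gtens_odd[OF x])
      (auto simp: nplus_PLin nminusC_PLin nminusC_gpar intro: blockop_slin[OF Np_blockop])
  have 2: "Hm m N n q j (Hp m N n q i (single (\<mu>, A, b) 1))
      = - tens (nminusC m N j (nplus m N i (single A (single \<mu> 1))))
          (Nm m n q j (edeg m False j \<mu>) (Np m n q i (edeg m True i \<mu>) (single b 1)))"
    unfolding Hp_def Hm_def using assms e nplus_edeg(2)[OF assms(1) e assms(2,3)]
    by (intro gtens_gtens_odd[OF x])
      (auto simp: nplus_PLin nminusC_PLin nplus_gpar intro: blockop_slin[OF Nm_blockop])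
  have sb: "single b 1 \<in> supp_in {b. fgood N n b}" using x by (simp add: tgood_def supp_in_single)
  have "Nm m n q j (edeg m False j \<mu>) (Np m n q i (edeg m True i \<mu>) (single b 1))
      = - Np m n q i (edeg m True i \<mu>) (Nm m n q j (edeg m False j \<mu>) (single b 1))"
    by (rule blockop_anticommute[OF Np_blockop[OF assms(2)] Nm_blockop[OF assms(3)] assms(2,3,4) sb])
  then show "Hp m N n q i (Hm m N n q j (single (\<mu>, A, b) 1)) = Hm m N n q j (Hp m N n q i (single (\<mu>, A, b) 1))"
    by (simp add: 1 2 nplus_nminusC[OF assms(1) e assms(2,3)] tens_uminus)
qed

section \<open>Parity of the operators\<close>

definition tpar :: "tlab \<Rightarrow> nat" where
  "tpar = (\<lambda>(\<mu>, A, b). card A + fpar b)"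

lemma lookup_grading: "lookup (grading v) x = (-1) ^ tpar x * lookup v x"
proof -
  have "lookup (grading v) x = (\<Sum>y\<in>keys v. if y = x then (-1) ^ tpar x * lookup v x else 0)"
    unfolding grading_def lookup_lext
    by (intro sum.cong refl) (auto simp: lookup_single when_def tpar_def)
  then show ?thesis by (auto simp: in_keys_iff)
qed

lemma slin_grading: "slin grading"
  unfolding grading_def by (rule slin_lext)

lemma grading_grading [simp]: "grading (grading v) = v"
  by (rule poly_mapping_eqI) (simp add: lookup_grading flip: power_add mult.assoc)

lemma grading_Mcar: "v \<in> Mcar m N n q \<Longrightarrow> grading v \<in> Mcar m N n q"
  by (auto simp: Mcar_iff lookup_grading intro: Amin_mult Amin_sign intro!: supp_inI dest: supp_inD)

text \<open>Stated with a sign-compatible \<open>\<rho>\<close> so that linear operators and the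
  antilinear \<open>dag\<close> are both covered; d is the parity of f.\<close>

lemma semilinear_grading:
  assumes f: "\<And>v. f v = (\<Sum>x\<in>keys v. smul (\<rho> (lookup v x)) (g x))"
    and \<rho>: "\<And>k r. \<rho> ((-1) ^ k * r) = (-1) ^ k * \<rho> r"
    and par: "\<And>x y. tgood m N n x \<Longrightarrow> lookup (g x) y \<noteq> 0 \<Longrightarrow> even (tpar y + tpar x + d)"
    and v: "v \<in> TG m N n"
  shows "grading (f v) = smul ((-1) ^ d) (f (grading v))"
proof (rule poly_mapping_eqI)
  fix y
  have keys: "keys (grading v) = keys v"
    by (auto simp: in_keys_iff lookup_grading)
  have *: "(-1) ^ tpar y * (\<rho> (lookup v x) * lookup (g x) y) = (-1) ^ d * ((-1) ^ tpar x * \<rho> (lookup v x) * lookup (g x) y)"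
    if "x \<in> keys v" for x
  proof (cases "lookup (g x) y = 0")
    case False
    have "tgood m N n x" using v that by (auto simp: supp_in_def)
    then have "(-1 :: ratB) ^ tpar y = (-1) ^ d * (-1) ^ tpar x"
    proof -
      have "even (tpar y) \<longleftrightarrow> even (d + tpar x)" using par[OF \<open>tgood m N n x\<close> False] by presburger
      then have "(-1 :: ratB) ^ tpar y = (-1) ^ (d + tpar x)" by (simp only: minus_one_power_iff)
      then show ?thesis by (simp only: power_add)
    qed
    then show ?thesis by (simp add: mult_ac)
  qed simp
  show "lookup (grading (f v)) y = lookup (smul ((-1) ^ d) (f (grading v))) y"
    by (simp add: lookup_grading f keys lookup_sum \<rho> sum_distrib_left) (intro sum.cong refl *)
qed

lemma slin_grading_comm:
  assumes "slin f" "\<And>x y. tgood m N n x \<Longrightarrow> lookup (f (single x 1)) y \<noteq> 0 \<Longrightarrow> even (tpar y + tpar x + d)"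
    and "v \<in> TG m N n"
  shows "grading (f v) = smul ((-1) ^ d) (f (grading v))"
  by (rule semilinear_grading[where \<rho> = "\<lambda>r. r" and g = "\<lambda>x. f (single x 1)",
        OF slin_expand[OF assms(1)] refl assms(2,3)])

lemma gtens_parity:
  assumes "\<And>B. B \<in> keys (X (single A (single \<mu> 1))) \<Longrightarrow> even (card B + card A + d1)"
    and "\<And>b'. lookup (Y \<mu> (single b 1)) b' \<noteq> 0 \<Longrightarrow> even (fpar b' + fpar b + d2)"
    and "lookup (gtens d X Y (single (\<mu>, A, b) 1)) y \<noteq> 0"
  shows "even (tpar y + tpar (\<mu>, A, b) + (d1 + d2))"
proof -
  obtain \<nu> B b' where y: "y = (\<nu>, B, b')" by (cases y)
  have "lookup (lookup (X (single A (single \<mu> 1))) B) \<nu> \<noteq> 0" and 2: "lookup (Y \<mu> (single b 1)) b' \<noteq> 0"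
    using assms(3) unfolding gtens_single y lookup_smul lookup_tens by auto
  then have 1: "B \<in> keys (X (single A (single \<mu> 1)))" by (auto simp: in_keys_iff)
  show ?thesis
    using assms(1)[OF 1] assms(2)[OF 2] by (simp add: y tpar_def) presburger
qed

lemma Hp_grading:
  assumes "N \<le> m" "i \<in> {1..N}" "v \<in> TG m N n"
  shows "grading (Hp m N n q i v) = Hp m N n q i (grading v)"
proof -
  have "even (tpar y + tpar x + 2)" if x: "tgood m N n x" and nz: "lookup (Hp m N n q i (single x 1)) y \<noteq> 0" for x y
  proof -
    obtain \<mu> A b where xe: "x = (\<mu>, A, b)" by (cases x)
    note e = tgood_PCl[OF x[unfolded xe]]
    have b: "fgood N n b" using x by (simp add: xe tgood_def)
    have "even (tpar y + tpar (\<mu>, A, b) + (1 + 1))"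
    proof (rule gtens_parity)
      show "lookup (gtens 1 (nplus m N i) (\<lambda>\<mu>. Np m n q i (edeg m True i \<mu>)) (single (\<mu>, A, b) 1)) y \<noteq> 0"
        using nz by (simp add: Hp_def xe)
      show "even (card B + card A + 1)" if "B \<in> keys (nplus m N i (single A (single \<mu> 1)))" for B
        using odd_map_keys[OF nplus_PLin[OF assms(1,2)] e _ that] nplus_gpar[OF assms(1) e assms(2)] by simp
      show "even (fpar b' + fpar b + 1)" if "lookup (Np m n q i (edeg m True i \<mu>) (single b 1)) b' \<noteq> 0" for b'
        using blockop_elt(2)[OF Np_blockop[OF assms(2)] b assms(2) that] by simp
    qed
    then show ?thesis by (simp add: xe)
  qed
  from slin_grading_comm[OF Hp_slin this assms(3)] show ?thesis by simp
qed

lemma Hm_grading: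
  assumes "N \<le> m" "i \<in> {1..N}" "v \<in> TG m N n"
  shows "grading (Hm m N n q i v) = Hm m N n q i (grading v)"
proof -
  have "even (tpar y + tpar x + 2)" if x: "tgood m N n x" and nz: "lookup (Hm m N n q i (single x 1)) y \<noteq> 0" for x y
  proof -
    obtain \<mu> A b where xe: "x = (\<mu>, A, b)" by (cases x)
    note e = tgood_PCl[OF x[unfolded xe]]
    have b: "fgood N n b" using x by (simp add: xe tgood_def)
    have "even (tpar y + tpar (\<mu>, A, b) + (1 + 1))"
    proof (rule gtens_parity)
      show "lookup (gtens 1 (nminusC m N i) (\<lambda>\<mu>. Nm m n q i (edeg m False i \<mu>)) (single (\<mu>, A, b) 1)) y \<noteq> 0"
        using nz by (simp add: Hm_def xe)
      show "even (card B + card A + 1)" if "B \<in> keys (nminusC m N i (single A (single \<mu> 1)))" for B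
        using odd_map_keys[OF nminusC_PLin[OF assms(1,2)] e _ that] nminusC_gpar[OF assms(1) e assms(2)] by simp
      show "even (fpar b' + fpar b + 1)" if "lookup (Nm m n q i (edeg m False i \<mu>) (single b 1)) b' \<noteq> 0" for b'
        using blockop_elt(2)[OF Nm_blockop[OF assms(2)] b assms(2) that] by simp
    qed
    then show ?thesis by (simp add: xe)
  qed
  from slin_grading_comm[OF Hm_slin this assms(3)] show ?thesis by simp
qed

lemma dZ_PLin: "k \<in> {1..N} \<Longrightarrow> PLin m N (dZ m k)"
  unfolding PLin_def dZ_def
  by (auto simp: cw_add slin_pd slin_add[OF slin_clmul] sum.distrib cw_cscale slin_cscale[OF slin_clmul] cscale_sum
      slin_zero pd_Psc intro!: PCl_sum PCl_clmul PCl_cw)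

lemma dZ_gpar: "F \<in> FinL \<Longrightarrow> gpar (dZ m k F) = - dZ m k (gpar F)"
  by (simp add: dZ_def slin_sum[OF slin_gpar] gpar_clmul cw_supp_in slin_zero slin_pd cw_gpar sum_negf)

lemma Ap_slin: "slin (Ap m n q k)"
proof -
  have "slin (\<lambda>v. gtens 0 (dZ m k) (\<lambda>_. id) v + gtens 1 id (\<lambda>_. Qp m n q k) v)"
    by (intro slin_plus slin_gtens)
  then show ?thesis by (simp add: Ap_def plus_fun_def)
qed

lemma Ap_Mcar:
  assumes "k \<in> {1..N}" "v \<in> Mcar m N n q"
  shows "Ap m n q k v \<in> Mcar m N n q"
proof -
  have "gtens 0 (dZ m k) (\<lambda>_. id) v \<in> Mcar m N n q"
    by (rule gtens_Mcar[OF _ _ assms(2)])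
      (auto simp: PLin_PCl[OF dZ_PLin[OF assms(1)]] lookup_single when_def split: if_splits)
  moreover have "gtens 1 id (\<lambda>_. Qp m n q k) v \<in> Mcar m N n q"
    by (rule gtens_Mcar[OF _ _ assms(2)])
      (auto intro: blockop_elt(1,3)[OF Qp_blockop[OF assms(1)] _ assms(1)])
  ultimately show ?thesis by (simp add: Ap_def Mcar_add)
qed

lemma Ap_grading:
  assumes "k \<in> {1..N}" "v \<in> TG m N n"
  shows "grading (Ap m n q k v) = - Ap m n q k (grading v)"
proof -
  have "even (tpar y + tpar x + 1)" if x: "tgood m N n x" and nz: "lookup (Ap m n q k (single x 1)) y \<noteq> 0" for x y
  proof -
    obtain \<mu> A b where xe: "x = (\<mu>, A, b)" by (cases x)
    note e = tgood_PCl[OF x[unfolded xe]]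
    have b: "fgood N n b" using x by (simp add: xe tgood_def)
    have "lookup (gtens 0 (dZ m k) (\<lambda>_. id) (single (\<mu>, A, b) 1)) y \<noteq> 0 \<or> lookup (gtens 1 id (\<lambda>_. Qp m n q k) (single (\<mu>, A, b) 1)) y \<noteq> 0"
      using nz by (auto simp: Ap_def xe lookup_add)
    then show ?thesis
    proof
      assume nz: "lookup (gtens 0 (dZ m k) (\<lambda>_. id) (single (\<mu>, A, b) 1)) y \<noteq> 0"
      have "even (tpar y + tpar (\<mu>, A, b) + (1 + 0))"
      proof (rule gtens_parity[OF _ _ nz])
        show "even (card B + card A + 1)" if "B \<in> keys (dZ m k (single A (single \<mu> 1)))" for B
          using odd_map_keys[OF dZ_PLin[OF assms(1)] e _ that] dZ_gpar[OF PCl_FinL[OF e]] by simp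
        show "even (fpar b' + fpar b + 0)" if "lookup (id (single b (1::ratB))) b' \<noteq> 0" for b'
          using that by (auto simp: lookup_single when_def split: if_splits)
      qed
      then show ?thesis by (simp add: xe)
    next
      assume nz: "lookup (gtens 1 id (\<lambda>_. Qp m n q k) (single (\<mu>, A, b) 1)) y \<noteq> 0"
      have "even (tpar y + tpar (\<mu>, A, b) + (0 + 1))"
      proof (rule gtens_parity[OF _ _ nz])
        show "even (card B + card A + 0)" if "B \<in> keys (id (single A (single \<mu> (1::complex))))" for B
          using that by (auto split: if_splits)
        show "even (fpar b' + fpar b + 1)" if "lookup (Qp m n q k (single b 1)) b' \<noteq> 0" for b'
          using blockop_elt(2)[OF Qp_blockop[OF assms(1)] b assms(1) that] by simp
      qed
      then show ?thesis by (simp add: xe)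
    qed
  qed
  from slin_grading_comm[OF Ap_slin this assms(2)] show ?thesis by (simp add: smul_minus_left)
qed

lemma conj_psc_uminus: "conj_psc (- p) = - conj_psc p"
  by (rule poly_mapping_eqI) (simp add: lookup_conj_psc)

section \<open>The involution and the operators A^-\<close>

definition dagb :: "tlab \<Rightarrow> tot" where
  "dagb = (\<lambda>(\<mu>, A, b). tens (dagC (single A (single \<mu> 1))) (dag_ferm (single b 1)))"

lemma dag_eq: "dag v = (\<Sum>x\<in>keys v. smul (conj_rat (lookup v x)) (dagb x))"
  unfolding dag_def dagb_def by (intro sum.cong) (auto split: prod.splits)

lemma dag_add: "dag (v + w) = dag v + dag w"
proof -
  have *: "dag u = (\<Sum>x\<in>keys v \<union> keys w. smul (conj_rat (lookup u x)) (dagb x))" if "keys u \<subseteq> keys v \<union> keys w" for u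
    unfolding dag_eq using that by (intro sum.mono_neutral_left) (auto simp: in_keys_iff)
  show ?thesis
    using Poly_Mapping.keys_add[of v w]
    by (simp add: * lookup_add conj_rat_add smul_add_left sum.distrib)
qed

lemma dag_Mcar: "v \<in> Mcar m N n q \<Longrightarrow> dag v \<in> Mcar m N n q"
proof (rule semilinear_Mcar[OF dag_eq])
  fix x assume x: "tgood m N n x"
  obtain \<mu> A b where xe: "x = (\<mu>, A, b)" by (cases x)
  have "fgood N n (dag_lab \<circ> b)" using x by (simp add: xe tgood_def fgood_dag)
  then show "dagb x \<in> Mcar m N n q"
    using x unfolding xe dagb_def prod.case dag_ferm_single
    by (intro Mcar_tens PCl_dagC supp_in_smul)
      (auto simp: supp_in_single lookup_single when_def fsgn_def Amin_sign intro: tgood_PCl)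
qed (auto simp: Amin_conj)

lemma dag_grading: "v \<in> TG m N n \<Longrightarrow> grading (dag v) = dag (grading v)"
proof -
  assume v: "v \<in> TG m N n"
  have "even (tpar y + tpar x + 0)" if "tgood m N n x" and nz: "lookup (dagb x) y \<noteq> 0" for x y
  proof -
    obtain \<mu> A b where xe: "x = (\<mu>, A, b)" by (cases x)
    obtain \<nu> B b' where y: "y = (\<nu>, B, b')" by (cases y)
    have nz': "lookup (lookup (dagC (single A (single \<mu> 1))) B) \<nu> \<noteq> 0"
        "lookup (dag_ferm (single b (1::ratB))) b' \<noteq> 0"
      using nz by (auto simp: xe y dagb_def lookup_tens)
    have "gpar (dagC (single A (single \<mu> 1))) = dagC (gpar (single A (single \<mu> 1)))"
      by (rule dagC_gpar[symmetric])
    also have "\<dots> = smul ((-1) ^ card A) (dagC (single A (single \<mu> 1)))"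
      unfolding gpar_single dag_pcl_smul
      by (cases "even (card A)") (simp_all add: conj_psc_uminus)
    finally have "even (card B) \<longleftrightarrow> even (card A)"
      by (rule gpar_keys) (use nz'(1) in \<open>auto simp: in_keys_iff\<close>)
    moreover have "b' = dag_lab \<circ> b"
      using nz'(2) by (auto simp: dag_ferm_single lookup_single when_def split: if_splits)
    then have "fpar b' = fpar b" by (simp add: fpar_def)
    ultimately show ?thesis by (simp add: xe y tpar_def)
  qed
  from semilinear_grading[OF dag_eq _ this v] show ?thesis by (simp add: conj_rat_mult)
qed

lemma Am_Mcar: "k \<in> {1..N} \<Longrightarrow> v \<in> Mcar m N n q \<Longrightarrow> Am m n q k v \<in> Mcar m N n q"
  by (simp add: Am_def dag_Mcar Ap_Mcar)

lemma Am_add: "Am m n q k (v + w) = Am m n q k v + Am m n q k w"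
  by (simp add: Am_def dag_add slin_add[OF Ap_slin])

lemma dag_uminus: "dag (- v) = - dag v"
proof -
  have "dag v + dag (- v) = 0" using dag_add[of v "- v"] by (simp add: dag_eq[of 0])
  then show ?thesis by (rule minus_unique[symmetric])
qed

lemma Am_grading:
  assumes "k \<in> {1..N}" "v \<in> Mcar m N n q"
  shows "grading (Am m n q k v) = - Am m n q k (grading v)"
proof -
  have "dag v \<in> Mcar m N n q" "Ap m n q k (dag v) \<in> Mcar m N n q"
    using assms by (simp_all add: dag_Mcar Ap_Mcar)
  then show ?thesis
    using assms by (simp add: Am_def dag_grading[OF Mcar_TG] Ap_grading[OF assms(1) Mcar_TG] dag_uminus)
qed

text \<open>With d = 0 no sign occurs, so maps acting on the bosonic factor alone compose as they do
  on Clifford polynomials, and the inverse of the gauge extends to the module.\<close>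

lemma GM_inverse:
  assumes "PIso m N G" "v \<in> Mcar m N n q"
  shows "gtens 0 G (\<lambda>_. id) v \<in> Mcar m N n q"
    and "gtens 0 (inv_into (PCl m N) G) (\<lambda>_. id) (gtens 0 G (\<lambda>_. id) v) = v"
    and "gtens 0 G (\<lambda>_. id) (gtens 0 (inv_into (PCl m N) G) (\<lambda>_. id) v) = v"
proof -
  have comp: "gtens 0 X (\<lambda>_. id) (gtens 0 Y (\<lambda>_. id) v) = v"
    if X: "PLin m N X" and Y: "PLin m N Y" and XY: "\<And>F. F \<in> PCl m N \<Longrightarrow> X (Y F) = F" for X Y
  proof (rule slin_TG_eqI[OF slin_comp[OF slin_gtens slin_gtens] slin_id Mcar_TG[OF assms(2)]])
    fix \<mu> A b assume "tgood m N n (\<mu>, A, b)"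
    note e = tgood_PCl[OF this]
    have "gtens 0 X (\<lambda>_. id) (tens (Y (single A (single \<mu> 1))) (single b 1))
        = smul 1 (tens (X (Y (single A (single \<mu> 1)))) (id (single b 1)))"
      by (rule gtens_tens[OF PLin_PCl[OF Y e] X]) (simp_all add: slin_def)
    then show "gtens 0 X (\<lambda>_. id) (gtens 0 Y (\<lambda>_. id) (single (\<mu>, A, b) 1)) = single (\<mu>, A, b) 1"
      by (simp add: gtens_single XY[OF e] tens_single)
  qed
  have G: "PLin m N G" "PLin m N (inv_into (PCl m N) G)"
    using assms(1) PIso_inv(1)[OF assms(1)] by (simp_all add: PIso_def)
  show "gtens 0 G (\<lambda>_. id) v \<in> Mcar m N n q"
    by (rule gtens_Mcar[OF PLin_PCl[OF G(1)] _ assms(2)])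
      (auto simp: lookup_single when_def split: if_splits)
  show "gtens 0 (inv_into (PCl m N) G) (\<lambda>_. id) (gtens 0 G (\<lambda>_. id) v) = v"
    by (rule comp[OF G(2,1) PIso_inv(3)[OF assms(1)]])
  show "gtens 0 G (\<lambda>_. id) (gtens 0 (inv_into (PCl m N) G) (\<lambda>_. id) v) = v"
    by (rule comp[OF G PIso_inv(2)[OF assms(1)]])
qed

section \<open>Transport\<close>

locale opspace =
  fixes V :: "tot set"
  assumes V_zero: "0 \<in> V" and V_add: "v \<in> V \<Longrightarrow> w \<in> V \<Longrightarrow> v + w \<in> V"
    and V_uminus: "v \<in> V \<Longrightarrow> - v \<in> V" and V_mscale: "v \<in> V \<Longrightarrow> mscale c v \<in> V"
    and V_grading: "v \<in> V \<Longrightarrow> grading v \<in> V"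
begin

text \<open>Additivity on the carrier. For \<open>Am\<close> it follows directly from additivity of
  \<open>dag\<close>, and it yields compatibility with natural multiples, which the computation of
  the exponential uses.\<close>

definition lin :: "(tot \<Rightarrow> tot) \<Rightarrow> bool" where
  "lin X \<longleftrightarrow> (\<forall>v\<in>V. X v \<in> V) \<and> (\<forall>v\<in>V. \<forall>w\<in>V. X (v + w) = X v + X w)"

lemma lin_V: "lin X \<Longrightarrow> v \<in> V \<Longrightarrow> X v \<in> V"
  and lin_add: "lin X \<Longrightarrow> v \<in> V \<Longrightarrow> w \<in> V \<Longrightarrow> X (v + w) = X v + X w"
  by (auto simp: lin_def)

lemma lin_zero: "lin X \<Longrightarrow> X 0 = 0"
  using lin_add[of X 0 0] by (simp add: V_zero)

lemma lin_uminus: "lin X \<Longrightarrow> v \<in> V \<Longrightarrow> X (- v) = - X v"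
  using lin_add[of X v "- v"] by (simp add: V_uminus lin_zero minus_unique[symmetric])

lemma lin_diff: "lin X \<Longrightarrow> v \<in> V \<Longrightarrow> w \<in> V \<Longrightarrow> X (v - w) = X v - X w"
  using lin_add[of X v "- w"] by (simp add: V_uminus lin_uminus)

lemma V_diff: "v \<in> V \<Longrightarrow> w \<in> V \<Longrightarrow> v - w \<in> V"
  using V_add[of v "- w"] by (simp add: V_uminus)

lemma V_sum: "(\<And>i. i \<in> I \<Longrightarrow> f i \<in> V) \<Longrightarrow> sum f I \<in> V"
  by (induction I rule: infinite_finite_induct) (auto intro: V_zero V_add)

lemma lin_sum: "lin X \<Longrightarrow> (\<And>i. i \<in> I \<Longrightarrow> f i \<in> V) \<Longrightarrow> X (sum f I) = (\<Sum>i\<in>I. X (f i))"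
  by (induction I rule: infinite_finite_induct) (auto simp: lin_zero lin_add V_sum)

lemma lin_id: "lin id" and lin_comp: "lin X \<Longrightarrow> lin Y \<Longrightarrow> lin (X \<circ> Y)"
  and lin_plus: "lin X \<Longrightarrow> lin Y \<Longrightarrow> lin (X + Y)" and lin_minus: "lin X \<Longrightarrow> lin Y \<Longrightarrow> lin (X - Y)"
  by (auto simp: lin_def V_add V_diff)

lemma lin_fsum: "(\<And>i. i \<in> I \<Longrightarrow> lin (f i)) \<Longrightarrow> lin (sum f I)"
proof -
  have "lin 0" by (simp add: lin_def V_zero)
  then show "(\<And>i. i \<in> I \<Longrightarrow> lin (f i)) \<Longrightarrow> lin (sum f I)"
    by (induction I rule: infinite_finite_induct) (simp_all add: lin_plus)
qed

lemma lin_acomm: "lin X \<Longrightarrow> lin Y \<Longrightarrow> lin (acomm X Y)"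
  by (auto simp: lin_def acomm_def V_add)

definition isinv :: "(tot \<Rightarrow> tot) \<Rightarrow> (tot \<Rightarrow> tot) \<Rightarrow> bool" where
  "isinv X Z \<longleftrightarrow> lin X \<and> lin Z \<and> (\<forall>v\<in>V. X (Z v) = v \<and> Z (X v) = v)"

lemma isinv_sym: "isinv X Z \<Longrightarrow> isinv Z X"
  by (auto simp: isinv_def)

lemma inv_into_eq:
  assumes "isinv X Z" "v \<in> V"
  shows "inv_into V X v = Z v"
proof (rule inv_into_f_eq)
  show "inj_on X V" by (rule inj_on_inverseI[of V Z X]) (use assms(1) in \<open>simp add: isinv_def\<close>)
qed (use assms in \<open>auto simp: isinv_def lin_V\<close>)

lemma isinv_inv_into:
  assumes "isinv X Z"
  shows "isinv X (inv_into V X)"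
  using assms inv_into_eq[OF assms] by (auto simp: isinv_def lin_def V_add)

section \<open>Ordered products and exponentials\<close>

definition prd :: "(nat \<Rightarrow> tot \<Rightarrow> tot) \<Rightarrow> nat list \<Rightarrow> tot \<Rightarrow> tot" where
  "prd f ks = foldr (\<lambda>i T. f i \<circ> T) ks id"

lemma prd_Nil [simp]: "prd f [] v = v"
  and prd_Cons [simp]: "prd f (k # ks) v = f k (prd f ks v)"
  by (simp_all add: prd_def)

lemma prd_append: "prd f (ks @ ls) v = prd f ks (prd f ls v)"
  by (induction ks) auto

lemma prd_lin: "(\<And>i. i \<in> set ks \<Longrightarrow> lin (f i)) \<Longrightarrow> lin (prd f ks)"
  by (induction ks) (auto simp: lin_def V_add)

lemma prd_commute:
  assumes "\<And>i. i \<in> set ks \<Longrightarrow> lin (f i)" "\<And>i w. i \<in> set ks \<Longrightarrow> w \<in> V \<Longrightarrow> Z (f i w) = f i (Z w)" "v \<in> V"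
  shows "Z (prd f ks v) = prd f ks (Z v)"
  using assms(1,2)
proof (induction ks)
  case (Cons k ks)
  have "prd f ks v \<in> V" using Cons.prems(1) assms(3) by (intro lin_V[OF prd_lin]) auto
  with Cons show ?case by simp
qed simp

text \<open>Both products run in the same order, so the last f has to travel past the earlier g to
  meet its inverse; cross-commutation for different indices allows this.\<close>

lemma prd_inverse:
  assumes "distinct ks" "\<And>i. i \<in> set ks \<Longrightarrow> lin (f i) \<and> lin (g i)"
    and "\<And>i w. i \<in> set ks \<Longrightarrow> w \<in> V \<Longrightarrow> f i (g i w) = w"
    and "\<And>i j w. i \<in> set ks \<Longrightarrow> j \<in> set ks \<Longrightarrow> i \<noteq> j \<Longrightarrow> w \<in> V \<Longrightarrow> f i (g j w) = g j (f i w)"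
    and "v \<in> V"
  shows "prd f ks (prd g ks v) = v"
  using assms
proof (induction ks arbitrary: v rule: rev_induct)
  case (snoc k ks)
  have "f k (prd g ks (g k v)) = prd g ks (f k (g k v))"
  proof (rule prd_commute)
    fix i w assume "i \<in> set ks" "w \<in> V"
    then show "f k (g i w) = g i (f k w)"
      using snoc.prems(1) by (intro snoc.prems(4)) auto
  qed (use snoc.prems in \<open>auto simp: lin_V\<close>)
  with snoc show ?case by (auto simp: prd_append)
qed simp

text \<open>The same exchange as in \<open>prd_inverse\<close>, used to regroup the product of all 1
  + H_i^+ and the product of all 1 - H_i^- into the product of the R_i.\<close>

lemma prd_mult:
  assumes "distinct ks" "\<And>i. i \<in> set ks \<Longrightarrow> lin (f i) \<and> lin (g i)"
    and "\<And>i j w. i \<in> set ks \<Longrightarrow> j \<in> set ks \<Longrightarrow> i \<noteq> j \<Longrightarrow> w \<in> V \<Longrightarrow> f i (g j w) = g j (f i w)"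
    and "v \<in> V"
  shows "prd (\<lambda>i. f i \<circ> g i) ks v = prd f ks (prd g ks v)"
  using assms
proof (induction ks arbitrary: v rule: rev_induct)
  case (snoc k ks)
  have "f k (prd g ks (g k v)) = prd g ks (f k (g k v))"
  proof (rule prd_commute)
    fix i w assume "i \<in> set ks" "w \<in> V"
    then show "f k (g i w) = g i (f k w)"
      using snoc.prems(1) by (intro snoc.prems(3)) auto
  qed (use snoc.prems in \<open>auto simp: lin_V\<close>)
  moreover have "prd (\<lambda>i. f i \<circ> g i) ks (f k (g k v)) = prd f ks (prd g ks (f k (g k v)))"
    by (rule snoc.IH) (use snoc.prems in \<open>auto simp: lin_V\<close>)
  ultimately show ?case by (simp add: prd_append comp_def)
qed simp

lemma mscale_add: "mscale c (v + w) = mscale c v + mscale c w"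
  by (simp add: mscale_def smul_add)

lemma mscale_add_left: "mscale (c + d) v = mscale c v + mscale d v"
  by (simp add: mscale_def rc_add smul_add_left)

lemma mscale_mscale: "mscale c (mscale d v) = mscale (c * d) v"
  by (simp add: mscale_def rc_mult)

lemma mscale_zero [simp]: "mscale c 0 = 0" "mscale 0 v = 0"
  by (simp_all add: mscale_def)

lemma mscale_one [simp]: "mscale 1 v = v"
  by (simp add: mscale_def)

text \<open>Since \<open>H\<^sup>2 = 0\<close>, only the terms linear in \<open>H\<close> survive in \<open>(X + H)\<^sup>k\<close>.\<close>

lemma expo_step:
  assumes X: "lin X" and H: "lin H" and comm: "\<And>v. v \<in> V \<Longrightarrow> H (X v) = X (H v)"
    and sq: "\<And>v. v \<in> V \<Longrightarrow> H (H v) = 0"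
    and nil: "\<And>v. v \<in> V \<Longrightarrow> (X ^^ D) v = 0" and v: "v \<in> V"
  shows "((X + H) ^^ Suc D) v = 0" "expo mscale (X + H) v = expo mscale X (v + H v)"
proof -
  have pw: "(X ^^ k) w \<in> V" if "w \<in> V" for k w
    using that by (induction k) (auto simp: lin_V[OF X])
  have pw_add: "(X ^^ k) (w + w') = (X ^^ k) w + (X ^^ k) w'" if "w \<in> V" "w' \<in> V" for k w w'
    using that by (induction k) (auto simp: lin_add[OF X] pw)
  have H_pw: "H ((X ^^ k) w) = (X ^^ k) (H w)" if "w \<in> V" for k w
    using that by (induction k) (auto simp: comm pw)
  have X_nat: "X (mscale (of_nat k) w) = mscale (of_nat k) (X w)" if "w \<in> V" for k w
    by (induction k) (auto simp: mscale_add_left lin_zero[OF X] lin_add[OF X] V_mscale that)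
  have H_nat: "H (mscale (of_nat k) w) = mscale (of_nat k) (H w)" if "w \<in> V" for k w
    by (induction k) (auto simp: mscale_add_left lin_zero[OF H] lin_add[OF H] V_mscale that)
  have pw_zero: "(X ^^ k) 0 = 0" for k
    by (induction k) (auto simp: lin_zero[OF X])
  have Hv: "H v \<in> V" by (rule lin_V[OF H v])
  \<comment> \<open>The binomial expansion cut off after the first power of H; the coefficient k + 1
    later turns 1/(k + 1)! into 1/k!.\<close>
  have main: "((X + H) ^^ Suc k) v = (X ^^ Suc k) v + mscale (of_nat (Suc k)) ((X ^^ k) (H v))" for k
  proof (induction k)
    case 0
    then show ?case by simp
  next
    case (Suc k)
    have 1: "(X ^^ Suc k) v \<in> V" "mscale (of_nat (Suc k)) ((X ^^ k) (H v)) \<in> V"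
      using pw[OF v, of "Suc k"] pw[OF Hv, of k] V_mscale by blast+
    have "((X + H) ^^ Suc (Suc k)) v = X (((X + H) ^^ Suc k) v) + H (((X + H) ^^ Suc k) v)"
      by simp
    also have "X (((X + H) ^^ Suc k) v) = (X ^^ Suc (Suc k)) v + mscale (of_nat (Suc k)) ((X ^^ Suc k) (H v))"
      unfolding Suc lin_add[OF X 1] X_nat[OF pw[OF Hv]] by simp
    also have "H (((X + H) ^^ Suc k) v) = (X ^^ Suc k) (H v)"
      unfolding Suc lin_add[OF H 1] H_nat[OF pw[OF Hv]] H_pw[OF v] H_pw[OF Hv] sq[OF v] pw_zero by simp
    also have "(X ^^ Suc (Suc k)) v + mscale (of_nat (Suc k)) ((X ^^ Suc k) (H v)) + (X ^^ Suc k) (H v)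
        = (X ^^ Suc (Suc k)) v + mscale (of_nat (Suc (Suc k))) ((X ^^ Suc k) (H v))"
      unfolding of_nat_Suc[of "Suc k"] mscale_add_left by (simp only: mscale_one add_ac)
    finally show ?case .
  qed
  have nilS: "(X ^^ Suc D) w = 0" if "w \<in> V" for w
    using nil[OF that] by (simp add: lin_zero[OF X])
  show z: "((X + H) ^^ Suc D) v = 0"
    using main[of D] nilS[OF v] nil[OF Hv] by simp
  have "expo mscale (X + H) v = (\<Sum>k<Suc D. mscale (1 / fact k) (((X + H) ^^ k) v))"
    by (rule expo_eq[where sc = mscale]) (use z in \<open>auto simp: lin_zero[OF X] lin_zero[OF H]\<close>)
  also have "\<dots> = v + (\<Sum>k<D. mscale (1 / fact (Suc k)) (((X + H) ^^ Suc k) v))"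
    unfolding sum.lessThan_Suc_shift by simp
  also have "(\<Sum>k<D. mscale (1 / fact (Suc k)) (((X + H) ^^ Suc k) v))
      = (\<Sum>k<D. mscale (1 / fact (Suc k)) ((X ^^ Suc k) v) + mscale (1 / fact k) ((X ^^ k) (H v)))"
  proof (intro sum.cong refl)
    fix k
    have "1 / fact (Suc k) * of_nat (Suc k) = (1 / fact k :: complex)"
      by (simp add: field_simps del: of_nat_Suc)
    then show "mscale (1 / fact (Suc k)) (((X + H) ^^ Suc k) v)
        = mscale (1 / fact (Suc k)) ((X ^^ Suc k) v) + mscale (1 / fact k) ((X ^^ k) (H v))"
      unfolding main mscale_add mscale_mscale by simp
  qed
  also have "v + \<dots> = (\<Sum>k<Suc D. mscale (1 / fact k) ((X ^^ k) v)) + (\<Sum>k<Suc D. mscale (1 / fact k) ((X ^^ k) (H v)))"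
    unfolding sum.distrib sum.lessThan_Suc_shift[of "\<lambda>k. mscale (1 / fact k) ((X ^^ k) v)"]
    using nil[OF Hv] by (simp add: add.assoc)
  also have "\<dots> = (\<Sum>k<Suc D. mscale (1 / fact k) ((X ^^ k) (v + H v)))"
    unfolding pw_add[OF v Hv] mscale_add sum.distrib ..
  also have "\<dots> = expo mscale X (v + H v)"
    by (rule expo_eq[symmetric, where sc = mscale]) (use nilS[OF V_add[OF v Hv]] in \<open>auto simp: lin_zero[OF X]\<close>)
  finally show "expo mscale (X + H) v = expo mscale X (v + H v)" .
qed

definition squarefam :: "nat \<Rightarrow> (nat \<Rightarrow> tot \<Rightarrow> tot) \<Rightarrow> bool" where
  "squarefam N H \<longleftrightarrow> (\<forall>i\<in>{1..N}. lin (H i) \<and> (\<forall>v\<in>V. H i (H i v) = 0) \<and>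
     (\<forall>j\<in>{1..N}. \<forall>v\<in>V. H i (H j v) = H j (H i v)))"

text \<open>The vanishing of the (k + 1)-st power is proved along with the product formula because
  it is the nilpotency that \<open>expo_step\<close> asks for at the next summand.\<close>

lemma expo_sum_square_zero:
  assumes "squarefam N H" "k \<le> N" "v \<in> V"
  shows "((\<Sum>i=1..k. H i) ^^ Suc k) v = 0 \<and> expo mscale (\<Sum>i=1..k. H i) v = prd (\<lambda>i. id + H i) [1..<Suc k] v"
  using assms(2,3)
proof (induction k arbitrary: v)
  case 0
  have "expo mscale (0 :: tot \<Rightarrow> tot) v = (\<Sum>k<1. mscale (1 / fact k) (((0 :: tot \<Rightarrow> tot) ^^ k) v))"
    by (rule expo_eq[where sc = mscale]) (auto simp: One_nat_def)
  then show ?case by (simp add: One_nat_def zero_fun_def)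
next
  case (Suc k)
  let ?X = "\<Sum>i=1..k. H i"
  have k: "Suc k \<in> {1..N}" and ki: "\<And>i. i \<in> {1..k} \<Longrightarrow> i \<in> {1..N}" using Suc.prems by auto
  have X: "lin ?X" and H: "lin (H (Suc k))"
    using assms(1) k ki by (auto intro!: lin_fsum simp: squarefam_def)
  have comm: "H (Suc k) (?X w) = ?X (H (Suc k) w)" if w: "w \<in> V" for w
  proof -
    have "H (Suc k) (?X w) = (\<Sum>i=1..k. H (Suc k) (H i w))"
      unfolding sum_fun_apply using assms(1) ki w by (intro lin_sum[OF H]) (auto simp: squarefam_def lin_V)
    also have "\<dots> = ?X (H (Suc k) w)"
      unfolding sum_fun_apply using assms(1) k ki w by (intro sum.cong) (auto simp: squarefam_def)
    finally show ?thesis .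
  qed
  have sq: "H (Suc k) (H (Suc k) w) = 0" if "w \<in> V" for w
    using assms(1) k that by (auto simp: squarefam_def)
  have nil: "(?X ^^ Suc k) w = 0" if "w \<in> V" for w
    using Suc.IH[of w] Suc.prems(1) that by simp
  have sum: "(\<Sum>i=1..Suc k. H i) = ?X + H (Suc k)" by simp
  have "v + H (Suc k) v \<in> V" using Suc.prems(2) by (simp add: V_add lin_V[OF H])
  then have e: "expo mscale ?X (v + H (Suc k) v) = prd (\<lambda>i. id + H i) [1..<Suc k] (v + H (Suc k) v)"
    using Suc.IH[OF Suc_leD[OF Suc.prems(1)]] by blast
  have l: "[1..<Suc (Suc k)] = [1..<Suc k] @ [Suc k]" by simp
  have f: "(id + H (Suc k)) v = v + H (Suc k) v" by simp
  show ?case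
    unfolding sum l prd_append prd_Cons prd_Nil f e[symmetric]
    using expo_step[OF X H comm sq nil Suc.prems(2)] by blast
qed

lemma isinv_unipotent: "lin H \<Longrightarrow> (\<And>v. v \<in> V \<Longrightarrow> H (H v) = 0) \<Longrightarrow> isinv (id + H) (id - H)"
  by (auto simp: isinv_def lin_plus lin_minus lin_id lin_diff lin_add lin_V V_add)

lemma isinv_comp: "isinv X X' \<Longrightarrow> isinv Y Y' \<Longrightarrow> isinv (X \<circ> Y) (Y' \<circ> X')"
  by (auto simp: isinv_def lin_comp lin_V)

lemma expo_family:
  assumes H: "squarefam N H"
  shows "isinv (expo mscale (\<Sum>i=1..N. H i)) (prd (\<lambda>i. id - H i) [1..<Suc N])"
    and "v \<in> V \<Longrightarrow> expo mscale (\<Sum>i=1..N. H i) v = prd (\<lambda>i. id + H i) [1..<Suc N] v"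
proof -
  have lin: "lin (H i)" and sq: "w \<in> V \<Longrightarrow> H i (H i w) = 0" if "i \<in> {1..N}" for i w
    using H that by (auto simp: squarefam_def)
  have comm: "H i (H j w) = H j (H i w)" if "i \<in> {1..N}" "j \<in> {1..N}" "w \<in> V" for i j w
    using H that by (auto simp: squarefam_def)
  have e: "expo mscale (\<Sum>i=1..N. H i) v = prd (\<lambda>i. id + H i) [1..<Suc N] v" if "v \<in> V" for v
    using expo_sum_square_zero[OF H order_refl that] by blast
  then show "v \<in> V \<Longrightarrow> expo mscale (\<Sum>i=1..N. H i) v = prd (\<lambda>i. id + H i) [1..<Suc N] v" .
  have set: "set [1..<Suc N] = {1..N}" by auto
  have lp: "lin (id + H i)" "lin (id - H i)" if "i \<in> {1..N}" for i
    using that by (simp_all add: lin_plus lin_minus lin_id lin)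
  have "prd (\<lambda>i. id + H i) [1..<Suc N] (prd (\<lambda>i. id - H i) [1..<Suc N] v) = v" if "v \<in> V" for v
    by (rule prd_inverse) (use that lp in \<open>auto simp: set lin_add lin_diff lin lin_V V_add V_diff sq comm simp del: upt_Suc\<close>)
  moreover have "prd (\<lambda>i. id - H i) [1..<Suc N] (prd (\<lambda>i. id + H i) [1..<Suc N] v) = v" if "v \<in> V" for v
    by (rule prd_inverse) (use that lp in \<open>auto simp: set lin_add lin_diff lin lin_V V_add V_diff sq comm simp del: upt_Suc\<close>)
  moreover have P: "lin (prd (\<lambda>i. id + H i) [1..<Suc N])" "lin (prd (\<lambda>i. id - H i) [1..<Suc N])"
    using lp by (auto intro!: prd_lin simp: set simp del: upt_Suc)
  ultimately show "isinv (expo mscale (\<Sum>i=1..N. H i)) (prd (\<lambda>i. id - H i) [1..<Suc N])"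
    using P e by (auto simp: isinv_def lin_def V_add)
qed

section \<open>Odd operators and ordered conjugation\<close>

definition oddop :: "(tot \<Rightarrow> tot) \<Rightarrow> bool" where
  "oddop X \<longleftrightarrow> lin X \<and> (\<forall>v\<in>V. grading (X v) = - X (grading v))"

text \<open>An odd operator has even part 0 and is its own odd part on V, so of the four terms in
  the superbracket only the anticommutator is left.\<close>

lemma ads_odd:
  assumes "oddop Y" "oddop X" "v \<in> V"
  shows "ads Y X v = acomm Y X v"
proof -
  have lin: "lin X" "lin Y" using assms by (simp_all add: oddop_def)
  have ev: "evenpart Z w = 0" and od: "oddpart Z w = Z w" if "oddop Z" "w \<in> V" for Z w
  proof -
    have Z: "lin Z" "grading (Z (grading w)) = - Z w"
      using that V_grading[OF that(2)] by (auto simp: oddop_def)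
    then show "evenpart Z w = 0" by (simp add: evenpart_def)
    have "mscale (1 / 2) (Z w) + mscale (1 / 2) (Z w) = Z w"
      by (simp flip: mscale_add_left)
    then show "oddpart Z w = Z w" using Z by (simp add: oddpart_def mscale_add)
  qed
  show ?thesis
    using assms lin by (simp add: ads_def ev od V_zero lin_V lin_zero acomm_def)
qed

definition conj :: "(tot \<Rightarrow> tot) \<Rightarrow> (tot \<Rightarrow> tot) \<Rightarrow> tot \<Rightarrow> tot" where
  "conj R X = R \<circ> X \<circ> inv_into V R"

text \<open>Kept in the shape identity plus (conjugation minus identity) so that it matches the
  products of I + K_i; \<open>conjs_Cons\<close> simplifies each factor to plain
  conjugation.\<close>

definition conjs :: "(nat \<Rightarrow> tot \<Rightarrow> tot) \<Rightarrow> nat list \<Rightarrow> (tot \<Rightarrow> tot) \<Rightarrow> tot \<Rightarrow> tot" where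
  "conjs R ks = foldr (\<lambda>i T. (id + (\<lambda>X. conj (R i) X - X)) \<circ> T) ks id"

lemma conjs_Nil [simp]: "conjs R [] X = X"
  by (simp add: conjs_def)

lemma conjs_Cons: "conjs R (k # ks) X = conj (R k) (conjs R ks X)"
  by (simp add: conjs_def fun_eq_iff)

lemma conj_oddop:
  assumes "isinv R S" "\<And>v. v \<in> V \<Longrightarrow> grading (R v) = R (grading v)" "oddop X"
  shows "oddop (conj R X)"
proof -
  have inv: "isinv R (inv_into V R)" by (rule isinv_inv_into[OF assms(1)])
  have "grading (inv_into V R v) = inv_into V R (grading v)" if "v \<in> V" for v
    using inv that assms(2)[of "inv_into V R v"] unfolding isinv_def by (metis V_grading lin_V)
  then show ?thesis
    using inv assms(2,3) unfolding oddop_def conj_def isinv_def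
    by (auto simp: lin_comp lin_V V_grading lin_uminus)
qed

text \<open>Nested conjugations amount to one conjugation by the ordered product. Q may be any
  inverse of that product, so the explicit U^- (U^+)^-1 can be inserted later.\<close>

lemma conjs_prd:
  assumes "\<And>i. i \<in> set ks \<Longrightarrow> isinv (R i) (S i)" "lin X" "isinv (prd R ks) Q" "v \<in> V"
  shows "conjs R ks X v = prd R ks (X (Q v))"
  using assms(1,3,4)
proof (induction ks arbitrary: v Q)
  case Nil
  then show ?case by (simp add: isinv_def prd_def)
next
  case (Cons k ks)
  have k: "isinv (R k) (S k)" using Cons.prems(1) by simp
  \<comment> \<open>Q inverts R_k times the tail, so the tail alone is inverted by Q after
    R_k.\<close>
  have ks: "isinv (prd R ks) (Q \<circ> R k)"
  proof -
    have "lin (prd R ks)" using Cons.prems(1) by (intro prd_lin) (auto simp: isinv_def)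
    moreover have "prd R ks (Q (R k w)) = w" if "w \<in> V" for w
    proof -
      have "R k (prd R ks (Q (R k w))) = R k w"
        using Cons.prems(2) k that by (simp add: isinv_def lin_V)
      then have "S k (R k (prd R ks (Q (R k w)))) = S k (R k w)" by simp
      moreover have "prd R ks (Q (R k w)) \<in> V"
        using k that Cons.prems(2) by (intro lin_V[OF \<open>lin (prd R ks)\<close>]) (simp add: isinv_def lin_V)
      ultimately show ?thesis
        using k that unfolding isinv_def by metis
    qed
    ultimately show ?thesis
      using Cons.prems(2) k by (auto simp: isinv_def lin_comp lin_V)
  qed
  have "conjs R ks X (S k v) = prd R ks (X ((Q \<circ> R k) (S k v)))"
    using Cons.prems k by (intro Cons.IH ks) (auto simp: isinv_def lin_V)
  then show ?case
    using Cons.prems k by (simp add: conjs_Cons conj_def inv_into_eq[OF k]) (simp add: isinv_def)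
qed

text \<open>Conjugating by the outermost \<open>R\<^sub>a\<close> replaces \<open>A\<close> by \<open>A + \<Theta>\<^sub>a\<close> in the anticommutator; the
  \<open>\<Theta>\<^sub>a\<close>-term is split off and the rest is handled by the remaining factors.\<close>

lemma telescope:
  assumes R: "\<And>i. i \<in> {a..<b} \<Longrightarrow> isinv (R i) (S i) \<and> (\<forall>v\<in>V. grading (R i v) = R i (grading v))"
    and A: "oddop A" and Y: "oddop Y" and "a \<le> b" "v \<in> V"
  shows "acomm A (conjs R [a..<b] Y) v = conjs R [a..<b] (acomm A Y) v +
    (\<Sum>r=a..<b. conjs R [a..<r] (conj (R r) (ads ((inv_into V (R r) \<circ> A \<circ> R r) - A) (conjs R [r + 1..<b] Y))) v)"
  using assms(4,1,5)
proof (induction a arbitrary: v rule: inc_induct)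
  case base
  then show ?case by simp
next
  case (step a)
  let ?R = "R a" and ?S = "inv_into V (R a)" and ?B = "conjs R [Suc a..<b] Y"
  let ?\<Theta> = "(?S \<circ> A \<circ> ?R) - A"
  have a: "isinv ?R (S a)" and gr: "\<And>v. v \<in> V \<Longrightarrow> grading (?R v) = ?R (grading v)"
    using step.prems(1)[of a] step.hyps by auto
  have inv: "isinv ?R ?S" by (rule isinv_inv_into[OF a])
  have linRS: "lin ?R" "lin ?S" and RS: "\<And>v. v \<in> V \<Longrightarrow> ?R (?S v) = v" "\<And>v. v \<in> V \<Longrightarrow> ?S (?R v) = v"
    using inv by (auto simp: isinv_def)
  \<comment> \<open>Oddness of every tail makes the bracket at each later r an anticommutator as
    well.\<close>
  have odd_conjs: "oddop (conjs R [c..<b] Y)" if "a \<le> c" "c \<le> b" for c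
    using that(2,1)
  proof (induction c rule: inc_induct)
    case base
    then show ?case using Y by simp
  next
    case (step c)
    then show ?case
      using step.prems \<open>\<And>i. i \<in> {a..<b} \<Longrightarrow> isinv (R i) (S i) \<and> (\<forall>v\<in>V. grading (R i v) = R i (grading v))\<close>[of c]
      by (auto simp: upt_conv_Cons conjs_Cons intro!: conj_oddop)
  qed
  have B: "oddop ?B" using step.hyps by (intro odd_conjs) auto
  have linA: "lin A" and linB: "lin ?B" using A B by (simp_all add: oddop_def)
  have oddSAR: "oddop (?S \<circ> A \<circ> ?R)"
  proof -
    have "grading (?S v) = ?S (grading v)" if "v \<in> V" for v
      using that gr[of "?S v"] RS linRS by (metis V_grading lin_V)
    then show ?thesis
      using A gr linRS by (auto simp: oddop_def lin_comp lin_V V_grading lin_uminus)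
  qed
  have \<Theta>: "oddop ?\<Theta>"
    using oddSAR A unfolding oddop_def
    by (auto simp: lin_minus slin_diff[OF slin_grading] simp del: comp_apply)
  have Sv: "?S v \<in> V" using step.prems(2) by (rule lin_V[OF linRS(2)])
  have split: "acomm A (conjs R [a..<b] Y) v = ?R (acomm A ?B (?S v) + ads ?\<Theta> ?B (?S v))"
  proof -
    have "acomm A (conjs R [a..<b] Y) v = A (?R (?B (?S v))) + ?R (?B (?S (A v)))"
      using step.hyps by (simp add: acomm_def upt_conv_Cons conjs_Cons conj_def)
    also have "A (?R (?B (?S v))) = ?R (?S (A (?R (?B (?S v)))))"
      using Sv linRS linA linB by (simp add: RS lin_V)
    also have "A v = A (?R (?S v))" using step.prems(2) by (simp add: RS)
    also have "?R (?S (A (?R (?B (?S v))))) + ?R (?B (?S (A (?R (?S v)))))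
        = ?R (?S (A (?R (?B (?S v)))) + ?B (?S (A (?R (?S v)))))"
      using Sv linRS linA linB by (simp add: lin_add lin_V)
    also have "?S (A (?R (?B (?S v)))) + ?B (?S (A (?R (?S v)))) = acomm A ?B (?S v) + acomm ?\<Theta> ?B (?S v)"
      using Sv linRS linA linB by (simp add: acomm_def lin_V lin_diff)
    also have "acomm ?\<Theta> ?B (?S v) = ads ?\<Theta> ?B (?S v)"
      by (rule ads_odd[OF \<Theta> B Sv, symmetric])
    finally show ?thesis .
  qed
  have IH: "acomm A ?B (?S v) = conjs R [Suc a..<b] (acomm A Y) (?S v) +
    (\<Sum>r=Suc a..<b. conjs R [Suc a..<r] (conj (R r) (ads ((inv_into V (R r) \<circ> A \<circ> R r) - A) (conjs R [r + 1..<b] Y))) (?S v))"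
    using step.prems(1) Sv by (intro step.IH) auto
  let ?W = "\<lambda>r. conj (R r) (ads ((inv_into V (R r) \<circ> A \<circ> R r) - A) (conjs R [r + 1..<b] Y))"
  have lin_conj: "lin (conj (R i) Z)" if "i \<in> {a..<b}" "lin Z" for i Z
    using step.prems(1)[OF that(1)] isinv_inv_into[of "R i" "S i"] that(2)
    by (auto simp: conj_def isinv_def lin_comp)
  have lin_conjs: "lin (conjs R [c..<d] Z)" if "a \<le> c" "d \<le> b" "lin Z" for c d Z
  proof (cases "c \<le> d")
    case True
    then show ?thesis
      using that(1)
    proof (induction c rule: inc_induct)
      case (step c)
      then show ?case
        using that(2) by (auto simp: upt_conv_Cons conjs_Cons intro!: lin_conj)
    qed (simp add: that(3))
  qed (simp add: that(3))
  \<comment> \<open>R_a is additive on V only, so each summand must be placed in V before R_a is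
    distributed over the sum. The superbracket is additive there because it coincides with an
    anticommutator.\<close>
  have W_V: "conjs R [Suc a..<r] (?W r) (?S v) \<in> V" if r: "r \<in> {Suc a..<b}" for r
  proof -
    have iR: "isinv (R r) (S r)" and gR: "\<And>v. v \<in> V \<Longrightarrow> grading (R r v) = R r (grading v)"
      using step.prems(1)[of r] r by auto
    have "isinv (R r) (inv_into V (R r))" by (rule isinv_inv_into[OF iR])
    then have i: "lin (inv_into V (R r))" "lin (R r)" "\<And>v. v \<in> V \<Longrightarrow> R r (inv_into V (R r) v) = v"
      "\<And>v. v \<in> V \<Longrightarrow> inv_into V (R r) (R r v) = v" by (auto simp: isinv_def)
    have g': "grading (inv_into V (R r) v) = inv_into V (R r) (grading v)" if "v \<in> V" for v
      using that gR[of "inv_into V (R r) v"] i by (metis V_grading lin_V)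
    have o1: "oddop ((inv_into V (R r) \<circ> A \<circ> R r) - A)"
      using A gR g' i(1,2) unfolding oddop_def
      by (auto simp: lin_minus lin_comp lin_V V_grading lin_uminus slin_diff[OF slin_grading])
    have o2: "oddop (conjs R [r + 1..<b] Y)" using r by (intro odd_conjs) auto
    have "lin (ads ((inv_into V (R r) \<circ> A \<circ> R r) - A) (conjs R [r + 1..<b] Y))"
      using lin_acomm[of "(inv_into V (R r) \<circ> A \<circ> R r) - A" "conjs R [r + 1..<b] Y"] o1 o2 ads_odd[OF o1 o2]
      unfolding lin_def oddop_def by (auto simp: V_add)
    then have "lin (conjs R [Suc a..<r] (?W r))"
      using r by (intro lin_conjs lin_conj) auto
    then show ?thesis using Sv by (rule lin_V)
  qed
  have conj_a: "?R (conjs R [Suc a..<d] Z (?S v)) = conjs R [a..<d] Z v" if "a < d" for d Z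
    using that by (simp add: upt_conv_Cons conjs_Cons conj_def)
  have "acomm A (conjs R [a..<b] Y) v = ?R (acomm A ?B (?S v)) + ?R (ads ?\<Theta> ?B (?S v))"
    unfolding split using lin_acomm[OF linA linB] Sv ads_odd[OF \<Theta> B Sv] lin_acomm[of ?\<Theta> ?B] \<Theta> linB
    by (intro lin_add[OF linRS(1)]) (auto simp: lin_V oddop_def)
  \<comment> \<open>The split-off bracket is the summand r = a, whose list of outer conjugations is
    empty.\<close>
  also have "?R (ads ?\<Theta> ?B (?S v)) = conjs R [a..<a] (?W a) v"
    by (simp add: conj_def Suc_eq_plus1)
  also have "?R (acomm A ?B (?S v)) = conjs R [a..<b] (acomm A Y) v + (\<Sum>r=Suc a..<b. conjs R [a..<r] (?W r) v)"
  proof -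
    have "conjs R [Suc a..<b] (acomm A Y) (?S v) \<in> V"
      using Sv Y by (intro lin_V[OF lin_conjs] lin_acomm linA) (auto simp: oddop_def)
    then have "?R (acomm A ?B (?S v)) = ?R (conjs R [Suc a..<b] (acomm A Y) (?S v))
        + ?R (\<Sum>r=Suc a..<b. conjs R [Suc a..<r] (?W r) (?S v))"
      unfolding IH by (rule lin_add[OF linRS(1) _ V_sum[OF W_V]])
    also have "?R (\<Sum>r=Suc a..<b. conjs R [Suc a..<r] (?W r) (?S v))
        = (\<Sum>r=Suc a..<b. ?R (conjs R [Suc a..<r] (?W r) (?S v)))"
      by (rule lin_sum[OF linRS(1) W_V])
    also have "?R (conjs R [Suc a..<b] (acomm A Y) (?S v)) + (\<Sum>r=Suc a..<b. ?R (conjs R [Suc a..<r] (?W r) (?S v)))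
        = conjs R [a..<b] (acomm A Y) v + (\<Sum>r=Suc a..<b. conjs R [a..<r] (?W r) v)"
      unfolding conj_a[OF step.hyps(2)] by (intro arg_cong2[of _ _ _ _ "(+)"] sum.cong refl conj_a) simp
    finally show ?thesis .
  qed
  finally have "acomm A (conjs R [a..<b] Y) v = conjs R [a..<b] (acomm A Y) v
      + (\<Sum>r=Suc a..<b. conjs R [a..<r] (?W r) v) + conjs R [a..<a] (?W a) v" .
  moreover have "(\<Sum>r=a..<b. conjs R [a..<r] (?W r) v)
      = conjs R [a..<a] (?W a) v + (\<Sum>r=Suc a..<b. conjs R [a..<r] (?W r) v)"
    by (rule sum.atLeast_Suc_lessThan[OF step.hyps(2)])
  ultimately show ?case by (simp only: add_ac)
qed

end

theorem theorem6p9: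
  fixes q :: real and m N n :: nat
  assumes "0 < q" and "q < 1" and "N \<ge> 1" and "n \<ge> 1" and "m \<ge> 2 * N"
  shows "\<forall>k\<in>{1..N}. \<forall>j\<in>{1..N}. \<forall>v\<in>Mcar m N n q.
      (Lseed m n q k j + acomm (Ap m n q k) (Omg m N n q j)) v =
      (T_all m N n q (Lseed m n q k j)
        + (\<Sum>r=1..N. T_below m N n q r (Ad m N n q (Ri m N n q r)
             (ads (Theta m N n q k r) (T_above m N n q r (Am m n q j)))))) v
      \<and>
      acomm (Dp m N n q k) (Dm m N n q j) v =
      (GM m N q \<circ> opinv m N n q (Up m N n q) \<circ>
        (Lseed m n q k j + acomm (Ap m n q k) (Omg m N n q j)) \<circ>
        Up m N n q \<circ> opinv m N n q (GM m N q)) v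
      \<and>
      acomm (Dp m N n q k) (Dm m N n q j) v =
      (GM m N q \<circ> opinv m N n q (Up m N n q) \<circ>
        (T_all m N n q (Lseed m n q k j)
          + (\<Sum>r=1..N. T_below m N n q r (Ad m N n q (Ri m N n q r)
               (ads (Theta m N n q k r) (T_above m N n q r (Am m n q j)))))) \<circ>
        Up m N n q \<circ> opinv m N n q (GM m N q)) v"
proof -
  have Nm: "N \<le> m" using assms(5) by simp
  define V where "V = Mcar m N n q"
  interpret opspace V
    unfolding V_def
    by unfold_locales (auto intro: Mcar_add Mcar_uminus Mcar_mscale grading_Mcar)
  let ?Hp = "Hp m N n q" and ?Hm = "Hm m N n q" and ?R = "Ri m N n q"
  have TG: "v \<in> TG m N n" if "v \<in> V" for v
    using that Mcar_TG by (simp add: V_def)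
  have sl: "lin X" if "slin X" "\<And>v. v \<in> V \<Longrightarrow> X v \<in> V" for X
    using that by (simp add: lin_def slin_add)
  have linHp: "lin (?Hp i)" and linHm: "lin (?Hm i)" if "i \<in> {1..N}" for i
    by (rule sl[OF Hp_slin], simp add: V_def Hp_Mcar[OF Nm that],
        rule sl[OF Hm_slin], simp add: V_def Hm_Mcar[OF Nm that])
  have fam: "squarefam N ?Hp" "squarefam N ?Hm"
    using linHp linHm Hp_Hp[OF Nm _ _ TG] Hm_Hm[OF Nm _ _ TG] by (auto simp: squarefam_def)
  define Pp Mp Pm Mm where "Pp = prd (\<lambda>i. id + ?Hp i) [1..<Suc N]" and "Mp = prd (\<lambda>i. id - ?Hp i) [1..<Suc N]"
    and "Pm = prd (\<lambda>i. id + ?Hm i) [1..<Suc N]" and "Mm = prd (\<lambda>i. id - ?Hm i) [1..<Suc N]"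
  have U: "isinv (Up m N n q) Mp" and Up_eq: "\<And>v. v \<in> V \<Longrightarrow> Up m N n q v = Pp v"
    using expo_family[OF fam(1)] by (simp_all add: Up_def Mp_def Pp_def)
  have W: "isinv (Um m N n q) Mm"
    using expo_family(1)[OF fam(2)] by (simp add: Um_def Mm_def)
  have opinv: "opinv m N n q X = inv_into V X" for X
    by (simp add: opinv_def V_def fun_eq_iff)
  \<comment> \<open>Square zero makes I - H^+ and I + H^- the inverses of the two factors;
    composition reverses their order.\<close>
  have Ri: "isinv (?R i) ((id + ?Hm i) \<circ> (id - ?Hp i))" if "i \<in> {1..N}" for i
    unfolding Ri_def using fam that
    by (intro isinv_comp isinv_unipotent isinv_sym[OF isinv_unipotent]) (auto simp: squarefam_def)
  have Ri_grading: "grading (?R i v) = ?R i (grading v)" if "i \<in> {1..N}" "v \<in> V" for i v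
    using that linHm[OF that(1)]
    by (simp add: Ri_def slin_add[OF slin_grading] slin_diff[OF slin_grading] TG V_diff lin_V
        Hp_grading[OF Nm that(1)] Hm_grading[OF Nm that(1)])
  \<comment> \<open>Factors with different labels commute, which interleaves the ordered product for
    U^+ with the one for the inverse of U^-.\<close>
  have Rq: "Rq m N n q v = prd ?R [1..<Suc N] v" if v: "v \<in> V" for v
  proof -
    have "prd ?R [1..<Suc N] v = prd (\<lambda>i. (id + ?Hp i) \<circ> (id - ?Hm i)) [1..<Suc N] v"
      by (simp add: Ri_def[abs_def])
    also have "\<dots> = Pp (Mm v)"
      unfolding Pp_def Mm_def
    proof (rule prd_mult[OF _ _ _ v])
      fix i j w assume ij: "i \<in> set [1..<Suc N]" "j \<in> set [1..<Suc N]" "i \<noteq> j" "w \<in> V"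
      then have ij': "i \<in> {1..N}" "j \<in> {1..N}" by auto
      have "?Hp i (w - ?Hm j w) = ?Hp i w - ?Hp i (?Hm j w)"
        by (rule slin_diff[OF Hp_slin])
      moreover have "?Hm j (w + ?Hp i w) = ?Hm j w + ?Hm j (?Hp i w)"
        by (rule slin_add[OF Hm_slin])
      ultimately show "(id + ?Hp i) ((id - ?Hm j) w) = (id - ?Hm j) ((id + ?Hp i) w)"
        using Hp_Hm[OF Nm ij' ij(3) TG[OF ij(4)]] by simp
    next
      fix i assume "i \<in> set [1..<Suc N]"
      then have "i \<in> {1..N}" by auto
      then show "lin (id + ?Hp i) \<and> lin (id - ?Hm i)"
        by (simp add: lin_plus lin_minus lin_id linHp linHm)
    qed simp
    also have "Mm v = inv_into V (Um m N n q) v" by (rule inv_into_eq[OF W v, symmetric])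
    also have "Pp (inv_into V (Um m N n q) v) = Up m N n q (inv_into V (Um m N n q) v)"
      using isinv_inv_into[OF W] v by (intro Up_eq[symmetric]) (simp add: isinv_def lin_V)
    finally show ?thesis by (simp add: Rq_def opinv)
  qed
  let ?U = "Up m N n q" and ?U' = "inv_into V (Up m N n q)" and ?W = "Um m N n q" and ?W' = "inv_into V (Um m N n q)"
  have iU: "isinv ?U ?U'" and iW: "isinv ?W ?W'"
    using isinv_inv_into U W by blast+
  have iRq: "isinv (Rq m N n q) (?W \<circ> ?U')"
    unfolding Rq_def opinv using isinv_comp[OF iU isinv_sym[OF iW]] .
  have Rq': "inv_into V (Rq m N n q) v = ?W (?U' v)" if "v \<in> V" for v
    using inv_into_eq[OF iRq that] by simp
  \<comment> \<open>On V the ordered product of the R_i agrees with \<open>Rq\<close>, whose inverse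
    is known explicitly.\<close>
  have iprd: "isinv (prd ?R [1..<Suc N]) (?W \<circ> ?U')"
  proof -
    have "lin (prd ?R [1..<Suc N])" using Ri by (intro prd_lin) (auto simp: isinv_def)
    moreover have "?W (?U' u) \<in> V" if "u \<in> V" for u
      using iU iW that by (simp add: isinv_def lin_V)
    ultimately show ?thesis
      using iRq by (auto simp: isinv_def Rq[symmetric] simp del: upt_Suc)
  qed
  let ?g = "GM m N q"
  have ig: "isinv ?g (inv_into V ?g)"
  proof -
    have G: "PIso m N (Gpbw m N q)" using assms by (intro Gpbw_PIso) auto
    note I = GM_inverse[OF G] and J = GM_inverse[OF PIso_inv(1)[OF G]]
    have "lin (gtens 0 (Gpbw m N q) (\<lambda>_. id))" "lin (gtens 0 (inv_into (PCl m N) (Gpbw m N q)) (\<lambda>_. id))"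
      by (rule sl[OF slin_gtens], simp add: V_def I(1), rule sl[OF slin_gtens], simp add: V_def J(1))
    then have "isinv ?g (gtens 0 (inv_into (PCl m N) (Gpbw m N q)) (\<lambda>_. id))"
      unfolding isinv_def GM_def using I(2,3) by (simp add: V_def)
    then show ?thesis by (rule isinv_inv_into)
  qed
  show ?thesis
  proof (intro ballI)
    fix k j v assume k: "k \<in> {1..N}" and j: "j \<in> {1..N}" and "v \<in> Mcar m N n q"
    then have v: "v \<in> V" by (simp add: V_def)
    let ?A = "Ap m n q k" and ?B = "Am m n q j"
    have A: "oddop ?A"
      unfolding oddop_def using Ap_grading[OF k TG]
      by (auto intro!: sl[OF Ap_slin]) (simp add: V_def Ap_Mcar[OF k])
    have B: "oddop ?B"
      unfolding oddop_def lin_def using Am_Mcar[OF j] Am_grading[OF j] by (auto simp: V_def Am_add)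
    have linA: "lin ?A" and linB: "lin ?B" using A B by (simp_all add: oddop_def)
    have Ad: "Ad m N n q X Y = conj X Y" for X Y
      by (simp add: Ad_def conj_def opinv)
    have T: "Tprod m N n q a b = conjs ?R [a..<b]" for a b
      by (simp add: Tprod_def conjs_def Kap_def[abs_def] Ad)
    let ?L = "Lseed m n q k j + acomm ?A (Omg m N n q j)"
    let ?Z = "T_all m N n q (Lseed m n q k j) + (\<Sum>r=1..N. T_below m N n q r (Ad m N n q (?R r)
             (ads (Theta m N n q k r) (T_above m N n q r ?B))))"
    \<comment> \<open>The subtracted A_j^- in Omega cancels the seed, leaving the anticommutator of
      A_k^+ with R A_j^- R^-1.\<close>
    have L_eq: "?L w = ?A (Rq m N n q (?B (?W (?U' w)))) + Rq m N n q (?B (?W (?U' (?A w))))" if w: "w \<in> V" for w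
    proof -
      have Aw: "?A w \<in> V" using linA w by (rule lin_V)
      have "?B w \<in> V" "Rq m N n q (?B (?W (?U' w))) \<in> V"
        using w linB iRq iU iW by (auto simp: isinv_def lin_V)
      then show ?thesis
        using w Aw by (simp add: Lseed_def acomm_def Omg_def Ad conj_def Rq' lin_diff[OF linA])
    qed
    have first: "?L w = ?Z w" if w: "w \<in> V" for w
    proof -
      have Aw: "?A w \<in> V" using linA w by (rule lin_V)
      have cB: "conjs ?R [1..<Suc N] ?B u = Rq m N n q (?B (?W (?U' u)))" if "u \<in> V" for u
      proof -
        have "conjs ?R [1..<Suc N] ?B u = prd ?R [1..<Suc N] (?B ((?W \<circ> ?U') u))"
          by (rule conjs_prd[OF Ri linB iprd that]) auto
        also have "\<dots> = Rq m N n q (?B (?W (?U' u)))"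
          using that linB iU iW by (subst Rq) (auto simp: isinv_def lin_V)
        finally show ?thesis .
      qed
      have "?L w = acomm ?A (conjs ?R [1..<Suc N] ?B) w"
        unfolding L_eq[OF w] by (simp only: acomm_def cB[OF w] cB[OF Aw])
      also have "\<dots> = conjs ?R [1..<Suc N] (acomm ?A ?B) w
          + (\<Sum>r=1..<Suc N. conjs ?R [1..<r] (conj (?R r) (ads ((inv_into V (?R r) \<circ> ?A \<circ> ?R r) - ?A) (conjs ?R [r + 1..<Suc N] ?B))) w)"
      proof (rule telescope[OF _ A B _ w])
        show "isinv (?R i) (inv_into V (?R i)) \<and> (\<forall>v\<in>V. grading (?R i v) = ?R i (grading v))"
          if "i \<in> {1..<Suc N}" for i
          using that isinv_inv_into[OF Ri] Ri_grading by auto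
      qed simp
      also have "\<dots> = ?Z w"
        by (simp add: T Ad Lseed_def Theta_def opinv sum_fun_apply atLeastLessThanSuc_atLeastAtMost
            Suc_eq_plus1[symmetric] del: upt_Suc)
      finally show ?thesis .
    qed
    \<comment> \<open>As R = U^+ (U^-)^-1, conjugating R A_j^- R^-1 back by U^+ gives (U^-)^-1 A_j^-
      U^-, and the gauges between the two transported operators cancel on V.\<close>
    have second: "acomm (Dp m N n q k) (Dm m N n q j) v = ?g (?U' (?L (?U (inv_into V ?g v))))"
    proof -
      define w where "w = inv_into V ?g v"
      have w: "w \<in> V" using ig v by (simp add: w_def isinv_def lin_V)
      have lins: "lin ?g" "lin (inv_into V ?g)" "lin ?U" "lin ?U'" "lin ?W" "lin ?W'"
        using ig iU iW by (auto simp: isinv_def)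
      have cancel: "inv_into V ?g (?g u) = u" "?U (?U' u) = u" "?U' (?U u) = u" "?W (?W' u) = u" "?W' (?W u) = u"
        if "u \<in> V" for u
        using that ig iU iW by (auto simp: isinv_def)
      have D: "Dp m N n q k u = ?g (?U' (?A (?U (inv_into V ?g u))))"
        "Dm m N n q j u = ?g (?W' (?B (?W (inv_into V ?g u))))" for u
        by (simp_all add: Dp_def Dm_def opinv)
      have 1: "acomm (Dp m N n q k) (Dm m N n q j) v
          = ?g (?U' (?A (?U (?W' (?B (?W w)))))) + ?g (?W' (?B (?W (?U' (?A (?U w))))))"
        using w lins linA linB by (simp add: acomm_def D w_def[symmetric] cancel lin_V)
      have "?U' (?L (?U w)) = ?U' (?A (?U (?W' (?B (?W w))))) + ?W' (?B (?W (?U' (?A (?U w)))))"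
        unfolding L_eq[OF lin_V[OF lins(3) w]]
        using w lins linA linB by (simp add: Rq_def opinv cancel lin_V lin_add)
      then show ?thesis
        unfolding 1 w_def[symmetric] using w lins linA linB by (simp add: lin_add lin_V)
    qed
    have "?U (inv_into V ?g v) \<in> V" using v ig iU by (simp add: isinv_def lin_V)
    then have third: "?g (?U' (?L (?U (inv_into V ?g v)))) = ?g (?U' (?Z (?U (inv_into V ?g v))))"
      by (simp only: first)
    show "?L v = ?Z v \<and>
      acomm (Dp m N n q k) (Dm m N n q j) v =
      (?g \<circ> opinv m N n q (Up m N n q) \<circ> ?L \<circ> Up m N n q \<circ> opinv m N n q ?g) v \<and>
      acomm (Dp m N n q k) (Dm m N n q j) v =
      (?g \<circ> opinv m N n q (Up m N n q) \<circ> ?Z \<circ> Up m N n q \<circ> opinv m N n q ?g) v"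
      unfolding comp_apply opinv using first[OF v] second third by metis
  qed
qed

end
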